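(* Let $n\geq 1$, let $F:[0,+\infty)\rightarrow\mathbb R$ be a continuous function bounded from below and let $\omega\subset\mathbb R^n$ be a measurable set. Consider the control system $(E_F)$ associated with $F$ and $\omega$. (i) If $\inf F\le 0$ and the evolution system $(E_F)$ is exponentially stabilizable from $\omega$, then the set $\omega$ is thick. (ii) When $\liminf_{+\infty}F>\inf F$ and $\omega$ is a thick set, there exist positive constants $C=C(\omega)\geq 1$ and $R_0=R_0(F)>0$ such that for all $R\geq R_0$ and $t\geq 0$, $$\big\Vert e^{-t(F(\vert D_x\vert)+Ce^{CR}(\alpha_R-\inf F)\mathbf 1_{\omega}K_R)}\big\Vert_{\mathcal L(L^2(\mathbb R^n))}\le \sqrt 2\,Ce^{CR}e^{-(\alpha_R+\inf F)t/2},$$ where $\alpha_R=\inf_{r\geq R}F(r)$ and $K_R$ is the orthogonal projection $$K_R:L^2(\mathbb R^n)\rightarrow\big\{f\in L^2(\mathbb R^n):\operatorname{Supp}\widehat f\subset\overline{B(0,R)}\big\},$$ with $\overline{B(0,R)}$ the closed Euclidean ball centered at $0$ with radius $R$. (iii) When $\liminf_{+\infty}F>\vert\inf F\vert$ and $\omega$ is a thick set, the evolution system $(E_F)$ is exponentially stabilizable from $\omega$.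
   Context: $L^2(\mathbb R^n)$ is the space of complex-valued square-integrable functions, $\mathcal L(L^2(\mathbb R^n))$ the bounded linear operators on it, $\widehat f$ the Fourier transform of $f$ (with $\widehat f(\xi)=\int e^{-ix\cdot\xi}f(x)\,dx$ on Schwartz functions), and $\mathbf 1_\omega$ the characteristic function of $\omega$, also viewed as a multiplication operator. For a continuous function $F:[0,+\infty)\to\mathbb R$ bounded from below, $F(|D_x|)$ is the Fourier multiplier with symbol $F(|\xi|)$, where $|\cdot|$ is the Euclidean norm, with domain $\{u\in L^2(\mathbb R^n): F(|D_x|)u\in L^2(\mathbb R^n)\}$. For $B\in\mathcal L(L^2(\mathbb R^n))$, $(e^{-t(F(|D_x|)+B)})_{t\geq0}$ denotes the strongly continuous semigroup generated by $-(F(|D_x|)+B)$ (it exists by bounded perturbation theory). The control system $(E_F)$ is $$\partial_tf(t,x)+F(|D_x|)f(t,x)=h(t,x)\mathbf 1_\omega(x),\quad t>0,\ x\in\mathbb R^n,\qquad f(0,\cdot)=f_0\in L^2(\mathbb R^n).$$ Exponential stabilizability: $(E_F)$ is exponentially stabilizable from $\omega$ at rate $\alpha>0$ if there exist $M_\alpha\geq1$ and a feedback $K_\alpha\in\mathcal L(L^2(\mathbb R^n))$ such that $\Vert e^{-t(F(|D_x|)+\mathbf 1_\omega K_\alpha)}\Vert_{\mathcal L(L^2(\mathbb R^n))}\le M_\alpha e^{-\alpha t}$ for all $t\geq0$. It is exponentially stabilizable from $\omega$ if this holds for some rate $\alpha>0$. Thickness: given $\gamma\in(0,1)$ and $L>0$,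 a set $\omega\subset\mathbb R^n$ is $\gamma$-thick at scale $L$ if it is measurable and $\operatorname{Leb}(\omega\cap(x+[0,L]^n))\geq\gamma L^n$ for all $x\in\mathbb R^n$, where $\operatorname{Leb}$ is Lebesgue measure. It is thick if it is $\gamma$-thick at scale $L$ for some $\gamma\in(0,1)$ and $L>0$. $C(\omega)$ means the constant depends on $\omega$ (and the dimension) but not on $F,R,t$; $R_0(F)$ means $R_0$ depends only on $F$. *)

theory Defs
  imports "HOL-Analysis.Analysis"
begin

section \<open>The Hilbert space of square-integrable complex functions\<close>

definition square_integrable :: "(real^'n::finite \<Rightarrow> complex) \<Rightarrow> bool" where
  "square_integrable f \<longleftrightarrow>
     f \<in> borel_measurable lebesgue \<and> integrable lebesgue (\<lambda>x. (norm (f x))\<^sup>2)"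

definition L2_rel :: "(real^'n::finite \<Rightarrow> complex) \<Rightarrow> (real^'n \<Rightarrow> complex) \<Rightarrow> bool" where
  "L2_rel f g \<longleftrightarrow>
     square_integrable f \<and> square_integrable g \<and> (AE x in lebesgue. f x = g x)"

lemma square_integrable_zero: "square_integrable (\<lambda>_. 0)"
  by (simp add: square_integrable_def)

lemma square_integrable_add:
  assumes "square_integrable f" "square_integrable g"
  shows "square_integrable (\<lambda>x. f x + g x)"
proof -
  have [measurable]: "f \<in> borel_measurable lebesgue" "g \<in> borel_measurable lebesgue"
    using assms by (auto simp: square_integrable_def)
  have "integrable lebesgue (\<lambda>x. 2 * (norm (f x))\<^sup>2 + 2 * (norm (g x))\<^sup>2)"
    using assms by (auto simp: square_integrable_def)
  moreover have "(norm (f x + g x))\<^sup>2 \<le> 2 * (norm (f x))\<^sup>2 + 2 * (norm (g x))\<^sup>2" for x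
  proof -
    have "(norm (f x + g x))\<^sup>2 \<le> (norm (f x) + norm (g x))\<^sup>2"
      by (intro power_mono norm_triangle_ineq) auto
    also have "\<dots> \<le> 2 * (norm (f x))\<^sup>2 + 2 * (norm (g x))\<^sup>2"
      using sum_squares_bound[of "norm (f x)" "norm (g x)"]
      by (simp add: power2_sum)
    finally show ?thesis .
  qed
  ultimately have "integrable lebesgue (\<lambda>x. (norm (f x + g x))\<^sup>2)"
    by - (rule Bochner_Integration.integrable_bound[where f = "\<lambda>x. 2 * (norm (f x))\<^sup>2 + 2 * (norm (g x))\<^sup>2"]; auto intro!: AE_I2)
  then show ?thesis by (simp add: square_integrable_def)
qed

lemma square_integrable_cmult:
  assumes "square_integrable f"
  shows "square_integrable (\<lambda>x. c * f x)"
  using assms by (auto simp: square_integrable_def norm_mult power_mult_distrib)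

lemma square_integrable_scaleR:
  "square_integrable f \<Longrightarrow> square_integrable (\<lambda>x. r *\<^sub>R f x)"
  using square_integrable_cmult[of f "of_real r"] by (simp add: scaleR_conv_of_real)

lemma square_integrable_uminus:
  "square_integrable f \<Longrightarrow> square_integrable (\<lambda>x. - f x)"
  using square_integrable_cmult[of f "-1"] by simp

lemma square_integrable_diff:
  "square_integrable f \<Longrightarrow> square_integrable g \<Longrightarrow> square_integrable (\<lambda>x. f x - g x)"
  using square_integrable_add[of f "\<lambda>x. - g x"] by (simp add: square_integrable_uminus)

lemma square_integrable_inner:
  assumes "square_integrable f" "square_integrable g"
  shows "integrable lebesgue (\<lambda>x. inner (f x) (g x))"
proof -
  have [measurable]: "f \<in> borel_measurable lebesgue" "g \<in> borel_measurable lebesgue"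
    using assms by (auto simp: square_integrable_def)
  have "integrable lebesgue (\<lambda>x. (norm (f x))\<^sup>2 + (norm (g x))\<^sup>2)"
    using assms by (auto simp: square_integrable_def)
  moreover have "\<bar>inner (f x) (g x)\<bar> \<le> (norm (f x))\<^sup>2 + (norm (g x))\<^sup>2" for x
  proof -
    have "\<bar>inner (f x) (g x)\<bar> \<le> norm (f x) * norm (g x)"
      by (rule Cauchy_Schwarz_ineq2)
    also have "\<dots> \<le> 2 * norm (f x) * norm (g x)" by simp
    also have "\<dots> \<le> (norm (f x))\<^sup>2 + (norm (g x))\<^sup>2"
      by (rule sum_squares_bound)
    finally show ?thesis .
  qed
  ultimately show ?thesis
    by - (rule Bochner_Integration.integrable_bound[where f = "\<lambda>x. (norm (f x))\<^sup>2 + (norm (g x))\<^sup>2"]; auto intro!: AE_I2)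
qed

lemma L2_rel_part_equivp: "part_equivp L2_rel"
proof (rule part_equivpI)
  show "\<exists>f. L2_rel f f"
    by (rule exI[of _ "\<lambda>_. 0"]) (simp add: L2_rel_def square_integrable_zero)
  show "symp L2_rel" by (rule sympI) (auto simp: L2_rel_def)
  show "transp L2_rel" by (rule transpI) (auto simp: L2_rel_def)
qed

quotient_type (overloaded) 'n L2 = "real^('n::finite) \<Rightarrow> complex" / partial: L2_rel
  by (rule L2_rel_part_equivp)

instantiation L2 :: (finite) real_inner
begin

lift_definition zero_L2 :: "'a L2" is "\<lambda>_. 0"
  by (simp add: L2_rel_def square_integrable_zero)

lift_definition plus_L2 :: "'a L2 \<Rightarrow> 'a L2 \<Rightarrow> 'a L2" is "\<lambda>f g x. f x + g x"
  by (auto simp: L2_rel_def square_integrable_add)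

lift_definition minus_L2 :: "'a L2 \<Rightarrow> 'a L2 \<Rightarrow> 'a L2" is "\<lambda>f g x. f x - g x"
  by (auto simp: L2_rel_def square_integrable_diff)

lift_definition uminus_L2 :: "'a L2 \<Rightarrow> 'a L2" is "\<lambda>f x. - f x"
  by (auto simp: L2_rel_def square_integrable_uminus)

lift_definition scaleR_L2 :: "real \<Rightarrow> 'a L2 \<Rightarrow> 'a L2" is "\<lambda>r f x. r *\<^sub>R f x"
  by (auto simp: L2_rel_def square_integrable_scaleR)

lift_definition inner_L2 :: "'a L2 \<Rightarrow> 'a L2 \<Rightarrow> real"
  is "\<lambda>f g. LINT x|lebesgue. inner (f x) (g x)"
  by (intro integral_cong_AE) (auto simp: L2_rel_def square_integrable_def)

lift_definition norm_L2 :: "'a L2 \<Rightarrow> real"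
  is "\<lambda>f. sqrt (LINT x|lebesgue. (norm (f x))\<^sup>2)"
  by (intro arg_cong[where f = sqrt] integral_cong_AE)
     (auto simp: L2_rel_def square_integrable_def)

definition dist_L2 :: "'a L2 \<Rightarrow> 'a L2 \<Rightarrow> real" where
  "dist_L2 f g = norm (f - g)"

definition sgn_L2 :: "'a L2 \<Rightarrow> 'a L2" where
  "sgn_L2 f = scaleR (inverse (norm f)) f"

definition uniformity_L2 :: "('a L2 \<times> 'a L2) filter" where
  "uniformity_L2 = (INF e\<in>{0 <..}. principal {(x, y). dist x y < e})"

definition open_L2 :: "'a L2 set \<Rightarrow> bool" where
  "open_L2 U \<longleftrightarrow> (\<forall>x\<in>U. eventually (\<lambda>(x', y). x' = x \<longrightarrow> y \<in> U) uniformity)"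

instance
proof
  fix f g h :: "'a L2" and r s :: real
  show "f + g + h = f + (g + h)" "f + g = g + f" "0 + f = f" "- f + f = 0" "f - g = f + - g"
       "r *\<^sub>R (f + g) = r *\<^sub>R f + r *\<^sub>R g" "(r + s) *\<^sub>R f = r *\<^sub>R f + s *\<^sub>R f"
       "r *\<^sub>R s *\<^sub>R f = (r * s) *\<^sub>R f" "1 *\<^sub>R f = f"
    by (transfer;
        auto simp: L2_rel_def algebra_simps square_integrable_zero
             intro: square_integrable_add square_integrable_diff square_integrable_scaleR)+
  show "dist f g = norm (f - g)" "sgn f = scaleR (inverse (norm f)) f"
    by (simp_all add: dist_L2_def sgn_L2_def)
  show "(uniformity :: ('a L2 \<times> 'a L2) filter)
          = (INF e\<in>{0 <..}. principal {(x, y). dist x y < e})"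
    by (rule uniformity_L2_def)
  show "open U \<longleftrightarrow> (\<forall>x\<in>U. eventually (\<lambda>(x', y). x' = x \<longrightarrow> y \<in> U) uniformity)"
    for U :: "'a L2 set"
    by (rule open_L2_def)
  show "inner f g = inner g f"
    by transfer (simp add: inner_commute)
  show "inner (f + g) h = inner f h + inner g h"
    by transfer (simp add: inner_add_left L2_rel_def square_integrable_inner)
  show "inner (r *\<^sub>R f) g = r * inner f g"
    by transfer simp
  show "0 \<le> inner f f"
    by transfer simp
  show "inner f f = 0 \<longleftrightarrow> f = 0"
  proof transfer
    fix f :: "real^'a \<Rightarrow> complex" assume "L2_rel f f"
    then have sq: "square_integrable f" by (simp add: L2_rel_def)
    have "(LINT x|lebesgue. inner (f x) (f x)) = 0 \<longleftrightarrow> (AE x in lebesgue. inner (f x) (f x) = 0)"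
      by (rule integral_nonneg_eq_0_iff_AE) (use sq in \<open>auto intro: square_integrable_inner\<close>)
    then show "(LINT x|lebesgue. inner (f x) (f x)) = 0 \<longleftrightarrow> L2_rel f (\<lambda>_. 0)"
      using sq by (simp add: L2_rel_def square_integrable_zero)
  qed
  show "norm f = sqrt (inner f f)"
    by transfer (simp add: power2_norm_eq_inner)
qed

end

lift_definition scaleC_L2 :: "complex \<Rightarrow> 'n::finite L2 \<Rightarrow> 'n L2" is "\<lambda>c f x. c * f x"
  by (auto simp: L2_rel_def square_integrable_cmult)

text \<open>Complex inner product, antilinear in the second argument; its real part is \<^const>\<open>inner\<close>.\<close>
definition cinner_L2 :: "'n::finite L2 \<Rightarrow> 'n L2 \<Rightarrow> complex" where
  "cinner_L2 f g = (LINT x|lebesgue. rep_L2 f x * cnj (rep_L2 g x))"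

definition bounded_clinear_L2 :: "('n::finite L2 \<Rightarrow> 'n L2) \<Rightarrow> bool" where
  "bounded_clinear_L2 T \<longleftrightarrow>
     bounded_linear T \<and> (\<forall>c f. T (scaleC_L2 c f) = scaleC_L2 c (T f))"

definition orth_proj_L2 :: "'n::finite L2 set \<Rightarrow> 'n L2 \<Rightarrow> 'n L2" where
  "orth_proj_L2 V f = (THE p. p \<in> V \<and> (\<forall>g\<in>V. cinner_L2 (f - p) g = 0))"

definition indicator_L2 :: "(real^'n::finite) set \<Rightarrow> 'n L2 \<Rightarrow> 'n L2" where
  "indicator_L2 \<omega> f = abs_L2 (\<lambda>x. indicator \<omega> x * rep_L2 f x)"

text \<open>Support of an \<open>L\<^sup>2\<close> class: the complement of the largest open set on which it vanishes
  almost everywhere (a topological support of a representative would not be well defined).\<close>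
definition supp_L2 :: "'n::finite L2 \<Rightarrow> (real^'n) set" where
  "supp_L2 f = - \<Union>{U. open U \<and> (AE x in lebesgue. x \<in> U \<longrightarrow> rep_L2 f x = 0)}"


section \<open>The Fourier transform\<close>

primrec iter_partial_deriv ::
  "'n::finite list \<Rightarrow> (real^'n \<Rightarrow> complex) \<Rightarrow> real^'n \<Rightarrow> complex" where
  "iter_partial_deriv [] \<phi> = \<phi>"
| "iter_partial_deriv (i # is) \<phi> =
     (\<lambda>x. frechet_derivative (iter_partial_deriv is \<phi>) (at x) (axis i 1))"

definition schwartz :: "(real^'n::finite \<Rightarrow> complex) set" where
  "schwartz = {\<phi>. \<forall>is. (\<forall>x. iter_partial_deriv is \<phi> differentiable at x) \<and>
     (\<forall>k::nat. bounded (range (\<lambda>x. norm x ^ k *\<^sub>R iter_partial_deriv is \<phi> x)))}"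

definition fourier_integral :: "(real^'n::finite \<Rightarrow> complex) \<Rightarrow> real^'n \<Rightarrow> complex" where
  "fourier_integral \<phi> \<xi> = (LINT x|lebesgue. exp (- \<i> * of_real (inner x \<xi>)) * \<phi> x)"

text \<open>The Fourier transform on \<open>L\<^sup>2\<close> is the continuous extension from the Schwartz space.\<close>
definition fourier_L2 :: "'n::finite L2 \<Rightarrow> 'n L2" where
  "fourier_L2 = (THE \<F>. bounded_clinear_L2 \<F> \<and>
     (\<forall>\<phi>\<in>schwartz. \<F> (abs_L2 \<phi>) = abs_L2 (fourier_integral \<phi>)))"


section \<open>Unbounded operators and semigroups\<close>

text \<open>Unbounded operators are represented by their graphs; the domain of \<open>A\<close> is
  \<^term>\<open>Domain A\<close>.\<close>

text \<open>\<open>F(|D\<^sub>x|)\<close>: a pair \<open>(u, v)\<close> lies in the graph iff the product of the symbol with the Fourier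
  transform of \<open>u\<close> is square-integrable and is the Fourier transform of \<open>v\<close>.\<close>
definition fourier_multiplier :: "(real \<Rightarrow> real) \<Rightarrow> ('n::finite L2 \<times> 'n L2) set" where
  "fourier_multiplier F = {(u, v). AE \<xi> in lebesgue.
     rep_L2 (fourier_L2 v) \<xi> = of_real (F (norm \<xi>)) * rep_L2 (fourier_L2 u) \<xi>}"

text \<open>\<open>-(A + B)\<close> for an everywhere defined \<open>B\<close>\<close>
definition neg_perturbed ::
  "('n::finite L2 \<times> 'n L2) set \<Rightarrow> ('n L2 \<Rightarrow> 'n L2) \<Rightarrow> ('n L2 \<times> 'n L2) set" where
  "neg_perturbed A B = {(u, - (v + B u)) | u v. (u, v) \<in> A}"

text \<open>Only the values at times \<open>t \<ge> 0\<close> matter.\<close>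
definition C0_semigroup :: "(real \<Rightarrow> 'n::finite L2 \<Rightarrow> 'n L2) \<Rightarrow> bool" where
  "C0_semigroup T \<longleftrightarrow>
     (\<forall>t\<ge>0. bounded_clinear_L2 (T t)) \<and>
     T 0 = id \<and>
     (\<forall>s\<ge>0. \<forall>t\<ge>0. T (s + t) = T s \<circ> T t) \<and>
     (\<forall>f. ((\<lambda>t. T t f) \<longlongrightarrow> f) (at_right 0))"

definition generator :: "(real \<Rightarrow> 'n::finite L2 \<Rightarrow> 'n L2) \<Rightarrow> ('n L2 \<times> 'n L2) set" where
  "generator T = {(u, v). ((\<lambda>t. (T t u - u) /\<^sub>R t) \<longlongrightarrow> v) (at_right 0)}"

text \<open>The semigroup generated by a given operator is unique at times \<open>t \<ge> 0\<close>, so that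
  \<open>\<exists>T. generates A T \<and> P T\<close> says that \<open>e\<^sup>t\<^sup>A\<close> exists and satisfies \<open>P\<close>. The generator is the full one:
  equality of graphs includes equality of domains.\<close>
definition generates ::
  "('n::finite L2 \<times> 'n L2) set \<Rightarrow> (real \<Rightarrow> 'n L2 \<Rightarrow> 'n L2) \<Rightarrow> bool" where
  "generates A T \<longleftrightarrow> C0_semigroup T \<and> generator T = A"


section \<open>Stabilizability and thickness\<close>

text \<open>Symbols are functions on \<open>[0, \<infinity>)\<close>; values at negative arguments are irrelevant.\<close>
definition admissible_symbol :: "(real \<Rightarrow> real) \<Rightarrow> bool" where
  "admissible_symbol F \<longleftrightarrow> continuous_on {0..} F \<and> bdd_below (F ` {0..})"

definition exp_stabilizable_at_rate ::
  "(real \<Rightarrow> real) \<Rightarrow> (real^'n::finite) set \<Rightarrow> real \<Rightarrow> bool" where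
  "exp_stabilizable_at_rate F \<omega> \<alpha> \<longleftrightarrow>
     (\<exists>M\<ge>1. \<exists>K. bounded_clinear_L2 K \<and>
       (\<exists>T. generates (neg_perturbed (fourier_multiplier F) (\<lambda>f. indicator_L2 \<omega> (K f))) T \<and>
            (\<forall>t\<ge>0. onorm (T t) \<le> M * exp (- \<alpha> * t))))"

definition exp_stabilizable :: "(real \<Rightarrow> real) \<Rightarrow> (real^'n::finite) set \<Rightarrow> bool" where
  "exp_stabilizable F \<omega> \<longleftrightarrow> (\<exists>\<alpha>>0. exp_stabilizable_at_rate F \<omega> \<alpha>)"

definition thick_at_scale :: "real \<Rightarrow> real \<Rightarrow> (real^'n::finite) set \<Rightarrow> bool" where
  "thick_at_scale \<gamma> L \<omega> \<longleftrightarrow> \<omega> \<in> sets lebesgue \<and>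
     (\<forall>x. measure lebesgue (\<omega> \<inter> (+) x ` cbox 0 (\<chi> i. L)) \<ge> \<gamma> * L ^ CARD('n))"

definition thick :: "(real^'n::finite) set \<Rightarrow> bool" where
  "thick \<omega> \<longleftrightarrow> (\<exists>\<gamma> L. 0 < \<gamma> \<and> \<gamma> < 1 \<and> 0 < L \<and> thick_at_scale \<gamma> L \<omega>)"

text \<open>\<open>K\<^sub>R\<close>: orthogonal projection onto the functions with frequencies in the closed ball\<close>
definition freq_proj :: "real \<Rightarrow> 'n::finite L2 \<Rightarrow> 'n L2" where
  "freq_proj R = orth_proj_L2 {f. supp_L2 (fourier_L2 f) \<subseteq> cball 0 R}"

definition inf_from :: "real \<Rightarrow> (real \<Rightarrow> real) \<Rightarrow> real" where
  "inf_from R F = (INF r\<in>{R..}. F r)"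

end

theory Submission
  imports Defs "HOL-Probability.Probability" "HOL-Computational_Algebra.Polynomial"
begin

text \<open>
  Everything is read on the Fourier side. On \<open>L\<^sup>2\<close> the transform is \<open>(2\<pi>)\<^sup>n\<^sup>/\<^sup>2\<close> times a unitary operator, and it
  turns \<open>F(|D\<^sub>x|)\<close> into multiplication by \<open>F(|\<xi>|)\<close>, a real function bounded from below; so \<open>-F(|D\<^sub>x|)\<close>
  generates the semigroup of multiplications by \<open>e\<^sup>-\<^sup>t\<^sup>F\<close>, and a bounded perturbation of a generator is a
  generator, by Duhamel's formula. Unitarity (\<open>norm_fourier_L2\<close>) comes from Gaussians: a Gaussian weight
  makes Fubini's theorem applicable in the double integrals, and it is then removed by a limit. The
  convolutions of boxes with Gaussians are Schwartz functions with an explicit transform and span a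
  dense subspace; this identifies the continuous extension from the Schwartz space.

  Necessity of thickness (\<open>stabilizable_imp_thick\<close>). Let the feedback produce the decay rate \<open>\<alpha>\<close>. As
  \<open>inf F \<le> 0 < \<alpha>\<close>, there is a frequency \<open>\<xi>\<^sub>0\<close> with \<open>\<mu> = F(|\<xi>\<^sub>0|) < \<alpha>\<close>. Pairing an orbit with its initial
  value \<open>u\<close> and integrating over all times yields the observability estimate
  \<open>\<parallel>u\<parallel> \<le> M/(\<alpha> - \<mu>) (\<parallel>F(|D\<^sub>x|)u - \<mu>u\<parallel> + k\<parallel>1\<^sub>\<omega>u\<parallel>)\<close>. For a wave packet \<open>u\<close> with frequencies close to \<open>\<xi>\<^sub>0\<close> the
  first term on the right is absorbed, so \<open>1\<^sub>\<omega>u\<close> carries a fixed part of the mass of \<open>u\<close>; this applies to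
  all translates of \<open>u\<close>, whose mass is concentrated in balls of one fixed radius. Hence \<open>\<omega>\<close> has a fixed
  part of every large cube.

  Sufficiency. The only property of a thick set that enters is the spectral inequality
  (\<open>Logvinenko_Sereda\<close>): \<open>\<parallel>u\<parallel>\<^sup>2 \<le> D\<parallel>1\<^sub>\<omega>u\<parallel>\<^sup>2\<close> with \<open>D = Ce\<^sup>C\<^sup>R\<close> if \<open>u\<close> has frequencies in the ball of radius
  \<open>R\<close>. Such a function is approximated by its Taylor polynomials of degree \<open>O(R)\<close>, with an error that
  is integrated over all base points and is therefore measured by Plancherel's theorem; a polynomial is
  controlled by its values on a large subset of a cube through Remez' inequality on a line segment that
  meets this subset in a set of large length.

  Given this inequality (\<open>low_frequency_feedback_decay\<close>), split \<open>u = p + q\<close> with \<open>p = K\<^sub>Ru\<close> and put \<open>m = inf F\<close>,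
  \<open>\<alpha>\<^sub>R = inf\<^bsub>r\<ge>R\<^esub> F(r)\<close>. High frequencies decay at rate \<open>\<alpha>\<^sub>R\<close> by themselves, low frequencies are damped by the
  feedback at a rate of order \<open>\<alpha>\<^sub>R - m\<close>, and the only coupling is the feedback term seen by \<open>q\<close>. The weight
  \<open>D\<^sup>2\<close> in the Lyapunov functional \<open>D\<^sup>2\<parallel>p\<parallel>\<^sup>2 + \<parallel>q\<parallel>\<^sup>2\<close> makes this coupling a square that can be absorbed, and the
  functional decays at rate \<open>\<alpha>\<^sub>R + m\<close>. If \<open>liminf F > |m|\<close>, this rate is positive for large \<open>R\<close>.
\<close>


section \<open>The space L2: representatives, limits, completeness\<close>

lemma L2_rel_refl: "L2_rel f f \<longleftrightarrow> square_integrable f"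
  by (auto simp: L2_rel_def)

lemma square_integrable_rep [simp, intro]: "square_integrable (rep_L2 u)"
  using Quotient_rep_reflp[OF Quotient_L2] L2_rel_refl by blast

lemma rep_L2_measurable [measurable]: "rep_L2 u \<in> borel_measurable lebesgue"
  using square_integrable_rep[of u] by (simp add: square_integrable_def)

lemma abs_rep_L2 [simp]: "abs_L2 (rep_L2 u) = u"
  by (rule Quotient_abs_rep[OF Quotient_L2])

lemma rep_abs_L2:
  assumes "square_integrable f"
  shows "AE x in lebesgue. rep_L2 (abs_L2 f) x = f x"
  using Quotient_rep_abs[OF Quotient_L2, of f] assms by (simp add: L2_rel_def)

lemma abs_L2_eqI:
  assumes "square_integrable f" "square_integrable g" "AE x in lebesgue. f x = g x"
  shows "abs_L2 f = abs_L2 g"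
  using assms Quotient_rel_abs[OF Quotient_L2, of f g] by (simp add: L2_rel_def)

lemma L2_eqI:
  assumes "AE x in lebesgue. rep_L2 u x = rep_L2 v x"
  shows "u = v"
  using abs_L2_eqI[OF square_integrable_rep square_integrable_rep assms] by simp

lemma abs_L2_eqI':
  assumes "square_integrable f" "AE x in lebesgue. f x = rep_L2 u x"
  shows "abs_L2 f = u"
  using abs_L2_eqI[OF assms(1) square_integrable_rep assms(2)] by simp

lemma abs_L2_add:
  "square_integrable f \<Longrightarrow> square_integrable g \<Longrightarrow> abs_L2 f + abs_L2 g = abs_L2 (\<lambda>x. f x + g x)"
  by (rule plus_L2.abs_eq) (auto simp: L2_rel_refl)

lemma abs_L2_diff:
  "square_integrable f \<Longrightarrow> square_integrable g \<Longrightarrow> abs_L2 f - abs_L2 g = abs_L2 (\<lambda>x. f x - g x)"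
  by (rule minus_L2.abs_eq) (auto simp: L2_rel_refl)

lemma abs_L2_scaleC:
  "square_integrable f \<Longrightarrow> scaleC_L2 c (abs_L2 f) = abs_L2 (\<lambda>x. c * f x)"
  by (rule scaleC_L2.abs_eq) (auto simp: L2_rel_refl)

lemma rep_add_L2: "AE x in lebesgue. rep_L2 (u + v) x = rep_L2 u x + rep_L2 v x"
  using rep_abs_L2[OF square_integrable_add[OF square_integrable_rep[of u] square_integrable_rep[of v]]]
  by (simp flip: abs_L2_add)

lemma rep_diff_L2: "AE x in lebesgue. rep_L2 (u - v) x = rep_L2 u x - rep_L2 v x"
  using rep_abs_L2[OF square_integrable_diff[OF square_integrable_rep[of u] square_integrable_rep[of v]]]
  by (simp flip: abs_L2_diff)

lemma rep_scaleC_L2: "AE x in lebesgue. rep_L2 (scaleC_L2 c u) x = c * rep_L2 u x"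
  using rep_abs_L2[OF square_integrable_cmult[OF square_integrable_rep[of u], of c]]
  by (simp flip: abs_L2_scaleC)

lemma scaleR_scaleC_L2: "r *\<^sub>R u = scaleC_L2 (of_real r) u"
  by transfer (auto simp: L2_rel_def scaleR_conv_of_real square_integrable_cmult)

lemma rep_scaleR_L2: "AE x in lebesgue. rep_L2 (r *\<^sub>R u) x = of_real r * rep_L2 u x"
  unfolding scaleR_scaleC_L2 by (rule rep_scaleC_L2)

lemma rep_uminus_L2: "AE x in lebesgue. rep_L2 (- u) x = - rep_L2 u x"
  using rep_scaleR_L2[of "-1" u] by simp

lemma norm_abs_L2:
  "square_integrable f \<Longrightarrow> norm (abs_L2 f) = sqrt (LINT x|lebesgue. (norm (f x))\<^sup>2)"
  by (rule norm_L2.abs_eq) (auto simp: L2_rel_refl)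

lemma norm_abs_L2_sq:
  "square_integrable f \<Longrightarrow> (norm (abs_L2 f))\<^sup>2 = (LINT x|lebesgue. (norm (f x))\<^sup>2)"
  by (simp add: norm_abs_L2)

lemma norm_L2_sq: "(norm u)\<^sup>2 = (LINT x|lebesgue. (norm (rep_L2 u x))\<^sup>2)"
  using norm_abs_L2_sq[OF square_integrable_rep[of u]] by simp

lemma inner_L2_rep: "inner u v = (LINT x|lebesgue. inner (rep_L2 u x) (rep_L2 v x))"
  using inner_L2.abs_eq[of "rep_L2 u" "rep_L2 v"] by (simp add: L2_rel_refl)

lemma nn_integral_abs_L2:
  assumes "square_integrable f"
  shows "(\<integral>\<^sup>+x. ennreal ((norm (f x))\<^sup>2) \<partial>lebesgue) = ennreal ((norm (abs_L2 f))\<^sup>2)"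
  using assms by (subst nn_integral_eq_integral) (auto simp: square_integrable_def norm_abs_L2_sq)

lemma square_integrableI_nn:
  assumes "f \<in> borel_measurable lebesgue"
    and "(\<integral>\<^sup>+x. ennreal ((norm (f x))\<^sup>2) \<partial>lebesgue) < \<infinity>"
  shows "square_integrable f"
  unfolding square_integrable_def
  using assms by (auto intro!: integrableI_bounded)

lemma norm_abs_L2_le_nn:
  assumes "f \<in> borel_measurable lebesgue" "0 \<le> c"
    and "(\<integral>\<^sup>+x. ennreal ((norm (f x))\<^sup>2) \<partial>lebesgue) \<le> ennreal (c\<^sup>2)"
  shows "square_integrable f" "norm (abs_L2 f) \<le> c"
proof -
  show sq: "square_integrable f"
    using assms(1) le_less_trans[OF assms(3)] by (intro square_integrableI_nn) auto
  have "ennreal ((norm (abs_L2 f))\<^sup>2) \<le> ennreal (c\<^sup>2)"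
    using assms(3) by (simp add: nn_integral_abs_L2[OF sq])
  then have "(norm (abs_L2 f))\<^sup>2 \<le> c\<^sup>2" by (simp add: ennreal_le_iff)
  then show "norm (abs_L2 f) \<le> c" using assms(2) by (rule power2_le_imp_le)
qed

lemma square_integrable_bound:
  assumes "square_integrable g" "f \<in> borel_measurable lebesgue"
    "AE x in lebesgue. norm (f x) \<le> norm (g x)"
  shows "square_integrable f"
  unfolding square_integrable_def
proof
  show "integrable lebesgue (\<lambda>x. (norm (f x))\<^sup>2)"
  proof (rule Bochner_Integration.integrable_bound)
    show "integrable lebesgue (\<lambda>x. (norm (g x))\<^sup>2)"
      using assms(1) by (simp add: square_integrable_def)
    show "AE x in lebesgue. norm ((norm (f x))\<^sup>2) \<le> norm ((norm (g x))\<^sup>2)"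
      using assms(3) by eventually_elim (auto intro: power_mono)
  qed (use assms(2) in measurable)
qed (fact assms(2))

lemma norm_abs_L2_mono:
  assumes "square_integrable g" "f \<in> borel_measurable lebesgue"
    "AE x in lebesgue. norm (f x) \<le> norm (g x)"
  shows "norm (abs_L2 f) \<le> norm (abs_L2 g)"
proof -
  have sq: "square_integrable f" by (rule square_integrable_bound[OF assms])
  have "(LINT x|lebesgue. (norm (f x))\<^sup>2) \<le> (LINT x|lebesgue. (norm (g x))\<^sup>2)"
  proof (rule integral_mono_AE)
    show "AE x in lebesgue. (norm (f x))\<^sup>2 \<le> (norm (g x))\<^sup>2"
      using assms(3) by eventually_elim (auto intro: power_mono)
  qed (use sq assms(1) in \<open>auto simp: square_integrable_def\<close>)
  then show ?thesis by (simp add: norm_abs_L2 sq assms(1))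
qed

text \<open>Dominated convergence for the integrals of \<open>|f\<^sub>k - g|\<^sup>2\<close>, which are dominated by \<open>4h\<^sup>2\<close>.\<close>

lemma L2_dominated_convergence:
  assumes h: "square_integrable h"
    and f: "\<And>k. f k \<in> borel_measurable lebesgue" "g \<in> borel_measurable lebesgue"
    and dom: "\<And>k. AE x in lebesgue. norm (f k x) \<le> norm (h x)"
    and lim: "AE x in lebesgue. (\<lambda>k. f k x) \<longlonglongrightarrow> g x"
  shows "square_integrable g" "(\<lambda>k. abs_L2 (f k)) \<longlonglongrightarrow> abs_L2 g"
proof -
  note [measurable] = f
  have "AE x in lebesgue. \<forall>k. norm (f k x) \<le> norm (h x)"
    using dom by (simp add: AE_all_countable)
  then have gle: "AE x in lebesgue. norm (g x) \<le> norm (h x)"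
    using lim by eventually_elim (auto intro: Lim_bounded tendsto_norm)
  show sg: "square_integrable g" by (rule square_integrable_bound[OF h f(2) gle])
  have sf: "square_integrable (f k)" for k by (rule square_integrable_bound[OF h f(1) dom])
  have "(\<lambda>k. LINT x|lebesgue. (norm (f k x - g x))\<^sup>2) \<longlonglongrightarrow> (LINT x|(lebesgue::(real^'a) measure). (0::real))"
  proof (rule integral_dominated_convergence[where w = "\<lambda>x. 4 * (norm (h x))\<^sup>2"])
    show "AE x in lebesgue. (\<lambda>k. (norm (f k x - g x))\<^sup>2) \<longlonglongrightarrow> 0"
      using lim
    proof eventually_elim
      case (elim x)
      from tendsto_power[OF tendsto_norm_zero[OF LIM_zero[OF elim]], of 2] show ?case by simp
    qed
    show "AE x in lebesgue. norm ((norm (f k x - g x))\<^sup>2) \<le> 4 * (norm (h x))\<^sup>2" for k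
      using dom[of k] gle
    proof eventually_elim
      case (elim x)
      have "norm (f k x - g x) \<le> 2 * norm (h x)"
        using elim norm_triangle_ineq4[of "f k x" "g x"] by linarith
      then have "(norm (f k x - g x))\<^sup>2 \<le> (2 * norm (h x))\<^sup>2" by (intro power_mono) auto
      then show ?case by simp
    qed
    show "integrable lebesgue (\<lambda>x. 4 * (norm (h x))\<^sup>2)"
      using h by (simp add: square_integrable_def)
  qed measurable
  then have "(\<lambda>k. (norm (abs_L2 (f k) - abs_L2 g))\<^sup>2) \<longlonglongrightarrow> 0"
    by (simp add: abs_L2_diff sf sg norm_abs_L2_sq square_integrable_diff)
  then have "(\<lambda>k. sqrt ((norm (abs_L2 (f k) - abs_L2 g))\<^sup>2)) \<longlonglongrightarrow> sqrt 0"
    by (rule tendsto_real_sqrt)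
  then show "(\<lambda>k. abs_L2 (f k)) \<longlonglongrightarrow> abs_L2 g"
    by (simp add: tendsto_norm_zero_iff LIM_zero_iff)
qed

text \<open>Fatou's lemma in the form needed to identify the limit of a Cauchy sequence.\<close>

lemma L2_Fatou:
  assumes g: "g \<in> borel_measurable lebesgue" and c: "0 \<le> c"
    and lim: "AE x in lebesgue. (\<lambda>k. rep_L2 (u k) x) \<longlonglongrightarrow> g x"
    and bd: "eventually (\<lambda>k. norm (u k - v) \<le> c) sequentially"
  shows "square_integrable g" "norm (abs_L2 g - v) \<le> c"
proof -
  note [measurable] = g
  have AEd: "AE x in lebesgue. \<forall>k. rep_L2 (u k - v) x = rep_L2 (u k) x - rep_L2 v x"
    by (subst AE_all_countable) (blast intro: rep_diff_L2)
  have "(\<integral>\<^sup>+x. ennreal ((norm (g x - rep_L2 v x))\<^sup>2) \<partial>lebesgue)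
      = (\<integral>\<^sup>+x. liminf (\<lambda>k. ennreal ((norm (rep_L2 (u k - v) x))\<^sup>2)) \<partial>lebesgue)"
  proof (rule nn_integral_cong_AE)
    show "AE x in lebesgue. ennreal ((norm (g x - rep_L2 v x))\<^sup>2)
        = liminf (\<lambda>k. ennreal ((norm (rep_L2 (u k - v) x))\<^sup>2))"
      using AEd lim
    proof eventually_elim
      case (elim x)
      have "(\<lambda>k. ennreal ((norm (rep_L2 (u k - v) x))\<^sup>2)) \<longlonglongrightarrow> ennreal ((norm (g x - rep_L2 v x))\<^sup>2)"
        using elim by (intro tendsto_ennrealI) (auto intro!: tendsto_intros)
      from lim_imp_Liminf[OF _ this] show ?case by simp
    qed
  qed
  also have "\<dots> \<le> liminf (\<lambda>k. \<integral>\<^sup>+x. ennreal ((norm (rep_L2 (u k - v) x))\<^sup>2) \<partial>lebesgue)"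
    by (rule nn_integral_liminf) measurable
  also have "\<dots> = liminf (\<lambda>k. ennreal ((norm (u k - v))\<^sup>2))"
    by (simp add: nn_integral_abs_L2)
  also have "\<dots> \<le> ennreal (c\<^sup>2)"
    by (rule Liminf_le)
      (use bd in \<open>auto elim!: eventually_mono intro!: ennreal_leI power_mono\<close>)
  finally have le: "(\<integral>\<^sup>+x. ennreal ((norm (g x - rep_L2 v x))\<^sup>2) \<partial>lebesgue) \<le> ennreal (c\<^sup>2)" .
  have sqd: "square_integrable (\<lambda>x. g x - rep_L2 v x)" "norm (abs_L2 (\<lambda>x. g x - rep_L2 v x)) \<le> c"
    using norm_abs_L2_le_nn[OF _ c le] by auto
  have "square_integrable (\<lambda>x. (g x - rep_L2 v x) + rep_L2 v x)"
    using sqd(1) by (rule square_integrable_add) simp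
  then show sg: "square_integrable g" by simp
  have "abs_L2 g - v = abs_L2 (\<lambda>x. g x - rep_L2 v x)"
    using abs_L2_diff[OF sg square_integrable_rep[of v]] by simp
  then show "norm (abs_L2 g - v) \<le> c" using sqd(2) by simp
qed

lemma square_integrable_of_real_norm:
  "square_integrable f \<Longrightarrow> square_integrable (\<lambda>x. complex_of_real (norm (f x)))"
  by (rule square_integrable_bound[of f]) (auto simp: square_integrable_def)

text \<open>The sum of the moduli of the increments has \<open>L\<^sup>2\<close> norm at most \<open>2\<close> by monotone convergence, hence is
  finite almost everywhere, and there the series of increments converges absolutely.\<close>

lemma L2_summable_AE_convergent:
  fixes u :: "nat \<Rightarrow> 'n::finite L2"
  assumes "\<And>k. norm (u (Suc k) - u k) \<le> (1/2)^k"
  shows "AE x in lebesgue. convergent (\<lambda>k. rep_L2 (u k) x)"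
proof -
  define d where "d k x = norm (rep_L2 (u (Suc k)) x - rep_L2 (u k) x)" for k x
  have [measurable]: "d k \<in> borel_measurable lebesgue" for k unfolding d_def by measurable
  have sqd0: "square_integrable (\<lambda>x. rep_L2 (u (Suc k)) x - rep_L2 (u k) x)" for k
    by (intro square_integrable_diff) auto
  have sqd: "square_integrable (\<lambda>x. complex_of_real (d k x))" for k
    unfolding d_def by (rule square_integrable_of_real_norm[OF sqd0])
  have nd: "norm (abs_L2 (\<lambda>x. complex_of_real (d k x))) \<le> (1/2)^k" for k
  proof -
    have "norm (abs_L2 (\<lambda>x. complex_of_real (d k x)))
        \<le> norm (abs_L2 (\<lambda>x. rep_L2 (u (Suc k)) x - rep_L2 (u k) x))"
      by (rule norm_abs_L2_mono[OF sqd0]) (auto simp: d_def)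
    also have "\<dots> = norm (u (Suc k) - u k)"
      by (simp flip: abs_L2_diff)
    finally show ?thesis using assms[of k] by simp
  qed
  define G where "G m x = (\<Sum>k<m. d k x)" for m x
  have [measurable]: "G m \<in> borel_measurable lebesgue" for m unfolding G_def by measurable
  have G: "square_integrable (\<lambda>x. complex_of_real (G m x)) \<and>
      norm (abs_L2 (\<lambda>x. complex_of_real (G m x))) \<le> (\<Sum>k<m. (1/2)^k)" for m
  proof (induction m)
    case 0
    have "abs_L2 (\<lambda>_. 0) = (0 :: 'n L2)" by (simp add: zero_L2_def)
    then show ?case by (simp add: G_def square_integrable_zero)
  next
    case (Suc m)
    have eq: "(\<lambda>x. complex_of_real (G (Suc m) x))
        = (\<lambda>x. complex_of_real (G m x) + complex_of_real (d m x))"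
      by (simp add: G_def)
    have "norm (abs_L2 (\<lambda>x. complex_of_real (G m x)) + abs_L2 (\<lambda>x. complex_of_real (d m x)))
        \<le> (\<Sum>k<m. (1/2)^k) + (1/2)^m"
      using Suc nd[of m] by (intro order.trans[OF norm_triangle_ineq] add_mono) auto
    then show ?case unfolding eq using Suc sqd[of m]
      by (simp add: abs_L2_add square_integrable_add)
  qed
  have geo: "(\<Sum>k<m. (1/2::real)^k) \<le> 2" for m
  proof -
    have "(\<Sum>k<m. (1/2::real)^k) = 2 - 2 * (1/2)^m" by (induction m) simp_all
    then show ?thesis by simp
  qed
  have int: "(\<integral>\<^sup>+x. ennreal ((G m x)\<^sup>2) \<partial>lebesgue) \<le> ennreal (2\<^sup>2)" for m
  proof -
    have "(\<integral>\<^sup>+x. ennreal ((G m x)\<^sup>2) \<partial>lebesgue)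
        = ennreal ((norm (abs_L2 (\<lambda>x. complex_of_real (G m x))))\<^sup>2)"
      using nn_integral_abs_L2[OF conjunct1[OF G[of m]]] by simp
    also have "\<dots> \<le> ennreal (2\<^sup>2)"
      using G[of m] geo[of m] by (intro ennreal_leI power_mono) auto
    finally show ?thesis .
  qed
  have dn: "0 \<le> d k x" for k x by (simp add: d_def)
  have Gmono: "G m x \<le> G m' x" if "m \<le> m'" for m m' x
    unfolding G_def using that by (intro sum_mono2) (auto simp: dn)
  have Gn: "0 \<le> G m x" for m x unfolding G_def by (intro sum_nonneg) (auto simp: dn)
  have "(\<integral>\<^sup>+x. (SUP m. ennreal ((G m x)\<^sup>2)) \<partial>lebesgue) = (SUP m. \<integral>\<^sup>+x. ennreal ((G m x)\<^sup>2) \<partial>lebesgue)"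
    by (rule nn_integral_monotone_convergence_SUP)
       (auto simp: incseq_def le_fun_def intro!: ennreal_leI power_mono Gmono Gn)
  also have "\<dots> \<le> ennreal (2\<^sup>2)" by (rule SUP_least) (rule int)
  finally have "(\<integral>\<^sup>+x. (SUP m. ennreal ((G m x)\<^sup>2)) \<partial>lebesgue) \<noteq> \<infinity>"
    by (metis ennreal_neq_top infinity_ennreal_def top.extremum_uniqueI)
  then have "AE x in lebesgue. (SUP m. ennreal ((G m x)\<^sup>2)) \<noteq> \<infinity>"
    by (intro nn_integral_PInf_AE) measurable
  then show ?thesis
  proof eventually_elim
    case (elim x)
    then obtain c where c: "0 \<le> c" "(SUP m. ennreal ((G m x)\<^sup>2)) = ennreal c"
      by (metis ennreal_cases infinity_ennreal_def)
    have "(G m x)\<^sup>2 \<le> c" for m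
    proof -
      have "ennreal ((G m x)\<^sup>2) \<le> ennreal c" unfolding c(2)[symmetric] by (rule SUP_upper) simp
      then show ?thesis using c(1) by (simp add: ennreal_le_iff)
    qed
    then have "G m x \<le> sqrt c" for m using real_le_rsqrt by blast
    then have "summable (\<lambda>k. d k x)"
      by (intro summableI_nonneg_bounded[where x = "sqrt c"]) (auto simp: dn G_def)
    then have "summable (\<lambda>k. rep_L2 (u (Suc k)) x - rep_L2 (u k) x)"
      unfolding d_def by (rule summable_norm_cancel)
    then have "convergent (\<lambda>m. \<Sum>k<m. rep_L2 (u (Suc k)) x - rep_L2 (u k) x)"
      by (simp add: summable_iff_convergent)
    then have "convergent (\<lambda>m. rep_L2 (u m) x - rep_L2 (u 0) x)"
      by (simp only: sum_lessThan_telescope[where f = "\<lambda>k. rep_L2 (u k) x"])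
    then have "convergent (\<lambda>m. (rep_L2 (u m) x - rep_L2 (u 0) x) + rep_L2 (u 0) x)"
      by (rule convergent_add) (rule convergent_const)
    then show ?case by simp
  qed
qed

instance L2 :: (finite) banach
proof
  fix X :: "nat \<Rightarrow> 'a L2" assume X: "Cauchy X"
  have "\<exists>N. \<forall>m\<ge>N. \<forall>n\<ge>N. norm (X m - X n) < (1/2)^k" for k
    using CauchyD[OF X, of "(1/2)^k"] by simp
  then obtain N where N: "\<And>k m n. m \<ge> N k \<Longrightarrow> n \<ge> N k \<Longrightarrow> norm (X m - X n) < (1/2)^k"
    by metis
  \<comment> \<open>A subsequence along which the increments are at most \<open>2\<^sup>-\<^sup>k\<close>; its pointwise limit is the limit in
    norm, by Fatou's lemma.\<close>
  define r where "r = rec_nat (N 0) (\<lambda>k r. Suc (max r (N (Suc k))))"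
  have r: "r (Suc k) = Suc (max (r k) (N (Suc k)))" "r 0 = N 0" for k by (simp_all add: r_def)
  have smr: "strict_mono r" by (rule strict_monoI_Suc) (simp add: r less_Suc_eq_le)
  have rN: "N k \<le> r k" for k by (cases k) (auto simp: r)
  have "norm (X (r (Suc k)) - X (r k)) \<le> (1/2)^k" for k
    using N[of k "r (Suc k)" "r k"] rN[of k] strict_monoD[OF smr, of k "Suc k"] by simp
  from L2_summable_AE_convergent[of "\<lambda>k. X (r k)", OF this]
  have conv: "AE x in lebesgue. convergent (\<lambda>k. rep_L2 (X (r k)) x)" .
  define g where "g x = lim (\<lambda>k. rep_L2 (X (r k)) x)" for x
  have [measurable]: "g \<in> borel_measurable lebesgue"
    unfolding g_def by (rule borel_measurable_lim_metric) measurable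
  have lim: "AE x in lebesgue. (\<lambda>k. rep_L2 (X (r k)) x) \<longlonglongrightarrow> g x"
    using conv by eventually_elim (simp add: g_def convergent_LIMSEQ_iff)
  have "(\<lambda>k. X (r k)) \<longlonglongrightarrow> abs_L2 g"
  proof (rule LIMSEQ_I)
    fix e :: real assume e: "e > 0"
    then obtain M where M: "\<And>m n. m \<ge> M \<Longrightarrow> n \<ge> M \<Longrightarrow> norm (X m - X n) < e/2"
      using CauchyD[OF X, of "e/2"] by auto
    have "norm (X (r k) - abs_L2 g) < e" if "k \<ge> M" for k
    proof -
      have "norm (abs_L2 g - X (r k)) \<le> e/2"
      proof (rule L2_Fatou(2)[OF _ _ lim])
        show "eventually (\<lambda>m. norm (X (r m) - X (r k)) \<le> e/2) sequentially"
          unfolding eventually_sequentially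
        proof (intro exI allI impI)
          fix m assume "M \<le> m"
          then show "norm (X (r m) - X (r k)) \<le> e/2"
            using M[of "r m" "r k"] seq_suble[OF smr, of m] seq_suble[OF smr, of k] that by simp
        qed
      qed (use e in auto)
      then show ?thesis using e by (simp add: norm_minus_commute)
    qed
    then show "\<exists>no. \<forall>n\<ge>no. norm (X (r n) - abs_L2 g) < e" by blast
  qed
  then have "X \<longlonglongrightarrow> abs_L2 g"
    using Cauchy_converges_subseq[OF X smr] by (simp add: o_def)
  then show "convergent X" by (auto simp: convergent_def)
qed

subsection \<open>Step functions on boxes are dense\<close>

definition csubspace_L2 :: "'n::finite L2 set \<Rightarrow> bool" where
  "csubspace_L2 W \<longleftrightarrow> 0 \<in> W \<and> (\<forall>u\<in>W. \<forall>v\<in>W. u + v \<in> W) \<and> (\<forall>c. \<forall>u\<in>W. scaleC_L2 c u \<in> W)"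

lemma csubspace_L2_diff:
  assumes "csubspace_L2 W" "u \<in> W" "v \<in> W" shows "u - v \<in> W"
proof -
  have "- v = scaleC_L2 (-1) v" using scaleR_scaleC_L2[of "-1" v] by simp
  then have "u + (- v) \<in> W" using assms unfolding csubspace_L2_def by metis
  then show ?thesis by simp
qed

lemma csubspace_L2_abs_sum:
  fixes W :: "'n::finite L2 set"
  assumes W: "csubspace_L2 W" and "finite I"
    and "\<And>i. i \<in> I \<Longrightarrow> square_integrable (f i)" "\<And>i. i \<in> I \<Longrightarrow> abs_L2 (f i) \<in> W"
  shows "square_integrable (\<lambda>x. \<Sum>i\<in>I. f i x) \<and> abs_L2 (\<lambda>x. \<Sum>i\<in>I. f i x) \<in> W"
  using assms(2,3,4)
proof (induction I rule: finite_induct)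
  case empty
  have "abs_L2 (\<lambda>_. 0) = (0 :: 'n L2)" by (simp add: zero_L2_def)
  then show ?case using W by (simp add: square_integrable_zero csubspace_L2_def)
next
  case (insert i I)
  then have "abs_L2 (f i) + abs_L2 (\<lambda>x. \<Sum>i\<in>I. f i x) \<in> W"
    using W by (simp add: csubspace_L2_def)
  then show ?case using insert
    by (simp add: abs_L2_add square_integrable_add)
qed

lemma square_integrable_indicator:
  fixes A :: "(real^'n::finite) set"
  assumes "A \<in> sets lebesgue" "A \<subseteq> box a b"
  shows "square_integrable (indicator A)"
proof -
  have "emeasure lebesgue A \<le> emeasure lebesgue (box a b)"
    using assms by (intro emeasure_mono) auto
  also have "\<dots> < \<infinity>" using emeasure_lborel_box_finite[of a b] by simp
  finally have "integrable lebesgue (indicator A :: _ \<Rightarrow> real)"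
    using assms by (simp add: integrable_indicator_iff)
  moreover have "(\<lambda>x. (norm (indicator A x :: complex))\<^sup>2) = (indicator A :: _ \<Rightarrow> real)"
    by (auto simp: indicator_def)
  ultimately show ?thesis using assms(1) by (simp add: square_integrable_def)
qed

lemma Borel_version_complex:
  fixes f :: "real^'n::finite \<Rightarrow> complex"
  assumes f: "f \<in> borel_measurable lebesgue"
  shows "\<exists>g\<in>borel_measurable lborel. AE x in lborel. f x = g x"
proof -
  have "(\<lambda>x. Re (f x)) \<in> borel_measurable lebesgue" "(\<lambda>x. Im (f x)) \<in> borel_measurable lebesgue"
    using f by measurable
  from completion_ex_borel_measurable_real[OF this(1)] completion_ex_borel_measurable_real[OF this(2)]
  obtain a b where [measurable]: "a \<in> borel_measurable lborel" "b \<in> borel_measurable lborel"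
    and ae: "AE x in lborel. Re (f x) = a x" "AE x in lborel. Im (f x) = b x" by blast
  show ?thesis
  proof
    show "AE x in lborel. f x = Complex (a x) (b x)"
      using ae by eventually_elim (simp add: complex_eq_iff)
  qed (simp add: Complex_eq)
qed

text \<open>Boxes are an intersection-stable generator of the Borel sets, so Dynkin's lemma extends membership in
  \<open>W\<close> from boxes to Borel subsets of a large box, and then linearity and dominated convergence extend it to
  simple functions and to all functions.\<close>

theorem L2_box_dense:
  fixes W :: "'n::finite L2 set"
  assumes W: "csubspace_L2 W" and cl: "closed W"
    and box: "\<And>a b. abs_L2 (indicator (box a b)) \<in> W"
  shows "u \<in> W"
proof -
  define B :: "nat \<Rightarrow> (real^'n) set" where "B k = box (- (\<chi> i. real k)) (\<chi> i. real k)" for k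
  have sqB: "A \<in> sets borel \<Longrightarrow> square_integrable (indicator (A \<inter> B k))" for A k
    unfolding B_def by (rule square_integrable_indicator[where a = "- (\<chi> i. real k)" and b = "(\<chi> i. real k)"]) auto
  have [measurable]: "B k \<in> sets borel" "B k \<in> sets lebesgue" for k by (auto simp: B_def)
  have Blim: "eventually (\<lambda>k. x \<in> B k) sequentially" for x
  proof -
    obtain k0 :: nat where k0: "norm x < real k0" using reals_Archimedean2 by blast
    show ?thesis
      unfolding eventually_sequentially
    proof (intro exI allI impI)
      fix k assume "k0 \<le> k"
      then have "- real k < x $ i \<and> x $ i < real k" for i
        using k0 component_le_norm_cart[of x i] by (simp add: abs_if split: if_splits)
      then show "x \<in> B k" by (simp add: B_def mem_box_cart)
    qed
  qed
  have sets_borel_box: "sets borel = sigma_sets UNIV (range (\<lambda>(a, b). box a b :: (real^'n) set))"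
    by (subst borel_eq_box) (rule sets_measure_of, simp)
  have indW: "abs_L2 (indicator (A \<inter> B k)) \<in> W" if A: "A \<in> sets borel" for A k
  proof -
    \<comment> \<open>Differences and disjoint unions of sets become differences and series of indicators; the cutoff
      \<open>B k\<close> keeps all of them square integrable.\<close>
    have "Int_stable (range (\<lambda>(a, b). box a b :: (real^'n) set))"
      by (auto simp: Int_stable_def box_Int_box)
    moreover have "range (\<lambda>(a, b). box a b :: (real^'n) set) \<subseteq> Pow UNIV" by simp
    moreover have "A \<in> sigma_sets UNIV (range (\<lambda>(a, b). box a b :: (real^'n) set))"
      using A sets_borel_box by blast
    ultimately show ?thesis
    proof (induction rule: sigma_sets_induct_disjoint)
      fix A :: "(real^'n) set" assume "A \<in> range (\<lambda>(a, b). box a b)"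
      then obtain a b where "A = box a b" by auto
      then have "\<exists>c d. A \<inter> B k = box c d" unfolding B_def by (simp add: box_Int_box) blast
      then obtain c d where "A \<inter> B k = box c d" by blast
      then show "abs_L2 (indicator (A \<inter> B k)) \<in> W" using box by simp
    next
      have "(indicator ({} \<inter> B k) :: real^'n \<Rightarrow> complex) = (\<lambda>_. 0)" by auto
      moreover have "abs_L2 (\<lambda>_. 0) = (0 :: 'n L2)" by (simp add: zero_L2_def)
      ultimately show "abs_L2 (indicator ({} \<inter> B k)) \<in> W" using W by (simp add: csubspace_L2_def)
    next
      fix A assume "A \<in> sigma_sets UNIV (range (\<lambda>(a, b). box a b :: (real^'n) set))"
        and IH: "abs_L2 (indicator (A \<inter> B k)) \<in> W"
      then have A: "A \<in> sets borel" using sets_borel_box by blast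
      have eq: "(indicator ((UNIV - A) \<inter> B k) :: real^'n \<Rightarrow> complex)
          = (\<lambda>x. indicator (B k) x - indicator (A \<inter> B k) x)"
        by (auto simp: indicator_def fun_eq_iff)
      have "square_integrable (indicator (B k) :: real^'n \<Rightarrow> complex)"
        using sqB[of UNIV k] by simp
      then have "abs_L2 (indicator ((UNIV - A) \<inter> B k))
          = abs_L2 (indicator (B k)) - abs_L2 (indicator (A \<inter> B k))"
        unfolding eq using sqB[OF A] by (simp add: abs_L2_diff)
      also have "\<dots> \<in> W" using IH box[of "- (\<chi> i. real k)" "\<chi> i. real k"]
        by (intro csubspace_L2_diff[OF W]) (simp_all add: B_def)
      finally show "abs_L2 (indicator ((UNIV - A) \<inter> B k)) \<in> W" .
    next
      fix A :: "nat \<Rightarrow> (real^'n) set"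
      assume disj: "disjoint_family A"
        and "range A \<subseteq> sigma_sets UNIV (range (\<lambda>(a, b). box a b))"
        and IH: "\<And>i. abs_L2 (indicator (A i \<inter> B k)) \<in> W"
      then have A: "A i \<in> sets borel" for i using sets_borel_box by blast
      have eqf: "(\<Sum>i<m. indicator (A i \<inter> B k) x) = (indicator ((\<Union>i<m. A i) \<inter> B k) x :: complex)" for m x
      proof -
        have "indicator ((\<Union>i<m. A i) \<inter> B k) x = (indicator (\<Union>i<m. A i \<inter> B k) x :: complex)"
          by (simp add: Int_UN_distrib2 indicator_def)
        also have "\<dots> = (\<Sum>i<m. indicator (A i \<inter> B k) x)"
          by (rule indicator_UN_disjoint)
             (use disj in \<open>auto simp: disjoint_family_on_def\<close>)
        finally show ?thesis by simp
      qed
      have "abs_L2 (indicator ((\<Union>i<m. A i) \<inter> B k)) \<in> W" for m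
      proof -
        have "(indicator ((\<Union>i<m. A i) \<inter> B k) :: real^'n \<Rightarrow> complex)
            = (\<lambda>x. \<Sum>i<m. indicator (A i \<inter> B k) x)"
          by (simp add: eqf fun_eq_iff)
        then show ?thesis
          using csubspace_L2_abs_sum[OF W, of "{..<m}" "\<lambda>i. indicator (A i \<inter> B k)"] sqB[OF A] IH
          by simp
      qed
      moreover have "(\<lambda>m. abs_L2 (indicator ((\<Union>i<m. A i) \<inter> B k)))
          \<longlonglongrightarrow> abs_L2 (indicator ((\<Union>i. A i) \<inter> B k))"
      proof (rule L2_dominated_convergence(2))
        show "square_integrable (indicator (B k) :: real^'n \<Rightarrow> complex)"
          using sqB[of UNIV k] by simp
        have "(\<Union>i<m. A i) \<in> sets borel" for m using A by auto
        from sqB[OF this]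
        show "(indicator ((\<Union>i<m. A i) \<inter> B k) :: _ \<Rightarrow> complex) \<in> borel_measurable lebesgue" for m
          unfolding square_integrable_def by blast
        have "(\<Union>i. A i) \<in> sets borel" using A by auto
        from sqB[OF this]
        show "(indicator ((\<Union>i. A i) \<inter> B k) :: _ \<Rightarrow> complex) \<in> borel_measurable lebesgue"
          unfolding square_integrable_def by blast
        show "AE x in lebesgue. (\<lambda>m. indicator ((\<Union>i<m. A i) \<inter> B k) x)
            \<longlonglongrightarrow> (indicator ((\<Union>i. A i) \<inter> B k) x :: complex)"
        proof (rule AE_I2)
          fix x
          show "(\<lambda>m. indicator ((\<Union>i<m. A i) \<inter> B k) x)
            \<longlonglongrightarrow> (indicator ((\<Union>i. A i) \<inter> B k) x :: complex)"
          proof (cases "\<exists>i. x \<in> A i")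
            case True
            then obtain i where "x \<in> A i" by blast
            then have "\<forall>m\<ge>Suc i. indicator ((\<Union>i<m. A i) \<inter> B k) x
                = (indicator ((\<Union>i. A i) \<inter> B k) x :: complex)"
              by (auto simp: indicator_def)
            then show ?thesis by (intro tendsto_eventually) (auto simp: eventually_sequentially)
          qed (auto simp: indicator_def)
        qed
        show "AE x in lebesgue. cmod (indicator ((\<Union>i<m. A i) \<inter> B k) x) \<le> cmod (indicator (B k) x)" for m
          by (rule AE_I2) (auto simp: indicator_def)
      qed
      ultimately show "abs_L2 (indicator ((\<Union>i. A i) \<inter> B k)) \<in> W"
        by (rule closed_sequentially[OF cl])
    qed
  qed
  \<comment> \<open>A Borel representative is approximated by simple functions cut off to large boxes.\<close>
  from Borel_version_complex[OF rep_L2_measurable[of u]]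
  obtain f where f[measurable]: "f \<in> borel_measurable lborel" and fae: "AE x in lborel. rep_L2 u x = f x"
    by blast
  have fm[measurable]: "f \<in> borel_measurable lebesgue" using measurable_completion[OF f] .
  have fae': "AE x in lebesgue. rep_L2 u x = f x" using fae by (rule AE_completion)
  have sf: "square_integrable f"
    by (rule square_integrable_bound[OF square_integrable_rep[of u] fm]) (use fae' in eventually_elim, simp)
  have uf: "u = abs_L2 f" using abs_L2_eqI'[OF sf, of u] fae' by (auto simp: eq_commute)
  obtain s where s: "\<And>i. simple_function lborel (s i)" "\<And>x. (\<lambda>i. s i x) \<longlonglongrightarrow> f x"
      "\<And>i x. norm (s i x) \<le> 2 * norm (f x)"
    using borel_measurable_implies_sequence_metric[of f lborel 0] f by (auto simp: dist_norm)
  define h where "h k x = indicator (B k) x * s k x" for k x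
  have hm: "h k \<in> borel_measurable lebesgue" for k
    using borel_measurable_simple_function[OF s(1)[of k]] unfolding h_def
    by (intro borel_measurable_times measurable_completion) auto
  have "abs_L2 (h k) \<in> W" for k
  proof -
    have fin: "finite (range (s k))" using simple_functionD(1)[OF s(1)[of k]] by simp
    have A: "s k -` {c} \<in> sets borel" for c
      using simple_functionD(2)[OF s(1)[of k], of "{c}"] by simp
    have "(h k) = (\<lambda>x. \<Sum>c\<in>range (s k). c * indicator (s k -` {c} \<inter> B k) x)"
    proof
      fix x
      have "(\<Sum>c\<in>range (s k). c * indicator (s k -` {c} \<inter> B k) x)
          = (\<Sum>c\<in>range (s k). if c = s k x then c * indicator (B k) x else 0)"
        by (intro sum.cong) (auto simp: indicator_def)
      then show "h k x = (\<Sum>c\<in>range (s k). c * indicator (s k -` {c} \<inter> B k) x)"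
        using fin by (simp add: h_def)
    qed
    moreover have "abs_L2 (\<lambda>x. c * indicator (s k -` {c} \<inter> B k) x) \<in> W" for c
      using indW[OF A, of c k] W abs_L2_scaleC[OF sqB[OF A], of c c k]
      by (simp add: csubspace_L2_def) metis
    ultimately show ?thesis
      using csubspace_L2_abs_sum[OF W fin, of "\<lambda>c x. c * indicator (s k -` {c} \<inter> B k) x"]
        square_integrable_cmult[OF sqB[OF A]] by simp
  qed
  moreover have "(\<lambda>k. abs_L2 (h k)) \<longlonglongrightarrow> abs_L2 f"
  proof (rule L2_dominated_convergence(2))
    show "square_integrable (\<lambda>x. 2 * f x)" by (rule square_integrable_cmult[OF sf])
    show "AE x in lebesgue. norm (h k x) \<le> norm (2 * f x)" for k
      using s(3)[of k] by (intro AE_I2) (auto simp: h_def indicator_def norm_mult)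
    show "AE x in lebesgue. (\<lambda>k. h k x) \<longlonglongrightarrow> f x"
    proof (rule AE_I2)
      fix x
      have "eventually (\<lambda>k. s k x = h k x) sequentially"
        using Blim[of x] by eventually_elim (simp add: h_def)
      then show "(\<lambda>k. h k x) \<longlonglongrightarrow> f x" using s(2)[of x] by (rule Lim_transform_eventually[rotated])
    qed
  qed (use hm fm in auto)
  ultimately have "abs_L2 f \<in> W" by (rule closed_sequentially[OF cl])
  then show ?thesis using uf by simp
qed


section \<open>Gaussians and the Plancherel inequality\<close>

lemma borel_measurable_cnj [measurable]: "cnj \<in> borel_measurable borel"
  by (intro borel_measurable_continuous_onI continuous_intros)

lemma Basis_prod_cart:
  "(\<Prod>b\<in>Basis. f b (x \<bullet> b)) = (\<Prod>i\<in>UNIV. f (axis i 1) (x $ i))" for x :: "real^'n::finite"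
proof -
  have B: "(Basis :: (real^'n) set) = (\<lambda>i. axis i 1) ` UNIV" by (auto simp: Basis_vec_def)
  have "inj (\<lambda>i. axis i (1::real) :: real^'n)" by (auto simp: inj_on_def axis_eq_axis)
  then show ?thesis unfolding B by (subst prod.reindex) (auto simp: cart_eq_inner_axis)
qed

text \<open>Fubini's theorem for products of functions of one coordinate. All explicit integrals below reduce
  through it to integrals on the line.\<close>

lemma
  fixes g :: "'n::finite \<Rightarrow> real \<Rightarrow> 'b::{real_normed_field,banach,second_countable_topology}"
  assumes g: "\<And>i. integrable lborel (g i)"
  shows integrable_lborel_tensor: "integrable lborel (\<lambda>x::real^'n. \<Prod>i\<in>UNIV. g i (x $ i))"
    and integral_lborel_tensor:
      "(LINT x|lborel. (\<Prod>i\<in>UNIV. g i ((x::real^'n) $ i))) = (\<Prod>i\<in>UNIV. (LINT s|lborel. g i s))"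
proof -
  interpret product_sigma_finite "\<lambda>b::real^'n. lborel :: real measure" ..
  have B: "(Basis :: (real^'n) set) = (\<lambda>i. axis i 1) ` UNIV" by (auto simp: Basis_vec_def)
  have inj: "inj (\<lambda>i. axis i (1::real) :: real^'n)" by (auto simp: inj_on_def axis_eq_axis)
  define G where "G b = g (inv (\<lambda>i. axis i (1::real) :: real^'n) b)" for b
  have Gax: "G (axis i 1) = g i" for i unfolding G_def by (simp add: inv_f_f[OF inj])
  have eq: "(\<Prod>i\<in>UNIV. g i (x $ i)) = (\<Prod>b\<in>Basis. G b (x \<bullet> b))" for x :: "real^'n"
    by (simp add: Basis_prod_cart Gax)
  have Gi: "integrable lborel (G b)" for b unfolding G_def by (rule g)
  have [measurable]: "G b \<in> borel_measurable borel" for b using Gi[of b] by simp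
  have comp: "(\<Prod>b\<in>Basis. G b ((\<Sum>b\<in>Basis. f b *\<^sub>R b) \<bullet> b)) = (\<Prod>b\<in>Basis. G b (f b))" for f :: "real^'n \<Rightarrow> real"
    by (intro prod.cong) auto
  have int: "integrable (\<Pi>\<^sub>M b\<in>Basis. lborel) (\<lambda>x. \<Prod>b\<in>(Basis::(real^'n) set). G b (x b))"
    by (rule product_integrable_prod) (auto intro: Gi)
  show "integrable lborel (\<lambda>x::real^'n. \<Prod>i\<in>UNIV. g i (x $ i))"
    unfolding eq
    by (subst lborel_eq, subst integrable_distr_eq) (simp_all add: comp int)
  have "(LINT x|lborel. (\<Prod>b\<in>Basis. G b ((x::real^'n) \<bullet> b))) = (\<Prod>b\<in>(Basis::(real^'n) set). integral\<^sup>L lborel (G b))"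
    by (subst lborel_eq, subst integral_distr) (simp_all add: comp product_integral_prod Gi)
  also have "\<dots> = (\<Prod>i\<in>UNIV. (LINT s|lborel. g i s))"
    unfolding B by (subst prod.reindex) (auto simp: inj Gax)
  finally show "(LINT x|lborel. (\<Prod>i\<in>UNIV. g i ((x::real^'n) $ i))) = (\<Prod>i\<in>UNIV. (LINT s|lborel. g i s))"
    by (simp add: eq)
qed

lemma integral_lborel_translate:
  fixes f :: "'a::euclidean_space \<Rightarrow> 'b::{banach,second_countable_topology}"
  assumes [measurable]: "f \<in> borel_measurable borel"
  shows "(LINT x|lborel. f (x + a)) = (LINT x|lborel. f x)"
  by (subst (2) lborel_distr_plus[symmetric, of a]) (simp add: integral_distr add.commute)

lemma nn_integral_lborel_translate:
  fixes f :: "'a::euclidean_space \<Rightarrow> ennreal"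
  assumes [measurable]: "f \<in> borel_measurable borel"
  shows "(\<integral>\<^sup>+x. f (x + a) \<partial>lborel) = (\<integral>\<^sup>+x. f x \<partial>lborel)"
  by (subst (2) lborel_distr_plus[symmetric, of a]) (simp add: nn_integral_distr add.commute)

text \<open>The characteristic function of the normal distribution, rescaled.\<close>

lemma gaussian_fourier_1d:
  assumes "\<sigma> > 0"
  shows "(LINT s|lborel. exp (\<i> * of_real (t * s)) * of_real (normal_density 0 \<sigma> s))
    = complex_of_real (exp (- (\<sigma> * t)\<^sup>2 / 2))"
proof -
  have nd: "\<sigma> * normal_density 0 \<sigma> (\<sigma> * s) = std_normal_density s" for s
    using assms by (simp add: normal_density_def real_sqrt_mult power_mult_distrib)
  have "(LINT s|lborel. exp (\<i> * of_real (t * s)) * of_real (normal_density 0 \<sigma> s))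
      = \<bar>\<sigma>\<bar> *\<^sub>R (LINT s|lborel. exp (\<i> * of_real (t * (\<sigma> * s))) * of_real (normal_density 0 \<sigma> (\<sigma> * s)))"
    using lborel_integral_real_affine[of \<sigma> "\<lambda>s. exp (\<i> * of_real (t * s)) * of_real (normal_density 0 \<sigma> s)" 0] assms
    by simp
  also have "\<dots> = (LINT s|lborel. std_normal_density s *\<^sub>R iexp ((t * \<sigma>) * s))"
    unfolding integral_scaleR_right[symmetric]
    using assms by (intro Bochner_Integration.integral_cong) (auto simp: scaleR_conv_of_real nd[symmetric] ac_simps)
  also have "\<dots> = char std_normal_distribution (t * \<sigma>)"
    unfolding char_def by (subst integral_density) auto
  also have "\<dots> = complex_of_real (exp (- (\<sigma> * t)\<^sup>2 / 2))"
    by (simp add: char_std_normal_distribution mult.commute)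
  finally show ?thesis .
qed

lemma exp_square_normal_density:
  assumes "\<sigma> > 0"
  shows "exp (- (\<sigma> * t)\<^sup>2 / 2) = sqrt (2 * pi) / \<sigma> * normal_density 0 (1 / \<sigma>) t"
  using assms by (simp add: normal_density_def real_sqrt_divide power_mult_distrib power_divide field_simps)

lemma integrable_exp_square:
  assumes "\<sigma> > 0"
  shows "integrable lborel (\<lambda>t. exp (- (\<sigma> * t)\<^sup>2 / 2) :: real)"
  unfolding exp_square_normal_density[OF assms] using assms by simp

text \<open>The Gaussian \<open>exp (- \<sigma>\<^sup>2t\<^sup>2/2)\<close> is a multiple of the normal density of deviation \<open>1/\<sigma>\<close>, so this is again
  a characteristic function.\<close>

lemma gaussian_inverse_fourier_1d:
  assumes "\<sigma> > 0"
  shows "(LINT t|lborel. exp (\<i> * of_real (s * t)) * of_real (exp (- (\<sigma> * t)\<^sup>2 / 2)))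
    = complex_of_real (2 * pi * normal_density 0 \<sigma> s)"
proof -
  have "(LINT t|lborel. exp (\<i> * of_real (s * t)) * of_real (exp (- (\<sigma> * t)\<^sup>2 / 2)))
      = (LINT t|lborel. of_real (sqrt (2 * pi) / \<sigma>) *
          (exp (\<i> * of_real (s * t)) * of_real (normal_density 0 (1 / \<sigma>) t)))"
    unfolding exp_square_normal_density[OF assms] by (simp add: ac_simps)
  also have "\<dots> = of_real (sqrt (2 * pi) / \<sigma> * exp (- (1 / \<sigma> * s)\<^sup>2 / 2))"
    using assms by (subst integral_mult_right_zero, subst gaussian_fourier_1d) auto
  also have "sqrt (2 * pi) / \<sigma> * exp (- (1 / \<sigma> * s)\<^sup>2 / 2) = 2 * pi * normal_density 0 \<sigma> s"
  proof -
    have "sqrt (2 * pi) * sqrt (2 * pi) = 2 * pi" by simp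
    then have "sqrt (2 * pi) / \<sigma> = 2 * pi / sqrt (2 * pi * \<sigma>\<^sup>2)"
      using assms by (simp add: real_sqrt_mult field_simps)
    then show ?thesis using assms by (simp add: normal_density_def power_divide)
  qed
  finally show ?thesis .
qed

text \<open>A Gaussian probability density of width \<open>\<sigma>\<close> and its Fourier transform. Both are written as products
  over the coordinates, so that their integrals factor.\<close>

definition gauss :: "real \<Rightarrow> real^'n::finite \<Rightarrow> real" where
  "gauss \<sigma> x = (\<Prod>i\<in>UNIV. normal_density 0 \<sigma> (x $ i))"

definition gweight :: "real \<Rightarrow> real^'n::finite \<Rightarrow> real" where
  "gweight \<sigma> \<xi> = (\<Prod>i\<in>UNIV. exp (- (\<sigma> * \<xi> $ i)\<^sup>2 / 2))"

lemma gauss_measurable [measurable]: "gauss \<sigma> \<in> borel_measurable borel"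
  unfolding gauss_def by measurable

lemma gweight_measurable [measurable]: "gweight \<sigma> \<in> borel_measurable borel"
  unfolding gweight_def by measurable

lemma gauss_nonneg [simp]: "0 \<le> gauss \<sigma> x" unfolding gauss_def by (intro prod_nonneg) auto
lemma gweight_nonneg [simp]: "0 \<le> gweight \<sigma> x" unfolding gweight_def by (intro prod_nonneg) auto
lemma gauss_even: "gauss \<sigma> (x - y) = gauss \<sigma> (y - x)"
  unfolding gauss_def by (intro prod.cong) (auto simp: normal_density_def power2_commute)

lemma exp_inner_prod: "exp (\<i> * of_real (x \<bullet> y)) = (\<Prod>i\<in>UNIV. exp (\<i> * of_real (x $ i * y $ i)))"
  for x y :: "real^'n::finite"
  by (simp add: inner_vec_def sum_distrib_left exp_sum)

lemma norm_exp_i [simp]: "norm (exp (\<i> * of_real r)) = 1" "norm (exp (- (\<i> * of_real r))) = 1"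
  by (simp_all add: norm_exp_eq_Re)

lemma integrable_gauss: "\<sigma> > 0 \<Longrightarrow> integrable lborel (gauss \<sigma>)"
  unfolding gauss_def[abs_def] by (rule integrable_lborel_tensor) auto

lemma integral_gauss: "\<sigma> > 0 \<Longrightarrow> (LINT x|lborel. gauss \<sigma> x) = 1"
  unfolding gauss_def[abs_def] by (subst integral_lborel_tensor) auto

lemma integrable_gweight: "\<sigma> > 0 \<Longrightarrow> integrable lborel (gweight \<sigma>)"
  unfolding gweight_def[abs_def] by (rule integrable_lborel_tensor) (rule integrable_exp_square)

lemma nn_integral_gauss: "\<sigma> > 0 \<Longrightarrow> (\<integral>\<^sup>+x. ennreal (gauss \<sigma> (x - y)) \<partial>lborel) = 1"
  using nn_integral_lborel_translate[of "\<lambda>x. ennreal (gauss \<sigma> x)" "- y"]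
  by (simp add: nn_integral_eq_integral integrable_gauss integral_gauss)

lemma gauss_fourier:
  fixes \<xi> :: "real^'n::finite"
  assumes "\<sigma> > 0"
  shows "(LINT x|lborel. exp (\<i> * of_real (\<xi> \<bullet> x)) * of_real (gauss \<sigma> x)) = complex_of_real (gweight \<sigma> \<xi>)"
proof -
  let ?g = "\<lambda>i s. exp (\<i> * of_real (\<xi> $ i * s)) * complex_of_real (normal_density 0 \<sigma> s)"
  have "integrable lborel (?g i)" for i
    by (rule Bochner_Integration.integrable_bound[OF integrable_normal_density[OF assms, of 0]])
       (auto simp: norm_mult)
  from integral_lborel_tensor[of ?g, OF this] show ?thesis
    unfolding gauss_def gweight_def
    by (simp only: exp_inner_prod prod.distrib[symmetric] of_real_prod
        gaussian_fourier_1d[OF assms])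
qed

lemma gweight_fourier:
  fixes x :: "real^'n::finite"
  assumes "\<sigma> > 0"
  shows "(LINT \<xi>|lborel. exp (\<i> * of_real (x \<bullet> \<xi>)) * of_real (gweight \<sigma> \<xi>))
    = complex_of_real ((2 * pi) ^ CARD('n) * gauss \<sigma> x)"
proof -
  have "integrable lborel (\<lambda>s. exp (\<i> * of_real (x $ i * s)) * complex_of_real (exp (- (\<sigma> * s)\<^sup>2 / 2)))" for i
    by (rule Bochner_Integration.integrable_bound[OF integrable_exp_square[OF assms]])
       (auto simp: norm_mult)
  from integral_lborel_tensor[OF this] have "(LINT \<xi>|lborel. exp (\<i> * of_real (x \<bullet> \<xi>)) * of_real (gweight \<sigma> \<xi>))
    = (\<Prod>i\<in>UNIV. complex_of_real (2 * pi * normal_density 0 \<sigma> (x $ i)))"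
    unfolding gweight_def
    by (simp only: exp_inner_prod prod.distrib[symmetric] of_real_prod gaussian_inverse_fourier_1d[OF assms])
  also have "\<dots> = complex_of_real ((2 * pi) ^ CARD('n) * gauss \<sigma> x)"
    by (simp add: gauss_def prod.distrib flip: of_real_prod)
  finally show ?thesis .
qed

text \<open>The Fourier integral against the Borel measure, for which product measurability and Fubini's theorem
  are at hand.\<close>

definition FT :: "(real^'n::finite \<Rightarrow> complex) \<Rightarrow> real^'n \<Rightarrow> complex" where
  "FT f \<xi> = (LINT x|lborel. exp (- (\<i> * of_real (x \<bullet> \<xi>))) * f x)"

lemma FT_measurable [measurable]:
  assumes [measurable]: "f \<in> borel_measurable borel"
  shows "FT f \<in> borel_measurable borel"
  unfolding FT_def by measurable

lemma FT_bound: "norm (FT f \<xi>) \<le> (LINT x|lborel. norm (f x))"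
  unfolding FT_def by (rule integral_norm_bound[THEN order.trans]) (simp add: norm_mult)

text \<open>Fubini for kernels bounded by a product of two integrable functions.\<close>

lemma integrable_pair_bound:
  fixes f :: "'a::euclidean_space \<Rightarrow> 'b::euclidean_space \<Rightarrow> 'c::{banach,second_countable_topology}"
  assumes [measurable]: "case_prod f \<in> borel_measurable (lborel \<Otimes>\<^sub>M lborel)"
    and a: "integrable lborel a" and b: "integrable lborel b"
    and bd: "\<And>x y. norm (f x y) \<le> a x * (b y :: real)"
  shows "integrable (lborel \<Otimes>\<^sub>M lborel) (case_prod f)"
proof -
  have [measurable]: "a \<in> borel_measurable borel" "b \<in> borel_measurable borel"
    using a b by simp_all
  have "integrable (lborel \<Otimes>\<^sub>M lborel) (case_prod (\<lambda>x y. a x * b y))"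
    using a b by (intro lborel_pair.Fubini_integrable) (auto simp: norm_mult abs_mult)
  then show ?thesis
    by (rule Bochner_Integration.integrable_bound) (auto intro!: AE_I2 order.trans[OF bd] abs_ge_self)
qed

text \<open>With the Gaussian weight the integrand is integrable in both variables together; integrating over
  \<open>\<xi>\<close> first produces the inverse transform of the weight, that is, a mollification of \<open>f\<close>.\<close>

lemma FT_inversion_weighted:
  fixes f :: "real^'n::finite \<Rightarrow> complex"
  assumes f: "integrable lborel f" and \<sigma>: "\<sigma> > 0"
  shows "(LINT \<xi>|lborel. exp (\<i> * of_real (y \<bullet> \<xi>)) * (of_real (gweight \<sigma> \<xi>) * FT f \<xi>))
    = of_real ((2 * pi) ^ CARD('n)) * (LINT x|lborel. of_real (gauss \<sigma> (y - x)) * f x)"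
proof -
  have [measurable]: "f \<in> borel_measurable borel" using f by simp
  have int: "integrable (lborel \<Otimes>\<^sub>M lborel)
      (\<lambda>(\<xi>, x). exp (\<i> * of_real ((y - x) \<bullet> \<xi>)) * of_real (gweight \<sigma> \<xi>) * f x)"
    by (rule integrable_pair_bound[OF _ integrable_gweight[OF \<sigma>] integrable_norm[OF f]])
       (auto simp: norm_mult)
  have "(LINT \<xi>|lborel. exp (\<i> * of_real (y \<bullet> \<xi>)) * (of_real (gweight \<sigma> \<xi>) * FT f \<xi>))
      = (LINT \<xi>|lborel. LINT x|lborel. exp (\<i> * of_real ((y - x) \<bullet> \<xi>)) * of_real (gweight \<sigma> \<xi>) * f x)"
    unfolding FT_def integral_mult_right_zero[symmetric]
    by (intro Bochner_Integration.integral_cong refl)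
       (simp add: inner_diff_left right_diff_distrib exp_diff exp_minus field_simps)
  also have "\<dots> = (LINT x|lborel. LINT \<xi>|lborel. exp (\<i> * of_real ((y - x) \<bullet> \<xi>)) * of_real (gweight \<sigma> \<xi>) * f x)"
    using lborel_pair.Fubini_integral[OF int] by simp
  also have "\<dots> = (LINT x|lborel. of_real ((2 * pi) ^ CARD('n)) * (of_real (gauss \<sigma> (y - x)) * f x))"
    unfolding integral_mult_left_zero gweight_fourier[OF \<sigma>] by (simp add: mult.assoc)
  finally show ?thesis by simp
qed

lemma norm_integral_le_nn_integral:
  fixes f :: "'a \<Rightarrow> 'b::{banach,second_countable_topology}"
  shows "ennreal (norm (integral\<^sup>L M f)) \<le> (\<integral>\<^sup>+x. ennreal (norm (f x)) \<partial>M)"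
  by (cases "integrable M f") (auto simp: integral_norm_bound_ennreal not_integrable_integral_eq)

text \<open>Schur's test: \<open>2|f(y)||f(x)| \<le> |f(y)|\<^sup>2 + |f(x)|\<^sup>2\<close>, and the kernel has mass \<open>1\<close> in each variable.\<close>

lemma gauss_form_bound:
  fixes f :: "real^'n::finite \<Rightarrow> complex"
  assumes [measurable]: "f \<in> borel_measurable borel" and \<sigma>: "\<sigma> > 0"
  shows "(\<integral>\<^sup>+y. \<integral>\<^sup>+x. ennreal (norm (f y) * (gauss \<sigma> (y - x) * norm (f x))) \<partial>lborel \<partial>lborel)
    \<le> (\<integral>\<^sup>+x. ennreal ((norm (f x))\<^sup>2) \<partial>lborel)"
proof -
  define S where "S = (\<integral>\<^sup>+x. ennreal ((norm (f x))\<^sup>2) \<partial>lborel)"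
  have am: "norm (f y) * (g * norm (f x)) \<le> (g/2) * (norm (f y))\<^sup>2 + (g/2) * (norm (f x))\<^sup>2"
    if "0 \<le> g" for g x y
    using mult_left_mono[OF sum_squares_bound[of "norm (f y)" "norm (f x)"], of "g/2"] that
    by (simp add: algebra_simps)
  have half: "(\<integral>\<^sup>+y. \<integral>\<^sup>+x. ennreal (gauss \<sigma> (y - x)/2 * (norm (f y))\<^sup>2) \<partial>lborel \<partial>lborel) = ennreal (1/2) * S"
  proof -
    have "(\<integral>\<^sup>+x. ennreal (gauss \<sigma> (y - x)/2 * (norm (f y))\<^sup>2) \<partial>lborel) = ennreal (1/2) * ennreal ((norm (f y))\<^sup>2)" for y
    proof -
      have "(\<integral>\<^sup>+x. ennreal (gauss \<sigma> (y - x)/2 * (norm (f y))\<^sup>2) \<partial>lborel)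
          = (\<integral>\<^sup>+x. ennreal (gauss \<sigma> (x - y)) * (ennreal (1/2) * ennreal ((norm (f y))\<^sup>2)) \<partial>lborel)"
      proof (rule nn_integral_cong)
        fix x
        have "ennreal (gauss \<sigma> (x - y)) * (ennreal (1/2) * ennreal ((norm (f y))\<^sup>2))
            = ennreal (gauss \<sigma> (x - y) * (1/2 * (norm (f y))\<^sup>2))"
          by (subst ennreal_mult, simp, simp, subst ennreal_mult) simp_all
        then show "ennreal (gauss \<sigma> (y - x)/2 * (norm (f y))\<^sup>2)
            = ennreal (gauss \<sigma> (x - y)) * (ennreal (1/2) * ennreal ((norm (f y))\<^sup>2))"
          by (simp add: gauss_even[of \<sigma> y])
      qed
      also have "\<dots> = ennreal (1/2) * ennreal ((norm (f y))\<^sup>2)"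
        by (subst nn_integral_multc) (simp_all add: nn_integral_gauss[OF \<sigma>])
      finally show ?thesis .
    qed
    then show ?thesis by (simp add: nn_integral_cmult S_def)
  qed
  have "(\<integral>\<^sup>+y. \<integral>\<^sup>+x. ennreal (gauss \<sigma> (y - x)/2 * (norm (f x))\<^sup>2) \<partial>lborel \<partial>lborel)
      = (\<integral>\<^sup>+x. \<integral>\<^sup>+y. ennreal (gauss \<sigma> (y - x)/2 * (norm (f x))\<^sup>2) \<partial>lborel \<partial>lborel)"
    by (rule lborel_pair.Fubini') simp
  also have "\<dots> = ennreal (1/2) * S"
    using half by (simp add: gauss_even)
  finally have half': "(\<integral>\<^sup>+y. \<integral>\<^sup>+x. ennreal (gauss \<sigma> (y - x)/2 * (norm (f x))\<^sup>2) \<partial>lborel \<partial>lborel) = ennreal (1/2) * S" .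
  have "(\<integral>\<^sup>+y. \<integral>\<^sup>+x. ennreal (norm (f y) * (gauss \<sigma> (y - x) * norm (f x))) \<partial>lborel \<partial>lborel)
      \<le> (\<integral>\<^sup>+y. \<integral>\<^sup>+x. ennreal (gauss \<sigma> (y - x)/2 * (norm (f y))\<^sup>2)
          + ennreal (gauss \<sigma> (y - x)/2 * (norm (f x))\<^sup>2) \<partial>lborel \<partial>lborel)"
  proof (intro nn_integral_mono)
    fix x y
    show "ennreal (norm (f y) * (gauss \<sigma> (y - x) * norm (f x)))
        \<le> ennreal (gauss \<sigma> (y - x)/2 * (norm (f y))\<^sup>2) + ennreal (gauss \<sigma> (y - x)/2 * (norm (f x))\<^sup>2)"
      using am[of "gauss \<sigma> (y - x)" y x]
      by (subst ennreal_plus[symmetric]) (auto intro: ennreal_leI simp del: ennreal_plus)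
  qed
  also have "\<dots> = (\<integral>\<^sup>+y. (\<integral>\<^sup>+x. ennreal (gauss \<sigma> (y - x)/2 * (norm (f y))\<^sup>2) \<partial>lborel)
          + (\<integral>\<^sup>+x. ennreal (gauss \<sigma> (y - x)/2 * (norm (f x))\<^sup>2) \<partial>lborel) \<partial>lborel)"
    by (intro nn_integral_cong nn_integral_add) measurable
  also have "\<dots> = (\<integral>\<^sup>+y. (\<integral>\<^sup>+x. ennreal (gauss \<sigma> (y - x)/2 * (norm (f y))\<^sup>2) \<partial>lborel) \<partial>lborel)
          + (\<integral>\<^sup>+y. (\<integral>\<^sup>+x. ennreal (gauss \<sigma> (y - x)/2 * (norm (f x))\<^sup>2) \<partial>lborel) \<partial>lborel)"
    by (rule nn_integral_add) measurable
  also have "\<dots> = ennreal (1/2) * S + ennreal (1/2) * S"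
    by (simp only: half half')
  also have "\<dots> = S"
    by (subst distrib_right[symmetric], subst ennreal_plus[symmetric]) simp_all
  finally show ?thesis by (simp add: S_def)
qed

text \<open>The weighted square integral of the transform is, by inversion, the pairing of \<open>f\<close> with its
  mollification; this pairing is bounded independently of the width \<open>\<sigma>\<close>.\<close>

lemma FT_weighted_bound:
  fixes f :: "real^'n::finite \<Rightarrow> complex"
  assumes f: "integrable lborel f" and \<sigma>: "\<sigma> > 0"
  shows "(\<integral>\<^sup>+\<xi>. ennreal (gweight \<sigma> \<xi> * (norm (FT f \<xi>))\<^sup>2) \<partial>lborel)
    \<le> ennreal ((2 * pi) ^ CARD('n)) * (\<integral>\<^sup>+x. ennreal ((norm (f x))\<^sup>2) \<partial>lborel)"
proof -
  have fm[measurable]: "f \<in> borel_measurable borel" using f by simp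
  define A where "A = (LINT x|lborel. norm (f x))"
  have A0: "0 \<le> A" unfolding A_def by simp
  have int1: "integrable lborel (\<lambda>\<xi>. gweight \<sigma> \<xi> * (norm (FT f \<xi>))\<^sup>2)"
  proof (rule Bochner_Integration.integrable_bound)
    show "integrable lborel (\<lambda>\<xi>::real^'n. gweight \<sigma> \<xi> * A\<^sup>2)"
      by (intro integrable_mult_left) (rule integrable_gweight[OF \<sigma>])
    show "AE \<xi> in lborel. norm (gweight \<sigma> \<xi> * (norm (FT f \<xi>))\<^sup>2) \<le> norm (gweight \<sigma> \<xi> * A\<^sup>2)"
      by (intro AE_I2) (auto simp: abs_mult A_def intro!: mult_left_mono power_mono FT_bound)
  qed measurable
  have cnjFT: "cnj (FT f \<xi>) = (LINT y|lborel. exp (\<i> * of_real (y \<bullet> \<xi>)) * cnj (f y))" for \<xi>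
    unfolding FT_def 
    using Bochner_Integration.integral_cnj[of lborel "\<lambda>x. exp (- (\<i> * of_real (x \<bullet> \<xi>))) * f x", symmetric]
    by (simp add: exp_cnj)
  have int2: "integrable (lborel \<Otimes>\<^sub>M lborel)
      (\<lambda>(\<xi>, y). of_real (gweight \<sigma> \<xi>) * FT f \<xi> * (exp (\<i> * of_real (y \<bullet> \<xi>)) * cnj (f y)))"
  proof (rule integrable_pair_bound[OF _ _ integrable_norm[OF f]])
    show "integrable lborel (\<lambda>\<xi>::real^'n. gweight \<sigma> \<xi> * A)"
      by (intro integrable_mult_left) (rule integrable_gweight[OF \<sigma>])
    show "norm (of_real (gweight \<sigma> \<xi>) * FT f \<xi> * (exp (\<i> * of_real (y \<bullet> \<xi>)) * cnj (f y)))
        \<le> gweight \<sigma> \<xi> * A * norm (f y)" for \<xi> y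
      using FT_bound[of f \<xi>] by (auto simp: norm_mult A_def intro!: mult_right_mono mult_left_mono)
    have [measurable]: "FT f \<in> borel_measurable borel" by measurable
    show "(\<lambda>(\<xi>, y). of_real (gweight \<sigma> \<xi>) * FT f \<xi> * (exp (\<i> * of_real (y \<bullet> \<xi>)) * cnj (f y)))
        \<in> borel_measurable (lborel \<Otimes>\<^sub>M lborel)" by measurable
  qed
  have "complex_of_real (LINT \<xi>|lborel. gweight \<sigma> \<xi> * (norm (FT f \<xi>))\<^sup>2)
      = (LINT \<xi>|lborel. of_real (gweight \<sigma> \<xi>) * FT f \<xi> * cnj (FT f \<xi>))"
    by (subst integral_complex_of_real[symmetric])
       (simp add: mult.assoc complex_norm_square[symmetric] del: of_real_power)
  also have "\<dots> = (LINT \<xi>|lborel. LINT y|lborel. of_real (gweight \<sigma> \<xi>) * FT f \<xi> * (exp (\<i> * of_real (y \<bullet> \<xi>)) * cnj (f y)))"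
    unfolding cnjFT integral_mult_right_zero ..
  also have "\<dots> = (LINT y|lborel. LINT \<xi>|lborel. of_real (gweight \<sigma> \<xi>) * FT f \<xi> * (exp (\<i> * of_real (y \<bullet> \<xi>)) * cnj (f y)))"
    using lborel_pair.Fubini_integral[OF int2] by simp
  also have "\<dots> = (LINT y|lborel. (LINT \<xi>|lborel. exp (\<i> * of_real (y \<bullet> \<xi>)) * (of_real (gweight \<sigma> \<xi>) * FT f \<xi>)) * cnj (f y))"
    unfolding integral_mult_left_zero[symmetric]
    by (intro Bochner_Integration.integral_cong refl) (simp add: ac_simps)
  also have "\<dots> = (LINT y|lborel. of_real ((2 * pi) ^ CARD('n)) *
      (cnj (f y) * (LINT x|lborel. of_real (gauss \<sigma> (y - x)) * f x)))"
    unfolding FT_inversion_weighted[OF f \<sigma>] by (simp only: ac_simps)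
  also have "\<dots> = of_real ((2 * pi) ^ CARD('n)) *
      (LINT y|lborel. cnj (f y) * (LINT x|lborel. of_real (gauss \<sigma> (y - x)) * f x))"
    by (rule integral_mult_right_zero)
  finally have "(LINT \<xi>|lborel. gweight \<sigma> \<xi> * (norm (FT f \<xi>))\<^sup>2)
      = norm (of_real ((2 * pi) ^ CARD('n)) *
      (LINT y|lborel. cnj (f y) * (LINT x|lborel. of_real (gauss \<sigma> (y - x)) * f x)))"
    by (metis (no_types, lifting) abs_of_nonneg integral_nonneg_AE norm_of_real AE_I2 gweight_nonneg mult_nonneg_nonneg zero_le_power2)
  then have *: "ennreal (LINT \<xi>|lborel. gweight \<sigma> \<xi> * (norm (FT f \<xi>))\<^sup>2)
     = ennreal ((2 * pi) ^ CARD('n)) *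
      ennreal (norm (LINT y|lborel. cnj (f y) * (LINT x|lborel. of_real (gauss \<sigma> (y - x)) * f x)))"
    by (simp add: norm_mult norm_power ennreal_mult)
  have "ennreal (norm (LINT y|lborel. cnj (f y) * (LINT x|lborel. of_real (gauss \<sigma> (y - x)) * f x)))
     \<le> (\<integral>\<^sup>+y. ennreal (norm (cnj (f y) * (LINT x|lborel. of_real (gauss \<sigma> (y - x)) * f x))) \<partial>lborel)"
    by (rule norm_integral_le_nn_integral)
  also have "\<dots> \<le> (\<integral>\<^sup>+y. \<integral>\<^sup>+x. ennreal (norm (f y) * (gauss \<sigma> (y - x) * norm (f x))) \<partial>lborel \<partial>lborel)"
  proof (rule nn_integral_mono)
    fix y
    have "ennreal (norm (cnj (f y) * (LINT x|lborel. of_real (gauss \<sigma> (y - x)) * f x)))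
        = ennreal (norm (LINT x|lborel. cnj (f y) * (of_real (gauss \<sigma> (y - x)) * f x)))"
      by simp
    also have "\<dots> \<le> (\<integral>\<^sup>+x. ennreal (norm (cnj (f y) * (of_real (gauss \<sigma> (y - x)) * f x))) \<partial>lborel)"
      by (rule norm_integral_le_nn_integral)
    finally show "ennreal (norm (cnj (f y) * (LINT x|lborel. of_real (gauss \<sigma> (y - x)) * f x)))
        \<le> (\<integral>\<^sup>+x. ennreal (norm (f y) * (gauss \<sigma> (y - x) * norm (f x))) \<partial>lborel)"
      by (simp add: norm_mult)
  qed
  also note gauss_form_bound[OF fm \<sigma>]
  finally have "ennreal (LINT \<xi>|lborel. gweight \<sigma> \<xi> * (norm (FT f \<xi>))\<^sup>2)
      \<le> ennreal ((2 * pi) ^ CARD('n)) * (\<integral>\<^sup>+x. ennreal ((norm (f x))\<^sup>2) \<partial>lborel)"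
    unfolding * by (rule mult_left_mono) simp
  then show ?thesis using int1 by (simp add: nn_integral_eq_integral)
qed

lemma gweight_tendsto: "(\<lambda>m. gweight (1 / real (Suc m)) \<xi>) \<longlonglongrightarrow> 1"
proof -
  have "(\<lambda>m. gweight (1 / real (Suc m)) \<xi>) \<longlonglongrightarrow> (\<Prod>i\<in>(UNIV::'a set). exp (- (0 * \<xi> $ i)\<^sup>2 / 2))"
    unfolding gweight_def
    by (intro tendsto_prod tendsto_exp tendsto_divide tendsto_minus tendsto_power tendsto_mult tendsto_const)
       (use LIMSEQ_inverse_real_of_nat in \<open>auto simp: inverse_eq_divide\<close>)
  then show ?thesis by simp
qed

text \<open>Fatou's lemma as the weight tends to \<open>1\<close>. Only this inequality is proved directly; the equality follows
  later from the inversion formula.\<close>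

theorem FT_Plancherel_le:
  fixes f :: "real^'n::finite \<Rightarrow> complex"
  assumes f: "integrable lborel f"
  shows "(\<integral>\<^sup>+\<xi>. ennreal ((norm (FT f \<xi>))\<^sup>2) \<partial>lborel)
    \<le> ennreal ((2 * pi) ^ CARD('n)) * (\<integral>\<^sup>+x. ennreal ((norm (f x))\<^sup>2) \<partial>lborel)"
proof -
  have [measurable]: "f \<in> borel_measurable borel" using f by simp
  have lim: "(\<lambda>m. ennreal (gweight (1 / real (Suc m)) \<xi> * (norm (FT f \<xi>))\<^sup>2)) \<longlonglongrightarrow> ennreal ((norm (FT f \<xi>))\<^sup>2)" for \<xi>
    using tendsto_mult[OF gweight_tendsto[of \<xi>] tendsto_const] by (intro tendsto_ennrealI) simp
  have "(\<integral>\<^sup>+\<xi>. ennreal ((norm (FT f \<xi>))\<^sup>2) \<partial>lborel)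
      = (\<integral>\<^sup>+\<xi>. liminf (\<lambda>m. ennreal (gweight (1 / real (Suc m)) \<xi> * (norm (FT f \<xi>))\<^sup>2)) \<partial>lborel)"
    by (intro nn_integral_cong lim_imp_Liminf[OF _ lim, symmetric]) simp
  also have "\<dots> \<le> liminf (\<lambda>m. \<integral>\<^sup>+\<xi>. ennreal (gweight (1 / real (Suc m)) \<xi> * (norm (FT f \<xi>))\<^sup>2) \<partial>lborel)"
    by (rule nn_integral_liminf) measurable
  also have "\<dots> \<le> ennreal ((2 * pi) ^ CARD('n)) * (\<integral>\<^sup>+x. ennreal ((norm (f x))\<^sup>2) \<partial>lborel)"
    by (intro Liminf_le always_eventually allI FT_weighted_bound[OF f]) simp_all
  finally show ?thesis .
qed


section \<open>Multiplication operators and extension of the Fourier transform\<close>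

lemma bounded_clinear_L2I:
  assumes "\<And>u v. T (u + v) = T u + T v" "\<And>c u. T (scaleC_L2 c u) = scaleC_L2 c (T u)"
    "\<And>u. norm (T u) \<le> K * norm u"
  shows "bounded_clinear_L2 T"
  unfolding bounded_clinear_L2_def
proof
  show "bounded_linear T"
    by (rule bounded_linear_intro[where K = K])
       (use assms in \<open>auto simp: scaleR_scaleC_L2 mult.commute\<close>)
qed (use assms in auto)

lemma scaleC_L2_add: "scaleC_L2 c (u + v) = scaleC_L2 c u + scaleC_L2 c v"
proof (rule L2_eqI)
  show "AE x in lebesgue. rep_L2 (scaleC_L2 c (u + v)) x = rep_L2 (scaleC_L2 c u + scaleC_L2 c v) x"
    using rep_scaleC_L2[of c "u + v"] rep_add_L2[of u v] rep_add_L2[of "scaleC_L2 c u" "scaleC_L2 c v"]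
      rep_scaleC_L2[of c u] rep_scaleC_L2[of c v]
    by eventually_elim (simp add: algebra_simps)
qed

lemma scaleC_L2_scaleC: "scaleC_L2 c (scaleC_L2 d u) = scaleC_L2 (c * d) u"
proof (rule L2_eqI)
  show "AE x in lebesgue. rep_L2 (scaleC_L2 c (scaleC_L2 d u)) x = rep_L2 (scaleC_L2 (c * d) u) x"
    using rep_scaleC_L2[of c "scaleC_L2 d u"] rep_scaleC_L2[of d u] rep_scaleC_L2[of "c * d" u]
    by eventually_elim simp
qed

lemma norm_scaleC_L2: "norm (scaleC_L2 c u) = norm c * norm u"
proof -
  have "scaleC_L2 c u = abs_L2 (\<lambda>x. c * rep_L2 u x)"
    using abs_L2_scaleC[OF square_integrable_rep[of u], of c] by simp
  then have "(norm (scaleC_L2 c u))\<^sup>2 = (norm c * norm u)\<^sup>2"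
    by (simp add: norm_abs_L2_sq square_integrable_cmult norm_mult power_mult_distrib norm_L2_sq[of u])
  then show ?thesis by (simp add: power2_eq_iff_nonneg)
qed

lemma bounded_linear_scaleC_L2: "bounded_linear (scaleC_L2 c)"
  by (rule bounded_linear_intro[where K = "norm c"])
     (auto simp: scaleC_L2_add scaleR_scaleC_L2 scaleC_L2_scaleC norm_scaleC_L2 mult.commute)

text \<open>Identities between bounded operators are proved by density: the set where they hold is a closed
  subspace.\<close>

lemma csubspace_eq:
  assumes "bounded_clinear_L2 S" "bounded_clinear_L2 T"
  shows "csubspace_L2 {u. S u = T u}" "closed {u. S u = T u}"
proof -
  have bl: "bounded_linear S" "bounded_linear T" using assms by (auto simp: bounded_clinear_L2_def)
  show "csubspace_L2 {u. S u = T u}"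
    using assms bl by (auto simp: csubspace_L2_def bounded_clinear_L2_def linear_simps)
  show "closed {u. S u = T u}"
    by (intro closed_Collect_eq linear_continuous_on bl)
qed

lemma bounded_clinear_compose:
  assumes "bounded_clinear_L2 S" "bounded_clinear_L2 T"
  shows "bounded_clinear_L2 (\<lambda>u. S (T u))"
  using assms by (auto simp: bounded_clinear_L2_def intro: bounded_linear_compose)

lemma bounded_clinear_scaleR:
  assumes "bounded_clinear_L2 S"
  shows "bounded_clinear_L2 (\<lambda>u. r *\<^sub>R S u)"
  using assms unfolding bounded_clinear_L2_def
  by (auto intro: bounded_linear_const_scaleR)
     (simp add: scaleR_scaleC_L2 scaleC_L2_scaleC mult.commute)

lemma bounded_clinear_simps:
  assumes "bounded_clinear_L2 T"
  shows "T (u + v) = T u + T v" "T (u - v) = T u - T v" "T (- u) = - T u" "T 0 = 0"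
    "T (r *\<^sub>R u) = r *\<^sub>R T u" "T (scaleC_L2 c u) = scaleC_L2 c (T u)"
proof -
  interpret bounded_linear T using assms by (simp add: bounded_clinear_L2_def)
  show "T (u + v) = T u + T v" "T (u - v) = T u - T v" "T (- u) = - T u" "T 0 = 0"
    "T (r *\<^sub>R u) = r *\<^sub>R T u"
    by (rule add diff neg zero scaleR)+
  show "T (scaleC_L2 c u) = scaleC_L2 c (T u)" using assms by (simp add: bounded_clinear_L2_def)
qed

subsection \<open>Multiplication operators\<close>

definition mult_L2 :: "(real^'n::finite \<Rightarrow> complex) \<Rightarrow> 'n L2 \<Rightarrow> 'n L2" where
  "mult_L2 m u = abs_L2 (\<lambda>x. m x * rep_L2 u x)"

definition bdd_symbol :: "(real^'n::finite \<Rightarrow> complex) \<Rightarrow> real \<Rightarrow> bool" where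
  "bdd_symbol m c \<longleftrightarrow> m \<in> borel_measurable lebesgue \<and> (\<forall>x. norm (m x) \<le> c)"

lemma bdd_symbol_nonneg: "bdd_symbol m c \<Longrightarrow> 0 \<le> c"
  unfolding bdd_symbol_def by (meson norm_ge_zero order_trans)

lemma square_integrable_mult:
  assumes m: "bdd_symbol m c" and f: "square_integrable f"
  shows "square_integrable (\<lambda>x. m x * f x)"
proof (rule square_integrable_bound[OF square_integrable_cmult[OF f, of "of_real c"]])
  show "(\<lambda>x. m x * f x) \<in> borel_measurable lebesgue"
    using m f by (auto simp: bdd_symbol_def square_integrable_def)
  show "AE x in lebesgue. norm (m x * f x) \<le> norm (of_real c * f x)"
    using m bdd_symbol_nonneg[OF m]
    by (auto simp: norm_mult bdd_symbol_def intro!: AE_I2 mult_right_mono)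
qed

lemma rep_mult_L2:
  "bdd_symbol m c \<Longrightarrow> AE x in lebesgue. rep_L2 (mult_L2 m u) x = m x * rep_L2 u x"
  unfolding mult_L2_def by (intro rep_abs_L2 square_integrable_mult) auto

lemma mult_L2_abs:
  assumes "bdd_symbol m c" "square_integrable f"
  shows "mult_L2 m (abs_L2 f) = abs_L2 (\<lambda>x. m x * f x)"
  unfolding mult_L2_def
proof (rule abs_L2_eqI)
  show "AE x in lebesgue. m x * rep_L2 (abs_L2 f) x = m x * f x"
    using rep_abs_L2[OF assms(2)] by eventually_elim simp
qed (use assms in \<open>auto intro: square_integrable_mult\<close>)

lemma norm_mult_L2_le:
  assumes m: "bdd_symbol m c"
  shows "norm (mult_L2 m u) \<le> c * norm u"
proof -
  have "norm (abs_L2 (\<lambda>x. m x * rep_L2 u x)) \<le> norm (abs_L2 (\<lambda>x. of_real c * rep_L2 u x))"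
  proof (rule norm_abs_L2_mono)
    show "(\<lambda>x. m x * rep_L2 u x) \<in> borel_measurable lebesgue"
      using square_integrable_mult[OF m square_integrable_rep[of u]] by (simp add: square_integrable_def)
    show "AE x in lebesgue. norm (m x * rep_L2 u x) \<le> norm (of_real c * rep_L2 u x)"
      using m bdd_symbol_nonneg[OF m]
      by (auto simp: norm_mult bdd_symbol_def intro!: AE_I2 mult_right_mono)
  qed (auto intro: square_integrable_cmult)
  also have "\<dots> = c * norm u"
    using abs_L2_scaleC[OF square_integrable_rep[of u], of "of_real c", symmetric] bdd_symbol_nonneg[OF m]
    by (simp add: norm_scaleC_L2)
  finally show ?thesis by (simp add: mult_L2_def)
qed

lemma bounded_clinear_mult_L2:
  assumes m: "bdd_symbol m c"
  shows "bounded_clinear_L2 (mult_L2 m)"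
proof (rule bounded_clinear_L2I[OF _ _ norm_mult_L2_le[OF m]])
  fix u v :: "'a L2" and k
  show "mult_L2 m (u + v) = mult_L2 m u + mult_L2 m v"
  proof (rule L2_eqI)
    show "AE x in lebesgue. rep_L2 (mult_L2 m (u + v)) x = rep_L2 (mult_L2 m u + mult_L2 m v) x"
      using rep_mult_L2[OF m, of "u + v"] rep_add_L2[of u v] rep_add_L2[of "mult_L2 m u" "mult_L2 m v"]
        rep_mult_L2[OF m, of u] rep_mult_L2[OF m, of v]
      by eventually_elim (simp add: algebra_simps)
  qed
  show "mult_L2 m (scaleC_L2 k u) = scaleC_L2 k (mult_L2 m u)"
  proof (rule L2_eqI)
    show "AE x in lebesgue. rep_L2 (mult_L2 m (scaleC_L2 k u)) x = rep_L2 (scaleC_L2 k (mult_L2 m u)) x"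
      using rep_mult_L2[OF m, of "scaleC_L2 k u"] rep_scaleC_L2[of k u] rep_scaleC_L2[of k "mult_L2 m u"]
        rep_mult_L2[OF m, of u]
      by eventually_elim simp
  qed
qed

lemma mult_L2_mult:
  assumes m: "bdd_symbol m c" and m': "bdd_symbol m' c'"
  shows "mult_L2 m (mult_L2 m' u) = mult_L2 (\<lambda>x. m x * m' x) u"
proof -
  have "square_integrable (\<lambda>x. m' x * rep_L2 u x)" by (rule square_integrable_mult[OF m']) simp
  then show ?thesis
    unfolding mult_L2_def[of m' u] mult_L2_def[of "\<lambda>x. m x * m' x" u]
    by (subst mult_L2_abs[OF m]) (auto simp: mult.assoc)
qed

lemma mult_L2_tendsto:
  assumes m: "\<And>k. bdd_symbol (m k) c" and m': "bdd_symbol m' c'"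
    and lim: "\<And>x. (\<lambda>k. m k x) \<longlonglongrightarrow> m' x"
  shows "(\<lambda>k. mult_L2 (m k) u) \<longlonglongrightarrow> mult_L2 m' u"
  unfolding mult_L2_def
proof (rule L2_dominated_convergence(2))
  show "square_integrable (\<lambda>x. of_real c * rep_L2 u x)" by (intro square_integrable_cmult) simp
  show "AE x in lebesgue. norm (m k x * rep_L2 u x) \<le> norm (of_real c * rep_L2 u x)" for k
    using m[of k] bdd_symbol_nonneg[OF m[of k]]
    by (auto simp: norm_mult bdd_symbol_def intro!: AE_I2 mult_right_mono)
  show "AE x in lebesgue. (\<lambda>k. m k x * rep_L2 u x) \<longlonglongrightarrow> m' x * rep_L2 u x"
    by (intro AE_I2 tendsto_mult lim tendsto_const)
qed (use square_integrable_mult[OF m square_integrable_rep[of u]]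
       square_integrable_mult[OF m' square_integrable_rep[of u]] in \<open>auto simp: square_integrable_def\<close>)

lemma bdd_symbol_indicator: "A \<in> sets lebesgue \<Longrightarrow> bdd_symbol (indicator A) 1"
  by (auto simp: bdd_symbol_def indicator_def)

lemma indicator_L2_eq: "indicator_L2 \<omega> = mult_L2 (indicator \<omega>)"
  by (simp add: fun_eq_iff indicator_L2_def mult_L2_def)

lemma mult_L2_one: "mult_L2 (\<lambda>x. 1) u = u"
  by (simp add: mult_L2_def)

subsection \<open>Complex conjugation\<close>

definition cnj_L2 :: "'n::finite L2 \<Rightarrow> 'n L2" where
  "cnj_L2 u = abs_L2 (\<lambda>x. cnj (rep_L2 u x))"

lemma square_integrable_cnj: "square_integrable f \<Longrightarrow> square_integrable (\<lambda>x. cnj (f x))"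
  by (auto simp: square_integrable_def)

lemma rep_cnj_L2: "AE x in lebesgue. rep_L2 (cnj_L2 u) x = cnj (rep_L2 u x)"
  unfolding cnj_L2_def by (intro rep_abs_L2 square_integrable_cnj) simp

lemma cnj_L2_abs: "square_integrable f \<Longrightarrow> cnj_L2 (abs_L2 f) = abs_L2 (\<lambda>x. cnj (f x))"
  unfolding cnj_L2_def
  by (rule abs_L2_eqI) (auto intro: square_integrable_cnj dest: rep_abs_L2 elim: eventually_mono)

lemma norm_cnj_L2: "norm (cnj_L2 u) = norm u"
  unfolding cnj_L2_def
  by (subst norm_abs_L2) (auto intro: square_integrable_cnj simp: norm_abs_L2[of "rep_L2 u", simplified])

lemma cnj_L2_cnj [simp]: "cnj_L2 (cnj_L2 u) = u"
proof (rule L2_eqI)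
  show "AE x in lebesgue. rep_L2 (cnj_L2 (cnj_L2 u)) x = rep_L2 u x"
    using rep_cnj_L2[of "cnj_L2 u"] rep_cnj_L2[of u] by eventually_elim simp
qed

lemma cnj_L2_add: "cnj_L2 (u + v) = cnj_L2 u + cnj_L2 v"
proof (rule L2_eqI)
  show "AE x in lebesgue. rep_L2 (cnj_L2 (u + v)) x = rep_L2 (cnj_L2 u + cnj_L2 v) x"
    using rep_cnj_L2[of "u + v"] rep_add_L2[of u v] rep_add_L2[of "cnj_L2 u" "cnj_L2 v"]
      rep_cnj_L2[of u] rep_cnj_L2[of v]
    by eventually_elim simp
qed

lemma cnj_L2_scaleC: "cnj_L2 (scaleC_L2 c u) = scaleC_L2 (cnj c) (cnj_L2 u)"
proof (rule L2_eqI)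
  show "AE x in lebesgue. rep_L2 (cnj_L2 (scaleC_L2 c u)) x = rep_L2 (scaleC_L2 (cnj c) (cnj_L2 u)) x"
    using rep_cnj_L2[of "scaleC_L2 c u"] rep_scaleC_L2[of c u] rep_scaleC_L2[of "cnj c" "cnj_L2 u"]
      rep_cnj_L2[of u]
    by eventually_elim simp
qed

subsection \<open>The Fourier integral on integrable elements\<close>

lemma fourier_integral_cong_AE:
  assumes "f \<in> borel_measurable lebesgue" "g \<in> borel_measurable lebesgue"
    "AE x in lebesgue. f x = g x"
  shows "fourier_integral f = fourier_integral (g :: real^'n::finite \<Rightarrow> complex)"
proof
  fix \<xi> :: "real^'n"
  have [measurable]: "(\<lambda>x::real^'n. exp (- \<i> * of_real (x \<bullet> \<xi>))) \<in> borel_measurable lebesgue"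
    by (rule measurable_completion) measurable
  show "fourier_integral f \<xi> = fourier_integral g \<xi>"
    unfolding fourier_integral_def
  proof (rule integral_cong_AE)
    show "AE x in lebesgue. exp (- \<i> * of_real (x \<bullet> \<xi>)) * f x = exp (- \<i> * of_real (x \<bullet> \<xi>)) * g x"
      using assms(3) by eventually_elim simp
  qed (use assms(1,2) in measurable)
qed

lemma fourier_integral_FT:
  assumes [measurable]: "f \<in> borel_measurable borel"
  shows "fourier_integral f = FT f"
proof
  fix \<xi> :: "real^'a"
  have "(\<lambda>x. exp (- \<i> * of_real (x \<bullet> \<xi>)) * f x) \<in> borel_measurable lborel" by measurable
  from integral_completion[OF this] show "fourier_integral f \<xi> = FT f \<xi>"
    by (simp add: fourier_integral_def FT_def)
qed

lemma Borel_version_L1L2: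
  fixes f :: "real^'n::finite \<Rightarrow> complex"
  assumes sq: "square_integrable f" and int: "integrable lebesgue f"
  obtains g where "g \<in> borel_measurable borel" "AE x in lebesgue. f x = g x"
    "square_integrable g" "integrable lborel g" "fourier_integral f = FT g" "abs_L2 f = abs_L2 g"
proof -
  have fm: "f \<in> borel_measurable lebesgue" using sq by (simp add: square_integrable_def)
  from Borel_version_complex[OF this] obtain g where g[measurable]: "g \<in> borel_measurable lborel"
    and "AE x in lborel. f x = g x" by blast
  then have ae: "AE x in lebesgue. f x = g x" by (intro AE_completion)
  have gl: "g \<in> borel_measurable lebesgue" by (rule measurable_completion[OF g])
  have sg: "square_integrable g"
    by (rule square_integrable_bound[OF sq gl]) (use ae in eventually_elim, simp)
  have "integrable lebesgue g" using int ae fm gl integrable_cong_AE by blast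
  then have ig: "integrable lborel g" using integrable_completion[OF g] by simp
  have "fourier_integral f = FT g"
    using fourier_integral_cong_AE[OF fm gl ae] fourier_integral_FT[of g] g by simp
  moreover have "abs_L2 f = abs_L2 g" by (rule abs_L2_eqI[OF sq sg ae])
  ultimately show ?thesis using that[of g] g ae sg ig by simp
qed

text \<open>The factor \<open>(2\<pi>)\<^sup>n\<close> by which the transform, in the normalization without prefactor, multiplies squared
  norms.\<close>

definition plancherel_const :: "'n::finite itself \<Rightarrow> real" where
  "plancherel_const _ = (2 * pi) ^ CARD('n)"

lemma plancherel_const_pos [simp]: "0 < plancherel_const TYPE('n::finite)"
  by (simp add: plancherel_const_def)

lemma fourier_integral_L2:
  fixes f :: "real^'n::finite \<Rightarrow> complex"
  assumes sq: "square_integrable f" and int: "integrable lebesgue f"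
  shows "square_integrable (fourier_integral f)"
    "norm (abs_L2 (fourier_integral f)) \<le> sqrt (plancherel_const TYPE('n)) * norm (abs_L2 f)"
proof -
  obtain g where g[measurable]: "g \<in> borel_measurable borel" and sg: "square_integrable g"
    and ig: "integrable lborel g" and F: "fourier_integral f = FT g" and a: "abs_L2 f = abs_L2 g"
    using Borel_version_L1L2[OF assms] by metis
  have FTm[measurable]: "FT g \<in> borel_measurable lborel" by measurable
  have "(\<integral>\<^sup>+\<xi>. ennreal ((norm (FT g \<xi>))\<^sup>2) \<partial>lebesgue) = (\<integral>\<^sup>+\<xi>. ennreal ((norm (FT g \<xi>))\<^sup>2) \<partial>lborel)"
    by (rule nn_integral_completion)
  also have "\<dots> \<le> ennreal (plancherel_const TYPE('n)) * (\<integral>\<^sup>+x. ennreal ((norm (g x))\<^sup>2) \<partial>lborel)"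
    unfolding plancherel_const_def by (rule FT_Plancherel_le[OF ig])
  also have "(\<integral>\<^sup>+x. ennreal ((norm (g x))\<^sup>2) \<partial>lborel) = (\<integral>\<^sup>+x. ennreal ((norm (g x))\<^sup>2) \<partial>lebesgue)"
    by (rule nn_integral_completion[symmetric])
  also have "\<dots> = ennreal ((norm (abs_L2 g))\<^sup>2)" by (rule nn_integral_abs_L2[OF sg])
  also have "ennreal (plancherel_const TYPE('n)) * ennreal ((norm (abs_L2 g))\<^sup>2)
      = ennreal ((sqrt (plancherel_const TYPE('n)) * norm (abs_L2 g))\<^sup>2)"
    by (simp add: power_mult_distrib less_imp_le flip: ennreal_mult)
  finally have le: "(\<integral>\<^sup>+\<xi>. ennreal ((norm (FT g \<xi>))\<^sup>2) \<partial>lebesgue)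
      \<le> ennreal ((sqrt (plancherel_const TYPE('n)) * norm (abs_L2 g))\<^sup>2)" .
  have FTl: "FT g \<in> borel_measurable lebesgue" by (rule measurable_completion[OF FTm])
  show "square_integrable (fourier_integral f)"
    "norm (abs_L2 (fourier_integral f)) \<le> sqrt (plancherel_const TYPE('n)) * norm (abs_L2 f)"
    using norm_abs_L2_le_nn[OF FTl _ le] by (simp_all add: F a less_imp_le)
qed

lemma fourier_integral_add:
  assumes "integrable lebesgue f" "integrable lebesgue g"
  shows "fourier_integral (\<lambda>x. f x + g x) \<xi> = fourier_integral f \<xi> + fourier_integral g \<xi>"
proof -
  have m[measurable]: "(\<lambda>x::real^'a. exp (- \<i> * of_real (x \<bullet> \<xi>))) \<in> borel_measurable lebesgue"
    by (rule measurable_completion) measurable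
  have "integrable lebesgue (\<lambda>x. exp (- \<i> * of_real (x \<bullet> \<xi>)) * h x)" if "integrable lebesgue h" for h
    by (rule Bochner_Integration.integrable_bound[OF that])
       (use that m in \<open>auto simp: norm_mult intro!: borel_measurable_times\<close>)
  then show ?thesis using assms by (simp add: fourier_integral_def distrib_left)
qed

lemma fourier_integral_cmult: "fourier_integral (\<lambda>x. c * f x) \<xi> = c * fourier_integral f \<xi>"
  unfolding fourier_integral_def integral_mult_right_zero[symmetric] by (simp add: ac_simps)

text \<open>On classes with an integrable representative the transform is given by the integral; \<open>fourier_L1\<close> is
  meaningful only there.\<close>

definition L1_elem :: "'n::finite L2 \<Rightarrow> bool" where
  "L1_elem u \<longleftrightarrow> integrable lebesgue (rep_L2 u)"

definition fourier_L1 :: "'n::finite L2 \<Rightarrow> 'n L2" where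
  "fourier_L1 u = abs_L2 (fourier_integral (rep_L2 u))"

lemma L1_elem_abs:
  assumes sq: "square_integrable f" and int: "integrable lebesgue f"
  shows "L1_elem (abs_L2 f)" "fourier_L1 (abs_L2 f) = abs_L2 (fourier_integral f)"
proof -
  have fm: "f \<in> borel_measurable lebesgue" using sq by (simp add: square_integrable_def)
  show "L1_elem (abs_L2 f)" unfolding L1_elem_def
    using integrable_cong_AE[OF rep_L2_measurable fm rep_abs_L2[OF sq]] int by simp
  show "fourier_L1 (abs_L2 f) = abs_L2 (fourier_integral f)"
    unfolding fourier_L1_def using fourier_integral_cong_AE[OF rep_L2_measurable fm rep_abs_L2[OF sq]] by simp
qed

lemma fourier_L1_bound:
  fixes u :: "'n::finite L2"
  assumes "L1_elem u" shows "norm (fourier_L1 u) \<le> sqrt (plancherel_const TYPE('n)) * norm u"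
  using fourier_integral_L2(2)[OF square_integrable_rep[of u]] assms by (simp add: L1_elem_def fourier_L1_def)

lemma L1_add:
  assumes "L1_elem u" "L1_elem v"
  shows "L1_elem (u + v)" "fourier_L1 (u + v) = fourier_L1 u + fourier_L1 v"
proof -
  have sq: "square_integrable (\<lambda>x. rep_L2 u x + rep_L2 v x)" by (intro square_integrable_add) auto
  have i: "integrable lebesgue (rep_L2 u)" "integrable lebesgue (rep_L2 v)"
    using assms by (auto simp: L1_elem_def)
  have e: "u + v = abs_L2 (\<lambda>x. rep_L2 u x + rep_L2 v x)"
    by (simp flip: abs_L2_add)
  show "L1_elem (u + v)" unfolding e by (rule L1_elem_abs(1)[OF sq]) (use i in auto)
  have "fourier_L1 (u + v) = abs_L2 (fourier_integral (\<lambda>x. rep_L2 u x + rep_L2 v x))"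
    unfolding e by (rule L1_elem_abs(2)[OF sq]) (use i in auto)
  also have "fourier_integral (\<lambda>x. rep_L2 u x + rep_L2 v x)
      = (\<lambda>\<xi>. fourier_integral (rep_L2 u) \<xi> + fourier_integral (rep_L2 v) \<xi>)"
    using fourier_integral_add[OF i] by auto
  finally show "fourier_L1 (u + v) = fourier_L1 u + fourier_L1 v"
    using fourier_integral_L2(1)[OF square_integrable_rep i(1)] fourier_integral_L2(1)[OF square_integrable_rep i(2)]
    by (simp add: fourier_L1_def abs_L2_add)
qed

lemma L1_scaleC:
  assumes "L1_elem u"
  shows "L1_elem (scaleC_L2 c u)" "fourier_L1 (scaleC_L2 c u) = scaleC_L2 c (fourier_L1 u)"
proof -
  have sq: "square_integrable (\<lambda>x. c * rep_L2 u x)" by (intro square_integrable_cmult) auto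
  have i: "integrable lebesgue (rep_L2 u)" using assms by (auto simp: L1_elem_def)
  have e: "scaleC_L2 c u = abs_L2 (\<lambda>x. c * rep_L2 u x)"
    by (simp flip: abs_L2_scaleC)
  show "L1_elem (scaleC_L2 c u)" unfolding e by (rule L1_elem_abs(1)[OF sq]) (use i in auto)
  have "fourier_L1 (scaleC_L2 c u) = abs_L2 (fourier_integral (\<lambda>x. c * rep_L2 u x))"
    unfolding e by (rule L1_elem_abs(2)[OF sq]) (use i in auto)
  also have "fourier_integral (\<lambda>x. c * rep_L2 u x) = (\<lambda>\<xi>. c * fourier_integral (rep_L2 u) \<xi>)"
    by (auto simp: fourier_integral_cmult)
  finally show "fourier_L1 (scaleC_L2 c u) = scaleC_L2 c (fourier_L1 u)"
    using fourier_integral_L2(1)[OF square_integrable_rep i]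
    by (simp add: fourier_L1_def abs_L2_scaleC)
qed

lemma L1_diff:
  assumes "L1_elem u" "L1_elem v"
  shows "L1_elem (u - v)" "fourier_L1 (u - v) = fourier_L1 u - fourier_L1 v"
proof -
  have e: "w - w' = w + scaleC_L2 (-1) w'" for w w' :: "'a L2"
    using scaleR_scaleC_L2[of "-1" w'] by simp
  show "L1_elem (u - v)" "fourier_L1 (u - v) = fourier_L1 u - fourier_L1 v"
    unfolding e using L1_add[OF assms(1) L1_scaleC(1)[OF assms(2)]] L1_scaleC(2)[OF assms(2)] by simp_all
qed

subsection \<open>Truncation and the extension to all of L2\<close>

definition trunc_L2 :: "nat \<Rightarrow> 'n::finite L2 \<Rightarrow> 'n L2" where
  "trunc_L2 k = mult_L2 (indicator (ball 0 (real k)))"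

lemma bdd_symbol_ball: "bdd_symbol (indicator (ball 0 r)) 1"
  by (rule bdd_symbol_indicator) simp

lemma trunc_L2_tendsto: "(\<lambda>k. trunc_L2 k u) \<longlonglongrightarrow> u"
proof -
  have "(\<lambda>k. mult_L2 (indicator (ball 0 (real k))) u) \<longlonglongrightarrow> mult_L2 (\<lambda>x. 1) u"
  proof (rule mult_L2_tendsto[OF bdd_symbol_ball])
    show "bdd_symbol (\<lambda>x. 1) 1" by (simp add: bdd_symbol_def)
    fix x :: "real^'a"
    obtain k0 :: nat where k0: "norm x < real k0" using reals_Archimedean2 by blast
    have "eventually (\<lambda>k. indicator (ball 0 (real k)) x = (1::complex)) sequentially"
      unfolding eventually_sequentially
    proof (intro exI allI impI)
      fix k assume "k0 \<le> k" then show "indicator (ball 0 (real k)) x = (1::complex)"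
        using k0 by (simp add: indicator_def)
    qed
    then show "(\<lambda>k. indicator (ball 0 (real k)) x) \<longlonglongrightarrow> (1::complex)" by (rule tendsto_eventually)
  qed
  then show ?thesis by (simp add: trunc_L2_def mult_L2_one)
qed

lemma L1L2_bounded_support:
  fixes f :: "real^'n::finite \<Rightarrow> complex"
  assumes sq: "square_integrable f" and A: "A \<in> sets lebesgue" "emeasure lebesgue A < \<infinity>"
    and supp: "\<And>x. x \<notin> A \<Longrightarrow> f x = 0"
  shows "integrable lebesgue f"
proof (rule Bochner_Integration.integrable_bound)
  show "integrable lebesgue (\<lambda>x. indicator A x + (norm (f x))\<^sup>2 :: real)"
    using sq A by (intro Bochner_Integration.integrable_add) (auto simp: square_integrable_def integrable_indicator_iff)
  show "AE x in lebesgue. norm (f x) \<le> norm (indicator A x + (norm (f x))\<^sup>2 :: real)"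
  proof (rule AE_I2)
    fix x
    have "2 * norm (f x) \<le> 1 + (norm (f x))\<^sup>2" using sum_squares_bound[of 1 "norm (f x)"] by simp
    then have "norm (f x) \<le> 1 + (norm (f x))\<^sup>2" using norm_ge_zero[of "f x"] by linarith
    then show "norm (f x) \<le> norm (indicator A x + (norm (f x))\<^sup>2 :: real)"
      using supp[of x] by (cases "x \<in> A") (auto simp: indicator_def)
  qed
qed (use sq in \<open>simp add: square_integrable_def\<close>)

lemma L1_trunc: "L1_elem (trunc_L2 k u)"
  unfolding trunc_L2_def mult_L2_def
proof (rule L1_elem_abs(1))
  show sq: "square_integrable (\<lambda>x. indicator (ball 0 (real k)) x * rep_L2 u x)"
    by (rule square_integrable_mult[OF bdd_symbol_ball]) simp
  show "integrable lebesgue (\<lambda>x. indicator (ball 0 (real k)) x * rep_L2 u x)"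
    by (rule L1L2_bounded_support[OF sq, of "ball 0 (real k)"])
       (use emeasure_lborel_ball_finite[of "0::real^'a" "real k"] in auto)
qed

text \<open>The extension to all of \<open>L\<^sup>2\<close>: truncations to balls are integrable and converge, and their transforms
  form a Cauchy sequence by the Plancherel inequality.\<close>

definition fourier_ext :: "'n::finite L2 \<Rightarrow> 'n L2" where
  "fourier_ext u = lim (\<lambda>k. fourier_L1 (trunc_L2 k u))"

lemma fourier_L1_tendsto_L1:
  assumes "\<And>k. L1_elem (u k)" "L1_elem v" "u \<longlonglongrightarrow> (v :: 'n::finite L2)"
  shows "(\<lambda>k. fourier_L1 (u k)) \<longlonglongrightarrow> fourier_L1 v"
proof (rule LIM_zero_cancel, rule Lim_null_comparison)
  show "\<forall>\<^sub>F k in sequentially. norm (fourier_L1 (u k) - fourier_L1 v) \<le> sqrt (plancherel_const TYPE('n)) * norm (u k - v)"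
    using fourier_L1_bound[OF L1_diff(1)[OF assms(1,2)]] L1_diff(2)[OF assms(1,2)] by simp
  show "(\<lambda>k. sqrt (plancherel_const TYPE('n)) * norm (u k - v)) \<longlonglongrightarrow> 0"
    using tendsto_mult[OF tendsto_const tendsto_norm[OF LIM_zero[OF assms(3)]], of "sqrt (plancherel_const TYPE('n))"] by simp
qed

lemma fourier_ext_lim: "(\<lambda>k. fourier_L1 (trunc_L2 k u)) \<longlonglongrightarrow> fourier_ext (u :: 'n::finite L2)"
proof -
  let ?C = "sqrt (plancherel_const TYPE('n))"
  have C: "?C > 0" by simp
  have "Cauchy (\<lambda>k. fourier_L1 (trunc_L2 k u))"
  proof (rule CauchyI)
    fix e :: real assume "e > 0"
    then have "e / ?C > 0" using C by simp
    then obtain M where M: "\<And>m n. m \<ge> M \<Longrightarrow> n \<ge> M \<Longrightarrow> norm (trunc_L2 m u - trunc_L2 n u) < e / ?C"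
      using CauchyD[OF LIMSEQ_imp_Cauchy[OF trunc_L2_tendsto[of u]]] by blast
    have "norm (fourier_L1 (trunc_L2 m u) - fourier_L1 (trunc_L2 n u)) < e" if "m \<ge> M" "n \<ge> M" for m n
    proof -
      have "norm (fourier_L1 (trunc_L2 m u) - fourier_L1 (trunc_L2 n u)) \<le> ?C * norm (trunc_L2 m u - trunc_L2 n u)"
        using fourier_L1_bound[OF L1_diff(1)[OF L1_trunc L1_trunc]] L1_diff(2)[OF L1_trunc L1_trunc] by metis
      also have "\<dots> < ?C * (e / ?C)" using M[OF that] C by (intro mult_strict_left_mono)
      also have "\<dots> = e" using C by (metis less_irrefl nonzero_mult_div_cancel_left times_divide_eq_right)
      finally show ?thesis .
    qed
    then show "\<exists>M. \<forall>m\<ge>M. \<forall>n\<ge>M. norm (fourier_L1 (trunc_L2 m u) - fourier_L1 (trunc_L2 n u)) < e" by blast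
  qed
  then show ?thesis unfolding fourier_ext_def by (simp add: Cauchy_convergent convergent_LIMSEQ_iff[symmetric])
qed

lemma fourier_ext_L1: "L1_elem u \<Longrightarrow> fourier_ext u = fourier_L1 u"
  using LIMSEQ_unique[OF fourier_ext_lim fourier_L1_tendsto_L1[OF L1_trunc _ trunc_L2_tendsto]] by blast

lemma trunc_linear: "bounded_clinear_L2 (trunc_L2 k)"
  unfolding trunc_L2_def by (rule bounded_clinear_mult_L2[OF bdd_symbol_ball])

lemma trunc_add: "trunc_L2 k (u + v) = trunc_L2 k u + trunc_L2 k v"
  and trunc_scaleC: "trunc_L2 k (scaleC_L2 c u) = scaleC_L2 c (trunc_L2 k u)"
  using bounded_clinear_simps[OF trunc_linear] by blast+

lemma norm_fourier_ext_le: "norm (fourier_ext u) \<le> sqrt (plancherel_const TYPE('n)) * norm (u :: 'n::finite L2)"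
proof (rule LIMSEQ_le_const2[OF tendsto_norm[OF fourier_ext_lim]], intro exI allI impI)
  fix k
  have "norm (fourier_L1 (trunc_L2 k u)) \<le> sqrt (plancherel_const TYPE('n)) * norm (trunc_L2 k u)"
    by (rule fourier_L1_bound[OF L1_trunc])
  also have "\<dots> \<le> sqrt (plancherel_const TYPE('n)) * norm u"
    using norm_mult_L2_le[OF bdd_symbol_ball, of "real k" u]
    by (intro mult_left_mono) (auto simp: trunc_L2_def less_imp_le)
  finally show "norm (fourier_L1 (trunc_L2 k u)) \<le> sqrt (plancherel_const TYPE('n)) * norm u" .
qed

lemma bounded_clinear_fourier_ext: "bounded_clinear_L2 fourier_ext"
proof (rule bounded_clinear_L2I[OF _ _ norm_fourier_ext_le])
  fix u v :: "'a L2" and c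
  have "(\<lambda>k. fourier_L1 (trunc_L2 k (u + v))) \<longlonglongrightarrow> fourier_ext u + fourier_ext v"
    unfolding trunc_add L1_add(2)[OF L1_trunc L1_trunc] by (intro tendsto_add fourier_ext_lim)
  then show "fourier_ext (u + v) = fourier_ext u + fourier_ext v" using fourier_ext_lim LIMSEQ_unique by blast
  have "(\<lambda>k. fourier_L1 (trunc_L2 k (scaleC_L2 c u))) \<longlonglongrightarrow> scaleC_L2 c (fourier_ext u)"
    unfolding trunc_scaleC L1_scaleC(2)[OF L1_trunc]
    by (rule bounded_linear.tendsto[OF bounded_linear_scaleC_L2 fourier_ext_lim])
  then show "fourier_ext (scaleC_L2 c u) = scaleC_L2 c (fourier_ext u)" using fourier_ext_lim LIMSEQ_unique by blast
qed

lemma fourier_ext_abs: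
  assumes "square_integrable f" "integrable lebesgue f"
  shows "fourier_ext (abs_L2 f) = abs_L2 (fourier_integral f)"
  using fourier_ext_L1 L1_elem_abs[OF assms] by metis

subsection \<open>The conjugate transform\<close>

text \<open>The transform with the opposite phase, which is \<open>(2\<pi>)\<^sup>n\<close> times the inverse transform. Defining it by
  conjugation transfers all bounds from \<open>fourier_ext\<close>.\<close>

definition fourier_conj :: "'n::finite L2 \<Rightarrow> 'n L2" where
  "fourier_conj u = cnj_L2 (fourier_ext (cnj_L2 u))"

lemma bounded_clinear_fourier_conj: "bounded_clinear_L2 (fourier_conj :: 'n::finite L2 \<Rightarrow> 'n L2)"
proof (rule bounded_clinear_L2I)
  have F: "fourier_ext (u + v) = fourier_ext u + fourier_ext v" "fourier_ext (scaleC_L2 c u) = scaleC_L2 c (fourier_ext u)"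
    for u v :: "'n L2" and c
    using bounded_clinear_simps[OF bounded_clinear_fourier_ext] by blast+
  fix u v :: "'n L2" and c
  show "fourier_conj (u + v) = fourier_conj u + fourier_conj v" by (simp add: fourier_conj_def cnj_L2_add F)
  show "fourier_conj (scaleC_L2 c u) = scaleC_L2 c (fourier_conj u)" by (simp add: fourier_conj_def cnj_L2_scaleC F)
  show "norm (fourier_conj u) \<le> sqrt (plancherel_const TYPE('n)) * norm u"
    using norm_fourier_ext_le[of "cnj_L2 u"] by (simp add: fourier_conj_def norm_cnj_L2)
qed

lemma fourier_conj_abs:
  assumes sq: "square_integrable f" and int: "integrable lborel f"
    and [measurable]: "f \<in> borel_measurable borel"
  shows "square_integrable (\<lambda>x. LINT \<xi>|lborel. exp (\<i> * of_real (x \<bullet> \<xi>)) * f \<xi>)"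
    and "fourier_conj (abs_L2 f) = abs_L2 (\<lambda>x. LINT \<xi>|lborel. exp (\<i> * of_real (x \<bullet> \<xi>)) * f \<xi>)"
proof -
  have intl: "integrable lebesgue (\<lambda>x. cnj (f x))"
    using int integrable_completion[of "\<lambda>x. cnj (f x)" lborel] by simp
  have sqc: "square_integrable (\<lambda>x. cnj (f x))" by (rule square_integrable_cnj[OF sq])
  have eq: "cnj (fourier_integral (\<lambda>x. cnj (f x)) x) = (LINT \<xi>|lborel. exp (\<i> * of_real (x \<bullet> \<xi>)) * f \<xi>)" for x
  proof -
    have "fourier_integral (\<lambda>x. cnj (f x)) x = FT (\<lambda>x. cnj (f x)) x"
      by (subst fourier_integral_FT) simp_all
    then show ?thesis
      using Bochner_Integration.integral_cnj[of lborel "\<lambda>\<xi>. exp (- (\<i> * of_real (\<xi> \<bullet> x))) * cnj (f \<xi>)", symmetric]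
      by (simp add: FT_def exp_cnj inner_commute)
  qed
  have sF: "square_integrable (fourier_integral (\<lambda>x. cnj (f x)))" by (rule fourier_integral_L2(1)[OF sqc intl])
  show "square_integrable (\<lambda>x. LINT \<xi>|lborel. exp (\<i> * of_real (x \<bullet> \<xi>)) * f \<xi>)"
    using square_integrable_cnj[OF sF] unfolding eq .
  show "fourier_conj (abs_L2 f) = abs_L2 (\<lambda>x. LINT \<xi>|lborel. exp (\<i> * of_real (x \<bullet> \<xi>)) * f \<xi>)"
    unfolding fourier_conj_def using sq sF by (simp add: cnj_L2_abs fourier_ext_abs[OF sqc intl] eq)
qed


section \<open>Mollified boxes and Fourier inversion\<close>

lemma integral_lborel_affine:
  fixes f :: "'a::euclidean_space \<Rightarrow> 'b::{banach,second_countable_topology}"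
  assumes [measurable]: "f \<in> borel_measurable borel" and "c \<noteq> 0"
  shows "(LINT x|lborel. f x) = \<bar>c\<bar> ^ DIM('a) *\<^sub>R (LINT x|lborel. f (t + c *\<^sub>R x))"
  by (subst lborel_affine[OF assms(2), of t])
     (simp add: integral_density integral_distr)

lemma integrable_gauss_shift:
  assumes \<sigma>: "\<sigma> > 0" shows "integrable lborel (\<lambda>y. gauss \<sigma> (x - y))"
proof (rule integrableI_bounded)
  show "(\<integral>\<^sup>+y. ennreal (norm (gauss \<sigma> (x - y))) \<partial>lborel) < \<infinity>"
    using nn_integral_gauss[OF \<sigma>, of x] by (simp add: gauss_even[of \<sigma> x])
qed measurable

lemma integral_gauss_shift:
  assumes \<sigma>: "\<sigma> > 0" shows "(LINT y|lborel. gauss \<sigma> (x - y)) = 1"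
  using integral_lborel_translate[of "gauss \<sigma>" "- x"] integral_gauss[OF \<sigma>]
  by (simp add: gauss_even[of \<sigma> x])

text \<open>These functions serve two purposes: their transform is explicit and decays like a Gaussian, which
  gives the inversion formula for them, and they are Schwartz functions, which identifies the extension of
  the transform from the Schwartz space.\<close>

definition mollified_box :: "real \<Rightarrow> real^'n::finite \<Rightarrow> real^'n \<Rightarrow> real^'n \<Rightarrow> real" where
  "mollified_box \<sigma> a b x = (LINT y|lborel. gauss \<sigma> (x - y) * indicator (box a b) y)"

lemma mollified_box_measurable [measurable]: "mollified_box \<sigma> a b \<in> borel_measurable borel"
  unfolding mollified_box_def by measurable

lemma integrable_mollified_kernel:
  assumes \<sigma>: "\<sigma> > 0"
  shows "integrable lborel (\<lambda>y. gauss \<sigma> (x - y) * indicator (box a b) y)"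
  by (rule Bochner_Integration.integrable_bound[OF integrable_gauss_shift[OF \<sigma>, of x]])
     (auto simp: indicator_def)

lemma mollified_box_bounds:
  assumes \<sigma>: "\<sigma> > 0"
  shows "0 \<le> mollified_box \<sigma> a b x" "mollified_box \<sigma> a b x \<le> 1"
proof -
  show "0 \<le> mollified_box \<sigma> a b x"
    unfolding mollified_box_def by (intro integral_nonneg_AE AE_I2) (auto simp: indicator_def)
  have "mollified_box \<sigma> a b x \<le> (LINT y|lborel. gauss \<sigma> (x - y))"
    unfolding mollified_box_def
    by (intro integral_mono integrable_mollified_kernel integrable_gauss_shift \<sigma>) (auto simp: indicator_def)
  then show "mollified_box \<sigma> a b x \<le> 1" by (simp add: integral_gauss_shift[OF \<sigma>])
qed

lemma nn_integral_mollified_box: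
  assumes \<sigma>: "\<sigma> > 0"
  shows "(\<integral>\<^sup>+x. ennreal (mollified_box \<sigma> a b x) \<partial>lborel) = emeasure lborel (box a b)"
proof -
  have "(\<integral>\<^sup>+x. ennreal (mollified_box \<sigma> a b x) \<partial>lborel)
      = (\<integral>\<^sup>+x. \<integral>\<^sup>+y. ennreal (gauss \<sigma> (x - y) * indicator (box a b) y) \<partial>lborel \<partial>lborel)"
    unfolding mollified_box_def
    by (intro nn_integral_cong nn_integral_eq_integral[symmetric] integrable_mollified_kernel \<sigma>)
       (auto simp: indicator_def)
  also have "\<dots> = (\<integral>\<^sup>+y. \<integral>\<^sup>+x. ennreal (gauss \<sigma> (x - y) * indicator (box a b) y) \<partial>lborel \<partial>lborel)"
    by (rule lborel_pair.Fubini') simp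
  also have "\<dots> = (\<integral>\<^sup>+y. indicator (box a b) y \<partial>lborel)"
  proof (rule nn_integral_cong)
    fix y
    have "(\<integral>\<^sup>+x. ennreal (gauss \<sigma> (x - y) * indicator (box a b) y) \<partial>lborel)
        = (\<integral>\<^sup>+x. ennreal (gauss \<sigma> (x - y)) * indicator (box a b) y \<partial>lborel)"
      by (intro nn_integral_cong) (auto simp: indicator_def)
    then show "(\<integral>\<^sup>+x. ennreal (gauss \<sigma> (x - y) * indicator (box a b) y) \<partial>lborel) = indicator (box a b) y"
      by (simp add: nn_integral_multc nn_integral_gauss[OF \<sigma>])
  qed
  finally show ?thesis by simp
qed

lemma
  assumes \<sigma>: "\<sigma> > 0"
  shows integrable_mollified_box: "integrable lborel (mollified_box \<sigma> a b)"
    and integral_mollified_box: "(LINT x|lborel. mollified_box \<sigma> a b x) = measure lborel (box a b)"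
proof -
  have fin: "emeasure lborel (box a b) < \<infinity>" by (rule emeasure_lborel_box_finite)
  show "integrable lborel (mollified_box \<sigma> a b)"
    by (rule integrableI_bounded)
       (use mollified_box_bounds[OF \<sigma>, of a b] nn_integral_mollified_box[OF \<sigma>, of a b] fin in auto)
  show "(LINT x|lborel. mollified_box \<sigma> a b x) = measure lborel (box a b)"
    unfolding measure_def nn_integral_mollified_box[OF \<sigma>, of a b, symmetric]
    by (rule integral_eq_nn_integral) (auto simp: mollified_box_bounds[OF \<sigma>])
qed

lemma square_integrable_mollified_box:
  assumes \<sigma>: "\<sigma> > 0"
  shows "square_integrable (\<lambda>x. complex_of_real (mollified_box \<sigma> a b x))"
    "integrable lebesgue (\<lambda>x. complex_of_real (mollified_box \<sigma> a b x))"
proof -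
  have "(\<lambda>x. complex_of_real (mollified_box \<sigma> a b x)) \<in> borel_measurable lborel" by measurable
  then have m: "(\<lambda>x. complex_of_real (mollified_box \<sigma> a b x)) \<in> borel_measurable lebesgue"
    by (rule measurable_completion)
  have i: "integrable lebesgue (mollified_box \<sigma> a b)"
    using integrable_mollified_box[OF \<sigma>, of a b] integrable_completion[of "mollified_box \<sigma> a b" lborel] by simp
  show "integrable lebesgue (\<lambda>x. complex_of_real (mollified_box \<sigma> a b x))" using i by simp
  have "integrable lebesgue (\<lambda>x. (norm (complex_of_real (mollified_box \<sigma> a b x)))\<^sup>2)"
  proof (rule Bochner_Integration.integrable_bound[OF i])
    show "AE x in lebesgue. norm ((norm (complex_of_real (mollified_box \<sigma> a b x)))\<^sup>2) \<le> norm (mollified_box \<sigma> a b x)"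
      using mollified_box_bounds[OF \<sigma>, of a b] by (intro AE_I2) (simp add: power2_eq_square mult_left_le)
  qed (use m in measurable)
  then show "square_integrable (\<lambda>x. complex_of_real (mollified_box \<sigma> a b x))"
    using m by (simp add: square_integrable_def)
qed

lemma gweight_even: "gweight \<sigma> (- \<xi>) = gweight \<sigma> \<xi>"
  by (simp add: gweight_def)

lemma integrable_indicator_box:
  "integrable lborel (indicator (box a b) :: _ \<Rightarrow> complex)"
proof -
  have "integrable lborel (\<lambda>x. complex_of_real (indicator (box a b) x))"
    using emeasure_lborel_box_finite[of a b] by (intro integrable_of_real) (simp add: integrable_indicator_iff)
  moreover have "(\<lambda>x. complex_of_real (indicator (box a b) x)) = indicator (box a b)"
    by (simp add: fun_eq_iff indicator_def)
  ultimately show ?thesis by simp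
qed

text \<open>A transform of a convolution is the product of the transforms.\<close>

lemma FT_mollified_box:
  fixes a :: "real^'n::finite"
  assumes \<sigma>: "\<sigma> > 0"
  shows "FT (\<lambda>x. complex_of_real (mollified_box \<sigma> a b x)) \<xi>
    = of_real (gweight \<sigma> \<xi>) * FT (indicator (box a b)) \<xi>"
proof -
  have int: "integrable (lborel \<Otimes>\<^sub>M lborel) (\<lambda>(x, y). exp (- (\<i> * of_real (x \<bullet> \<xi>))) *
      complex_of_real (gauss \<sigma> (x - y) * indicator (box a b) y))"
  proof (rule lborel_pair.Fubini_integrable)
    have "(LINT y|lborel. norm (exp (- (\<i> * of_real (x \<bullet> \<xi>))) * complex_of_real (gauss \<sigma> (x - y) * indicator (box a b) y)))
        = mollified_box \<sigma> a b x" for x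
      unfolding mollified_box_def
      by (intro Bochner_Integration.integral_cong refl) (simp add: norm_mult indicator_def)
    then show "integrable lborel (\<lambda>x. LINT y|lborel. norm (case (x, y) of (x, y) \<Rightarrow> exp (- (\<i> * of_real (x \<bullet> \<xi>))) * complex_of_real (gauss \<sigma> (x - y) * indicator (box a b) y)))"
      using integrable_mollified_box[OF \<sigma>, of a b] by simp
    show "AE x in lborel. integrable lborel (\<lambda>y. case (x, y) of (x, y) \<Rightarrow> exp (- (\<i> * of_real (x \<bullet> \<xi>))) * complex_of_real (gauss \<sigma> (x - y) * indicator (box a b) y))"
      unfolding prod.case
      by (intro AE_I2 integrable_mult_right integrable_of_real integrable_mollified_kernel[OF \<sigma>])
  qed measurable
  have "FT (\<lambda>x. complex_of_real (mollified_box \<sigma> a b x)) \<xi>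
      = (LINT x|lborel. LINT y|lborel. exp (- (\<i> * of_real (x \<bullet> \<xi>))) * complex_of_real (gauss \<sigma> (x - y) * indicator (box a b) y))"
    unfolding FT_def mollified_box_def integral_mult_right_zero integral_complex_of_real ..
  also have "\<dots> = (LINT y|lborel. LINT x|lborel. exp (- (\<i> * of_real (x \<bullet> \<xi>))) * complex_of_real (gauss \<sigma> (x - y) * indicator (box a b) y))"
    using lborel_pair.Fubini_integral[OF int] by simp
  also have "\<dots> = (LINT y|lborel. of_real (gweight \<sigma> \<xi>) * (exp (- (\<i> * of_real (y \<bullet> \<xi>))) * indicator (box a b) y))"
  proof (intro Bochner_Integration.integral_cong refl)
    fix y
    have "(LINT x|lborel. exp (- (\<i> * of_real (x \<bullet> \<xi>))) * complex_of_real (gauss \<sigma> (x - y)))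
        = (LINT x|lborel. exp (- (\<i> * of_real ((x + y) \<bullet> \<xi>))) * complex_of_real (gauss \<sigma> ((x + y) - y)))"
      by (rule integral_lborel_translate[symmetric]) measurable
    also have "\<dots> = (LINT x|lborel. exp (- (\<i> * of_real (y \<bullet> \<xi>))) * (exp (\<i> * of_real ((- \<xi>) \<bullet> x)) * complex_of_real (gauss \<sigma> x)))"
    proof (intro Bochner_Integration.integral_cong refl)
      fix x
      have "exp (- (\<i> * of_real ((x + y) \<bullet> \<xi>))) = exp (- (\<i> * of_real (y \<bullet> \<xi>))) * exp (\<i> * of_real ((- \<xi>) \<bullet> x))"
        by (subst exp_add[symmetric]) (simp add: inner_add_left inner_commute algebra_simps)
      then show "exp (- (\<i> * of_real ((x + y) \<bullet> \<xi>))) * complex_of_real (gauss \<sigma> ((x + y) - y))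
          = exp (- (\<i> * of_real (y \<bullet> \<xi>))) * (exp (\<i> * of_real ((- \<xi>) \<bullet> x)) * complex_of_real (gauss \<sigma> x))"
        by (simp add: mult.assoc)
    qed
    also have "\<dots> = exp (- (\<i> * of_real (y \<bullet> \<xi>))) * of_real (gweight \<sigma> \<xi>)"
      unfolding integral_mult_right_zero gauss_fourier[OF \<sigma>] gweight_even ..
    finally have *: "(LINT x|lborel. exp (- (\<i> * of_real (x \<bullet> \<xi>))) * complex_of_real (gauss \<sigma> (x - y)))
        = exp (- (\<i> * of_real (y \<bullet> \<xi>))) * of_real (gweight \<sigma> \<xi>)" .
    have "(LINT x|lborel. exp (- (\<i> * of_real (x \<bullet> \<xi>))) * complex_of_real (gauss \<sigma> (x - y) * indicator (box a b) y))
       = (LINT x|lborel. exp (- (\<i> * of_real (x \<bullet> \<xi>))) * complex_of_real (gauss \<sigma> (x - y))) * indicator (box a b) y"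
      unfolding integral_mult_left_zero[symmetric]
      by (intro Bochner_Integration.integral_cong refl) (simp add: indicator_def)
    then show "(LINT x|lborel. exp (- (\<i> * of_real (x \<bullet> \<xi>))) * complex_of_real (gauss \<sigma> (x - y) * indicator (box a b) y))
       = of_real (gweight \<sigma> \<xi>) * (exp (- (\<i> * of_real (y \<bullet> \<xi>))) * indicator (box a b) y)"
      unfolding * by (simp add: ac_simps)
  qed
  also have "\<dots> = of_real (gweight \<sigma> \<xi>) * FT (indicator (box a b)) \<xi>"
    by (simp add: FT_def)
  finally show ?thesis .
qed

text \<open>The transform of the mollified box is the transform of the box times the Gaussian weight, so that the
  weighted inversion formula applies to the indicator of the box and returns its mollification.\<close>

lemma mollified_box_inversion:
  fixes a b :: "real^'n::finite"
  assumes \<sigma>: "\<sigma> > 0"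
  defines "v \<equiv> abs_L2 (\<lambda>x. complex_of_real (mollified_box \<sigma> a b x))"
  shows "fourier_conj (fourier_ext v) = plancherel_const TYPE('n) *\<^sub>R v"
proof -
  let ?r = "\<lambda>x. complex_of_real (mollified_box \<sigma> a b x)"
  let ?h = "\<lambda>\<xi>. complex_of_real (gweight \<sigma> \<xi>) * FT (indicator (box a b)) \<xi>"
  have FI: "fourier_integral ?r = ?h"
  proof
    fix \<xi> show "fourier_integral ?r \<xi> = ?h \<xi>"
      by (subst fourier_integral_FT) (auto simp: FT_mollified_box[OF \<sigma>])
  qed
  have Fv: "fourier_ext v = abs_L2 ?h"
    unfolding v_def fourier_ext_abs[OF square_integrable_mollified_box[OF \<sigma>]] FI ..
  have sqh: "square_integrable ?h"
    using fourier_integral_L2(1)[OF square_integrable_mollified_box[OF \<sigma>, of a b]] unfolding FI .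
  have hm[measurable]: "?h \<in> borel_measurable borel" by measurable
  have ih: "integrable lborel ?h"
  proof (rule Bochner_Integration.integrable_bound)
    show "integrable lborel (\<lambda>\<xi>::real^'n. gweight \<sigma> \<xi> * (LINT x|lborel. norm (indicator (box a b) x :: complex)))"
      by (intro integrable_mult_left) (rule integrable_gweight[OF \<sigma>])
    show "AE \<xi> in lborel. norm (?h \<xi>) \<le> norm (gweight \<sigma> \<xi> * (LINT x|lborel. norm (indicator (box a b) x :: complex)))"
      by (intro AE_I2) (auto simp: norm_mult abs_mult intro!: mult_left_mono FT_bound)
  qed measurable
  have "fourier_conj (fourier_ext v) = abs_L2 (\<lambda>x. LINT \<xi>|lborel. exp (\<i> * of_real (x \<bullet> \<xi>)) * ?h \<xi>)"
    unfolding Fv by (rule fourier_conj_abs(2)[OF sqh ih hm])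
  also have "(\<lambda>x. LINT \<xi>|lborel. exp (\<i> * of_real (x \<bullet> \<xi>)) * ?h \<xi>)
      = (\<lambda>x. of_real (plancherel_const TYPE('n)) * ?r x)"
  proof
    fix x
    have "(LINT \<xi>|lborel. exp (\<i> * of_real (x \<bullet> \<xi>)) * ?h \<xi>)
       = of_real ((2 * pi) ^ CARD('n)) * (LINT y|lborel. of_real (gauss \<sigma> (x - y)) * indicator (box a b) y)"
      by (rule FT_inversion_weighted[OF integrable_indicator_box \<sigma>])
    also have "(LINT y|lborel. complex_of_real (gauss \<sigma> (x - y)) * indicator (box a b) y) = ?r x"
      unfolding mollified_box_def integral_complex_of_real[symmetric]
      by (intro Bochner_Integration.integral_cong refl) (simp add: indicator_def)
    finally show "(LINT \<xi>|lborel. exp (\<i> * of_real (x \<bullet> \<xi>)) * ?h \<xi>) = of_real (plancherel_const TYPE('n)) * ?r x"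
      by (simp add: plancherel_const_def)
  qed
  also have "abs_L2 (\<lambda>x. of_real (plancherel_const TYPE('n)) * ?r x) = plancherel_const TYPE('n) *\<^sub>R v"
    unfolding v_def scaleR_scaleC_L2 by (rule abs_L2_scaleC[symmetric, OF square_integrable_mollified_box(1)[OF \<sigma>]])
  finally show ?thesis .
qed

text \<open>After rescaling, the mollification is the integral of a fixed Gaussian over the sets \<open>(box - x)/\<sigma>\<close>, which
  exhaust the space.\<close>

lemma mollified_box_pointwise:
  fixes a b :: "real^'n::finite"
  assumes x: "x \<in> box a b"
  shows "(\<lambda>m. mollified_box (1 / real (Suc m)) a b x) \<longlonglongrightarrow> 1"
proof -
  have resc: "mollified_box \<sigma> a b x = (LINT z|lborel. gauss 1 z * indicator (box a b) (x + \<sigma> *\<^sub>R z))"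
    if \<sigma>: "\<sigma> > 0" for \<sigma>
  proof -
    have g1: "\<sigma> ^ CARD('n) * gauss \<sigma> (- (\<sigma> *\<^sub>R z)) = gauss 1 z" for z :: "real^'n"
    proof -
      have "\<sigma> * normal_density 0 \<sigma> (- (\<sigma> * s)) = normal_density 0 1 s" for s
        using \<sigma> by (simp add: normal_density_def real_sqrt_mult power_mult_distrib)
      then have "(\<Prod>i\<in>(UNIV::'n set). \<sigma> * normal_density 0 \<sigma> (- (\<sigma> * z $ i))) = gauss 1 z"
        by (simp add: gauss_def)
      then show ?thesis by (simp add: gauss_def prod.distrib)
    qed
    have "mollified_box \<sigma> a b x = \<bar>\<sigma>\<bar> ^ DIM(real^'n) *\<^sub>R
       (LINT z|lborel. gauss \<sigma> (x - (x + \<sigma> *\<^sub>R z)) * indicator (box a b) (x + \<sigma> *\<^sub>R z))"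
      unfolding mollified_box_def by (rule integral_lborel_affine) (use \<sigma> in auto)
    also have "\<dots> = (LINT z|lborel. (\<sigma> ^ CARD('n) * gauss \<sigma> (- (\<sigma> *\<^sub>R z))) * indicator (box a b) (x + \<sigma> *\<^sub>R z))"
      using \<sigma> by (simp add: mult.assoc)
    finally show ?thesis by (simp only: g1)
  qed
  have "(\<lambda>m. LINT z|lborel. gauss 1 z * indicator (box a b) (x + (1 / real (Suc m)) *\<^sub>R z))
      \<longlonglongrightarrow> (LINT z|lborel. gauss 1 (z::real^'n))"
  proof (rule integral_dominated_convergence[where w = "gauss 1"])
    show "AE z in lborel. (\<lambda>m. gauss 1 z * indicator (box a b) (x + (1 / real (Suc m)) *\<^sub>R z)) \<longlonglongrightarrow> gauss 1 z"
    proof (rule AE_I2)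
      fix z
      have "(\<lambda>m. x + (1 / real (Suc m)) *\<^sub>R z) \<longlonglongrightarrow> x + 0 *\<^sub>R z"
        by (intro tendsto_add tendsto_scaleR tendsto_const)
           (use LIMSEQ_inverse_real_of_nat in \<open>simp add: inverse_eq_divide\<close>)
      then have "eventually (\<lambda>m. x + (1 / real (Suc m)) *\<^sub>R z \<in> box a b) sequentially"
        using x by (auto dest!: topological_tendstoD[OF _ open_box[of a b]])
      then have "eventually (\<lambda>m. gauss 1 z * indicator (box a b) (x + (1 / real (Suc m)) *\<^sub>R z) = gauss 1 z) sequentially"
        by eventually_elim simp
      then show "(\<lambda>m. gauss 1 z * indicator (box a b) (x + (1 / real (Suc m)) *\<^sub>R z)) \<longlonglongrightarrow> gauss 1 z"
        by (rule tendsto_eventually)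
    qed
    show "AE z in lborel. norm (gauss 1 z * indicator (box a b) (x + (1 / real (Suc m)) *\<^sub>R z)) \<le> gauss 1 z" for m
      by (rule AE_I2) (auto simp: indicator_def)
  qed (auto intro: integrable_gauss)
  then show ?thesis by (simp add: resc integral_gauss)
qed

text \<open>For a function \<open>0 \<le> r \<le> 1\<close> with the same integral as the indicator \<open>I\<close> one has
  \<open>\<integral>|r - I|\<^sup>2 \<le> \<integral>(r + I - 2rI) = 2\<integral>I - 2\<integral>rI\<close>, and the right-hand side tends to \<open>0\<close> because \<open>r\<close> tends to \<open>1\<close>
  inside the box.\<close>

lemma mollified_box_tendsto:
  fixes a b :: "real^'n::finite"
  shows "(\<lambda>m. abs_L2 (\<lambda>x. complex_of_real (mollified_box (1 / real (Suc m)) a b x))) \<longlonglongrightarrow> abs_L2 (indicator (box a b))"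
proof -
  define s where "s m = 1 / real (Suc m)" for m
  have s: "s m > 0" for m by (simp add: s_def)
  let ?r = "\<lambda>m x. mollified_box (s m) a b x"
  let ?I = "\<lambda>x. indicator (box a b) x :: real"
  define Q where "Q = measure lborel (box a b)"
  have iI: "integrable lborel ?I" using emeasure_lborel_box_finite[of a b] by (simp add: integrable_indicator_iff)
  have irI: "integrable lborel (\<lambda>x. ?r m x * ?I x)" for m
    by (rule Bochner_Integration.integrable_bound[OF integrable_mollified_box[OF s, of m a b]])
       (auto simp: indicator_def)
  have lim: "(\<lambda>m. LINT x|lborel. ?r m x * ?I x) \<longlonglongrightarrow> (LINT x|lborel. ?I x)"
  proof (rule integral_dominated_convergence[OF _ _ iI])
    show "AE x in lborel. (\<lambda>m. ?r m x * ?I x) \<longlonglongrightarrow> ?I x"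
      using mollified_box_pointwise[of _ a b] by (intro AE_I2) (auto simp: indicator_def s_def)
    show "AE x in lborel. norm (?r m x * ?I x) \<le> ?I x" for m
      using mollified_box_bounds[OF s, of m a b] by (intro AE_I2) (auto simp: indicator_def)
  qed measurable
  have sqI: "square_integrable (indicator (box a b) :: real^'n \<Rightarrow> complex)"
    by (rule square_integrable_indicator[of _ a b]) auto
  have le: "(norm (abs_L2 (\<lambda>x. complex_of_real (?r m x)) - abs_L2 (indicator (box a b))))\<^sup>2
      \<le> 2 * Q - 2 * (LINT x|lborel. ?r m x * ?I x)" for m
  proof -
    have bm: "(\<lambda>x. (norm (complex_of_real (?r m x) - indicator (box a b) x))\<^sup>2) \<in> borel_measurable lborel"
      by measurable
    have "(norm (abs_L2 (\<lambda>x. complex_of_real (?r m x)) - abs_L2 (indicator (box a b))))\<^sup>2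
        = (LINT x|lebesgue. (norm (complex_of_real (?r m x) - indicator (box a b) x))\<^sup>2)"
      by (simp add: abs_L2_diff square_integrable_mollified_box[OF s] sqI norm_abs_L2_sq
          square_integrable_diff)
    also have "\<dots> = (LINT x|lborel. (norm (complex_of_real (?r m x) - indicator (box a b) x))\<^sup>2)"
      by (rule integral_completion[OF bm])
    also have "\<dots> \<le> (LINT x|lborel. ?r m x + ?I x - 2 * (?r m x * ?I x))"
    proof (rule integral_mono_AE)
      have pw: "(norm (complex_of_real (?r m x) - indicator (box a b) x))\<^sup>2 \<le> ?r m x + ?I x - 2 * (?r m x * ?I x)" for x
      proof -
        have "complex_of_real (?r m x) - indicator (box a b) x = complex_of_real (?r m x - ?I x)"
          by (simp add: indicator_def)
        moreover have "?r m x * ?r m x \<le> ?r m x"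
          using mollified_box_bounds[OF s, of m a b x] by (simp add: mult_left_le)
        ultimately show ?thesis
          by (simp only: norm_of_real power2_abs) (simp add: power2_eq_square algebra_simps indicator_def)
      qed
      show int: "integrable lborel (\<lambda>x. ?r m x + ?I x - 2 * (?r m x * ?I x))"
        using irI[of m] iI integrable_mollified_box[OF s, of m a b] by simp
      show "AE x in lborel. (norm (complex_of_real (?r m x) - indicator (box a b) x))\<^sup>2 \<le> ?r m x + ?I x - 2 * (?r m x * ?I x)"
        using pw by simp
      show "integrable lborel (\<lambda>x. (norm (complex_of_real (?r m x) - indicator (box a b) x))\<^sup>2)"
        by (rule Bochner_Integration.integrable_bound[OF int]) (auto intro!: AE_I2 order.trans[OF pw])
    qed
    also have "\<dots> = 2 * Q - 2 * (LINT x|lborel. ?r m x * ?I x)"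
      using irI[of m] iI integrable_mollified_box[OF s, of m a b]
      by (simp add: integral_mollified_box[OF s] Q_def)
    finally show ?thesis .
  qed
  have lim2: "(\<lambda>m. 2 * Q - 2 * (LINT x|lborel. ?r m x * ?I x)) \<longlonglongrightarrow> 0"
    using tendsto_diff[OF tendsto_const[of "2*Q"] tendsto_mult[OF tendsto_const[of 2] lim]] by (simp add: Q_def)
  have "(\<lambda>m. (norm (abs_L2 (\<lambda>x. complex_of_real (?r m x)) - abs_L2 (indicator (box a b))))\<^sup>2) \<longlonglongrightarrow> 0"
    by (rule tendsto_sandwich[OF _ _ tendsto_const lim2]) (simp, intro always_eventually allI le)
  then have "(\<lambda>m. sqrt ((norm (abs_L2 (\<lambda>x. complex_of_real (?r m x)) - abs_L2 (indicator (box a b))))\<^sup>2)) \<longlonglongrightarrow> sqrt 0"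
    by (rule tendsto_real_sqrt)
  then have "(\<lambda>m. abs_L2 (\<lambda>x. complex_of_real (?r m x)) - abs_L2 (indicator (box a b))) \<longlonglongrightarrow> 0"
    by (simp add: tendsto_norm_zero_iff)
  then show ?thesis unfolding s_def by (rule LIM_zero_cancel)
qed

text \<open>Nonempty boxes suffice, and for them the mollifications are Schwartz functions.\<close>

theorem mollified_boxes_dense:
  fixes W :: "'n::finite L2 set"
  assumes W: "csubspace_L2 W" "closed W"
    and box: "\<And>\<sigma> a b. \<sigma> > 0 \<Longrightarrow> box a b \<noteq> {} \<Longrightarrow> abs_L2 (\<lambda>x. complex_of_real (mollified_box \<sigma> a b x)) \<in> W"
  shows "u \<in> W"
proof (rule L2_box_dense[OF W])
  fix a b :: "real^'n"
  show "abs_L2 (indicator (box a b)) \<in> W"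
  proof (cases "box a b = {}")
    case True
    then have "(indicator (box a b) :: real^'n \<Rightarrow> complex) = (\<lambda>_. 0)" by (simp add: fun_eq_iff)
    then have "abs_L2 (indicator (box a b)) = (0 :: 'n L2)" by (simp add: zero_L2_def)
    then show ?thesis using W by (simp add: csubspace_L2_def)
  next
    case False
    show ?thesis
      by (rule closed_sequentially[OF W(2) _ mollified_box_tendsto]) (simp add: box False)
  qed
qed

theorem fourier_conj_fourier_ext: "fourier_conj (fourier_ext u) = plancherel_const TYPE('n) *\<^sub>R (u :: 'n::finite L2)"
proof -
  have 1: "bounded_clinear_L2 (\<lambda>u::'n L2. fourier_conj (fourier_ext u))"
    by (rule bounded_clinear_compose[OF bounded_clinear_fourier_conj bounded_clinear_fourier_ext])
  have 2: "bounded_clinear_L2 (\<lambda>u::'n L2. plancherel_const TYPE('n) *\<^sub>R u)"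
    by (rule bounded_clinear_scaleR) (simp add: bounded_clinear_L2_def)
  have "u \<in> {u. fourier_conj (fourier_ext u) = plancherel_const TYPE('n) *\<^sub>R u}"
    by (rule mollified_boxes_dense[OF csubspace_eq[OF 1 2]]) (simp add: mollified_box_inversion)
  then show ?thesis by simp
qed

lemma cnj_L2_scaleR: "cnj_L2 (r *\<^sub>R u) = r *\<^sub>R cnj_L2 u"
  by (simp add: scaleR_scaleC_L2 cnj_L2_scaleC)

theorem fourier_ext_fourier_conj: "fourier_ext (fourier_conj u) = plancherel_const TYPE('n) *\<^sub>R (u :: 'n::finite L2)"
proof -
  have "fourier_ext (fourier_conj u) = cnj_L2 (fourier_conj (fourier_ext (cnj_L2 u)))" by (simp add: fourier_conj_def)
  then show ?thesis by (simp add: fourier_conj_fourier_ext cnj_L2_scaleR)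
qed


section \<open>The Fourier transform is the extension from Schwartz functions\<close>

text \<open>Schwartz functions on the line. The sequence of derivatives is part of the definition, which makes
  the rule for products over coordinates a statement about that sequence.\<close>

definition rapid :: "(real \<Rightarrow> real) \<Rightarrow> bool" where
  "rapid \<phi> \<longleftrightarrow> (\<exists>d. d 0 = \<phi> \<and> (\<forall>k s. (d k has_real_derivative d (Suc k) s) (at s)) \<and>
     (\<forall>k m. \<exists>C. \<forall>s. (1 + \<bar>s\<bar>) ^ m * \<bar>d k s\<bar> \<le> C))"

lemma tensor_has_derivative:
  fixes x :: "real^'n::finite"
  assumes "\<And>i. (g i has_real_derivative g' i) (at (x $ i))"
  shows "((\<lambda>x. complex_of_real (\<Prod>i\<in>UNIV. g i (x $ i))) has_derivative
    (\<lambda>h. complex_of_real (\<Sum>i\<in>UNIV. (g' i * h $ i) * (\<Prod>j\<in>UNIV - {i}. g j (x $ j))))) (at x)"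
proof -
  have 1: "((\<lambda>x. g i (x $ i)) has_derivative (\<lambda>h. g' i * h $ i)) (at x)" for i
    using has_derivative_compose[OF bounded_linear_imp_has_derivative[OF bounded_linear_vec_nth[of i]],
        of "g i" "(*) (g' i)" x UNIV] assms[of i]
    by (simp add: has_field_derivative_def)
  show ?thesis
    by (rule bounded_linear.has_derivative[OF bounded_linear_of_real])
       (rule has_derivative_prod, rule 1)
qed

text \<open>A partial derivative in direction \<open>i\<close> raises the order of the factor at \<open>i\<close> by one. An iterated
  derivative along a list of directions is thus the product in which the factor \<open>i\<close> is differentiated as
  often as \<open>i\<close> occurs in the list.\<close>

lemma schwartz_tensor:
  assumes "\<And>i. rapid (\<phi> i)"
  shows "(\<lambda>x::real^'n::finite. complex_of_real (\<Prod>i\<in>UNIV. \<phi> i (x $ i))) \<in> schwartz"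
proof -
  have "\<forall>i. \<exists>d. d 0 = \<phi> i \<and> (\<forall>k s. (d k has_real_derivative d (Suc k) s) (at s)) \<and>
     (\<forall>k m. \<exists>C. \<forall>s. (1 + \<bar>s\<bar>) ^ m * \<bar>d k s\<bar> \<le> C)"
    using assms by (simp add: rapid_def)
  then obtain d where d: "\<And>i. d i 0 = \<phi> i"
      "\<And>i k s. (d i k has_real_derivative d i (Suc k) s) (at s)"
      "\<And>i k m. \<exists>C. \<forall>s. (1 + \<bar>s\<bar>) ^ m * \<bar>d i k s\<bar> \<le> C"
    by metis
  define P where "P c x = complex_of_real (\<Prod>i\<in>UNIV. d i (c i) (x $ i))" for c and x :: "real^'n"
  have der: "(P c has_derivative (\<lambda>h. complex_of_real (\<Sum>i\<in>UNIV. (d i (Suc (c i)) (x $ i) * h $ i) *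
      (\<Prod>j\<in>UNIV - {i}. d j (c j) (x $ j))))) (at x)" for c x
    unfolding P_def by (rule tensor_has_derivative) (rule d)
  have "iter_partial_deriv is (\<lambda>x. complex_of_real (\<Prod>i\<in>UNIV. \<phi> i (x $ i))) = P (count_list is)" for "is"
  proof (induction "is")
    case Nil
    show ?case by (simp add: P_def[abs_def] d)
  next
    case (Cons l ls)
    have "frechet_derivative (P (count_list ls)) (at x) (axis l 1) = P (count_list (l # ls)) x" for x
    proof -
      let ?c = "count_list ls"
      have "frechet_derivative (P ?c) (at x) (axis l 1)
          = complex_of_real (\<Sum>i\<in>UNIV. (d i (Suc (?c i)) (x $ i) * axis l 1 $ i) * (\<Prod>j\<in>UNIV - {i}. d j (?c j) (x $ j)))"
        by (simp flip: frechet_derivative_at[OF der])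
      also have "(\<Sum>i\<in>UNIV. (d i (Suc (?c i)) (x $ i) * axis l 1 $ i) * (\<Prod>j\<in>UNIV - {i}. d j (?c j) (x $ j)))
          = (\<Sum>i\<in>UNIV. if i = l then d l (Suc (?c l)) (x $ l) * (\<Prod>j\<in>UNIV - {l}. d j (?c j) (x $ j)) else 0)"
        by (intro sum.cong) (auto simp: axis_def)
      also have "\<dots> = d l (Suc (?c l)) (x $ l) * (\<Prod>j\<in>UNIV - {l}. d j (?c j) (x $ j))"
        by simp
      also have "(\<Prod>j\<in>UNIV - {l}. d j (?c j) (x $ j)) = (\<Prod>j\<in>UNIV - {l}. d j (count_list (l # ls) j) (x $ j))"
        by (intro prod.cong) auto
      also have "d l (Suc (?c l)) (x $ l) * (\<Prod>j\<in>UNIV - {l}. d j (count_list (l # ls) j) (x $ j))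
          = (\<Prod>j\<in>UNIV. d j (count_list (l # ls) j) (x $ j))"
        by (subst (2) prod.remove[of _ l]) auto
      finally show ?thesis unfolding P_def[of "count_list (l # ls)" x] .
    qed
    then show ?case unfolding iter_partial_deriv.simps Cons by (intro ext)
  qed
  moreover have "P c differentiable at x" for c x
    using der unfolding differentiable_def by blast
  moreover have "bounded (range (\<lambda>x. norm x ^ k *\<^sub>R P c x))" for c k
  proof -
    obtain C where C: "\<And>i s. (1 + \<bar>s\<bar>) ^ k * \<bar>d i (c i) s\<bar> \<le> C i"
    proof -
      have "\<forall>i. \<exists>C. \<forall>s. (1 + \<bar>s\<bar>) ^ k * \<bar>d i (c i) s\<bar> \<le> C" using d(3) by blast
      then show ?thesis using that by metis
    qed
    have C0: "0 \<le> C i" for i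
      by (rule order.trans[OF _ C[of 0]]) simp
    \<comment> \<open>This distributes the polynomial weight over the factors.\<close>
    have nx: "norm x \<le> (\<Prod>i\<in>UNIV. 1 + \<bar>x $ i\<bar>)" for x :: "real^'n"
    proof -
      have "norm x \<le> (\<Sum>i\<in>UNIV. \<bar>x $ i\<bar>)" by (rule norm_le_l1_cart)
      also have "\<dots> \<le> (\<Prod>i\<in>UNIV. 1 + \<bar>x $ i\<bar>)"
      proof -
        have "1 + (\<Sum>i\<in>S. \<bar>x $ i\<bar>) \<le> (\<Prod>i\<in>S. 1 + \<bar>x $ i\<bar>)" if "finite S" for S
          using that
        proof (induction S rule: finite_induct)
          case (insert j S)
          have "1 + (\<Sum>i\<in>insert j S. \<bar>x $ i\<bar>) \<le> (1 + \<bar>x $ j\<bar>) * (1 + (\<Sum>i\<in>S. \<bar>x $ i\<bar>))"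
            using insert by (simp add: algebra_simps sum_nonneg)
          also have "\<dots> \<le> (1 + \<bar>x $ j\<bar>) * (\<Prod>i\<in>S. 1 + \<bar>x $ i\<bar>)"
            by (intro mult_left_mono insert.IH) simp
          finally show ?case using insert by simp
        qed simp
        from this[of UNIV] show ?thesis by simp
      qed
      finally show ?thesis .
    qed
    have "norm (norm x ^ k *\<^sub>R P c x) \<le> (\<Prod>i\<in>UNIV. C i)" for x
    proof -
      have "norm (norm x ^ k *\<^sub>R P c x) = norm x ^ k * (\<Prod>i\<in>UNIV. \<bar>d i (c i) (x $ i)\<bar>)"
        by (simp add: P_def abs_prod del: of_real_prod)
      also have "\<dots> \<le> (\<Prod>i\<in>UNIV. 1 + \<bar>x $ i\<bar>) ^ k * (\<Prod>i\<in>UNIV. \<bar>d i (c i) (x $ i)\<bar>)"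
        by (intro mult_right_mono power_mono nx prod_nonneg) auto
      also have "\<dots> = (\<Prod>i\<in>UNIV. (1 + \<bar>x $ i\<bar>) ^ k * \<bar>d i (c i) (x $ i)\<bar>)"
        by (simp add: prod.distrib prod_power_distrib)
      also have "\<dots> \<le> (\<Prod>i\<in>UNIV. C i)"
        by (intro prod_mono) (auto simp: C)
      finally show ?thesis .
    qed
    then show ?thesis unfolding bounded_iff by auto
  qed
  ultimately show ?thesis by (simp add: schwartz_def)
qed

subsection \<open>Antiderivative differences of Gaussians are rapidly decreasing\<close>

text \<open>The constant comes from \<open>v\<^sup>m \<le> e\<^sup>m\<^sup>v\<close> with \<open>v = cu\<^sup>2/(m+1)\<close>, where \<open>m+1\<close> instead of \<open>m\<close> avoids a division by zero.\<close>

lemma power_exp_square_bounded: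
  fixes c :: real assumes "c > 0"
  shows "\<exists>C. \<forall>u. (1 + \<bar>u\<bar>) ^ m * exp (- c * u\<^sup>2) \<le> C"
proof (intro exI allI)
  fix u :: real
  have e0: "(c / real (Suc m) * u\<^sup>2) ^ m \<le> exp (c * u\<^sup>2)"
  proof -
    have "(c / real (Suc m) * u\<^sup>2) ^ m \<le> (exp (c / real (Suc m) * u\<^sup>2)) ^ m"
    proof (rule power_mono)
      show "c / real (Suc m) * u\<^sup>2 \<le> exp (c / real (Suc m) * u\<^sup>2)"
        using exp_ge_add_one_self[of "c / real (Suc m) * u\<^sup>2"] by linarith
    qed (use assms in simp)
    also have "\<dots> = exp (real m * (c / real (Suc m) * u\<^sup>2))" by (rule exp_of_nat_mult[symmetric])
    also have "\<dots> \<le> exp (c * u\<^sup>2)"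
      using assms by (simp add: field_simps mult_left_mono)
    finally show ?thesis .
  qed
  define A where "A = (real (Suc m) / c) ^ m"
  have A: "u ^ (2 * m) * exp (- c * u\<^sup>2) \<le> A"
  proof -
    have "u ^ (2 * m) = A * (c / real (Suc m) * u\<^sup>2) ^ m"
      using assms by (simp add: A_def power_mult_distrib[symmetric] power_mult)
    also have "\<dots> \<le> A * exp (c * u\<^sup>2)" using e0 assms by (intro mult_left_mono) (auto simp: A_def)
    finally have "u ^ (2 * m) * exp (- c * u\<^sup>2) \<le> A * exp (c * u\<^sup>2) * exp (- c * u\<^sup>2)"
      by (intro mult_right_mono) auto
    also have "\<dots> = A" by (simp add: mult.assoc exp_add[symmetric])
    finally show ?thesis .
  qed
  have e1: "exp (- c * u\<^sup>2) \<le> 1" using assms by simp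
  have pm: "(1 + \<bar>u\<bar>) ^ m \<le> 2 ^ m * (1 + u ^ (2 * m))"
  proof (cases "\<bar>u\<bar> \<le> 1")
    case True
    then have "(1 + \<bar>u\<bar>) ^ m \<le> 2 ^ m" by (intro power_mono) auto
    also have "\<dots> \<le> 2 ^ m * (1 + u ^ (2 * m))" by (simp add: power_mult)
    finally show ?thesis .
  next
    case False
    have "(1 + \<bar>u\<bar>) ^ m \<le> (2 * u\<^sup>2) ^ m"
    proof (intro power_mono)
      have "\<bar>u\<bar> * 1 \<le> \<bar>u\<bar> * \<bar>u\<bar>" using False by (intro mult_left_mono) auto
      then have "\<bar>u\<bar> \<le> u\<^sup>2" by (simp add: power2_eq_square)
      then show "1 + \<bar>u\<bar> \<le> 2 * u\<^sup>2" using False by simp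
    qed simp
    also have "\<dots> \<le> 2 ^ m * (1 + u ^ (2 * m))" by (simp add: power_mult_distrib power_mult)
    finally show ?thesis .
  qed
  have "(1 + \<bar>u\<bar>) ^ m * exp (- c * u\<^sup>2) \<le> (2 ^ m * (1 + u ^ (2 * m))) * exp (- c * u\<^sup>2)"
    using pm by (intro mult_right_mono) auto
  also have "\<dots> = 2 ^ m * (exp (- c * u\<^sup>2) + u ^ (2 * m) * exp (- c * u\<^sup>2))"
    by (simp add: algebra_simps)
  also have "\<dots> \<le> 2 ^ m * (1 + A)"
    using A e1 by (intro mult_left_mono add_mono) auto
  finally show "(1 + \<bar>u\<bar>) ^ m * exp (- c * u\<^sup>2) \<le> 2 ^ m * (1 + (real (Suc m) / c) ^ m)"
    by (simp add: A_def)
qed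

lemma poly_growth: "\<exists>B k. \<forall>u::real. \<bar>poly p u\<bar> \<le> B * (1 + \<bar>u\<bar>) ^ k"
proof (induction p)
  case 0
  show ?case by (rule exI[of _ 0]) simp
next
  case (pCons a p)
  then obtain B k where B: "\<And>u::real. \<bar>poly p u\<bar> \<le> B * (1 + \<bar>u\<bar>) ^ k" by blast
  have "\<bar>poly (pCons a p) u\<bar> \<le> (\<bar>a\<bar> + B) * (1 + \<bar>u\<bar>) ^ Suc k" for u
  proof -
    have "\<bar>poly (pCons a p) u\<bar> \<le> \<bar>a\<bar> + \<bar>u\<bar> * \<bar>poly p u\<bar>"
      using abs_triangle_ineq[of a "u * poly p u"] by (simp add: abs_mult)
    also have "\<dots> \<le> \<bar>a\<bar> * (1 + \<bar>u\<bar>) ^ Suc k + (1 + \<bar>u\<bar>) * (B * (1 + \<bar>u\<bar>) ^ k)"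
    proof (intro add_mono mult_mono B)
      show "\<bar>a\<bar> \<le> \<bar>a\<bar> * (1 + \<bar>u\<bar>) ^ Suc k"
        using mult_left_mono[OF one_le_power[of "1 + \<bar>u\<bar>" "Suc k"], of "\<bar>a\<bar>"] by simp
    qed auto
    finally show ?thesis by (simp add: algebra_simps)
  qed
  then show ?case by blast
qed

lemma poly_normal_density_bounded:
  assumes "\<sigma> > 0"
  shows "\<exists>C. \<forall>u. (1 + \<bar>u\<bar>) ^ m * \<bar>poly p u * normal_density 0 \<sigma> u\<bar> \<le> C"
proof -
  obtain B k where B: "\<And>u::real. \<bar>poly p u\<bar> \<le> B * (1 + \<bar>u\<bar>) ^ k" using poly_growth by blast
  have B0: "0 \<le> B" using B[of 0] by (smt (verit) abs_ge_zero abs_zero add_0_right mult_cancel_left1 power_one)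
  obtain C where C: "\<And>u::real. (1 + \<bar>u\<bar>) ^ (m + k) * exp (- (1 / (2 * \<sigma>\<^sup>2)) * u\<^sup>2) \<le> C"
    using power_exp_square_bounded[of "1 / (2 * \<sigma>\<^sup>2)" "m + k"] assms by auto
  define K where "K = 1 / sqrt (2 * pi * \<sigma>\<^sup>2)"
  have K: "0 \<le> K" by (simp add: K_def)
  have nd: "normal_density 0 \<sigma> u = K * exp (- (1 / (2 * \<sigma>\<^sup>2)) * u\<^sup>2)" for u
    by (simp add: normal_density_def K_def)
  have "(1 + \<bar>u\<bar>) ^ m * \<bar>poly p u * normal_density 0 \<sigma> u\<bar> \<le> B * K * C" for u
  proof -
    have "(1 + \<bar>u\<bar>) ^ m * \<bar>poly p u * normal_density 0 \<sigma> u\<bar>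
        = (1 + \<bar>u\<bar>) ^ m * \<bar>poly p u\<bar> * (K * exp (- (1 / (2 * \<sigma>\<^sup>2)) * u\<^sup>2))"
      using K unfolding nd by (simp add: abs_mult)
    also have "\<dots> \<le> (1 + \<bar>u\<bar>) ^ m * (B * (1 + \<bar>u\<bar>) ^ k) * (K * exp (- (1 / (2 * \<sigma>\<^sup>2)) * u\<^sup>2))"
      using K by (intro mult_right_mono mult_left_mono B) auto
    also have "\<dots> = (B * K) * ((1 + \<bar>u\<bar>) ^ (m + k) * exp (- (1 / (2 * \<sigma>\<^sup>2)) * u\<^sup>2))"
      by (simp add: power_add)
    also have "\<dots> \<le> (B * K) * C" using B0 K by (intro mult_left_mono C) auto
    finally show ?thesis .
  qed
  then show ?thesis by blast
qed

text \<open>Polynomial weights are moderate: translations cost only a factor that depends on the translation.\<close>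

lemma weight_shift: "(1 + \<bar>s\<bar>) ^ m \<le> (1 + \<bar>t\<bar>) ^ m * (1 + \<bar>s - t\<bar>) ^ m" for s t :: real
proof -
  have "1 + \<bar>s\<bar> \<le> (1 + \<bar>t\<bar>) * (1 + \<bar>s - t\<bar>)"
  proof -
    have "0 \<le> \<bar>t\<bar> * \<bar>s - t\<bar>" by simp
    moreover have "\<bar>s\<bar> \<le> \<bar>t\<bar> + \<bar>s - t\<bar>" by arith
    ultimately have "1 + \<bar>s\<bar> \<le> 1 + \<bar>t\<bar> + \<bar>s - t\<bar> + \<bar>t\<bar> * \<bar>s - t\<bar>" by linarith
    then show ?thesis by (simp only: distrib_left distrib_right mult_1_left mult_1_right)
  qed
  then have "(1 + \<bar>s\<bar>) ^ m \<le> ((1 + \<bar>t\<bar>) * (1 + \<bar>s - t\<bar>)) ^ m" by (intro power_mono) auto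
  then show ?thesis by (simp add: power_mult_distrib)
qed

lemma normal_density_deriv:
  assumes "\<sigma> > 0"
  shows "(normal_density 0 \<sigma> has_real_derivative (- u / \<sigma>\<^sup>2) * normal_density 0 \<sigma> u) (at u)"
proof -
  have "((\<lambda>u. 1 / sqrt (2 * pi * \<sigma>\<^sup>2) * exp (- u\<^sup>2 / (2 * \<sigma>\<^sup>2))) has_real_derivative
      1 / sqrt (2 * pi * \<sigma>\<^sup>2) * (exp (- u\<^sup>2 / (2 * \<sigma>\<^sup>2)) * (- u / \<sigma>\<^sup>2))) (at u)"
    using assms by (auto intro!: derivative_eq_intros simp: field_simps power2_eq_square)
  then show ?thesis unfolding normal_density_def[abs_def] by (simp add: mult_ac)
qed

definition mollified_interval :: "real \<Rightarrow> real \<Rightarrow> real \<Rightarrow> real \<Rightarrow> real" where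
  "mollified_interval \<sigma> a b s = (LINT t|lborel. normal_density 0 \<sigma> (s - t) * indicator {a<..<b} t)"

text \<open>The mollified indicator is a difference \<open>G(s - a) - G(s - b)\<close> of an antiderivative of the Gaussian. Its
  derivatives are therefore differences of shifted products of a polynomial and a Gaussian; the function
  itself, for which \<open>G\<close> does not decay, is estimated from the convolution integral.\<close>

lemma rapid_mollified_interval:
  assumes \<sigma>: "\<sigma> > 0" and ab: "a < b"
  shows "rapid (mollified_interval \<sigma> a b)"
proof -
  let ?g = "normal_density 0 \<sigma>"
  have cont: "isCont ?g u" for u
    using DERIV_isCont[OF normal_density_deriv[OF \<sigma>]] .
  obtain G where G: "\<And>u. (G has_vector_derivative ?g u) (at u)"
    using einterval_antiderivative[of "-\<infinity>" "\<infinity>" ?g] cont by auto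
  have G': "(G has_real_derivative ?g u) (at u)" for u
    using G[of u] by (simp add: has_real_derivative_iff_has_vector_derivative)
  have icc: "mollified_interval \<sigma> a b s = (LINT t|lborel. ?g (s - t) * indicator {a..b} t)" for s
    unfolding mollified_interval_def
  proof (rule integral_cong_AE)
    show "AE t in lborel. ?g (s - t) * indicator {a<..<b} t = ?g (s - t) * indicator {a..b} t"
      using AE_lborel_singleton[of a] AE_lborel_singleton[of b]
      by eventually_elim (auto simp: indicator_def)
  qed measurable
  have psi: "mollified_interval \<sigma> a b s = G (s - a) - G (s - b)" for s
  proof -
    have "(LINT t|lborel. ?g (s - t) * indicator {a..b} t) = (- G (s - b)) - (- G (s - a))"
    proof (rule integral_FTC_Icc_real[where F = "\<lambda>t. - G (s - t)"])
      show "((\<lambda>t. - G (s - t)) has_real_derivative ?g (s - t)) (at t)" for t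
        by (auto intro!: derivative_eq_intros DERIV_chain2[OF G'])
      show "isCont (\<lambda>t. ?g (s - t)) t" for t
        by (rule continuous_at_compose[unfolded o_def, of t "\<lambda>t. s - t" ?g])
           (auto intro: cont continuous_intros)
    qed (use ab in auto)
    then show ?thesis by (simp add: icc)
  qed
  \<comment> \<open>The polynomial factors of the derivatives of the Gaussian.\<close>
  define p where "p = rec_nat [:1:] (\<lambda>_ q. pderiv q - smult (1 / \<sigma>\<^sup>2) (pCons 0 q))"
  have p: "p 0 = [:1:]" "p (Suc k) = pderiv (p k) - smult (1 / \<sigma>\<^sup>2) (pCons 0 (p k))" for k
    by (simp_all add: p_def)
  define e where "e k u = poly (p k) u * ?g u" for k u
  have e: "(e k has_real_derivative e (Suc k) u) (at u)" for k u
    unfolding e_def p(2)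
    by (auto intro!: derivative_eq_intros normal_density_deriv[OF \<sigma>] simp: algebra_simps)
  define d where "d k = (case k of 0 \<Rightarrow> mollified_interval \<sigma> a b | Suc j \<Rightarrow> (\<lambda>s. e j (s - a) - e j (s - b)))" for k
  have "d 0 = mollified_interval \<sigma> a b" by (simp add: d_def)
  moreover have "(d k has_real_derivative d (Suc k) s) (at s)" for k s
  proof (cases k)
    case 0
    have "((\<lambda>s. G (s - a) - G (s - b)) has_real_derivative (?g (s - a) - ?g (s - b))) (at s)"
      by (auto intro!: derivative_eq_intros DERIV_chain2[OF G'])
    moreover have "(\<lambda>s. G (s - a) - G (s - b)) = d 0" by (auto simp: d_def psi)
    ultimately show ?thesis using 0 by (simp add: d_def e_def p)
  next
    case (Suc j)
    then show ?thesis
      by (auto simp: d_def intro!: derivative_eq_intros DERIV_chain2[OF e])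
  qed
  moreover have "\<exists>C. \<forall>s. (1 + \<bar>s\<bar>) ^ m * \<bar>d k s\<bar> \<le> C" for k m
  proof (cases k)
    case 0
    obtain C where C: "\<And>u. (1 + \<bar>u\<bar>) ^ m * \<bar>poly [:1:] u * ?g u\<bar> \<le> C"
      using poly_normal_density_bounded[OF \<sigma>, of m "[:1:]"] by blast
    define T where "T = max \<bar>a\<bar> \<bar>b\<bar>"
    have C0: "0 \<le> C" by (rule order.trans[OF _ C[of 0]]) simp
    have "(1 + \<bar>s\<bar>) ^ m * \<bar>mollified_interval \<sigma> a b s\<bar> \<le> (1 + T) ^ m * C * (b - a)" for s
    proof -
      have pw: "(1 + \<bar>s\<bar>) ^ m * (?g (s - t) * indicator {a..b} t) \<le> (1 + T) ^ m * C * indicator {a..b} t" for t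
      proof (cases "t \<in> {a..b}")
        case True
        have "(1 + \<bar>s\<bar>) ^ m * ?g (s - t) \<le> ((1 + \<bar>t\<bar>) ^ m * (1 + \<bar>s - t\<bar>) ^ m) * ?g (s - t)"
          by (intro mult_right_mono weight_shift) simp
        also have "\<dots> = (1 + \<bar>t\<bar>) ^ m * ((1 + \<bar>s - t\<bar>) ^ m * \<bar>poly [:1:] (s - t) * ?g (s - t)\<bar>)"
          by simp
        also have "\<dots> \<le> (1 + T) ^ m * C"
          using True C0 by (intro mult_mono power_mono C) (auto simp: T_def)
        finally show ?thesis using True by simp
      qed simp
      have nn: "0 \<le> mollified_interval \<sigma> a b s"
        unfolding icc by (intro integral_nonneg_AE AE_I2) (auto simp: indicator_def)
      have int: "integrable lborel (\<lambda>t. (1 + T) ^ m * C * indicator {a..b} t)"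
        using ab by (simp add: integrable_indicator_iff)
      have "(1 + \<bar>s\<bar>) ^ m * mollified_interval \<sigma> a b s
          = (LINT t|lborel. (1 + \<bar>s\<bar>) ^ m * (?g (s - t) * indicator {a..b} t))"
        unfolding icc by simp
      also have "\<dots> \<le> (LINT t|lborel. (1 + T) ^ m * C * indicator {a..b} t)"
      proof (rule integral_mono[OF _ int pw])
        show "integrable lborel (\<lambda>t. (1 + \<bar>s\<bar>) ^ m * (?g (s - t) * indicator {a..b} t))"
        proof (rule Bochner_Integration.integrable_bound[OF int])
          have "norm ((1 + \<bar>s\<bar>) ^ m * (?g (s - t) * indicator {a..b} t)) \<le> norm ((1 + T) ^ m * C * indicator {a..b} t)" for t
          proof -
            have "norm ((1 + \<bar>s\<bar>) ^ m * (?g (s - t) * indicator {a..b} t)) = (1 + \<bar>s\<bar>) ^ m * (?g (s - t) * indicator {a..b} t)"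
              by (simp add: abs_mult)
            also note pw[of t]
            finally show ?thesis unfolding real_norm_def by (rule order.trans[OF _ abs_ge_self])
          qed
          then show "AE t in lborel. norm ((1 + \<bar>s\<bar>) ^ m * (?g (s - t) * indicator {a..b} t)) \<le> norm ((1 + T) ^ m * C * indicator {a..b} t)"
            by (intro AE_I2)
        qed measurable
      qed
      also have "\<dots> = (1 + T) ^ m * C * (b - a)" using ab by simp
      finally show ?thesis using nn by simp
    qed
    then show ?thesis using 0 by (auto simp: d_def)
  next
    case (Suc j)
    obtain C where C: "\<And>u. (1 + \<bar>u\<bar>) ^ m * \<bar>poly (p j) u * ?g u\<bar> \<le> C"
      using poly_normal_density_bounded[OF \<sigma>, of m "p j"] by blast
    have sh: "(1 + \<bar>s\<bar>) ^ m * \<bar>e j (s - t)\<bar> \<le> (1 + \<bar>t\<bar>) ^ m * C" for s t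
    proof -
      have "(1 + \<bar>s\<bar>) ^ m * \<bar>e j (s - t)\<bar> \<le> ((1 + \<bar>t\<bar>) ^ m * (1 + \<bar>s - t\<bar>) ^ m) * \<bar>e j (s - t)\<bar>"
        by (intro mult_right_mono weight_shift) simp
      also have "\<dots> = (1 + \<bar>t\<bar>) ^ m * ((1 + \<bar>s - t\<bar>) ^ m * \<bar>e j (s - t)\<bar>)" by (simp only: mult.assoc)
      also have "\<dots> \<le> (1 + \<bar>t\<bar>) ^ m * C" unfolding e_def by (intro mult_left_mono C) simp
      finally show ?thesis .
    qed
    have "(1 + \<bar>s\<bar>) ^ m * \<bar>d k s\<bar> \<le> (1 + \<bar>a\<bar>) ^ m * C + (1 + \<bar>b\<bar>) ^ m * C" for s
    proof -
      have "(1 + \<bar>s\<bar>) ^ m * \<bar>d k s\<bar> \<le> (1 + \<bar>s\<bar>) ^ m * (\<bar>e j (s - a)\<bar> + \<bar>e j (s - b)\<bar>)"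
        using Suc by (intro mult_left_mono) (auto simp: d_def)
      also have "\<dots> \<le> (1 + \<bar>a\<bar>) ^ m * C + (1 + \<bar>b\<bar>) ^ m * C"
        using sh[of s a] sh[of s b] by (simp add: distrib_left)
      finally show ?thesis .
    qed
    then show ?thesis by blast
  qed
  ultimately show ?thesis unfolding rapid_def by blast
qed

lemma mollified_box_schwartz:
  fixes a b :: "real^'n::finite"
  assumes \<sigma>: "\<sigma> > 0" and ne: "box a b \<noteq> {}"
  shows "(\<lambda>x. complex_of_real (mollified_box \<sigma> a b x)) \<in> schwartz"
proof -
  have ab: "a $ i < b $ i" for i using ne by (auto simp: interval_ne_empty_cart)
  have "mollified_box \<sigma> a b x = (\<Prod>i\<in>UNIV. mollified_interval \<sigma> (a $ i) (b $ i) (x $ i))" for x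
  proof -
    have ind: "indicator (box a b) y = (\<Prod>i\<in>UNIV. indicator {a $ i<..<b $ i} (y $ i) :: real)" for y
      by (cases "y \<in> box a b") (auto simp: mem_box_cart indicator_def)
    let ?h = "\<lambda>i t. normal_density 0 \<sigma> (x $ i - t) * indicator {a $ i<..<b $ i} t"
    have "integrable lborel (?h i)" for i
    proof (rule Bochner_Integration.integrable_bound)
      show "integrable lborel (\<lambda>t. normal_density 0 \<sigma> (x $ i - t))"
        using lborel_integrable_real_affine[OF integrable_normal_density[OF \<sigma>, of 0], of "-1" "x $ i"] by simp
    qed (auto simp: indicator_def)
    from integral_lborel_tensor[of ?h, OF this] show ?thesis
      by (simp add: mollified_box_def mollified_interval_def gauss_def ind prod.distrib)
  qed
  then have "(\<lambda>x. complex_of_real (mollified_box \<sigma> a b x))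
      = (\<lambda>x. complex_of_real (\<Prod>i\<in>UNIV. mollified_interval \<sigma> (a $ i) (b $ i) (x $ i)))"
    by simp
  also have "\<dots> \<in> schwartz" by (rule schwartz_tensor) (rule rapid_mollified_interval[OF \<sigma> ab])
  finally show ?thesis .
qed

subsection \<open>Schwartz functions are integrable and square integrable\<close>

text \<open>A Schwartz function is dominated by a multiple of \<open>\<Prod>\<^sub>i 1/(1 + x\<^sub>i\<^sup>2)\<close>.\<close>

lemma schwartz_integrable:
  fixes \<phi> :: "real^'n::finite \<Rightarrow> complex"
  assumes "\<phi> \<in> schwartz"
  shows "square_integrable \<phi>" "integrable lebesgue \<phi>"
proof -
  have diff: "\<phi> differentiable at x" for x
    using assms unfolding schwartz_def by (auto dest: spec[of _ "[]"])
  have bdd: "bounded (range (\<lambda>x. norm x ^ k *\<^sub>R \<phi> x))" for k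
    using assms unfolding schwartz_def by (auto dest: spec[of _ "[]"])
  have "continuous_on UNIV \<phi>"
    using diff by (simp add: continuous_on_eq_continuous_at differentiable_imp_continuous_within)
  then have m[measurable]: "\<phi> \<in> borel_measurable borel" by (rule borel_measurable_continuous_onI)
  then have "\<phi> \<in> borel_measurable lborel" by simp
  then have ml: "\<phi> \<in> borel_measurable lebesgue" by (rule measurable_completion)
  let ?N = "2 * CARD('n)"
  obtain A where A: "\<And>x. norm (\<phi> x) \<le> A" using bdd[of 0] by (auto simp: bounded_iff)
  obtain B where B: "\<And>x. norm x ^ ?N * norm (\<phi> x) \<le> B" using bdd[of ?N] by (auto simp: bounded_iff)
  define w where "w s = inverse (1 + s\<^sup>2)" for s :: real
  have wi: "integrable lborel w"
  proof -
    have "set_integrable lborel (einterval (-\<infinity>) \<infinity>) w"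
      using integrable_inverse_1_plus_square by (simp add: w_def[abs_def])
    then show ?thesis by (simp add: set_integrable_def einterval_eq)
  qed
  have wn: "0 < w s" for s by (simp add: w_def add_pos_nonneg)
  define W where "W x = (\<Prod>i\<in>UNIV. w (x $ i))" for x :: "real^'n"
  have Wi: "integrable lborel W" unfolding W_def[abs_def] by (rule integrable_lborel_tensor) (rule wi)
  have Wn: "0 < W x" for x unfolding W_def by (intro prod_pos) (simp add: wn)
  have W1: "1 \<le> (1 + (norm x)\<^sup>2) ^ CARD('n) * W x" for x
  proof -
    have "(1 + (norm x)\<^sup>2) ^ CARD('n) * W x = (\<Prod>i\<in>UNIV. (1 + (norm x)\<^sup>2) * w (x $ i))"
      by (simp add: W_def prod.distrib)
    also have "\<dots> \<ge> (\<Prod>i\<in>(UNIV::'n set). 1)"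
    proof (intro prod_mono conjI)
      fix i
      have "(x $ i)\<^sup>2 \<le> (norm x)\<^sup>2" using component_le_norm_cart[of x i] by (rule abs_le_square_iff[THEN iffD1, of "x $ i" "norm x", simplified])
      then show "1 \<le> (1 + (norm x)\<^sup>2) * w (x $ i)"
        by (simp add: w_def field_simps add_pos_nonneg)
    qed simp
    finally show ?thesis by simp
  qed
  have dom: "norm (\<phi> x) \<le> 2 ^ CARD('n) * (A + B) * W x" for x
  proof -
    have "(1 + (norm x)\<^sup>2) ^ CARD('n) \<le> 2 ^ CARD('n) * (1 + norm x ^ ?N)"
    proof (cases "norm x \<le> 1")
      case True
      then have "(1 + (norm x)\<^sup>2) ^ CARD('n) \<le> 2 ^ CARD('n)" by (intro power_mono) (auto simp: power_le_one)
      also have "\<dots> \<le> 2 ^ CARD('n) * (1 + norm x ^ ?N)" by simp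
      finally show ?thesis .
    next
      case False
      then have "1 \<le> (norm x)\<^sup>2" by (intro one_le_power) simp
      then have "(1 + (norm x)\<^sup>2) ^ CARD('n) \<le> (2 * (norm x)\<^sup>2) ^ CARD('n)" by (intro power_mono) auto
      also have "\<dots> \<le> 2 ^ CARD('n) * (1 + norm x ^ ?N)" by (simp add: power_mult_distrib power_mult)
      finally show ?thesis .
    qed
    then have "(1 + (norm x)\<^sup>2) ^ CARD('n) * norm (\<phi> x) \<le> (2 ^ CARD('n) * (1 + norm x ^ ?N)) * norm (\<phi> x)"
      by (rule mult_right_mono) simp
    also have "\<dots> = 2 ^ CARD('n) * (norm (\<phi> x) + norm x ^ ?N * norm (\<phi> x))" by (simp add: algebra_simps)
    also have "\<dots> \<le> 2 ^ CARD('n) * (A + B)" using A[of x] B[of x] by (intro mult_left_mono add_mono) auto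
    finally have "(1 + (norm x)\<^sup>2) ^ CARD('n) * norm (\<phi> x) * W x \<le> 2 ^ CARD('n) * (A + B) * W x"
      using Wn[of x] by (intro mult_right_mono) auto
    moreover have "norm (\<phi> x) \<le> (1 + (norm x)\<^sup>2) ^ CARD('n) * W x * norm (\<phi> x)"
      using mult_right_mono[OF W1[of x], of "norm (\<phi> x)"] by simp
    ultimately show ?thesis by (simp add: mult_ac)
  qed
  have int: "integrable lborel \<phi>"
    by (rule Bochner_Integration.integrable_bound[OF integrable_mult_right[OF Wi, of "2 ^ CARD('n) * (A + B)"]])
       (auto intro!: AE_I2 order.trans[OF dom abs_ge_self])
  then show i: "integrable lebesgue \<phi>" using integrable_completion[of \<phi> lborel] by simp
  have "integrable lebesgue (\<lambda>x. (norm (\<phi> x))\<^sup>2)"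
  proof (rule Bochner_Integration.integrable_bound[OF integrable_mult_right[OF integrable_norm[OF i], of A]])
    show "AE x in lebesgue. norm ((norm (\<phi> x))\<^sup>2) \<le> norm (A * norm (\<phi> x))"
      using A order.trans[OF norm_ge_zero A]
      by (intro AE_I2) (auto simp: power2_eq_square abs_mult intro!: mult_right_mono)
  qed (use ml in measurable)
  then show "square_integrable \<phi>" using ml by (simp add: square_integrable_def)
qed

subsection \<open>Unitarity\<close>

text \<open>The definite description is satisfied by the extension from integrable functions, and uniquely so,
  because two operators that agree on Schwartz functions agree on mollified boxes.\<close>

theorem fourier_L2_eq: "(fourier_L2 :: 'n::finite L2 \<Rightarrow> 'n L2) = fourier_ext"
  unfolding fourier_L2_def
proof (rule the_equality)
  show "bounded_clinear_L2 (fourier_ext :: 'n L2 \<Rightarrow> 'n L2) \<and>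
      (\<forall>\<phi>\<in>schwartz. fourier_ext (abs_L2 \<phi> :: 'n L2) = abs_L2 (fourier_integral \<phi>))"
    using bounded_clinear_fourier_ext fourier_ext_abs schwartz_integrable by blast
  fix G :: "'n L2 \<Rightarrow> 'n L2"
  assume G: "bounded_clinear_L2 G \<and> (\<forall>\<phi>\<in>schwartz. G (abs_L2 \<phi>) = abs_L2 (fourier_integral \<phi>))"
  have "u \<in> {u. G u = fourier_ext u}" for u
  proof (rule mollified_boxes_dense[OF csubspace_eq[OF conjunct1[OF G] bounded_clinear_fourier_ext]])
    fix \<sigma> :: real and a b :: "real^'n"
    assume \<sigma>: "\<sigma> > 0" and ne: "box a b \<noteq> {}"
    have "G (abs_L2 (\<lambda>x. complex_of_real (mollified_box \<sigma> a b x)))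
        = abs_L2 (fourier_integral (\<lambda>x. complex_of_real (mollified_box \<sigma> a b x)))"
      using G mollified_box_schwartz[OF \<sigma> ne] by blast
    then show "abs_L2 (\<lambda>x. complex_of_real (mollified_box \<sigma> a b x)) \<in> {u. G u = fourier_ext u}"
      using fourier_ext_abs[OF square_integrable_mollified_box[OF \<sigma>, of a b]] by simp
  qed
  then show "G = fourier_ext" by auto
qed

definition ifourier :: "'n::finite L2 \<Rightarrow> 'n L2" where
  "ifourier u = (1 / plancherel_const TYPE('n)) *\<^sub>R fourier_conj u"

lemma bounded_clinear_fourier: "bounded_clinear_L2 fourier_L2"
  by (simp add: fourier_L2_eq bounded_clinear_fourier_ext)

lemma bounded_clinear_ifourier: "bounded_clinear_L2 ifourier"
  unfolding ifourier_def[abs_def] by (rule bounded_clinear_scaleR[OF bounded_clinear_fourier_conj])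

lemma plancherel_const_ne: "plancherel_const TYPE('n::finite) \<noteq> 0"
  using plancherel_const_pos[where 'n = 'n] by linarith

lemma ifourier_fourier [simp]: "ifourier (fourier_L2 u) = (u :: 'n::finite L2)"
  by (simp add: ifourier_def fourier_L2_eq fourier_conj_fourier_ext plancherel_const_ne)

lemma fourier_ifourier [simp]: "fourier_L2 (ifourier u) = (u :: 'n::finite L2)"
  unfolding ifourier_def fourier_L2_eq bounded_clinear_simps[OF bounded_clinear_fourier_ext]
  by (simp add: fourier_ext_fourier_conj plancherel_const_ne)

text \<open>Both the transform and the conjugate transform increase norms at most by \<open>(2\<pi>)\<^sup>n\<^sup>/\<^sup>2\<close>, and their
  composition multiplies norms by exactly \<open>(2\<pi>)\<^sup>n\<close>; so there is equality at each step.\<close>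

theorem norm_fourier_L2: "norm (fourier_L2 u) = sqrt (plancherel_const TYPE('n)) * norm (u :: 'n::finite L2)"
proof (rule antisym)
  show "norm (fourier_L2 u) \<le> sqrt (plancherel_const TYPE('n)) * norm u"
    unfolding fourier_L2_eq by (rule norm_fourier_ext_le)
  have "plancherel_const TYPE('n) * norm u = norm (fourier_conj (fourier_ext u))"
    by (simp add: fourier_conj_fourier_ext less_imp_le)
  also have "\<dots> \<le> sqrt (plancherel_const TYPE('n)) * norm (fourier_ext u)"
    using norm_fourier_ext_le[of "cnj_L2 (fourier_ext u)"] by (simp add: fourier_conj_def norm_cnj_L2)
  finally have "sqrt (plancherel_const TYPE('n)) * (sqrt (plancherel_const TYPE('n)) * norm u)
      \<le> sqrt (plancherel_const TYPE('n)) * norm (fourier_ext u)"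
    by (simp add: mult.assoc[symmetric] less_imp_le)
  then show "sqrt (plancherel_const TYPE('n)) * norm u \<le> norm (fourier_L2 u)"
    by (simp add: fourier_L2_eq)
qed

lemma inner_fourier_L2:
  "inner (fourier_L2 u) (fourier_L2 v) = plancherel_const TYPE('n) * inner u (v :: 'n::finite L2)"
proof -
  have sq: "(norm (fourier_L2 w))\<^sup>2 = plancherel_const TYPE('n) * (norm w)\<^sup>2" for w :: "'n L2"
    by (simp add: norm_fourier_L2 power_mult_distrib less_imp_le)
  have pol: "inner x y = ((norm (x + y))\<^sup>2 - (norm x)\<^sup>2 - (norm y)\<^sup>2) / 2" for x y :: "'n L2"
    by (simp add: power2_norm_eq_inner inner_add_left inner_add_right inner_commute)
  show ?thesis
    unfolding pol[of "fourier_L2 u"] pol[of u]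
    unfolding bounded_clinear_simps(1)[OF bounded_clinear_fourier, symmetric] sq
    by (simp add: algebra_simps diff_divide_distrib add_divide_distrib)
qed

lemma ifourier_abs:
  fixes g :: "real^'n::finite \<Rightarrow> complex"
  assumes "square_integrable g" "integrable lborel g" "g \<in> borel_measurable borel"
  defines "U \<equiv> \<lambda>x. of_real (1 / plancherel_const TYPE('n)) * (LINT \<xi>|lborel. exp (\<i> * of_real (x \<bullet> \<xi>)) * g \<xi>)"
  shows "square_integrable U" "ifourier (abs_L2 g) = abs_L2 U"
  unfolding U_def ifourier_def scaleR_scaleC_L2 fourier_conj_abs(2)[OF assms(1-3)]
  using fourier_conj_abs(1)[OF assms(1-3)] by (rule square_integrable_cmult, simp add: abs_L2_scaleC)


section \<open>A Remez inequality along rays\<close>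

lemma nn_integral_lborel_affine:
  fixes f :: "'a::euclidean_space \<Rightarrow> ennreal"
  assumes [measurable]: "f \<in> borel_measurable borel" and "c \<noteq> 0"
  shows "(\<integral>\<^sup>+x. f x \<partial>lborel) = ennreal (\<bar>c\<bar> ^ DIM('a)) * (\<integral>\<^sup>+x. f (t + c *\<^sub>R x) \<partial>lborel)"
  by (subst lborel_affine[OF assms(2), of t])
     (simp add: nn_integral_density nn_integral_distr nn_integral_cmult)

text \<open>Greedy choice: after a point close to the infimum of \<open>A\<close>, discarding everything up to distance \<open>\<eta>\<close> costs
  little more than \<open>\<eta>\<close> of measure.\<close>

lemma separated_points:
  fixes A :: "real set" and k :: nat
  assumes "A \<in> sets borel" "A \<subseteq> {0..1}" "\<eta> > 0" "measure lborel A > real k * \<eta>"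
  shows "\<exists>x::nat \<Rightarrow> real. (\<forall>i\<le>k. x i \<in> A) \<and> (\<forall>i<k. x (Suc i) \<ge> x i + \<eta>)"
  using assms
proof (induction k arbitrary: A)
  case 0
  then have "A \<noteq> {}" by auto
  then obtain a where "a \<in> A" by auto
  then show ?case by (intro exI[of _ "\<lambda>_. a"]) auto
next
  case (Suc k)
  define P where "P = real (Suc k) * \<eta>"
  define s where "s = (measure lborel A - P) / 2"
  have s: "s > 0" using Suc.prems(4) by (simp add: s_def P_def)
  have ne: "A \<noteq> {}"
  proof
    assume "A = {}"
    then have "real (Suc k) * \<eta> < 0" using Suc.prems(4) by (simp del: of_nat_Suc)
    moreover have "0 \<le> real (Suc k) * \<eta>" using Suc.prems(3) by (intro mult_nonneg_nonneg) auto
    ultimately show False by linarith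
  qed
  have bb: "bdd_below A" using Suc.prems by (intro bdd_belowI[of _ 0]) auto
  obtain x0 where x0: "x0 \<in> A" "x0 < Inf A + s"
    using cInf_lessD[OF ne, of "Inf A + s"] s by auto
  define A' where "A' = A \<inter> {x0 + \<eta>..}"
  have A': "A' \<in> sets borel" "A' \<subseteq> {0..1}" using Suc.prems by (auto simp: A'_def)
  have sub: "A \<subseteq> {Inf A..x0 + \<eta>} \<union> A'"
    using cInf_lower[OF _ bb] by (auto simp: A'_def)
  have fm: "B \<in> fmeasurable lborel" if "B \<in> sets borel" "B \<subseteq> {0..1}" for B :: "real set"
    by (rule fmeasurableI2[of "{0..1}"]) (use that in \<open>auto simp: fmeasurable_def\<close>)
  have icc: "{Inf A..x0 + \<eta>} \<in> fmeasurable lborel" using fmeasurable_cbox[of "Inf A" "x0 + \<eta>"] by simp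
  have "measure lborel A \<le> measure lborel ({Inf A..x0 + \<eta>} \<union> A')"
    using Suc.prems A' fm icc by (intro measure_mono_fmeasurable sub) (auto intro: fmeasurable.Un)
  also have "\<dots> \<le> measure lborel {Inf A..x0 + \<eta>} + measure lborel A'"
    using A' by (intro measure_Un_le) auto
  also have "measure lborel {Inf A..x0 + \<eta>} \<le> \<eta> + s"
    using x0 cInf_lower[OF x0(1) bb] Suc.prems(3) by simp
  finally have "measure lborel A' \<ge> measure lborel A - \<eta> - s" by linarith
  moreover have "measure lborel A - \<eta> - s > real k * \<eta>"
  proof -
    have "measure lborel A = P + 2 * s" by (simp add: s_def diff_divide_distrib)
    moreover have "P = real k * \<eta> + \<eta>" by (simp add: P_def algebra_simps)
    ultimately show ?thesis using s by linarith
  qed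
  ultimately have "measure lborel A' > real k * \<eta>" by linarith
  from Suc.IH[OF A' Suc.prems(3) this] obtain x
    where x: "\<And>i. i \<le> k \<Longrightarrow> x i \<in> A'" "\<And>i. i < k \<Longrightarrow> x (Suc i) \<ge> x i + \<eta>" by blast
  show ?case
  proof (rule exI[of _ "case_nat x0 x"], intro conjI allI impI)
    fix i assume "i \<le> Suc k"
    then show "case_nat x0 x i \<in> A" using x(1) x0(1) by (cases i) (auto simp: A'_def)
  next
    fix i assume "i < Suc k"
    then show "case_nat x0 x (Suc i) \<ge> case_nat x0 x i + \<eta>"
      using x(1)[of 0] x(2) by (cases i) (auto simp: A'_def)
  qed
qed

lemma separated_diff:
  fixes x :: "nat \<Rightarrow> real"
  assumes "\<And>i. i < k \<Longrightarrow> x (Suc i) \<ge> x i + \<eta>" "i \<le> j" "j \<le> k"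
  shows "x j - x i \<ge> real (j - i) * \<eta>"
  using assms(2,3)
proof (induction j rule: dec_induct)
  case (step j)
  then have "x (Suc j) \<ge> x j + \<eta>" "x j - x i \<ge> real (j - i) * \<eta>" using assms(1)[of j] by auto
  moreover have "real (Suc j - i) = real (j - i) + 1" using step by (simp add: Suc_diff_le)
  ultimately show ?case by (simp add: algebra_simps)
qed simp

lemma prod_dist_nat:
  assumes "i \<le> k"
  shows "(\<Prod>j\<in>{..k} - {i}. \<bar>real i - real j\<bar>) = fact i * fact (k - i)"
  using assms
proof (induction k rule: dec_induct)
  case base
  have "{..i} - {i} = {..<i}" by auto
  then have "(\<Prod>j\<in>{..i} - {i}. \<bar>real i - real j\<bar>) = (\<Prod>j<i. real (Suc (i - Suc j)))"
    by (intro prod.cong) (auto simp: of_nat_diff)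
  also have "\<dots> = (\<Prod>j<i. real (Suc j))" by (rule prod.nat_diff_reindex)
  also have "\<dots> = fact i" by (simp add: fact_prod_Suc atLeast0LessThan)
  finally show ?case by simp
next
  case (step k)
  have "{..Suc k} - {i} = insert (Suc k) ({..k} - {i})" using step by auto
  then have "(\<Prod>j\<in>{..Suc k} - {i}. \<bar>real i - real j\<bar>) = \<bar>real i - real (Suc k)\<bar> * (fact i * fact (k - i))"
    using step by (simp add: step.IH)
  also have "\<bar>real i - real (Suc k)\<bar> = real (Suc (k - i))" using step by (simp add: of_nat_diff)
  finally show ?case using step by (simp add: Suc_diff_le)
qed

lemma power_div_fact_le_exp:
  fixes x :: real assumes "0 \<le> x" shows "x ^ n / fact n \<le> exp x"
proof -
  have "(\<Sum>i\<in>{n}. x ^ i /\<^sub>R fact i) \<le> (\<Sum>i. x ^ i /\<^sub>R fact i)"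
    using assms exp_converges[of x] by (intro sum_le_suminf) (auto simp: sums_iff)
  then show ?thesis using exp_converges[of x] by (simp add: sums_iff divide_inverse mult.commute)
qed

lemma Lagrange_at_zero:
  fixes x :: "nat \<Rightarrow> complex" and q :: "complex poly"
  assumes inj: "inj_on x {..k}" and deg: "degree q \<le> k"
  shows "poly q 0 = (\<Sum>i\<le>k. poly q (x i) * (\<Prod>j\<in>{..k} - {i}. (- x j) / (x i - x j)))"
proof -
  define l where "l i = (\<Prod>j\<in>{..k} - {i}. smult (1 / (x i - x j)) [:- x j, 1:])" for i
  define p where "p = (\<Sum>i\<le>k. smult (poly q (x i)) (l i))"
  have dl: "degree (l i) \<le> k" if "i \<le> k" for i
  proof -
    have "degree (l i) \<le> (\<Sum>j\<in>{..k} - {i}. degree (smult (1 / (x i - x j)) [:- x j, 1:]))"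
      unfolding l_def using degree_prod_sum_le[of "{..k} - {i}" "\<lambda>j. smult (1 / (x i - x j)) [:- x j, 1:]"] by (simp add: o_def)
    also have "\<dots> \<le> (\<Sum>j\<in>{..k} - {i}. 1)"
      by (intro sum_mono order.trans[OF degree_smult_le]) simp
    also have "\<dots> = k" using that by simp
    finally show ?thesis .
  qed
  have ln: "poly (l i) z = (\<Prod>j\<in>{..k} - {i}. (z - x j) / (x i - x j))" for i z
    by (simp add: l_def poly_prod diff_divide_distrib)
  have lx: "poly (l i) (x m) = (if i = m then 1 else 0)" if "i \<le> k" "m \<le> k" for i m
  proof (cases "i = m")
    case True
    have "(\<Prod>j\<in>{..k} - {i}. (x i - x j) / (x i - x j)) = (\<Prod>j\<in>{..k} - {i}. 1)"
      using inj that by (intro prod.cong) (auto simp: inj_on_def)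
    then show ?thesis using True by (simp add: ln)
  next
    case False
    then have "m \<in> {..k} - {i}" using that by auto
    then have "(\<Prod>j\<in>{..k} - {i}. (x m - x j) / (x i - x j)) = 0"
      by (intro prod_zero) (auto intro!: bexI[of _ m])
    then show ?thesis using False by (simp add: ln)
  qed
  have pq: "p = q"
  proof (rule poly_eqI_degree[of "x ` {..k}"])
    fix z assume "z \<in> x ` {..k}"
    then obtain m where m: "m \<le> k" "z = x m" by auto
    have "poly p z = (\<Sum>i\<le>k. poly q (x i) * (if i = m then 1 else 0))"
      unfolding p_def poly_sum using m by (intro sum.cong) (auto simp: lx)
    also have "\<dots> = (\<Sum>i\<le>k. if i = m then poly q (x m) else 0)" by (intro sum.cong) auto
    also have "\<dots> = poly q z" using m by simp
    finally show "poly p z = poly q z" .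
  next
    have "degree p \<le> k"
      unfolding p_def by (intro degree_sum_le order.trans[OF degree_smult_le dl]) auto
    then show "degree p < card (x ` {..k})" by (simp add: card_image[OF inj])
    show "degree q < card (x ` {..k})" using deg by (simp add: card_image[OF inj])
  qed
  have "poly q 0 = poly p 0" by (simp add: pq)
  also have "\<dots> = (\<Sum>i\<le>k. poly q (x i) * (\<Prod>j\<in>{..k} - {i}. (- x j) / (x i - x j)))"
    by (simp add: p_def poly_sum ln)
  finally show ?thesis .
qed

text \<open>Interpolate at \<open>k + 1\<close> points of \<open>A\<close> with mutual distances at least \<open>\<delta>/(k+1)\<close>. The Lagrange coefficient of
  the \<open>i\<close>-th point at \<open>0\<close> is at most \<open>((k+1)/\<delta>)\<^sup>k / (i!(k-i)!)\<close>, and the sum of these is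
  \<open>((k+1)/\<delta>)\<^sup>k 2\<^sup>k/k!\<close>, which grows only exponentially in \<open>k\<close> because \<open>(k+1)\<^sup>k/k! \<le> e\<^sup>k\<^sup>+\<^sup>1\<close>.\<close>

theorem Remez_at_zero:
  fixes a :: "nat \<Rightarrow> complex"
  assumes A: "A \<in> sets borel" "A \<subseteq> {0..1}" and d: "0 < \<delta>" "\<delta> \<le> measure lborel A"
    and B: "\<And>t. t \<in> A \<Longrightarrow> norm (\<Sum>m\<le>k. a m * of_real t ^ m) \<le> B"
  shows "norm (a 0) \<le> (2 * exp 1 / \<delta>) ^ Suc k * B"
proof -
  define \<eta> where "\<eta> = \<delta> / real (Suc k)"
  have \<eta>: "\<eta> > 0" using d by (simp add: \<eta>_def)
  have "real k * \<eta> < \<delta>" using d by (simp add: \<eta>_def field_simps)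
  then have "measure lborel A > real k * \<eta>" using d by simp
  from separated_points[OF A \<eta> this] obtain x
    where x: "\<And>i. i \<le> k \<Longrightarrow> x i \<in> A" "\<And>i. i < k \<Longrightarrow> x (Suc i) \<ge> x i + \<eta>" by blast
  have sep: "\<bar>x i - x j\<bar> \<ge> \<bar>real i - real j\<bar> * \<eta>" if "i \<le> k" "j \<le> k" for i j
    using separated_diff[of k x \<eta> i j, OF x(2)] separated_diff[of k x \<eta> j i, OF x(2)] that
    by (cases "i \<le> j") (auto simp: of_nat_diff abs_if)
  have x01: "0 \<le> x i" "x i \<le> 1" if "i \<le> k" for i using x(1)[OF that] A by auto
  have inj: "inj_on (\<lambda>i. complex_of_real (x i)) {..k}"
  proof (rule inj_onI)
    fix i j assume ij: "i \<in> {..k}" "j \<in> {..k}" "complex_of_real (x i) = complex_of_real (x j)"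
    then have "\<bar>real i - real j\<bar> * \<eta> \<le> 0" using sep[of i j] by simp
    then show "i = j" using \<eta> by (auto simp: mult_le_0_iff)
  qed
  define q where "q = (\<Sum>m\<le>k. monom (a m) m)"
  have dq: "degree q \<le> k"
    unfolding q_def by (intro degree_sum_le order.trans[OF degree_monom_le]) auto
  have pq: "poly q z = (\<Sum>m\<le>k. a m * z ^ m)" for z by (simp add: q_def poly_sum poly_monom)
  have q0: "poly q 0 = a 0"
  proof -
    have "(\<Sum>m\<le>k. a m * 0 ^ m) = (\<Sum>m\<le>k. if m = 0 then a 0 else 0)"
      by (intro sum.cong) auto
    then show ?thesis by (simp add: pq)
  qed
  have B0: "0 \<le> B" using B[OF x(1)[of 0]] norm_ge_zero order.trans by blast
  have d1: "\<delta> \<le> 1"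
  proof -
    have "measure lborel A \<le> measure lborel {0..1::real}"
      using A fmeasurable_cbox[of "0::real" 1] by (intro measure_mono_fmeasurable) auto
    then show ?thesis using d by simp
  qed
  have lag: "norm (\<Prod>j\<in>{..k} - {i}. (- complex_of_real (x j)) / (complex_of_real (x i) - complex_of_real (x j)))
      \<le> (1 / \<eta>) ^ k * (real (k choose i) / fact k)" if "i \<le> k" for i
  proof -
    have "norm (\<Prod>j\<in>{..k} - {i}. (- complex_of_real (x j)) / (complex_of_real (x i) - complex_of_real (x j)))
        = (\<Prod>j\<in>{..k} - {i}. \<bar>x j\<bar> / \<bar>x i - x j\<bar>)"
      unfolding prod_norm[symmetric]
      by (intro prod.cong) (auto simp: norm_divide simp flip: of_real_diff)
    also have "\<dots> \<le> (\<Prod>j\<in>{..k} - {i}. 1 / (\<bar>real i - real j\<bar> * \<eta>))"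
    proof (intro prod_mono conjI frac_le)
      fix j assume j: "j \<in> {..k} - {i}"
      then show "\<bar>x j\<bar> \<le> 1" using x01[of j] by auto
      show "0 < \<bar>real i - real j\<bar> * \<eta>" using j \<eta> by auto
      show "\<bar>real i - real j\<bar> * \<eta> \<le> \<bar>x i - x j\<bar>" using sep[OF that, of j] j by auto
    qed auto
    also have "\<dots> = (\<Prod>j\<in>{..k} - {i}. (1 / \<eta>) * (1 / \<bar>real i - real j\<bar>))"
      by (intro prod.cong) auto
    also have "\<dots> = (1 / \<eta>) ^ k * (1 / (\<Prod>j\<in>{..k} - {i}. \<bar>real i - real j\<bar>))"
      using that by (simp add: prod.distrib prod_dividef power_one_over)
    also have "\<dots> = (1 / \<eta>) ^ k * (real (k choose i) / fact k)"
      using that by (simp add: prod_dist_nat binomial_fact)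
    finally show ?thesis .
  qed
  have "norm (a 0) = norm (\<Sum>i\<le>k. poly q (of_real (x i)) *
      (\<Prod>j\<in>{..k} - {i}. (- complex_of_real (x j)) / (complex_of_real (x i) - complex_of_real (x j))))"
    using Lagrange_at_zero[OF inj dq] q0 by simp
  also have "\<dots> \<le> (\<Sum>i\<le>k. B * ((1 / \<eta>) ^ k * (real (k choose i) / fact k)))"
  proof (rule sum_norm_le)
    fix i assume "i \<in> {..k}"
    then have i: "i \<le> k" by simp
    show "norm (poly q (of_real (x i)) *
      (\<Prod>j\<in>{..k} - {i}. (- complex_of_real (x j)) / (complex_of_real (x i) - complex_of_real (x j))))
      \<le> B * ((1 / \<eta>) ^ k * (real (k choose i) / fact k))"
      unfolding norm_mult using B[OF x(1)[OF i]] lag[OF i] B0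
      by (intro mult_mono) (auto simp: pq)
  qed
  also have "\<dots> = B * ((1 / \<eta>) ^ k * (real (\<Sum>i\<le>k. k choose i) / fact k))"
    by (simp add: sum_distrib_left sum_divide_distrib of_nat_sum)
  also have "\<dots> = B * ((2 / \<delta>) ^ k * (real (Suc k) ^ k / fact k))"
    by (simp add: choose_row_sum \<eta>_def power_mult_distrib power_divide)
  also have "\<dots> \<le> B * ((2 / \<delta>) ^ Suc k * exp (real (Suc k)))"
  proof (intro mult_left_mono[OF _ B0] mult_mono power_div_fact_le_exp)
    show "(2 / \<delta>) ^ k \<le> (2 / \<delta>) ^ Suc k" using d d1 by (intro power_increasing) auto
  qed (use d in auto)
  also have "exp (real (Suc k)) = exp 1 ^ Suc k"
    using exp_of_nat_mult[of "Suc k" "1::real"] by simp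
  also have "B * ((2 / \<delta>) ^ Suc k * exp 1 ^ Suc k) = (2 * exp 1 / \<delta>) ^ Suc k * B"
    by (simp only: power_mult_distrib[symmetric]) (simp add: mult.commute)
  finally show ?thesis .
qed

subsection \<open>Rays that spend much time in a given set\<close>

lemma Bernoulli_power:
  fixes h :: real assumes "0 \<le> h" "h \<le> 1" shows "1 - real n * h \<le> (1 - h) ^ n"
  using Bernoulli_inequality[of "- h" n] assms by simp

lemma scaled_cube:
  assumes "0 < t"
  shows "t *\<^sub>R y \<in> cbox 0 (\<chi> i. t * L) \<longleftrightarrow> y \<in> cbox 0 ((\<chi> i. L) :: real^'n::finite)"
  using assms by (auto simp: mem_box_cart zero_le_mult_iff)

lemma measure_cube: "0 \<le> L \<Longrightarrow> measure lborel (cbox 0 ((\<chi> i. L) :: real^'n::finite)) = L ^ CARD('n)"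
  by (subst content_cbox_cart) (auto simp: interval_ne_empty_cart)

lemma emeasure_cube: "0 \<le> L \<Longrightarrow> emeasure lborel (cbox 0 ((\<chi> i. L) :: real^'n::finite)) = ennreal (L ^ CARD('n))"
  using measure_cube[of L, where 'n = 'n] emeasure_eq_ennreal_measure[of lborel "cbox 0 ((\<chi> i. L) :: real^'n)"]
    emeasure_lborel_cbox_finite[of 0 "(\<chi> i. L) :: real^'n"] by simp

text \<open>Compare two evaluations of the integral of the indicator of \<open>t y \<in> E\<close> over \<open>y\<close> in the cube and \<open>t \<in> [0, 1]\<close>.
  For \<open>t\<close> close to \<open>1\<close> the contracted cube \<open>t Q\<close> still contains a part of \<open>E\<close> of measure \<open>\<theta>/2 L\<^sup>n\<close>, so the integral is not small; hence
  some segment from \<open>0\<close> to \<open>y\<close> spends a long time in \<open>E\<close>.\<close>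

lemma long_ray:
  fixes E :: "(real^'n::finite) set"
  assumes L: "0 < L" and \<theta>: "0 < \<theta>" "\<theta> \<le> 1"
    and E[measurable]: "E \<in> sets borel" and EQ: "E \<subseteq> cbox 0 (\<chi> i. L)"
    and mE: "measure lborel E \<ge> \<theta> * L ^ CARD('n)"
  shows "\<exists>y. measure lborel {t\<in>{0..1}. t *\<^sub>R y \<in> E} \<ge> \<theta>\<^sup>2 / (8 * CARD('n))"
proof (rule ccontr)
  define Q where "Q = cbox 0 ((\<chi> i. L) :: real^'n)"
  define n where "n = CARD('n)"
  have n: "n \<ge> 1" by (simp add: n_def Suc_leI)
  define \<delta> where "\<delta> = \<theta>\<^sup>2 / (8 * real n)"
  \<comment> \<open>For \<open>t > 1 - h\<close> the set \<open>Q - t Q\<close> has at most the fraction \<open>n h = \<theta>/2\<close> of the measure of \<open>Q\<close>.\<close>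
  define h where "h = \<theta> / (2 * real n)"
  have h: "0 < h" "h \<le> 1" using \<theta> n by (auto simp: h_def field_simps)
  assume "\<not> ?thesis"
  then have lt: "measure lborel {t\<in>{0..1}. t *\<^sub>R y \<in> E} < \<delta>" for y
    by (auto simp: \<delta>_def n_def not_le)
  have meas[measurable]: "{t\<in>{0..1}. t *\<^sub>R y \<in> E} \<in> sets borel" for y :: "real^'n" by measurable
  have Q[measurable]: "Q \<in> sets borel" by (simp add: Q_def)
  have em: "emeasure lborel {t\<in>{0..1}. t *\<^sub>R y \<in> E} \<le> ennreal \<delta>" for y
  proof -
    have "emeasure lborel {t\<in>{0..1}. t *\<^sub>R y \<in> E} \<le> emeasure lborel {0..1::real}"
      by (intro emeasure_mono) auto
    then have "emeasure lborel {t\<in>{0..1}. t *\<^sub>R y \<in> E} < \<infinity>"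
      by (rule le_less_trans) simp
    then have "emeasure lborel {t\<in>{0..1}. t *\<^sub>R y \<in> E} = ennreal (measure lborel {t\<in>{0..1}. t *\<^sub>R y \<in> E})"
      by (intro emeasure_eq_ennreal_measure) auto
    then show ?thesis using lt[of y] by (simp add: ennreal_leI)
  qed
  let ?f = "\<lambda>y t. indicator Q y * (indicator {0..1} t * indicator E (t *\<^sub>R y)) :: ennreal"
  have up: "(\<integral>\<^sup>+y. \<integral>\<^sup>+t. ?f y t \<partial>lborel \<partial>lborel) \<le> ennreal (\<delta> * L ^ n)"
  proof -
    have "(\<integral>\<^sup>+t. ?f y t \<partial>lborel) \<le> indicator Q y * ennreal \<delta>" for y
    proof -
      have "(\<integral>\<^sup>+t. ?f y t \<partial>lborel) = indicator Q y * (\<integral>\<^sup>+t. indicator {t\<in>{0..1}. t *\<^sub>R y \<in> E} t \<partial>lborel)"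
        by (subst nn_integral_cmult[symmetric]) (auto intro!: nn_integral_cong simp: indicator_def)
      also have "(\<integral>\<^sup>+t. indicator {t\<in>{0..1}. t *\<^sub>R y \<in> E} t \<partial>lborel) = emeasure lborel {t\<in>{0..1}. t *\<^sub>R y \<in> E}"
        by (rule nn_integral_indicator) (use meas in simp)
      also have "indicator Q y * \<dots> \<le> indicator Q y * ennreal \<delta>" by (intro mult_left_mono em) simp
      finally show ?thesis .
    qed
    then have "(\<integral>\<^sup>+y. \<integral>\<^sup>+t. ?f y t \<partial>lborel \<partial>lborel) \<le> (\<integral>\<^sup>+y. indicator Q y * ennreal \<delta> \<partial>lborel)"
      by (intro nn_integral_mono)
    also have "\<dots> = ennreal (L ^ n) * ennreal \<delta>"
      using emeasure_cube[of L, where 'n = 'n] L by (simp add: nn_integral_multc Q_def n_def)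
    finally show ?thesis using L by (simp add: ennreal_mult' mult.commute \<delta>_def flip: ennreal_mult)
  qed
  have inner: "(\<integral>\<^sup>+y. ?f y t \<partial>lborel) \<ge> ennreal (\<theta> / 2 * L ^ n)" if t: "t \<in> {1 - h<..1}" for t
  proof -
    have t0: "0 < t" "t \<le> 1" using t h by auto
    define tQ where "tQ = cbox 0 ((\<chi> i. t * L) :: real^'n)"
    have tQQ: "tQ \<subseteq> Q"
    proof
      fix x assume x: "x \<in> tQ"
      have "t * L \<le> L" using t0 L by (simp add: mult_left_le_one_le)
      then show "x \<in> Q" using x by (auto simp: tQ_def Q_def mem_box_cart intro: order.trans)
    qed
    have [measurable]: "tQ \<in> sets borel" by (simp add: tQ_def)
    have fmE: "E \<in> fmeasurable lborel"
      by (rule fmeasurableI2[OF fmeasurable_cbox EQ]) simp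
    have mtQ: "measure lborel tQ = t ^ n * L ^ n"
      using measure_cube[of "t * L", where 'n = 'n] t0 L by (simp add: tQ_def n_def power_mult_distrib)
    have mQ: "measure lborel Q = L ^ n" using measure_cube[of L, where 'n = 'n] L by (simp add: Q_def n_def)
    have fmQ: "Q \<in> fmeasurable lborel" "tQ \<in> fmeasurable lborel" by (auto simp: Q_def tQ_def)
    have "measure lborel E \<le> measure lborel ((E \<inter> tQ) \<union> (Q - tQ))"
      using EQ fmE fmQ by (intro measure_mono_fmeasurable) (auto simp: Q_def[symmetric] intro!: fmeasurable.Un fmeasurable_Int_fmeasurable fmeasurable.Diff)
    also have "\<dots> \<le> measure lborel (E \<inter> tQ) + measure lborel (Q - tQ)"
      by (intro measure_Un_le) auto
    also have "measure lborel (Q - tQ) = L ^ n - t ^ n * L ^ n"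
      using measurable_measure_Diff[OF fmQ(1) _ tQQ] mQ mtQ by simp
    finally have 1: "measure lborel (E \<inter> tQ) \<ge> \<theta> * L ^ n - (1 - t ^ n) * L ^ n"
      using mE by (simp add: n_def algebra_simps)
    have "1 - \<theta> / 2 = 1 - real n * h" using n by (simp add: h_def)
    also have "\<dots> \<le> (1 - h) ^ n" by (rule Bernoulli_power) (use h in auto)
    also have "\<dots> \<le> t ^ n" using t h by (intro power_mono) auto
    finally have "(1 - t ^ n) * L ^ n \<le> (\<theta> / 2) * L ^ n" using L by (intro mult_right_mono) auto
    with 1 have 2: "measure lborel (E \<inter> tQ) \<ge> \<theta> / 2 * L ^ n" by (simp add: algebra_simps)
    have "ennreal (\<theta> / 2 * L ^ n) \<le> emeasure lborel (E \<inter> tQ)"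
      using 2 fmE fmQ by (subst emeasure_eq_measure2) (auto intro!: ennreal_leI fmeasurable_Int_fmeasurable)
    also have "\<dots> = (\<integral>\<^sup>+x. indicator (E \<inter> tQ) x \<partial>lborel)" by simp
    also have "\<dots> = ennreal (t ^ n) * (\<integral>\<^sup>+y. indicator (E \<inter> tQ) (t *\<^sub>R y) \<partial>lborel)"
      using t0 nn_integral_lborel_affine[of "indicator (E \<inter> tQ)" t 0] by (simp add: n_def)
    also have "\<dots> \<le> 1 * (\<integral>\<^sup>+y. indicator (E \<inter> tQ) (t *\<^sub>R y) \<partial>lborel)"
      using t0 by (intro mult_right_mono) (auto simp: power_le_one)
    also have "(\<integral>\<^sup>+y. indicator (E \<inter> tQ) (t *\<^sub>R y) \<partial>lborel) = (\<integral>\<^sup>+y. ?f y t \<partial>lborel)"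
      using t0 scaled_cube[OF t0(1), of _ L, where 'n = 'n]
      by (intro nn_integral_cong) (auto simp: indicator_def tQ_def Q_def)
    finally show ?thesis by simp
  qed
  have "ennreal (h * (\<theta> / 2 * L ^ n)) = (\<integral>\<^sup>+t. ennreal (\<theta> / 2 * L ^ n) * indicator {1 - h<..1} t \<partial>lborel)"
  proof -
    have "(\<integral>\<^sup>+t. ennreal (\<theta> / 2 * L ^ n) * indicator {1 - h<..1} t \<partial>lborel)
        = ennreal (\<theta> / 2 * L ^ n) * emeasure lborel {1 - h<..1}"
      by (rule nn_integral_cmult_indicator) simp
    also have "emeasure lborel {1 - h<..1} = ennreal h" using h by simp
    also have "ennreal (\<theta> / 2 * L ^ n) * ennreal h = ennreal (\<theta> / 2 * L ^ n * h)"
      using h \<theta> L by (intro ennreal_mult[symmetric]) auto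
    finally show ?thesis by (simp add: mult_ac)
  qed
  also have "\<dots> \<le> (\<integral>\<^sup>+t. \<integral>\<^sup>+y. ?f y t \<partial>lborel \<partial>lborel)"
    by (intro nn_integral_mono) (use inner in \<open>auto simp: indicator_def\<close>)
  also have "\<dots> = (\<integral>\<^sup>+y. \<integral>\<^sup>+t. ?f y t \<partial>lborel \<partial>lborel)"
    by (rule lborel_pair.Fubini') measurable
  also note up
  finally have "h * (\<theta> / 2 * L ^ n) \<le> \<delta> * L ^ n"
    using \<theta> L by (simp add: ennreal_le_iff \<delta>_def)
  then have "h * (\<theta> / 2) \<le> \<delta>" using L by simp
  then have "\<theta> * \<theta> \<le> 0" using n by (simp add: h_def \<delta>_def field_simps power2_eq_square)
  then show False using mult_pos_pos[OF \<theta>(1) \<theta>(1)] by linarith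
qed

text \<open>Remez' inequality bounds a value by a supremum over a set. By Markov's inequality the supremum may be
  replaced with a mean square, which, unlike a supremum, can be integrated over the position of the cube.\<close>

lemma ray_polynomial_bound:
  fixes p :: "real^'n::finite \<Rightarrow> complex" and a :: "nat \<Rightarrow> real^'n \<Rightarrow> complex"
  assumes L: "0 < L" and \<gamma>: "0 < \<gamma>" "\<gamma> \<le> 1"
    and E[measurable]: "E \<in> sets borel" and EQ: "E \<subseteq> cbox 0 (\<chi> i. L)"
    and mE: "measure lborel E \<ge> \<gamma> * L ^ CARD('n)"
    and p[measurable]: "p \<in> borel_measurable borel"
    and pa: "\<And>t y. p (t *\<^sub>R y) = (\<Sum>m\<le>k. a m y * of_real t ^ m)"
  defines "\<delta> \<equiv> \<gamma>\<^sup>2 / (32 * CARD('n))"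
  shows "ennreal ((norm (p 0))\<^sup>2) \<le> ennreal (2 * ((2 * exp 1 / \<delta>) ^ Suc k)\<^sup>2 / (\<gamma> * L ^ CARD('n)))
    * (\<integral>\<^sup>+y. ennreal ((norm (p y))\<^sup>2) * indicator E y \<partial>lborel)"
proof -
  define V where "V = \<gamma> * L ^ CARD('n)"
  have V: "V > 0" using L \<gamma> by (simp add: V_def)
  define M where "M = (2 * exp 1 / \<delta>) ^ Suc k"
  have M: "M > 0" using \<gamma> by (simp add: M_def \<delta>_def)
  define I where "I = (\<integral>\<^sup>+y. ennreal ((norm (p y))\<^sup>2) * indicator E y \<partial>lborel)"
  have fmE: "E \<in> fmeasurable lborel"
    by (rule fmeasurableI2[OF fmeasurable_cbox EQ]) simp
  have key: "(norm (p 0))\<^sup>2 \<le> M\<^sup>2 * K" if K: "K > 0" "I \<le> ennreal (K * (V / 2))" for K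
  proof -
    \<comment> \<open>By Markov's inequality \<open>|p|\<^sup>2 \<le> K\<close> on at least half of \<open>E\<close>; Remez' inequality is applied on a segment
      that meets this half for a long time.\<close>
    define E' where "E' = {y\<in>E. (norm (p y))\<^sup>2 \<le> K}"
    have E'[measurable]: "E' \<in> sets borel" unfolding E'_def by measurable
    have "emeasure lborel {y\<in>E. 1 \<le> ennreal (1/K) * ennreal ((norm (p y))\<^sup>2)} \<le> ennreal (1/K) * I"
      unfolding I_def by (rule nn_integral_Markov_inequality) measurable
    also have "\<dots> \<le> ennreal (1/K) * ennreal (K * (V / 2))" by (intro mult_left_mono K) simp
    also have "\<dots> = ennreal (V / 2)" using K V by (simp flip: ennreal_mult)
    finally have *: "emeasure lborel {y\<in>E. 1 \<le> ennreal (1/K) * ennreal ((norm (p y))\<^sup>2)} \<le> ennreal (V / 2)" .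
    have "E - E' \<subseteq> {y\<in>E. 1 \<le> ennreal (1/K) * ennreal ((norm (p y))\<^sup>2)}"
      using K by (auto simp: E'_def field_simps simp flip: ennreal_mult ennreal_1)
    then have "emeasure lborel (E - E') \<le> ennreal (V / 2)"
      by (rule order.trans[OF emeasure_mono *]) measurable
    moreover have fmD: "E - E' \<in> fmeasurable lborel" "E' \<in> fmeasurable lborel"
      using fmE by (auto intro!: fmeasurable.Diff fmeasurableI2[OF fmE] simp: E'_def)
    ultimately have "measure lborel (E - E') \<le> V / 2"
      using V by (simp add: emeasure_eq_measure2 ennreal_le_iff)
    moreover have "measure lborel (E - E') = measure lborel E - measure lborel E'"
      by (rule measurable_measure_Diff[OF fmE]) (auto simp: E'_def)
    ultimately have mE': "measure lborel E' \<ge> (\<gamma> / 2) * L ^ CARD('n)"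
      using mE by (simp add: V_def)
    have d\<delta>: "(\<gamma> / 2)\<^sup>2 / (8 * CARD('n)) = \<delta>" by (simp add: \<delta>_def power_divide)
    have "E' \<subseteq> cbox 0 (\<chi> i. L)" using EQ by (auto simp: E'_def)
    from long_ray[OF L _ _ E' this mE'] \<gamma> obtain y where
      y: "measure lborel {t\<in>{0..1}. t *\<^sub>R y \<in> E'} \<ge> \<delta>" unfolding d\<delta> by auto
    have "norm (a 0 y) \<le> (2 * exp 1 / \<delta>) ^ Suc k * sqrt K"
    proof (rule Remez_at_zero[OF _ _ _ y])
      show "{t\<in>{0..1}. t *\<^sub>R y \<in> E'} \<in> sets borel" by measurable
      show "0 < \<delta>" using \<gamma> by (simp add: \<delta>_def)
      fix t assume "t \<in> {t\<in>{0..1}. t *\<^sub>R y \<in> E'}"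
      then have "(norm (p (t *\<^sub>R y)))\<^sup>2 \<le> K" by (simp add: E'_def)
      then show "norm (\<Sum>m\<le>k. a m y * of_real t ^ m) \<le> sqrt K"
        unfolding pa by (rule real_le_rsqrt)
    qed auto
    moreover have "p 0 = a 0 y"
    proof -
      have "p 0 = (\<Sum>m\<le>k. a m y * of_real 0 ^ m)" using pa[of 0 y] by simp
      also have "\<dots> = (\<Sum>m\<le>k. if m = 0 then a 0 y else 0)" by (intro sum.cong) auto
      finally show ?thesis by simp
    qed
    ultimately have "norm (p 0) \<le> M * sqrt K" by (simp add: M_def)
    then have "(norm (p 0))\<^sup>2 \<le> (M * sqrt K)\<^sup>2" by (intro power_mono) auto
    then show ?thesis using K by (simp add: power_mult_distrib)
  qed
  have goal: "ennreal ((norm (p 0))\<^sup>2) \<le> ennreal (2 * M\<^sup>2 / V) * I"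
  proof (cases "I = \<infinity>")
    case True
    then show ?thesis using M V by (simp add: ennreal_mult_top)
  next
    case False
    then obtain J where J: "0 \<le> J" "I = ennreal J" by (metis ennreal_cases infinity_ennreal_def)
    have "(norm (p 0))\<^sup>2 \<le> 2 * M\<^sup>2 / V * J"
    proof (rule field_le_epsilon)
      fix e :: real assume e: "e > 0"
      define K where "K = 2 * J / V + e / M\<^sup>2"
      have "K > 0" using J V e M by (auto simp: K_def intro!: add_nonneg_pos)
      moreover have "I \<le> ennreal (K * (V / 2))"
        unfolding J(2) using V e M by (intro ennreal_leI) (simp add: K_def field_simps)
      ultimately have "(norm (p 0))\<^sup>2 \<le> M\<^sup>2 * K" by (rule key)
      also have "\<dots> = 2 * M\<^sup>2 / V * J + e" using M V by (simp add: K_def field_simps)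
      finally show "(norm (p 0))\<^sup>2 \<le> 2 * M\<^sup>2 / V * J + e" .
    qed
    then show ?thesis unfolding J(2) using J V by (simp add: ennreal_leI flip: ennreal_mult)
  qed
  then show ?thesis by (simp add: M_def V_def I_def)
qed


section \<open>The Logvinenko--Sereda inequality\<close>

lemma norm_ifourier: "norm (ifourier u) = norm (u :: 'n::finite L2) / sqrt (plancherel_const TYPE('n))"
  using norm_fourier_L2[of "ifourier u"] plancherel_const_ne[where 'n = 'n] by (simp add: field_simps)

lemma nn_integral_abs_L2_lborel:
  assumes sq: "square_integrable f" and [measurable]: "f \<in> borel_measurable borel"
  shows "(\<integral>\<^sup>+x. ennreal ((norm (f x))\<^sup>2) \<partial>lborel) = ennreal ((norm (abs_L2 f))\<^sup>2)"
proof -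
  have "(\<integral>\<^sup>+x. ennreal ((norm (f x))\<^sup>2) \<partial>lborel) = (\<integral>\<^sup>+x. ennreal ((norm (f x))\<^sup>2) \<partial>lebesgue)"
    by (rule nn_integral_completion[symmetric])
  then show ?thesis using nn_integral_abs_L2[OF sq] by simp
qed

text \<open>The inverse transform as an integral: the band-limited function with spectral density \<open>g\<close>.\<close>

definition synth :: "(real^'n::finite \<Rightarrow> complex) \<Rightarrow> real^'n \<Rightarrow> complex" where
  "synth g x = of_real (1 / plancherel_const TYPE('n)) * (LINT \<xi>|lborel. exp (\<i> * of_real (x \<bullet> \<xi>)) * g \<xi>)"

lemma synth_measurable [measurable]:
  assumes [measurable]: "g \<in> borel_measurable borel"
  shows "synth g \<in> borel_measurable borel"
  unfolding synth_def by measurable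

lemma synth_L2:
  assumes "square_integrable g" "integrable lborel g" "g \<in> borel_measurable borel"
  shows "square_integrable (synth g)" "ifourier (abs_L2 g) = abs_L2 (synth g)"
  using ifourier_abs[OF assms] unfolding synth_def[abs_def] by simp_all

lemma integrable_phase:
  fixes g :: "real^'n::finite \<Rightarrow> complex"
  assumes g: "integrable lborel g" and [measurable]: "h \<in> borel_measurable borel"
    and bd: "\<And>\<xi>. norm (h \<xi>) \<le> c * norm (g \<xi>)"
  shows "integrable lborel h" "integrable lborel (\<lambda>\<xi>. exp (\<i> * of_real (x \<bullet> \<xi>)) * h \<xi>)"
proof -
  have i: "integrable lborel (\<lambda>\<xi>. c * norm (g \<xi>))" using g by simp
  show "integrable lborel h"
    by (rule Bochner_Integration.integrable_bound[OF i]) (auto intro!: AE_I2 order.trans[OF bd])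
  show "integrable lborel (\<lambda>\<xi>. exp (\<i> * of_real (x \<bullet> \<xi>)) * h \<xi>)"
    by (rule Bochner_Integration.integrable_bound[OF i]) (auto intro!: AE_I2 order.trans[OF bd] simp: norm_mult)
qed

text \<open>Taylor polynomial in \<open>y\<close> of \<open>synth g (z + y)\<close>.\<close>

definition taylor_sum :: "nat \<Rightarrow> real \<Rightarrow> complex" where
  "taylor_sum k s = (\<Sum>m\<le>k. (\<i> * of_real s) ^ m / fact m)"

definition taylor_synth :: "nat \<Rightarrow> (real^'n::finite \<Rightarrow> complex) \<Rightarrow> real^'n \<Rightarrow> real^'n \<Rightarrow> complex" where
  "taylor_synth k g z y = synth (\<lambda>\<xi>. taylor_sum k (y \<bullet> \<xi>) * g \<xi>) z"

lemma taylor_sum_measurable [measurable]: "taylor_sum k \<in> borel_measurable borel"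
  unfolding taylor_sum_def by measurable

lemma taylor_synth_measurable [measurable]:
  assumes [measurable]: "g \<in> borel_measurable borel"
  shows "(\<lambda>(z, y). taylor_synth k g z y) \<in> borel_measurable (borel \<Otimes>\<^sub>M borel)"
  unfolding taylor_synth_def synth_def by measurable

lemma inner_support_bound:
  assumes supp: "\<And>\<xi>. norm \<xi> > R \<Longrightarrow> g \<xi> = 0"
  shows "norm (g \<xi>) * \<bar>y \<bullet> \<xi>\<bar> ^ m \<le> norm (g \<xi>) * (norm y * R) ^ m"
proof (cases "norm \<xi> > R")
  case False
  have "\<bar>y \<bullet> \<xi>\<bar> \<le> norm y * norm \<xi>" by (rule Cauchy_Schwarz_ineq2)
  also have "\<dots> \<le> norm y * R" using False by (intro mult_left_mono) auto
  finally show ?thesis by (intro mult_left_mono power_mono) auto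
qed (simp add: supp)

lemma taylor_synth_ray:
  fixes g :: "real^'n::finite \<Rightarrow> complex"
  assumes g: "integrable lborel g" and [measurable]: "g \<in> borel_measurable borel"
    and supp: "\<And>\<xi>. norm \<xi> > R \<Longrightarrow> g \<xi> = 0"
  shows "taylor_synth k g z (t *\<^sub>R y)
    = (\<Sum>m\<le>k. synth (\<lambda>\<xi>. (\<i> * of_real (y \<bullet> \<xi>)) ^ m / fact m * g \<xi>) z * of_real t ^ m)"
proof -
  let ?h = "\<lambda>m \<xi>. (\<i> * of_real (y \<bullet> \<xi>)) ^ m / fact m * g \<xi>"
  have int: "integrable lborel (\<lambda>\<xi>. exp (\<i> * of_real (z \<bullet> \<xi>)) * ?h m \<xi>)" for m
  proof (rule integrable_phase(2)[OF g])
    show "norm (?h m \<xi>) \<le> ((norm y * R) ^ m / fact m) * norm (g \<xi>)" for \<xi>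
      using inner_support_bound[of R g \<xi> y m, OF supp]
      by (simp add: norm_mult norm_divide norm_power divide_simps mult.commute)
  qed measurable
  have "(LINT \<xi>|lborel. exp (\<i> * of_real (z \<bullet> \<xi>)) * (taylor_sum k ((t *\<^sub>R y) \<bullet> \<xi>) * g \<xi>))
      = (LINT \<xi>|lborel. (\<Sum>m\<le>k. of_real t ^ m * (exp (\<i> * of_real (z \<bullet> \<xi>)) * ?h m \<xi>)))"
    by (intro Bochner_Integration.integral_cong refl)
       (simp add: taylor_sum_def sum_distrib_left sum_distrib_right power_mult_distrib mult_ac)
  also have "\<dots> = (\<Sum>m\<le>k. of_real t ^ m * (LINT \<xi>|lborel. exp (\<i> * of_real (z \<bullet> \<xi>)) * ?h m \<xi>))"
  proof (subst Bochner_Integration.integral_sum)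
    show "integrable lborel (\<lambda>\<xi>. of_real t ^ m * (exp (\<i> * of_real (z \<bullet> \<xi>)) * ?h m \<xi>))" for m
      by (intro integrable_mult_right int)
  qed (simp only: integral_mult_right_zero)
  finally show ?thesis
    by (simp add: taylor_synth_def synth_def sum_distrib_left mult_ac)
qed

lemma taylor_synth_zero: "taylor_synth k g z 0 = synth g z"
proof -
  have "taylor_sum k 0 = 1"
  proof -
    have "taylor_sum k 0 = (\<Sum>m\<le>k. if m = 0 then 1 else 0)"
      unfolding taylor_sum_def by (intro sum.cong) auto
    then show ?thesis by simp
  qed
  then show ?thesis by (simp add: taylor_synth_def)
qed

text \<open>For fixed \<open>y\<close> the remainder is a function of \<open>z\<close> whose spectral density is \<open>g\<close> times the Taylor remainder of
  \<open>s \<mapsto> e\<^sup>i\<^sup>s\<close> at \<open>s = y\<cdot>\<xi>\<close>, and \<open>|y\<cdot>\<xi>| \<le> l R\<close> on the support of \<open>g\<close>. Plancherel's theorem in \<open>z\<close> thus replaces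
  pointwise Bernstein estimates.\<close>

lemma taylor_remainder_L2:
  fixes g :: "real^'n::finite \<Rightarrow> complex" and k :: nat
  assumes g: "integrable lborel g" and gm[measurable]: "g \<in> borel_measurable borel"
    and sq: "square_integrable g"
    and supp: "\<And>\<xi>. norm \<xi> > R \<Longrightarrow> g \<xi> = 0" and R: "0 \<le> R" and y: "norm y \<le> l"
  defines "\<eta> \<equiv> (l * R) ^ Suc k / fact (Suc k)"
  shows "(\<integral>\<^sup>+z. ennreal ((norm (synth g (z + y) - taylor_synth k g z y))\<^sup>2) \<partial>lborel)
    \<le> ennreal ((\<eta> * norm (abs_L2 (synth g)))\<^sup>2)"
proof -
  let ?\<rho> = "\<lambda>\<xi>. exp (\<i> * of_real (y \<bullet> \<xi>)) - taylor_sum k (y \<bullet> \<xi>)"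
  let ?h = "\<lambda>\<xi>. ?\<rho> \<xi> * g \<xi>"
  have l0: "0 \<le> l" using y norm_ge_zero order.trans by blast
  have \<eta>0: "0 \<le> \<eta>" using l0 R by (simp add: \<eta>_def)
  have bd: "norm (?h \<xi>) \<le> \<eta> * norm (g \<xi>)" for \<xi>
  proof -
    have "norm (?\<rho> \<xi>) \<le> \<bar>y \<bullet> \<xi>\<bar> ^ Suc k / fact (Suc k)"
      using iexp_approx1[of "y \<bullet> \<xi>" k] by (simp add: taylor_sum_def)
    then have "norm (?h \<xi>) \<le> (\<bar>y \<bullet> \<xi>\<bar> ^ Suc k / fact (Suc k)) * norm (g \<xi>)"
      unfolding norm_mult by (rule mult_right_mono) simp
    also have "\<dots> = norm (g \<xi>) * \<bar>y \<bullet> \<xi>\<bar> ^ Suc k / fact (Suc k)" by simp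
    also have "\<dots> \<le> norm (g \<xi>) * (norm y * R) ^ Suc k / fact (Suc k)"
      by (intro divide_right_mono inner_support_bound[OF supp]) auto
    also have "\<dots> \<le> norm (g \<xi>) * (l * R) ^ Suc k / fact (Suc k)"
      using y R by (intro divide_right_mono mult_left_mono power_mono mult_right_mono) auto
    finally show ?thesis by (simp add: \<eta>_def mult.commute)
  qed
  have hm[measurable]: "?h \<in> borel_measurable borel" by measurable
  have ih: "integrable lborel ?h" by (rule integrable_phase(1)[OF g hm bd])
  have hl: "?h \<in> borel_measurable lebesgue" using measurable_completion[of ?h lborel borel] hm by simp
  have bd': "AE \<xi> in lebesgue. norm (?h \<xi>) \<le> norm (of_real \<eta> * g \<xi>)"
    using bd \<eta>0 by (intro AE_I2) (simp add: norm_mult)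
  have sqe: "square_integrable (\<lambda>\<xi>. of_real \<eta> * g \<xi>)" by (rule square_integrable_cmult[OF sq])
  have sh: "square_integrable ?h" by (rule square_integrable_bound[OF sqe hl bd'])
  have nh: "norm (abs_L2 ?h) \<le> \<eta> * norm (abs_L2 g)"
    using norm_abs_L2_mono[OF sqe hl bd'] abs_L2_scaleC[OF sq, of "of_real \<eta>", symmetric] \<eta>0
    by (simp add: norm_scaleC_L2)
  have tay: "integrable lborel (\<lambda>\<xi>. exp (\<i> * of_real (z \<bullet> \<xi>)) * (taylor_sum k (y \<bullet> \<xi>) * g \<xi>))" for z
  proof (rule integrable_phase(2)[OF g])
    fix \<xi>
    have "norm (taylor_sum k (y \<bullet> \<xi>) * g \<xi>) = norm (exp (\<i> * of_real (y \<bullet> \<xi>)) * g \<xi> - ?h \<xi>)"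
      by (simp add: algebra_simps)
    also have "\<dots> \<le> norm (exp (\<i> * of_real (y \<bullet> \<xi>)) * g \<xi>) + norm (?h \<xi>)" by (rule norm_triangle_ineq4)
    also have "\<dots> \<le> (1 + \<eta>) * norm (g \<xi>)" using bd[of \<xi>] by (simp add: norm_mult distrib_right)
    finally show "norm (taylor_sum k (y \<bullet> \<xi>) * g \<xi>) \<le> (1 + \<eta>) * norm (g \<xi>)" .
  qed measurable
  have ig: "integrable lborel (\<lambda>\<xi>. exp (\<i> * of_real ((z + y) \<bullet> \<xi>)) * g \<xi>)" for z
    by (rule integrable_phase(2)[OF g gm, of 1]) simp
  have r: "synth g (z + y) - taylor_synth k g z y = synth ?h z" for z
  proof -
    have "(LINT \<xi>|lborel. exp (\<i> * of_real ((z + y) \<bullet> \<xi>)) * g \<xi>)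
        - (LINT \<xi>|lborel. exp (\<i> * of_real (z \<bullet> \<xi>)) * (taylor_sum k (y \<bullet> \<xi>) * g \<xi>))
        = (LINT \<xi>|lborel. exp (\<i> * of_real ((z + y) \<bullet> \<xi>)) * g \<xi>
          - exp (\<i> * of_real (z \<bullet> \<xi>)) * (taylor_sum k (y \<bullet> \<xi>) * g \<xi>))"
      by (rule Bochner_Integration.integral_diff[symmetric, OF ig tay])
    also have "\<dots> = (LINT \<xi>|lborel. exp (\<i> * of_real (z \<bullet> \<xi>)) * ?h \<xi>)"
      by (intro Bochner_Integration.integral_cong refl)
         (simp add: inner_add_left distrib_left exp_add algebra_simps)
    finally show ?thesis
      unfolding synth_def taylor_synth_def right_diff_distrib[symmetric] by (rule arg_cong)
  qed
  have "(\<integral>\<^sup>+z. ennreal ((norm (synth g (z + y) - taylor_synth k g z y))\<^sup>2) \<partial>lborel)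
      = ennreal ((norm (abs_L2 (synth ?h)))\<^sup>2)"
    unfolding r by (rule nn_integral_abs_L2_lborel) (use synth_L2(1)[OF sh ih hm] in measurable)
  also have "norm (abs_L2 (synth ?h)) = norm (abs_L2 ?h) / sqrt (plancherel_const TYPE('n))"
    using synth_L2(2)[OF sh ih hm] norm_ifourier[of "abs_L2 ?h"] by simp
  also have "ennreal ((norm (abs_L2 ?h) / sqrt (plancherel_const TYPE('n)))\<^sup>2)
      \<le> ennreal ((\<eta> * norm (abs_L2 g) / sqrt (plancherel_const TYPE('n)))\<^sup>2)"
    by (intro ennreal_leI power_mono divide_right_mono nh) (auto simp: less_imp_le)
  also have "\<eta> * norm (abs_L2 g) / sqrt (plancherel_const TYPE('n)) = \<eta> * norm (abs_L2 (synth g))"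
    using synth_L2(2)[OF sq g gm] norm_ifourier[of "abs_L2 g"] by simp
  finally show ?thesis .
qed

lemma emeasure_cube_translate:
  fixes \<omega> :: "(real^'n::finite) set"
  assumes [measurable]: "\<omega> \<in> sets borel" "Q \<in> sets borel"
  shows "emeasure lborel {y\<in>Q. z + y \<in> \<omega>} = emeasure lborel (\<omega> \<inter> (+) z ` Q)"
proof -
  have im: "(+) z ` Q = (\<lambda>x. x - z) -` Q" by (auto simp: image_iff intro!: bexI[of _ "_ - z"])
  have [measurable]: "(+) z ` Q \<in> sets borel"
    unfolding im using measurable_sets_borel[of "\<lambda>x. x - z" borel Q] assms by measurable
  have "emeasure lborel (\<omega> \<inter> (+) z ` Q) = (\<integral>\<^sup>+x. indicator (\<omega> \<inter> (+) z ` Q) x \<partial>lborel)" by simp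
  also have "\<dots> = (\<integral>\<^sup>+x. indicator (\<omega> \<inter> (+) z ` Q) (x + z) \<partial>lborel)"
    by (rule nn_integral_lborel_translate[symmetric]) measurable
  also have "\<dots> = (\<integral>\<^sup>+x. indicator {y\<in>Q. z + y \<in> \<omega>} x \<partial>lborel)"
    by (intro nn_integral_cong) (auto simp: indicator_def im add.commute)
  finally show ?thesis by simp
qed

text \<open>For every base point \<open>z\<close> the value at \<open>z\<close> is bounded by the mean square of the Taylor polynomial over the
  part of the cube \<open>z + Q\<close> that lies in \<open>\<omega>\<close>. Replacing the polynomial by the function and integrating over
  \<open>z\<close> gives the mass of the function on \<open>\<omega>\<close> and the remainder term. The average over all cubes, instead of a
  sum over the cubes of a tiling, is what makes Plancherel's theorem applicable to the remainder.\<close>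

lemma spectral_inequality_with_remainder:
  fixes g :: "real^'n::finite \<Rightarrow> complex" and \<omega> :: "(real^'n) set" and k :: nat
    and R L \<gamma> :: real
  assumes g: "integrable lborel g" and gm[measurable]: "g \<in> borel_measurable borel"
    and sq: "square_integrable g"
    and supp: "\<And>\<xi>. norm \<xi> > R \<Longrightarrow> g \<xi> = 0" and R: "0 \<le> R"
    and L: "0 < L" and \<gamma>: "0 < \<gamma>" "\<gamma> \<le> 1" and \<omega>[measurable]: "\<omega> \<in> sets borel"
    and thick: "\<And>z. measure lborel (\<omega> \<inter> (+) z ` cbox 0 (\<chi> i. L)) \<ge> \<gamma> * L ^ CARD('n)"
  defines "\<eta> \<equiv> (CARD('n) * L * R) ^ Suc k / fact (Suc k)"
  defines "M \<equiv> (2 * exp 1 / (\<gamma>\<^sup>2 / (32 * CARD('n)))) ^ Suc k"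
  defines "u \<equiv> abs_L2 (synth g)"
  shows "(norm u)\<^sup>2 \<le> 4 * M\<^sup>2 / \<gamma> * ((norm (indicator_L2 \<omega> u))\<^sup>2 + \<eta>\<^sup>2 * (norm u)\<^sup>2)"
proof -
  define Q where "Q = cbox 0 ((\<chi> i. L) :: real^'n)"
  have [measurable]: "Q \<in> sets borel" by (simp add: Q_def)
  define V where "V = L ^ CARD('n)"
  have V: "V > 0" using L by (simp add: V_def)
  have eQ: "emeasure lborel Q = ennreal V" using emeasure_cube[of L] L by (simp add: Q_def V_def)
  define C0 where "C0 = 2 * M\<^sup>2 / (\<gamma> * V)"
  have C0: "C0 \<ge> 0" using \<gamma> V by (simp add: C0_def)
  let ?U = "synth g" and ?p = "taylor_synth k g"
  define E where "E z = {y\<in>Q. z + y \<in> \<omega>}" for z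
  have Em[measurable]: "E z \<in> sets borel" for z unfolding E_def by measurable
  have mE: "measure lborel (E z) \<ge> \<gamma> * V" for z
    using thick[of z] emeasure_cube_translate[OF \<omega>, of Q z] by (simp add: E_def Q_def V_def measure_def)
  have pm: "?p z \<in> borel_measurable borel" for z
    using measurable_compose[of "\<lambda>y. (z, y)" borel "borel \<Otimes>\<^sub>M borel" "\<lambda>(z, y). ?p z y" borel] taylor_synth_measurable[OF gm, of k]
    by simp
  have pw: "ennreal ((norm (?U z))\<^sup>2) \<le> ennreal C0 * (\<integral>\<^sup>+y. ennreal ((norm (?p z y))\<^sup>2) * indicator (E z) y \<partial>lborel)" for z
    using ray_polynomial_bound[OF L \<gamma> Em[of z] _ _ pm taylor_synth_ray[OF g gm supp]] mE[of z]
    by (simp add: taylor_synth_zero C0_def M_def V_def E_def Q_def)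
  define NU where "NU = (\<integral>\<^sup>+z. ennreal ((norm (?U z))\<^sup>2) \<partial>lborel)"
  define NW where "NW = (\<integral>\<^sup>+z. ennreal ((norm (?U z))\<^sup>2) * indicator \<omega> z \<partial>lborel)"
  have NU: "NU = ennreal ((norm u)\<^sup>2)"
    unfolding NU_def u_def by (rule nn_integral_abs_L2_lborel) (use synth_L2(1)[OF sq g gm] in measurable)
  have sqU: "square_integrable ?U" by (rule synth_L2(1)[OF sq g gm])
  have NW: "NW = ennreal ((norm (indicator_L2 \<omega> u))\<^sup>2)"
  proof -
    have \<omega>l: "\<omega> \<in> sets lebesgue" using \<omega> by simp
    have "indicator_L2 \<omega> u = abs_L2 (\<lambda>x. indicator \<omega> x * ?U x)"
      unfolding u_def indicator_L2_eq by (rule mult_L2_abs[OF bdd_symbol_indicator[OF \<omega>l] sqU])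
    moreover have "(\<integral>\<^sup>+x. ennreal ((norm (indicator \<omega> x * ?U x))\<^sup>2) \<partial>lborel) = ennreal ((norm (abs_L2 (\<lambda>x. indicator \<omega> x * ?U x)))\<^sup>2)"
      by (rule nn_integral_abs_L2_lborel) (use square_integrable_mult[OF bdd_symbol_indicator[OF \<omega>l] sqU] in measurable)
    moreover have "NW = (\<integral>\<^sup>+x. ennreal ((norm (indicator \<omega> x * ?U x))\<^sup>2) \<partial>lborel)"
      unfolding NW_def by (intro nn_integral_cong) (auto simp: indicator_def)
    ultimately show ?thesis by simp
  qed
  let ?r = "\<lambda>z y. ?U (z + y) - ?p z y"
  have [measurable]: "(\<lambda>(z, y). ?p z y) \<in> borel_measurable (borel \<Otimes>\<^sub>M borel)" by measurable
  have r2: "(norm (?p z y))\<^sup>2 \<le> 2 * (norm (?U (z + y)))\<^sup>2 + 2 * (norm (?r z y))\<^sup>2" for z y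
  proof -
    have "norm (?p z y) \<le> norm (?U (z + y)) + norm (?r z y)"
      using norm_triangle_ineq4[of "?U (z + y)" "?r z y"] by simp
    then have "(norm (?p z y))\<^sup>2 \<le> (norm (?U (z + y)) + norm (?r z y))\<^sup>2" by (intro power_mono) auto
    also have "\<dots> \<le> 2 * (norm (?U (z + y)))\<^sup>2 + 2 * (norm (?r z y))\<^sup>2"
      using sum_squares_bound[of "norm (?U (z + y))" "norm (?r z y)"] by (simp add: power2_sum)
    finally show ?thesis .
  qed
  let ?a = "\<lambda>z y. indicator Q y * (ennreal ((norm (?U (z + y)))\<^sup>2) * indicator \<omega> (z + y))"
  let ?b = "\<lambda>z y. indicator Q y * ennreal ((norm (?r z y))\<^sup>2)"
  have am: "(\<lambda>(z, y). ?a z y) \<in> borel_measurable (lborel \<Otimes>\<^sub>M lborel)"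
    and bm: "(\<lambda>(z, y). ?b z y) \<in> borel_measurable (lborel \<Otimes>\<^sub>M lborel)" by measurable
  \<comment> \<open>For fixed \<open>y\<close>, the substitution \<open>z + y \<mapsto> z\<close> turns the integral over \<open>z\<close> into the mass on \<open>\<omega>\<close>.\<close>
  have Ia: "(\<integral>\<^sup>+z. \<integral>\<^sup>+y. ?a z y \<partial>lborel \<partial>lborel) = ennreal V * NW"
  proof -
    have "(\<integral>\<^sup>+z. \<integral>\<^sup>+y. ?a z y \<partial>lborel \<partial>lborel) = (\<integral>\<^sup>+y. \<integral>\<^sup>+z. ?a z y \<partial>lborel \<partial>lborel)"
      by (rule lborel_pair.Fubini'[symmetric]) (use am in measurable)
    also have "\<dots> = (\<integral>\<^sup>+y. indicator Q y * NW \<partial>lborel)"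
    proof (rule nn_integral_cong)
      fix y
      have "(\<integral>\<^sup>+z. ?a z y \<partial>lborel) = indicator Q y * (\<integral>\<^sup>+z. ennreal ((norm (?U (z + y)))\<^sup>2) * indicator \<omega> (z + y) \<partial>lborel)"
        by (rule nn_integral_cmult) measurable
      also have "(\<integral>\<^sup>+z. ennreal ((norm (?U (z + y)))\<^sup>2) * indicator \<omega> (z + y) \<partial>lborel) = NW"
        unfolding NW_def
        by (rule nn_integral_lborel_translate[of "\<lambda>z. ennreal ((norm (?U z))\<^sup>2) * indicator \<omega> z"]) measurable
      finally show "(\<integral>\<^sup>+z. ?a z y \<partial>lborel) = indicator Q y * NW" .
    qed
    also have "\<dots> = ennreal V * NW" by (simp add: nn_integral_multc eQ)
    finally show ?thesis .
  qed
  have Ib: "(\<integral>\<^sup>+z. \<integral>\<^sup>+y. ?b z y \<partial>lborel \<partial>lborel) \<le> ennreal V * ennreal ((\<eta> * norm u)\<^sup>2)"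
  proof -
    have "(\<integral>\<^sup>+z. \<integral>\<^sup>+y. ?b z y \<partial>lborel \<partial>lborel) = (\<integral>\<^sup>+y. \<integral>\<^sup>+z. ?b z y \<partial>lborel \<partial>lborel)"
      by (rule lborel_pair.Fubini'[symmetric]) (use bm in measurable)
    also have "\<dots> \<le> (\<integral>\<^sup>+y. indicator Q y * ennreal ((\<eta> * norm u)\<^sup>2) \<partial>lborel)"
    proof (rule nn_integral_mono)
      fix y
      have "(\<integral>\<^sup>+z. ?b z y \<partial>lborel) = indicator Q y * (\<integral>\<^sup>+z. ennreal ((norm (?r z y))\<^sup>2) \<partial>lborel)"
        by (rule nn_integral_cmult) measurable
      also have "\<dots> \<le> indicator Q y * ennreal ((\<eta> * norm u)\<^sup>2)"
      proof (cases "y \<in> Q")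
        case True
        have "norm y \<le> (\<Sum>i\<in>UNIV. \<bar>y $ i\<bar>)" by (rule norm_le_l1_cart)
        also have "\<dots> \<le> (\<Sum>i\<in>(UNIV::'n set). L)"
          using True by (intro sum_mono) (auto simp: Q_def mem_box_cart)
        also have "\<dots> = CARD('n) * L" by simp
        finally have "norm y \<le> CARD('n) * L" .
        from taylor_remainder_L2[OF g gm sq supp R this, of k] True
        show ?thesis by (simp add: \<eta>_def u_def)
      qed simp
      finally show "(\<integral>\<^sup>+z. ?b z y \<partial>lborel) \<le> indicator Q y * ennreal ((\<eta> * norm u)\<^sup>2)" .
    qed
    also have "\<dots> = ennreal V * ennreal ((\<eta> * norm u)\<^sup>2)" by (simp add: nn_integral_multc eQ)
    finally show ?thesis .
  qed
  have "NU \<le> (\<integral>\<^sup>+z. ennreal C0 * (\<integral>\<^sup>+y. 2 * ?a z y + 2 * ?b z y \<partial>lborel) \<partial>lborel)"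
    unfolding NU_def
  proof (rule nn_integral_mono)
    fix z
    have "(\<integral>\<^sup>+y. ennreal ((norm (?p z y))\<^sup>2) * indicator (E z) y \<partial>lborel) \<le> (\<integral>\<^sup>+y. 2 * ?a z y + 2 * ?b z y \<partial>lborel)"
    proof (rule nn_integral_mono)
      fix y
      show "ennreal ((norm (?p z y))\<^sup>2) * indicator (E z) y \<le> 2 * ?a z y + 2 * ?b z y"
      proof (cases "y \<in> E z")
        case True
        then have "y \<in> Q" "z + y \<in> \<omega>" by (auto simp: E_def)
        moreover have "ennreal ((norm (?p z y))\<^sup>2) \<le> ennreal (2 * (norm (?U (z + y)))\<^sup>2 + 2 * (norm (?r z y))\<^sup>2)"
          by (rule ennreal_leI[OF r2])
        moreover have "\<dots> = 2 * ennreal ((norm (?U (z + y)))\<^sup>2) + 2 * ennreal ((norm (?r z y))\<^sup>2)"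
          by (simp add: ennreal_plus ennreal_mult)
        ultimately show ?thesis using True by simp
      qed simp
    qed
    then have "ennreal C0 * (\<integral>\<^sup>+y. ennreal ((norm (?p z y))\<^sup>2) * indicator (E z) y \<partial>lborel)
        \<le> ennreal C0 * (\<integral>\<^sup>+y. 2 * ?a z y + 2 * ?b z y \<partial>lborel)"
      by (rule mult_left_mono) simp
    with pw[of z] show "ennreal ((norm (?U z))\<^sup>2) \<le> ennreal C0 * (\<integral>\<^sup>+y. 2 * ?a z y + 2 * ?b z y \<partial>lborel)"
      by (rule order.trans)
  qed
  also have "\<dots> = ennreal C0 * (\<integral>\<^sup>+z. \<integral>\<^sup>+y. 2 * ?a z y + 2 * ?b z y \<partial>lborel \<partial>lborel)"
    by (rule nn_integral_cmult) (use am bm in measurable)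
  also have "(\<integral>\<^sup>+z. \<integral>\<^sup>+y. 2 * ?a z y + 2 * ?b z y \<partial>lborel \<partial>lborel)
      = (\<integral>\<^sup>+z. 2 * (\<integral>\<^sup>+y. ?a z y \<partial>lborel) + 2 * (\<integral>\<^sup>+y. ?b z y \<partial>lborel) \<partial>lborel)"
    by (intro nn_integral_cong) (simp add: nn_integral_add nn_integral_cmult)
  also have "\<dots> = 2 * (\<integral>\<^sup>+z. \<integral>\<^sup>+y. ?a z y \<partial>lborel \<partial>lborel) + 2 * (\<integral>\<^sup>+z. \<integral>\<^sup>+y. ?b z y \<partial>lborel \<partial>lborel)"
    by (simp add: nn_integral_add nn_integral_cmult)
  also have "ennreal C0 * \<dots> \<le> ennreal C0 * (2 * (ennreal V * NW) + 2 * (ennreal V * ennreal ((\<eta> * norm u)\<^sup>2)))"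
    using Ib by (intro mult_left_mono add_mono) (auto simp: Ia)
  also have "\<dots> = ennreal (C0 * (2 * (V * (norm (indicator_L2 \<omega> u))\<^sup>2) + 2 * (V * (\<eta> * norm u)\<^sup>2)))"
    using C0 V unfolding NW by (simp add: ennreal_mult ennreal_plus)
  finally have "(norm u)\<^sup>2 \<le> C0 * (2 * (V * (norm (indicator_L2 \<omega> u))\<^sup>2) + 2 * (V * (\<eta> * norm u)\<^sup>2))"
    unfolding NU using C0 V by (simp add: ennreal_le_iff)
  also have "\<dots> = 4 * M\<^sup>2 / \<gamma> * ((norm (indicator_L2 \<omega> u))\<^sup>2 + \<eta>\<^sup>2 * (norm u)\<^sup>2)"
    using V \<gamma> by (simp add: C0_def field_simps power_mult_distrib)
  finally show ?thesis .
qed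

text \<open>The order \<open>k + 1 = N\<close> is chosen proportional to \<open>R\<close>: the factorial beats \<open>(A l R)\<^sup>N\<close> as soon as
  \<open>N \<ge> e\<^sup>2A l R\<close>, while \<open>A\<^sup>2\<^sup>N\<close> remains exponential in \<open>R\<close>.\<close>

lemma Taylor_order_choice:
  fixes \<gamma> A l :: real
  assumes \<gamma>: "0 < \<gamma>" "\<gamma> \<le> 1" and A: "A \<ge> 1" and l: "l \<ge> 0"
  shows "\<exists>C\<ge>1. \<forall>R\<ge>1. \<exists>k. 4 * (A ^ Suc k)\<^sup>2 / \<gamma> * ((l * R) ^ Suc k / fact (Suc k))\<^sup>2 \<le> 1 / 2 \<and>
    8 * (A ^ Suc k)\<^sup>2 / \<gamma> \<le> C * exp (C * R)"
proof -
  define \<kappa> where "\<kappa> = A * l * exp 2 + 8 / \<gamma>"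
  have \<kappa>0: "0 \<le> A * l * exp 2" "0 < 8 / \<gamma>" using A l \<gamma> by auto
  define C where "C = max (8 / \<gamma>) (2 * (\<kappa> + 1) * ln A)"
  have "8 / \<gamma> \<ge> 1" using \<gamma> by (simp add: field_simps)
  then have C1: "C \<ge> 1" by (simp add: C_def)
  show ?thesis
  proof (intro exI[of _ C] conjI allI impI C1)
    fix R :: real assume R: "R \<ge> 1"
    define N where "N = nat \<lceil>\<kappa> * R\<rceil>"
    have kR: "\<kappa> * R > 0" using \<kappa>0 R by (auto simp: \<kappa>_def intro!: mult_pos_pos add_nonneg_pos)
    have N1: "\<kappa> * R \<le> real N" "real N \<le> \<kappa> * R + 1"
      using kR by (auto simp: N_def)
    have Npos: "N > 0" using kR N1(1) by (metis le_less_trans not_less of_nat_0 of_nat_le_0_iff less_irrefl gr0I)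
    then obtain k where k: "N = Suc k" by (cases N) auto
    have Nl: "A * l * R * exp 2 \<le> real N"
    proof -
      have "A * l * R * exp 2 \<le> A * l * exp 2 * R + 8 / \<gamma> * R" using \<kappa>0 R by (simp add: mult_ac)
      also have "\<dots> = \<kappa> * R" by (simp add: \<kappa>_def distrib_right)
      finally show ?thesis using N1 by linarith
    qed
    have N8: "8 / \<gamma> \<le> real N"
    proof -
      have "8 / \<gamma> * 1 \<le> \<kappa> * R" using \<kappa>0 R by (intro mult_mono) (auto simp: \<kappa>_def)
      then show ?thesis using N1 by linarith
    qed
    have prod: "A ^ N * ((l * R) ^ N / fact N) \<le> exp (- real N)"
    proof -
      have "A ^ N * ((l * R) ^ N / fact N) = (A * l * R) ^ N / fact N"
        by (simp add: power_mult_distrib mult_ac)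
      also have "\<dots> \<le> (real N * exp (- 2)) ^ N / fact N"
      proof (intro divide_right_mono power_mono)
        have "A * l * R = A * l * R * exp 2 * exp (- 2)" by (simp add: mult.assoc exp_add[symmetric])
        also have "\<dots> \<le> real N * exp (- 2)" by (intro mult_right_mono Nl) auto
        finally show "A * l * R \<le> real N * exp (- 2)" .
      qed (use A l R in auto)
      also have "\<dots> = exp (- 2) ^ N * (real N ^ N / fact N)" by (simp add: power_mult_distrib)
      also have "\<dots> \<le> exp (- 2) ^ N * exp (real N)"
        by (intro mult_left_mono power_div_fact_le_exp) auto
      also have "\<dots> = exp (- real N)"
        by (simp add: exp_of_nat_mult[symmetric] exp_add[symmetric])
      finally show ?thesis .
    qed
    have e2: "exp (- real N) ^ 2 \<le> \<gamma> / 8"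
    proof -
      have "8 / \<gamma> \<le> exp (2 * real N)" using N8 exp_ge_add_one_self[of "2 * real N"] by linarith
      then have "1 / exp (2 * real N) \<le> \<gamma> / 8" using \<gamma> by (simp add: field_simps)
      then show ?thesis by (simp add: exp_minus power2_eq_square exp_add[symmetric] inverse_eq_divide flip: exp_of_nat_mult)
    qed
    have "4 * (A ^ N)\<^sup>2 / \<gamma> * ((l * R) ^ N / fact N)\<^sup>2 = 4 / \<gamma> * (A ^ N * ((l * R) ^ N / fact N))\<^sup>2"
      by (simp add: power_mult_distrib power_divide)
    also have "\<dots> \<le> 4 / \<gamma> * (exp (- real N))\<^sup>2"
      using \<gamma> A l R by (intro mult_left_mono power_mono prod) auto
    also have "\<dots> \<le> 4 / \<gamma> * (\<gamma> / 8)" using \<gamma> by (intro mult_left_mono e2) auto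
    also have "\<dots> = 1 / 2" using \<gamma> by simp
    finally have 1: "4 * (A ^ N)\<^sup>2 / \<gamma> * ((l * R) ^ N / fact N)\<^sup>2 \<le> 1 / 2" .
    have lnA: "0 \<le> ln A" using A by simp
    have "(A ^ N)\<^sup>2 = exp (2 * real N * ln A)"
    proof -
      have "A ^ N = exp (real N * ln A)" using A by (simp add: exp_of_nat_mult)
      then show ?thesis by (simp add: power2_eq_square exp_add[symmetric])
    qed
    also have "\<dots> \<le> exp (C * R)"
    proof -
      have "2 * real N * ln A \<le> 2 * ((\<kappa> + 1) * R) * ln A"
        using N1(2) R lnA by (intro mult_right_mono mult_left_mono) (auto simp: distrib_right)
      also have "\<dots> = 2 * (\<kappa> + 1) * ln A * R" by simp
      also have "\<dots> \<le> C * R" using R by (intro mult_right_mono) (auto simp: C_def)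
      finally show ?thesis by simp
    qed
    finally have "8 / \<gamma> * (A ^ N)\<^sup>2 \<le> C * exp (C * R)"
    proof (intro mult_mono)
      show "8 / \<gamma> \<le> C" by (simp add: C_def)
    qed (use C1 in auto)
    then have 2: "8 * (A ^ N)\<^sup>2 / \<gamma> \<le> C * exp (C * R)" by simp
    show "\<exists>k. 4 * (A ^ Suc k)\<^sup>2 / \<gamma> * ((l * R) ^ Suc k / fact (Suc k))\<^sup>2 \<le> 1 / 2 \<and>
      8 * (A ^ Suc k)\<^sup>2 / \<gamma> \<le> C * exp (C * R)"
      using 1 2 unfolding k by blast
  qed
qed

text \<open>With the Taylor order adapted to \<open>R\<close>, the remainder term is at most half of the left-hand side and is
  absorbed.\<close>

theorem Logvinenko_Sereda:
  fixes \<omega> :: "(real^'n::finite) set"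
  assumes "thick \<omega>"
  shows "\<exists>C\<ge>1. \<forall>R\<ge>1. \<forall>u :: 'n L2. (AE \<xi> in lebesgue. norm \<xi> > R \<longrightarrow> rep_L2 (fourier_L2 u) \<xi> = 0)
    \<longrightarrow> (norm u)\<^sup>2 \<le> C * exp (C * R) * (norm (indicator_L2 \<omega> u))\<^sup>2"
proof -
  obtain \<gamma> L where \<gamma>: "0 < \<gamma>" "\<gamma> < 1" and L: "0 < L" and \<omega>: "\<omega> \<in> sets lebesgue"
    and th: "\<And>x. measure lebesgue (\<omega> \<inter> (+) x ` cbox 0 (\<chi> i. L)) \<ge> \<gamma> * L ^ CARD('n)"
    using assms by (auto simp: thick_def thick_at_scale_def)
  \<comment> \<open>A Borel set of full measure in \<open>\<omega>\<close>.\<close>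
  obtain S N N' where S: "\<omega> = S \<union> N" "N \<subseteq> N'" "N' \<in> null_sets lborel" "S \<in> sets lborel"
    using sets_completionE[OF \<omega>] by metis
  have Sb: "S \<in> sets borel" using S(4) by simp
  have N'l: "N' \<in> null_sets lebesgue" using S(3) by (simp add: null_sets_completionI)
  have thS: "measure lborel (S \<inter> (+) z ` cbox 0 (\<chi> i. L)) \<ge> \<gamma> * L ^ CARD('n)" for z
  proof -
    let ?Q = "(+) z ` cbox 0 ((\<chi> i. L) :: real^'n)"
    have Q: "?Q \<in> sets borel" by (simp add: cbox_translation[symmetric])
    have "measure lebesgue (\<omega> \<inter> ?Q) = measure lebesgue (S \<inter> ?Q)"
    proof (rule measure_eq_AE)
      show "AE x in lebesgue. x \<in> \<omega> \<inter> ?Q \<longleftrightarrow> x \<in> S \<inter> ?Q"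
        using AE_not_in[OF N'l] by eventually_elim (use S(1,2) in auto)
    qed (use \<omega> Sb Q in auto)
    then show ?thesis using th[of z] Sb Q by (simp add: measure_completion)
  qed
  let ?A = "2 * exp 1 / (\<gamma>\<^sup>2 / (32 * CARD('n)))"
  have A: "?A \<ge> 1"
  proof -
    have "\<gamma>\<^sup>2 \<le> 1" using \<gamma> by (simp add: power_le_one)
    also have "1 \<le> 2 * exp 1 * (32 * real CARD('n))"
    proof -
      have "1 \<le> exp (1::real)" by simp
      moreover have "1 \<le> real CARD('n)" by (simp add: Suc_leI)
      ultimately have "1 * 1 \<le> exp 1 * real CARD('n)" by (intro mult_mono) auto
      then show ?thesis by simp
    qed
    finally show ?thesis using \<gamma> by (simp add: field_simps)
  qed
  from Taylor_order_choice[OF \<gamma>(1) less_imp_le[OF \<gamma>(2)] A, of "CARD('n) * L"] L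
  obtain C where C: "C \<ge> 1" and Ck: "\<And>R. R \<ge> 1 \<Longrightarrow> \<exists>k. 4 * (?A ^ Suc k)\<^sup>2 / \<gamma> * ((CARD('n) * L * R) ^ Suc k / fact (Suc k))\<^sup>2 \<le> 1 / 2 \<and>
    8 * (?A ^ Suc k)\<^sup>2 / \<gamma> \<le> C * exp (C * R)" by auto
  show ?thesis
  proof (intro exI[of _ C] conjI allI impI C)
    fix R :: real and u :: "'n L2"
    assume R: "R \<ge> 1" and ae: "AE \<xi> in lebesgue. norm \<xi> > R \<longrightarrow> rep_L2 (fourier_L2 u) \<xi> = 0"
    obtain k where k: "4 * (?A ^ Suc k)\<^sup>2 / \<gamma> * ((CARD('n) * L * R) ^ Suc k / fact (Suc k))\<^sup>2 \<le> 1 / 2"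
      "8 * (?A ^ Suc k)\<^sup>2 / \<gamma> \<le> C * exp (C * R)" using Ck[OF R] by blast
    obtain g0 where g0[measurable]: "g0 \<in> borel_measurable lborel"
      and g0ae: "AE x in lborel. rep_L2 (fourier_L2 u) x = g0 x"
      using Borel_version_complex[OF rep_L2_measurable] by blast
    define g where "g \<xi> = indicator (cball 0 R) \<xi> * g0 \<xi>" for \<xi> :: "real^'n"
    have gm[measurable]: "g \<in> borel_measurable borel"
      using g0 unfolding g_def by (intro borel_measurable_times borel_measurable_indicator) auto
    have gl: "g \<in> borel_measurable lebesgue" using measurable_completion[of g lborel borel] gm by simp
    have g0ae': "AE x in lebesgue. rep_L2 (fourier_L2 u) x = g0 x" using g0ae by (rule AE_completion)
    have gae: "AE x in lebesgue. g x = rep_L2 (fourier_L2 u) x"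
      using g0ae' ae by eventually_elim (auto simp: g_def indicator_def)
    have sq: "square_integrable g"
      by (rule square_integrable_bound[OF square_integrable_rep[of "fourier_L2 u"] gl])
         (use gae in eventually_elim, simp)
    have fu: "fourier_L2 u = abs_L2 g" using abs_L2_eqI'[OF sq gae] by simp
    have supp: "g \<xi> = 0" if "norm \<xi> > R" for \<xi> using that by (simp add: g_def)
    have "integrable lebesgue g"
      by (rule L1L2_bounded_support[OF sq, of "cball 0 R"])
         (use emeasure_lborel_cball_finite[of "0::real^'n" R] in \<open>auto simp: g_def\<close>)
    then have ig: "integrable lborel g" using integrable_completion[of g lborel] by simp
    have u: "u = abs_L2 (synth g)"
      using synth_L2(2)[OF sq ig gm] ifourier_fourier[of u] by (simp add: fu)
    have "(norm u)\<^sup>2 \<le> 4 * (?A ^ Suc k)\<^sup>2 / \<gamma> * ((norm (indicator_L2 S u))\<^sup>2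
        + ((CARD('n) * L * R) ^ Suc k / fact (Suc k))\<^sup>2 * (norm u)\<^sup>2)"
      unfolding u
      by (rule spectral_inequality_with_remainder[where k = k and R = R, OF ig gm sq supp _ L \<gamma>(1) less_imp_le[OF \<gamma>(2)] Sb thS])
         (use R in auto)
    also have "\<dots> = 4 * (?A ^ Suc k)\<^sup>2 / \<gamma> * (norm (indicator_L2 S u))\<^sup>2
        + (4 * (?A ^ Suc k)\<^sup>2 / \<gamma> * ((CARD('n) * L * R) ^ Suc k / fact (Suc k))\<^sup>2) * (norm u)\<^sup>2"
      by (simp only: distrib_left mult.assoc)
    also have "\<dots> \<le> 4 * (?A ^ Suc k)\<^sup>2 / \<gamma> * (norm (indicator_L2 S u))\<^sup>2 + (1 / 2) * (norm u)\<^sup>2"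
      by (intro add_left_mono mult_right_mono k) simp
    finally have "(norm u)\<^sup>2 \<le> 2 * (4 * (?A ^ Suc k)\<^sup>2 / \<gamma> * (norm (indicator_L2 S u))\<^sup>2)" by linarith
    also have "\<dots> = 8 * (?A ^ Suc k)\<^sup>2 / \<gamma> * (norm (indicator_L2 S u))\<^sup>2" by simp
    also have "\<dots> \<le> C * exp (C * R) * (norm (indicator_L2 S u))\<^sup>2" by (intro mult_right_mono k) simp
    also have "\<dots> \<le> C * exp (C * R) * (norm (indicator_L2 \<omega> u))\<^sup>2"
    proof -
      have "norm (indicator_L2 S u) \<le> norm (indicator_L2 \<omega> u)"
        unfolding indicator_L2_def
      proof (rule norm_abs_L2_mono)
        show "square_integrable (\<lambda>x. indicator \<omega> x * rep_L2 u x)"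
          by (rule square_integrable_mult[OF bdd_symbol_indicator[OF \<omega>]]) simp
        have Sl: "S \<in> sets lebesgue" using Sb by simp
        show "(\<lambda>x. indicator S x * rep_L2 u x) \<in> borel_measurable lebesgue"
          using square_integrable_mult[OF bdd_symbol_indicator[OF Sl] square_integrable_rep[of u]]
          by (simp add: square_integrable_def)
        show "AE x in lebesgue. norm (indicator S x * rep_L2 u x) \<le> norm (indicator \<omega> x * rep_L2 u x)"
          using S(1) by (intro AE_I2) (auto simp: indicator_def)
      qed
      then show ?thesis using C by (intro mult_left_mono power_mono) auto
    qed
    finally show "(norm u)\<^sup>2 \<le> C * exp (C * R) * (norm (indicator_L2 \<omega> u))\<^sup>2" .
  qed
qed


section \<open>Strongly continuous semigroups\<close>

lemma C0_semigroupD: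
  assumes "C0_semigroup S"
  shows "\<And>t. 0 \<le> t \<Longrightarrow> bounded_clinear_L2 (S t)" "S 0 u = u"
    "\<And>s t. 0 \<le> s \<Longrightarrow> 0 \<le> t \<Longrightarrow> S (s + t) u = S s (S t u)"
    "((\<lambda>t. S t u) \<longlongrightarrow> u) (at_right 0)"
  using assms by (auto simp: C0_semigroup_def)

lemma C0_semigroup_increment:
  assumes S: "C0_semigroup S" and M: "0 \<le> M"
    and bd: "\<And>r x. 0 \<le> r \<Longrightarrow> r \<le> T \<Longrightarrow> norm (S r x) \<le> M * norm x"
    and st: "0 \<le> s" "s \<le> T" "0 \<le> t" "t \<le> T"
  shows "norm (S t x - S s x) \<le> M * norm (S \<bar>t - s\<bar> x - x)"
proof -
  have *: "norm (S b x - S a x) \<le> M * norm (S (b - a) x - x)" if "0 \<le> a" "a \<le> b" "b \<le> T" for a b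
  proof -
    have "S b x = S a (S (b - a) x)" using C0_semigroupD(3)[OF S, of a "b - a" x] that by simp
    then have "S b x - S a x = S a (S (b - a) x - x)"
      using bounded_clinear_simps(2)[OF C0_semigroupD(1)[OF S that(1)]] by simp
    then show ?thesis using bd[of a "S (b - a) x - x"] that by simp
  qed
  show ?thesis
    using *[of s t] *[of t s] st by (cases "s \<le> t") (auto simp: norm_minus_commute)
qed

text \<open>Strong continuity at \<open>0\<close> and local boundedness give continuity in time, and boundedness makes it uniform
  enough to vary the vector at the same time.\<close>

lemma C0_semigroup_jointly_continuous:
  fixes S :: "real \<Rightarrow> 'n::finite L2 \<Rightarrow> 'n L2"
  assumes S: "C0_semigroup S" and M: "0 \<le> M"
    and bd: "\<And>r x. 0 \<le> r \<Longrightarrow> r \<le> T \<Longrightarrow> norm (S r x) \<le> M * norm x"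
  shows "continuous_on ({0..T} \<times> UNIV) (\<lambda>(t, x). S t x)"
  unfolding continuous_on_def
proof (intro ballI)
  fix p assume p: "p \<in> {0..T} \<times> (UNIV :: 'n L2 set)"
  obtain t0 x0 where p0: "p = (t0, x0)" "0 \<le> t0" "t0 \<le> T" using p by auto
  have lim0: "((\<lambda>r. S \<bar>r\<bar> x0 - x0) \<longlongrightarrow> 0) (at 0)"
  proof -
    have "((\<lambda>r. S r x0 - x0) \<longlongrightarrow> 0) (at_right 0)"
      using C0_semigroupD(4)[OF S, of x0] by (rule LIM_zero)
    then have 1: "((\<lambda>r. S \<bar>r\<bar> x0 - x0) \<longlongrightarrow> 0) (at_right 0)"
      by (rule Lim_transform_eventually) (auto simp: eventually_at_right_field intro!: exI[of _ 1])
    then have "((\<lambda>r. S \<bar>- r\<bar> x0 - x0) \<longlongrightarrow> 0) (at_right 0)" by simp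
    then have "((\<lambda>r. S \<bar>r\<bar> x0 - x0) \<longlongrightarrow> 0) (at_left 0)"
      by (subst filterlim_at_left_to_right) simp
    with 1 show ?thesis by (simp add: filterlim_split_at)
  qed
  have lim: "((\<lambda>q. S \<bar>fst q - t0\<bar> x0 - x0) \<longlongrightarrow> 0) (at p within {0..T} \<times> UNIV)"
  proof (rule tendsto_compose_at[of "\<lambda>q. fst q - t0" 0 _ "\<lambda>r. S \<bar>r\<bar> x0 - x0" 0, unfolded o_def])
    have "((\<lambda>q. fst q - t0) \<longlongrightarrow> fst p - t0) (at p within {0..T} \<times> UNIV)"
      by (intro tendsto_intros)
    then show "((\<lambda>q. fst q - t0) \<longlongrightarrow> 0) (at p within {0..T} \<times> UNIV)" by (simp add: p0)
    show "eventually (\<lambda>q. fst q - t0 = 0 \<longrightarrow> S \<bar>0\<bar> x0 - x0 = 0) (at p within {0..T} \<times> UNIV)"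
      by (simp add: C0_semigroupD(2)[OF S])
  qed (rule lim0)
  have dom: "((\<lambda>q. M * norm (snd q - x0) + M * norm (S \<bar>fst q - t0\<bar> x0 - x0)) \<longlongrightarrow> 0) (at p within {0..T} \<times> UNIV)"
  proof -
    have "((\<lambda>q. M * norm (snd q - x0) + M * norm (S \<bar>fst q - t0\<bar> x0 - x0)) \<longlongrightarrow> M * norm (snd p - x0) + M * norm (0 :: 'n L2)) (at p within {0..T} \<times> UNIV)"
      by (intro tendsto_intros lim)
    then show ?thesis by (simp add: p0)
  qed
  have "((\<lambda>q. (case q of (t, x) \<Rightarrow> S t x) - S t0 x0) \<longlongrightarrow> 0) (at p within {0..T} \<times> UNIV)"
  proof (rule Lim_null_comparison[OF _ dom])
    show "\<forall>\<^sub>F q in at p within {0..T} \<times> UNIV. norm ((case q of (t, x) \<Rightarrow> S t x) - S t0 x0)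
        \<le> M * norm (snd q - x0) + M * norm (S \<bar>fst q - t0\<bar> x0 - x0)"
    proof (rule eventually_at_topological[THEN iffD2], intro exI[of _ UNIV] conjI ballI impI)
      fix q assume "q \<in> {0..T} \<times> (UNIV :: 'n L2 set)"
      then obtain t x where q: "q = (t, x)" "0 \<le> t" "t \<le> T" by auto
      have eq: "S t x - S t0 x0 = S t (x - x0) + (S t x0 - S t0 x0)"
        using bounded_clinear_simps(2)[OF C0_semigroupD(1)[OF S q(2)]] by simp
      have "norm (S t x - S t0 x0) \<le> norm (S t (x - x0)) + norm (S t x0 - S t0 x0)"
        unfolding eq by (rule norm_triangle_ineq)
      also have "\<dots> \<le> M * norm (x - x0) + M * norm (S \<bar>t - t0\<bar> x0 - x0)"
        using bd q p0 by (intro add_mono C0_semigroup_increment[OF S M bd]) auto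
      finally show "norm ((case q of (t, x) \<Rightarrow> S t x) - S t0 x0)
        \<le> M * norm (snd q - x0) + M * norm (S \<bar>fst q - t0\<bar> x0 - x0)" by (simp add: q)
    qed auto
  qed
  then show "((\<lambda>(t, x). S t x) \<longlongrightarrow> (case p of (t, x) \<Rightarrow> S t x)) (at p within {0..T} \<times> UNIV)"
    unfolding p0(1) by (simp add: LIM_zero_iff case_prod_beta')
qed

lemma C0_semigroup_continuous:
  fixes S :: "real \<Rightarrow> 'n::finite L2 \<Rightarrow> 'n L2"
  assumes "C0_semigroup S" "0 \<le> M" "\<And>r x. 0 \<le> r \<Longrightarrow> r \<le> T \<Longrightarrow> norm (S r x) \<le> M * norm x"
  shows "continuous_on {0..T} (\<lambda>t. S t x)"
proof -
  have c: "continuous_on {0..T} (\<lambda>t. (t, x))" by (intro continuous_intros)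
  have "continuous_on {0..T} (\<lambda>t. (\<lambda>(t, x). S t x) (t, x))"
    by (rule continuous_on_compose2[OF C0_semigroup_jointly_continuous[OF assms(1,2)] c])
       (use assms(3) in auto)
  then show ?thesis by simp
qed

text \<open>Applying \<open>S t\<close> to the difference quotients at \<open>0\<close> gives the right derivative at \<open>t\<close>. For the left derivative
  the operator varies together with its argument, and joint continuity is used.\<close>

lemma orbit_differentiable:
  fixes S :: "real \<Rightarrow> 'n::finite L2 \<Rightarrow> 'n L2"
  assumes S: "C0_semigroup S" and M: "0 \<le> M"
    and bd: "\<And>r x. 0 \<le> r \<Longrightarrow> r \<le> T \<Longrightarrow> norm (S r x) \<le> M * norm x"
    and uv: "(u, v) \<in> generator S" and t: "0 < t" "t < T"
  shows "(S t u, S t v) \<in> generator S"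
    and "((\<lambda>t. S t u) has_vector_derivative S t v) (at t)"
proof -
  have bc: "bounded_clinear_L2 (S t)" using C0_semigroupD(1)[OF S] t by simp
  then have bl: "bounded_linear (S t)" by (simp add: bounded_clinear_L2_def)
  have q: "((\<lambda>h. (S h u - u) /\<^sub>R h) \<longlongrightarrow> v) (at_right 0)" using uv by (simp add: generator_def)
  have diffq: "S t ((S h u - u) /\<^sub>R h) = (S (t + h) u - S t u) /\<^sub>R h" "S (t + h) u = S h (S t u)"
    if "0 < h" for h
  proof -
    have "S (t + h) u = S t (S h u)" using C0_semigroupD(3)[OF S, of t h u] t that by simp
    then show "S t ((S h u - u) /\<^sub>R h) = (S (t + h) u - S t u) /\<^sub>R h"
      by (simp add: bounded_clinear_simps[OF bc])
    show "S (t + h) u = S h (S t u)"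
      using C0_semigroupD(3)[OF S, of h t u] t that by (simp add: add.commute)
  qed
  have r: "((\<lambda>h. (S (t + h) u - S t u) /\<^sub>R h) \<longlongrightarrow> S t v) (at_right 0)"
    by (rule Lim_transform_eventually[OF bounded_linear.tendsto[OF bl q]])
       (auto simp: eventually_at_right_field diffq intro!: exI[of _ 1])
  then have "((\<lambda>h. (S h (S t u) - S t u) /\<^sub>R h) \<longlongrightarrow> S t v) (at_right 0)"
    by (rule Lim_transform_eventually)
       (auto simp: eventually_at_right_field diffq intro!: exI[of _ 1])
  then show "(S t u, S t v) \<in> generator S" by (simp add: generator_def)
  have jc: "continuous_on ({0..T} \<times> UNIV) (\<lambda>(t, x). S t x)"
    by (rule C0_semigroup_jointly_continuous[OF S M bd])
  \<comment> \<open>The left derivative: \<open>(S\<^sub>t u - S\<^bsub>t-h\<^esub> u)/h = S\<^bsub>t-h\<^esub> ((S\<^sub>h u - u)/h)\<close>, and both the time and the vector converge.\<close>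
  have l: "((\<lambda>h. S (t - h) ((S h u - u) /\<^sub>R h)) \<longlongrightarrow> S t v) (at_right 0)"
  proof -
    have ev: "eventually (\<lambda>h. t - h \<in> {0..T}) (at_right 0)"
      using t by (auto simp: eventually_at_right_field intro!: exI[of _ t])
    have "((\<lambda>h. (t - h, (S h u - u) /\<^sub>R h)) \<longlongrightarrow> (t - 0, v)) (at_right 0)"
      by (intro tendsto_intros q)
    then have "((\<lambda>h. (\<lambda>(t, x). S t x) (t - h, (S h u - u) /\<^sub>R h)) \<longlongrightarrow> (\<lambda>(t, x). S t x) (t, v)) (at_right 0)"
      using t by (intro continuous_on_tendsto_compose[OF jc]) (use ev in \<open>auto elim: eventually_mono\<close>)
    then show ?thesis by simp
  qed
  have l': "((\<lambda>h. (S (t + h) u - S t u) /\<^sub>R h) \<longlongrightarrow> S t v) (at_left 0)"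
    unfolding filterlim_at_left_to_right
  proof (simp, rule Lim_transform_eventually[OF l])
    show "\<forall>\<^sub>F h in at_right 0. S (t - h) ((S h u - u) /\<^sub>R h) = - ((S (t - h) u - S t u) /\<^sub>R h)"
      unfolding eventually_at_right_field
    proof (intro exI[of _ t] conjI t allI impI)
      fix h assume h: "0 < h" "h < t"
      have "S t u = S (t - h) (S h u)" using C0_semigroupD(3)[OF S, of "t - h" h u] h by simp
      moreover have "bounded_clinear_L2 (S (t - h))" using C0_semigroupD(1)[OF S] h by simp
      ultimately show "S (t - h) ((S h u - u) /\<^sub>R h) = - ((S (t - h) u - S t u) /\<^sub>R h)"
        by (simp add: bounded_clinear_simps algebra_simps)
    qed
  qed
  have "((\<lambda>h. (S (t + h) u - S t u) /\<^sub>R h) \<longlongrightarrow> S t v) (at 0)"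
    using r l' by (simp add: filterlim_split_at)
  then show "((\<lambda>t. S t u) has_vector_derivative S t v) (at t)"
    unfolding has_vector_derivative_def has_derivative_at
  proof (intro conjI bounded_linear_scaleR_left)
    assume lim: "((\<lambda>h. (S (t + h) u - S t u) /\<^sub>R h) \<longlongrightarrow> S t v) (at 0)"
    have "((\<lambda>h. norm ((S (t + h) u - S t u) /\<^sub>R h - S t v)) \<longlongrightarrow> 0) (at 0)"
      using lim by (intro tendsto_norm_zero LIM_zero)
    then show "((\<lambda>h. norm (S (t + h) u - S t u - h *\<^sub>R S t v) / norm h) \<longlongrightarrow> 0) (at 0)"
    proof (rule Lim_transform_eventually)
      show "\<forall>\<^sub>F h in at 0. norm ((S (t + h) u - S t u) /\<^sub>R h - S t v) = norm (S (t + h) u - S t u - h *\<^sub>R S t v) / norm h"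
      proof (rule eventually_at_topological[THEN iffD2], intro exI[of _ UNIV] conjI ballI impI)
        fix h :: real assume "h \<noteq> 0"
        then have "(S (t + h) u - S t u) /\<^sub>R h - S t v = (S (t + h) u - S t u - h *\<^sub>R S t v) /\<^sub>R h"
          by (simp add: algebra_simps)
        then show "norm ((S (t + h) u - S t u) /\<^sub>R h - S t v) = norm (S (t + h) u - S t u - h *\<^sub>R S t v) / norm h"
          by (simp add: divide_inverse mult.commute)
      qed auto
    qed
  qed
qed

subsection \<open>Rescaling\<close>

lemma exp_quotient: "((\<lambda>h. (exp (c * h) - 1) / h) \<longlongrightarrow> c) (at_right (0::real))"
proof -
  have "((\<lambda>h. exp (c * h)) has_real_derivative c) (at 0)"
    by (auto intro!: derivative_eq_intros)
  then have "((\<lambda>h. (exp (c * h) - 1) / h) \<longlongrightarrow> c) (at 0)"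
    by (simp add: DERIV_def)
  then show ?thesis by (rule filterlim_mono) (auto simp: at_within_le_at)
qed

lemma C0_semigroup_rescale:
  fixes S :: "real \<Rightarrow> 'n::finite L2 \<Rightarrow> 'n L2"
  assumes S: "C0_semigroup S"
  shows "C0_semigroup (\<lambda>t u. exp (c * t) *\<^sub>R S t u)"
  unfolding C0_semigroup_def
proof (intro conjI allI impI)
  fix t :: real assume t: "0 \<le> t"
  show "bounded_clinear_L2 (\<lambda>u. exp (c * t) *\<^sub>R S t u)"
    by (rule bounded_clinear_scaleR[OF C0_semigroupD(1)[OF S t]])
next
  show "(\<lambda>u. exp (c * 0) *\<^sub>R S 0 u) = id" by (simp add: fun_eq_iff C0_semigroupD(2)[OF S])
next
  fix s t :: real assume st: "0 \<le> s" "0 \<le> t"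
  show "(\<lambda>u. exp (c * (s + t)) *\<^sub>R S (s + t) u) = (\<lambda>u. exp (c * s) *\<^sub>R S s u) \<circ> (\<lambda>u. exp (c * t) *\<^sub>R S t u)"
    using bounded_clinear_simps(5)[OF C0_semigroupD(1)[OF S st(1)]]
    by (simp add: fun_eq_iff C0_semigroupD(3)[OF S st] distrib_left exp_add)
next
  fix f :: "'n L2"
  have "((\<lambda>t. exp (c * t) *\<^sub>R S t f) \<longlongrightarrow> exp (c * 0) *\<^sub>R f) (at_right 0)"
    by (intro tendsto_intros C0_semigroupD(4)[OF S])
  then show "((\<lambda>t. exp (c * t) *\<^sub>R S t f) \<longlongrightarrow> f) (at_right 0)" by simp
qed

lemma generator_rescale_subset:
  fixes S :: "real \<Rightarrow> 'n::finite L2 \<Rightarrow> 'n L2"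
  assumes S: "C0_semigroup S" and uv: "(u, v) \<in> generator S"
  shows "(u, v + c *\<^sub>R u) \<in> generator (\<lambda>t u. exp (c * t) *\<^sub>R S t u)"
proof -
  have q: "((\<lambda>h. (S h u - u) /\<^sub>R h) \<longlongrightarrow> v) (at_right 0)" using uv by (simp add: generator_def)
  have "((\<lambda>h. exp (c * h) *\<^sub>R ((S h u - u) /\<^sub>R h) + ((exp (c * h) - 1) / h) *\<^sub>R u) \<longlongrightarrow> exp (c * 0) *\<^sub>R v + c *\<^sub>R u) (at_right 0)"
    by (intro tendsto_intros q exp_quotient)
  then have "((\<lambda>h. (exp (c * h) *\<^sub>R S h u - u) /\<^sub>R h) \<longlongrightarrow> v + c *\<^sub>R u) (at_right 0)"
    by (simp add: algebra_simps divide_inverse)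
  then show ?thesis by (simp add: generator_def)
qed

lemma generator_rescale:
  fixes S :: "real \<Rightarrow> 'n::finite L2 \<Rightarrow> 'n L2"
  assumes S: "C0_semigroup S"
  shows "generator (\<lambda>t u. exp (c * t) *\<^sub>R S t u) = {(u, v + c *\<^sub>R u) |u v. (u, v) \<in> generator S}"
proof (intro equalityI subsetI)
  fix p assume "p \<in> generator (\<lambda>t u. exp (c * t) *\<^sub>R S t u)"
  then obtain u w where p: "p = (u, w)" "(u, w) \<in> generator (\<lambda>t u. exp (c * t) *\<^sub>R S t u)" by (cases p) auto
  from generator_rescale_subset[OF C0_semigroup_rescale[OF S] p(2), of "- c"]
  have "(u, w - c *\<^sub>R u) \<in> generator S" by (simp add: exp_add[symmetric])
  then have "(u, (w - c *\<^sub>R u) + c *\<^sub>R u) \<in> {(u, v + c *\<^sub>R u) |u v. (u, v) \<in> generator S}" by blast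
  then show "p \<in> {(u, v + c *\<^sub>R u) |u v. (u, v) \<in> generator S}" by (simp add: p)
qed (use generator_rescale_subset[OF S] in auto)

subsection \<open>Bounded perturbations\<close>

text \<open>The convolution term of Duhamel's formula, written over \<open>[0, 1]\<close> so that its continuity is
  that of a parameter integral.\<close>

definition duhamel ::
  "(real \<Rightarrow> 'n::finite L2 \<Rightarrow> 'n L2) \<Rightarrow> ('n L2 \<Rightarrow> 'n L2) \<Rightarrow> (real \<Rightarrow> 'n L2) \<Rightarrow> real \<Rightarrow> 'n L2" where
  "duhamel S B g t = integral {0..1} (\<lambda>\<sigma>. S (t * \<sigma>) (B (g (t * (1 - \<sigma>)))))"

text \<open>After rescaling by an exponential, the semigroup decays at rate \<open>\<mu>\<close> and the perturbation has norm at
  most \<open>\<mu>/2\<close>. The Duhamel term is then a contraction with constant \<open>1/2\<close> on all of \<open>[0, \<infinity>)\<close>, and one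
  fixed point of the bounded continuous functions provides the perturbed orbit for all times.\<close>

context
  fixes S :: "real \<Rightarrow> 'n::finite L2 \<Rightarrow> 'n L2" and B :: "'n L2 \<Rightarrow> 'n L2" and \<mu> :: real
  assumes S: "C0_semigroup S" and \<mu>: "0 < \<mu>"
    and decay: "\<And>t x. 0 \<le> t \<Longrightarrow> norm (S t x) \<le> exp (- \<mu> * t) * norm x"
    and B: "bounded_clinear_L2 B" and Bbd: "\<And>x. norm (B x) \<le> (\<mu> / 2) * norm x"
begin

lemma contraction: "0 \<le> t \<Longrightarrow> norm (S t x) \<le> 1 * norm x"
proof -
  assume t: "0 \<le> t"
  have "norm (S t x) \<le> exp (- \<mu> * t) * norm x" by (rule decay[OF t])
  also have "\<dots> \<le> 1 * norm x" using t \<mu> by (intro mult_right_mono) auto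
  finally show ?thesis .
qed

lemma S_continuous: "continuous_on ({0..} \<times> UNIV) (\<lambda>(t, x). S t x)"
  unfolding continuous_on_eq_continuous_within
proof
  fix p :: "real \<times> 'n L2" assume p: "p \<in> {0..} \<times> UNIV"
  define T where "T = fst p + 1"
  have c: "continuous_on ({0..T} \<times> UNIV) (\<lambda>(t, x). S t x)"
    by (rule C0_semigroup_jointly_continuous[OF S, of 1]) (simp_all add: contraction[simplified])
  have "at p within {0..} \<times> UNIV = at p within {0..T} \<times> UNIV"
    by (rule at_within_nhd[of _ "{..<T} \<times> UNIV"]) (use p in \<open>auto simp: T_def open_Times\<close>)
  then show "continuous (at p within {0..} \<times> UNIV) (\<lambda>(t, x). S t x)"
    using c p by (auto simp: continuous_on_eq_continuous_within T_def)
qed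

lemma B_continuous: "continuous_on A f \<Longrightarrow> continuous_on A (\<lambda>x. B (f x))"
  using B by (auto simp: bounded_clinear_L2_def intro: bounded_linear.continuous_on)

lemma kernel_continuous:
  assumes g: "continuous_on {0..} g"
  shows "continuous_on ({0..} \<times> {0..1}) (\<lambda>(t, \<sigma>). S (t * \<sigma>) (B (g (t * (1 - \<sigma>)))))"
proof -
  have "continuous_on ({0..} \<times> {0..1}) (\<lambda>p. (fst p * snd p, B (g (fst p * (1 - snd p)))))"
    by (intro continuous_intros B_continuous continuous_on_compose2[OF g]) auto
  then have "continuous_on ({0..} \<times> {0..1}) (\<lambda>p. (\<lambda>(t, x). S t x) (fst p * snd p, B (g (fst p * (1 - snd p)))))"
    by (rule continuous_on_compose2[OF S_continuous]) auto
  then show ?thesis by (simp add: case_prod_beta')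
qed

lemma kernel_integrable:
  assumes g: "continuous_on {0..} g" and t: "0 \<le> t"
  shows "(\<lambda>\<sigma>. S (t * \<sigma>) (B (g (t * (1 - \<sigma>))))) integrable_on {0..1}"
proof -
  have "continuous_on {0..1::real} (\<lambda>\<sigma>. (t, \<sigma>))" by (intro continuous_intros)
  then have "continuous_on {0..1} (\<lambda>\<sigma>. (\<lambda>(t, \<sigma>). S (t * \<sigma>) (B (g (t * (1 - \<sigma>))))) (t, \<sigma>))"
    by (rule continuous_on_compose2[OF kernel_continuous[OF g]]) (use t in auto)
  then show ?thesis by (intro integrable_continuous_real) simp
qed

lemma duhamel_continuous:
  assumes g: "continuous_on {0..} g"
  shows "continuous_on {0..} (duhamel S B g)"
  unfolding duhamel_def[abs_def]
  using integral_continuous_on_param[of "{0..}" 0 1 "\<lambda>t \<sigma>. S (t * \<sigma>) (B (g (t * (1 - \<sigma>))))"] kernel_continuous[OF g]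
  by simp

lemma duhamel_bound:
  assumes g: "continuous_on {0..} g" and D: "\<And>s. 0 \<le> s \<Longrightarrow> norm (g s) \<le> D" and t: "0 \<le> t"
  shows "norm (t *\<^sub>R duhamel S B g t) \<le> D / 2"
proof (cases "t = 0")
  case True
  have "0 \<le> D" using D[of 0] norm_ge_zero order.trans by blast
  then show ?thesis using True by simp
next
  case False
  have D0: "0 \<le> D" using D[of 0] norm_ge_zero order.trans by blast
  let ?e = "\<lambda>\<sigma>. exp (- (\<mu> * t) * \<sigma>) * (\<mu> / 2 * D)"
  have "((\<lambda>\<sigma>. exp (- (\<mu> * t) * \<sigma>)) has_integral (- exp (- (\<mu> * t) * 1) / (\<mu> * t)) - (- exp (- (\<mu> * t) * 0) / (\<mu> * t))) {0..1}"
    using False t \<mu>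
    by (intro fundamental_theorem_of_calculus)
       (auto intro!: derivative_eq_intros simp flip: has_real_derivative_iff_has_vector_derivative)
  then have e: "((\<lambda>\<sigma>. ?e \<sigma>) has_integral ((1 - exp (- (\<mu> * t))) / (\<mu> * t)) * (\<mu> / 2 * D)) {0..1}"
    by (intro has_integral_mult_left) (simp add: diff_divide_distrib)
  have "norm (duhamel S B g t) \<le> integral {0..1} ?e"
    unfolding duhamel_def
  proof (rule integral_norm_bound_integral[OF kernel_integrable[OF g t]])
    show "?e integrable_on {0..1}" using e by blast
    fix \<sigma> :: real assume \<sigma>: "\<sigma> \<in> {0..1}"
    have "norm (S (t * \<sigma>) (B (g (t * (1 - \<sigma>))))) \<le> exp (- \<mu> * (t * \<sigma>)) * norm (B (g (t * (1 - \<sigma>))))"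
      using \<sigma> t by (intro decay) auto
    also have "\<dots> \<le> exp (- \<mu> * (t * \<sigma>)) * (\<mu> / 2 * D)"
    proof (intro mult_left_mono)
      have "norm (B (g (t * (1 - \<sigma>)))) \<le> \<mu> / 2 * norm (g (t * (1 - \<sigma>)))" by (rule Bbd)
      also have "\<dots> \<le> \<mu> / 2 * D" using \<sigma> t \<mu> by (intro mult_left_mono D) auto
      finally show "norm (B (g (t * (1 - \<sigma>)))) \<le> \<mu> / 2 * D" .
    qed simp
    finally show "norm (S (t * \<sigma>) (B (g (t * (1 - \<sigma>))))) \<le> ?e \<sigma>" by (simp add: mult_ac)
  qed
  also have "\<dots> = ((1 - exp (- (\<mu> * t))) / (\<mu> * t)) * (\<mu> / 2 * D)" using e by (rule integral_unique)
  also have "\<dots> \<le> (1 / (\<mu> * t)) * (\<mu> / 2 * D)"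
    using False t \<mu> D0 by (intro mult_right_mono divide_right_mono) auto
  finally have "norm (duhamel S B g t) \<le> D / 2 / t" using \<mu> by simp
  then show ?thesis using False t by (simp add: field_simps)
qed

lemma duhamel_diff:
  assumes g: "continuous_on {0..} g" and g': "continuous_on {0..} g'" and t: "0 \<le> t"
  shows "duhamel S B (\<lambda>s. g s - g' s) t = duhamel S B g t - duhamel S B g' t"
proof -
  have "duhamel S B (\<lambda>s. g s - g' s) t
      = integral {0..1} (\<lambda>\<sigma>. S (t * \<sigma>) (B (g (t * (1 - \<sigma>)))) - S (t * \<sigma>) (B (g' (t * (1 - \<sigma>)))))"
    unfolding duhamel_def
    by (intro integral_cong)
       (use t in \<open>simp add: bounded_clinear_simps[OF B] bounded_clinear_simps[OF C0_semigroupD(1)[OF S]]\<close>)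
  then show ?thesis using kernel_integrable[OF g t] kernel_integrable[OF g' t]
    by (simp add: duhamel_def integral_diff)
qed

lemma duhamel_eq_integral:
  assumes g: "continuous_on {0..} g" and t: "0 \<le> t"
  shows "((\<lambda>r. S r (B (g (t - r)))) has_integral t *\<^sub>R duhamel S B g t) {0..t}"
proof (cases "t = 0")
  case True then show ?thesis by (simp add: has_integral_refl)
next
  case False
  have "continuous_on {0..t} (\<lambda>r. (r, B (g (t - r))))"
    by (intro continuous_intros B_continuous continuous_on_compose2[OF g]) auto
  then have "continuous_on {0..t} (\<lambda>r. (\<lambda>(t, x). S t x) (r, B (g (t - r))))"
    by (rule continuous_on_compose2[OF S_continuous]) auto
  then have "(\<lambda>r. S r (B (g (t - r)))) integrable_on {0..t}"
    by (intro integrable_continuous_real) simp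
  then obtain I where I: "((\<lambda>r. S r (B (g (t - r)))) has_integral I) {0..t}" by blast
  then have "((\<lambda>\<sigma>. S (t *\<^sub>R \<sigma> + 0) (B (g (t - (t *\<^sub>R \<sigma> + 0))))) has_integral I /\<^sub>R t) {0..1}"
    using has_integral_affinity'[of "\<lambda>r. S r (B (g (t - r)))" I 0 t t 0] False t by simp
  then have "duhamel S B g t = I /\<^sub>R t"
    unfolding duhamel_def by (intro integral_unique) (simp add: algebra_simps)
  then show ?thesis using I False by simp
qed

text \<open>Functions are extended to negative times by their value at \<open>0\<close>, so that the fixed point lives in the
  Banach space of bounded continuous functions on the line.\<close>

definition picard :: "'n L2 \<Rightarrow> (real \<Rightarrow>\<^sub>C 'n L2) \<Rightarrow> real \<Rightarrow> 'n L2" where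
  "picard f g t = S (max 0 t) f + max 0 t *\<^sub>R duhamel S B (apply_bcontfun g) (max 0 t)"

lemma picard_bcontfun: "picard f g \<in> bcontfun"
proof (rule bcontfun_normI)
  have m: "continuous_on UNIV (\<lambda>t::real. max 0 t)" by (intro continuous_intros)
  have "continuous_on UNIV (\<lambda>t. S (max 0 t) f)"
  proof -
    have "continuous_on UNIV (\<lambda>t::real. (max 0 t, f))" by (intro continuous_intros)
    then have "continuous_on UNIV (\<lambda>t. (\<lambda>(t, x). S t x) (max 0 t, f))"
      by (rule continuous_on_compose2[OF S_continuous]) auto
    then show ?thesis by simp
  qed
  moreover have "continuous_on UNIV (\<lambda>t. duhamel S B (apply_bcontfun g) (max 0 t))"
    by (rule continuous_on_compose2[OF duhamel_continuous m]) auto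
  ultimately show "continuous_on UNIV (picard f g)"
    unfolding picard_def[abs_def] by (intro continuous_intros)
  fix t
  show "norm (picard f g t) \<le> norm f + norm g / 2"
    unfolding picard_def
    using contraction[of "max 0 t" f] duhamel_bound[of "apply_bcontfun g" "norm g" "max 0 t"]
    by (intro order.trans[OF norm_triangle_ineq] add_mono) (auto simp: norm_bounded)
qed

lemma picard_fixpoint: "\<exists>!g. Bcontfun (picard f g) = g"
proof (rule banach_fix_type[of "1/2"], simp, simp, intro allI)
  fix g g' :: "real \<Rightarrow>\<^sub>C 'n L2"
  show "dist (Bcontfun (picard f g)) (Bcontfun (picard f g')) \<le> 1 / 2 * dist g g'"
  proof (rule dist_bound)
    fix t :: real
    have "picard f g t - picard f g' t = max 0 t *\<^sub>R duhamel S B (\<lambda>s. g s - g' s) (max 0 t)"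
      by (subst duhamel_diff) (auto simp: picard_def algebra_simps)
    moreover have "norm (max 0 t *\<^sub>R duhamel S B (\<lambda>s. g s - g' s) (max 0 t)) \<le> dist g g' / 2"
      by (rule duhamel_bound) (auto intro!: continuous_intros simp: dist_norm[symmetric] dist_bounded)
    ultimately show "dist (apply_bcontfun (Bcontfun (picard f g)) t) (apply_bcontfun (Bcontfun (picard f g')) t) \<le> 1 / 2 * dist g g'"
      by (simp add: Bcontfun_inverse[OF picard_bcontfun] dist_norm)
  qed
qed

definition perturbed_sg :: "real \<Rightarrow> 'n L2 \<Rightarrow> 'n L2" where
  "perturbed_sg t f = apply_bcontfun (THE g. Bcontfun (picard f g) = g) t"

lemma perturbed_sg_continuous: "continuous_on A (\<lambda>t. perturbed_sg t f)"
  unfolding perturbed_sg_def by simp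

lemma perturbed_sg_eq: "0 \<le> t \<Longrightarrow> perturbed_sg t f = S t f + t *\<^sub>R duhamel S B (\<lambda>s. perturbed_sg s f) t"
proof -
  assume t: "0 \<le> t"
  let ?g = "THE g. Bcontfun (picard f g) = g"
  have "Bcontfun (picard f ?g) = ?g" by (rule theI'[OF picard_fixpoint])
  then have "apply_bcontfun (Bcontfun (picard f ?g)) t = apply_bcontfun ?g t" by simp
  then show ?thesis using t
    by (simp add: perturbed_sg_def Bcontfun_inverse[OF picard_bcontfun] picard_def)
qed

text \<open>A bounded continuous solution of Duhamel's equation is the fixed point. Linearity and the semigroup law
  are obtained from this by exhibiting solutions.\<close>

lemma perturbed_sg_unique:
  assumes v: "continuous_on {0..} v" "\<And>t. 0 \<le> t \<Longrightarrow> norm (v t) \<le> D"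
    and eq: "\<And>t. 0 \<le> t \<Longrightarrow> v t = S t f + t *\<^sub>R duhamel S B v t" and t: "0 \<le> t"
  shows "perturbed_sg t f = v t"
proof -
  have "(\<lambda>t. v (max 0 t)) \<in> bcontfun"
  proof (rule bcontfun_normI[where b = D])
    show "continuous_on UNIV (\<lambda>t. v (max 0 t))"
      by (rule continuous_on_compose2[OF v(1)]) (auto intro!: continuous_intros)
  qed (simp add: v(2))
  then have ap: "apply_bcontfun (Bcontfun (\<lambda>t. v (max 0 t))) = (\<lambda>t. v (max 0 t))"
    by (rule Bcontfun_inverse)
  let ?g = "Bcontfun (\<lambda>t. v (max 0 t))"
  have "duhamel S B (\<lambda>t. v (max 0 t)) s = duhamel S B v s" if "0 \<le> s" for s
    unfolding duhamel_def by (intro integral_cong) (use that in \<open>simp add: max_def\<close>)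
  then have "picard f ?g = (\<lambda>t. v (max 0 t))"
    by (simp add: picard_def[abs_def] ap eq[symmetric])
  then have "Bcontfun (picard f ?g) = ?g" by simp
  then have "(THE g. Bcontfun (picard f g) = g) = ?g"
    by (intro the1_equality picard_fixpoint)
  then show ?thesis using t by (simp add: perturbed_sg_def ap)
qed

lemma perturbed_sg_bound: "0 \<le> t \<Longrightarrow> norm (perturbed_sg t f) \<le> 2 * norm f"
proof -
  assume t: "0 \<le> t"
  define G where "G = (THE g. Bcontfun (picard f g) = g)"
  have fx: "Bcontfun (picard f G) = G" unfolding G_def by (rule theI'[OF picard_fixpoint])
  have "norm G \<le> norm f + norm G / 2"
  proof (rule norm_bound)
    fix s
    have "apply_bcontfun G s = picard f G s"
      using fx Bcontfun_inverse[OF picard_bcontfun, of f G] by simp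
    also have "norm \<dots> \<le> norm (S (max 0 s) f) + norm (max 0 s *\<^sub>R duhamel S B (apply_bcontfun G) (max 0 s))"
      unfolding picard_def by (rule norm_triangle_ineq)
    also have "\<dots> \<le> norm f + norm G / 2"
      using contraction[of "max 0 s" f]
      by (intro add_mono duhamel_bound) (auto simp: norm_bounded)
    finally show "norm (apply_bcontfun G s) \<le> norm f + norm G / 2" .
  qed
  then have "norm G \<le> 2 * norm f" by simp
  then show ?thesis unfolding perturbed_sg_def G_def[symmetric] using norm_bounded order.trans by blast
qed

lemma duhamel_combine:
  assumes g: "continuous_on {0..} g" and g': "continuous_on {0..} g'" and t: "0 \<le> t"
  shows "duhamel S B (\<lambda>s. g s + scaleC_L2 c (g' s)) t = duhamel S B g t + scaleC_L2 c (duhamel S B g' t)"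
proof -
  have "duhamel S B (\<lambda>s. g s + scaleC_L2 c (g' s)) t
      = integral {0..1} (\<lambda>\<sigma>. S (t * \<sigma>) (B (g (t * (1 - \<sigma>)))) + scaleC_L2 c (S (t * \<sigma>) (B (g' (t * (1 - \<sigma>))))))"
    unfolding duhamel_def
    by (intro integral_cong)
       (use t in \<open>simp add: bounded_clinear_simps[OF B] bounded_clinear_simps[OF C0_semigroupD(1)[OF S]]\<close>)
  also have "\<dots> = duhamel S B g t + integral {0..1} (scaleC_L2 c \<circ> (\<lambda>\<sigma>. S (t * \<sigma>) (B (g' (t * (1 - \<sigma>))))))"
    unfolding duhamel_def o_def
    using kernel_integrable[OF g t] integrable_linear[OF kernel_integrable[OF g' t] bounded_linear_scaleC_L2[of c]]
    by (intro integral_add) (simp_all add: o_def)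
  also have "integral {0..1} (scaleC_L2 c \<circ> (\<lambda>\<sigma>. S (t * \<sigma>) (B (g' (t * (1 - \<sigma>)))))) = scaleC_L2 c (duhamel S B g' t)"
    unfolding duhamel_def by (rule integral_linear[OF kernel_integrable[OF g' t] bounded_linear_scaleC_L2])
  finally show ?thesis .
qed

lemma perturbed_sg_linear: "0 \<le> t \<Longrightarrow> perturbed_sg t (f + scaleC_L2 c g) = perturbed_sg t f + scaleC_L2 c (perturbed_sg t g)"
proof (rule perturbed_sg_unique)
  have sc: "continuous_on A (\<lambda>t. scaleC_L2 c (perturbed_sg t g))" for A
    by (rule bounded_linear.continuous_on[OF bounded_linear_scaleC_L2 perturbed_sg_continuous])
  then show "continuous_on {0..} (\<lambda>t. perturbed_sg t f + scaleC_L2 c (perturbed_sg t g))"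
    by (intro continuous_intros perturbed_sg_continuous)
  show "norm (perturbed_sg t f + scaleC_L2 c (perturbed_sg t g)) \<le> 2 * norm f + norm c * (2 * norm g)" if "0 \<le> t" for t
    using perturbed_sg_bound[OF that, of f] perturbed_sg_bound[OF that, of g]
    by (intro order.trans[OF norm_triangle_ineq] add_mono) (auto simp: norm_scaleC_L2 intro: mult_left_mono)
  show "perturbed_sg t f + scaleC_L2 c (perturbed_sg t g) = S t (f + scaleC_L2 c g) + t *\<^sub>R duhamel S B (\<lambda>s. perturbed_sg s f + scaleC_L2 c (perturbed_sg s g)) t"
    if "0 \<le> t" for t
    unfolding duhamel_combine[OF perturbed_sg_continuous perturbed_sg_continuous that] perturbed_sg_eq[OF that, of f] perturbed_sg_eq[OF that, of g]
    by (simp add: bounded_clinear_simps[OF C0_semigroupD(1)[OF S that]] scaleC_L2_add scaleR_scaleC_L2 scaleC_L2_scaleC mult.commute algebra_simps)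
qed

lemma perturbed_sg_bounded_clinear: "0 \<le> t \<Longrightarrow> bounded_clinear_L2 (perturbed_sg t)"
proof (rule bounded_clinear_L2I[OF _ _ perturbed_sg_bound])
  have one: "scaleC_L2 1 u = u" for u :: "'n L2" using scaleR_scaleC_L2[of 1 u] by simp
  assume t: "0 \<le> t"
  show "perturbed_sg t (u + v) = perturbed_sg t u + perturbed_sg t v" for u v
    using perturbed_sg_linear[OF t, of u 1 v] by (simp add: one)
  have "perturbed_sg t 0 = 0" using perturbed_sg_bound[OF t, of 0] by simp
  then show "perturbed_sg t (scaleC_L2 c u) = scaleC_L2 c (perturbed_sg t u)" for c u
    using perturbed_sg_linear[OF t, of 0 c u] by simp
qed

lemma perturbed_sg_zero: "perturbed_sg 0 f = f"
  using perturbed_sg_eq[of 0 f] by (simp add: C0_semigroupD(2)[OF S])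

text \<open>The orbit restarted at time \<open>s\<close> solves Duhamel's equation with initial value \<open>perturbed_sg s f\<close>: split the
  integral over \<open>[0, t + s]\<close> at \<open>t\<close>.\<close>

lemma perturbed_sg_add: "0 \<le> s \<Longrightarrow> 0 \<le> t \<Longrightarrow> perturbed_sg (t + s) f = perturbed_sg t (perturbed_sg s f)"
proof -
  assume s: "0 \<le> s" and t: "0 \<le> t"
  have c: "continuous_on {0..} (\<lambda>t. perturbed_sg (t + s) f)"
    by (rule continuous_on_compose2[OF perturbed_sg_continuous[of UNIV]]) (auto intro!: continuous_intros)
  have "perturbed_sg t (perturbed_sg s f) = perturbed_sg (t + s) f"
  proof (rule perturbed_sg_unique[OF c _ _ t])
    show "norm (perturbed_sg (t + s) f) \<le> 2 * norm f" if "0 \<le> t" for t using perturbed_sg_bound[of "t + s" f] that s by simp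
    fix t :: real assume t: "0 \<le> t"
    let ?h = "\<lambda>r. S r (B (perturbed_sg (t + s - r) f))"
    have bl: "bounded_linear (S t)" using C0_semigroupD(1)[OF S t] by (simp add: bounded_clinear_L2_def)
    have I: "(?h has_integral (t + s) *\<^sub>R duhamel S B (\<lambda>r. perturbed_sg r f) (t + s)) {0..t + s}"
      using duhamel_eq_integral[OF perturbed_sg_continuous, of "t + s" f] s t by simp
    have I1: "(?h has_integral t *\<^sub>R duhamel S B (\<lambda>r. perturbed_sg (r + s) f) t) {0..t}"
      using duhamel_eq_integral[OF c t] by (simp add: algebra_simps)
    have "((\<lambda>r. S r (B (perturbed_sg (s - r) f))) has_integral s *\<^sub>R duhamel S B (\<lambda>r. perturbed_sg r f) s) {0..s}"
      by (rule duhamel_eq_integral[OF perturbed_sg_continuous s])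
    from has_integral_linear[OF this bl]
    have "((\<lambda>r. S t (S r (B (perturbed_sg (s - r) f)))) has_integral S t (s *\<^sub>R duhamel S B (\<lambda>r. perturbed_sg r f) s)) {0..s}"
      by (simp add: o_def)
    then have "((?h \<circ> (+) t) has_integral S t (s *\<^sub>R duhamel S B (\<lambda>r. perturbed_sg r f) s)) {0..s}"
      by (rule has_integral_eq[rotated]) (use C0_semigroupD(3)[OF S t] in auto)
    then have I2: "(?h has_integral S t (s *\<^sub>R duhamel S B (\<lambda>r. perturbed_sg r f) s)) {t..t + s}"
      unfolding has_integral_shift_Icc_real by (simp add: add.commute)
    from has_integral_combine[OF _ _ I1 I2] s t
    have "(?h has_integral (t *\<^sub>R duhamel S B (\<lambda>r. perturbed_sg (r + s) f) t + S t (s *\<^sub>R duhamel S B (\<lambda>r. perturbed_sg r f) s))) {0..t + s}"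
      by simp
    from has_integral_unique[OF I this]
    have "perturbed_sg (t + s) f = S (t + s) f + (t *\<^sub>R duhamel S B (\<lambda>r. perturbed_sg (r + s) f) t + S t (s *\<^sub>R duhamel S B (\<lambda>r. perturbed_sg r f) s))"
      using perturbed_sg_eq[of "t + s" f] s t by simp
    also have "S (t + s) f = S t (S s f)" by (rule C0_semigroupD(3)[OF S t s])
    finally show "perturbed_sg (t + s) f = S t (perturbed_sg s f) + t *\<^sub>R duhamel S B (\<lambda>r. perturbed_sg (r + s) f) t"
      using perturbed_sg_eq[OF s, of f] bounded_clinear_simps(1)[OF C0_semigroupD(1)[OF S t], of "S s f" "s *\<^sub>R duhamel S B (\<lambda>r. perturbed_sg r f) s"] by (simp add: add_ac)
  qed
  then show ?thesis by simp
qed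

lemma perturbed_sg_C0: "C0_semigroup perturbed_sg"
  unfolding C0_semigroup_def
proof (intro conjI allI impI)
  show "bounded_clinear_L2 (perturbed_sg t)" if "0 \<le> t" for t using that by (rule perturbed_sg_bounded_clinear)
  show "perturbed_sg 0 = id" by (simp add: fun_eq_iff perturbed_sg_zero)
  show "perturbed_sg (s + t) = perturbed_sg s \<circ> perturbed_sg t" if "0 \<le> s" "0 \<le> t" for s t
    using perturbed_sg_add[of t s] that by (simp add: fun_eq_iff)
  fix f
  have "isCont (\<lambda>t. perturbed_sg t f) 0" using perturbed_sg_continuous[of UNIV f] by (simp add: continuous_on_eq_continuous_at)
  then have "((\<lambda>t. perturbed_sg t f) \<longlongrightarrow> perturbed_sg 0 f) (at 0)" by (simp add: isCont_def)
  then show "((\<lambda>t. perturbed_sg t f) \<longlongrightarrow> f) (at_right 0)"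
    unfolding perturbed_sg_zero by (rule filterlim_mono) (auto simp: at_within_le_at)
qed

text \<open>The difference quotients of the two semigroups at \<open>0\<close> differ by the Duhamel mean, which tends to \<open>B u\<close>; so
  one of them converges if and only if the other does.\<close>

lemma perturbed_sg_generator: "generator perturbed_sg = {(u, v + B u) |u v. (u, v) \<in> generator S}"
proof -
  have lim: "((\<lambda>h. duhamel S B (\<lambda>s. perturbed_sg s u) h) \<longlongrightarrow> B u) (at_right 0)" for u
  proof -
    have "continuous_on {0..} (duhamel S B (\<lambda>s. perturbed_sg s u))" by (rule duhamel_continuous[OF perturbed_sg_continuous])
    then have "(duhamel S B (\<lambda>s. perturbed_sg s u) \<longlongrightarrow> duhamel S B (\<lambda>s. perturbed_sg s u) 0) (at 0 within {0..})"
      by (simp add: continuous_on_def)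
    moreover have "duhamel S B (\<lambda>s. perturbed_sg s u) 0 = B u"
      by (simp add: duhamel_def C0_semigroupD(2)[OF S] perturbed_sg_zero)
    moreover have "at_right 0 \<le> at (0::real) within {0..}" by (rule at_le) auto
    ultimately show ?thesis by (auto intro: filterlim_mono)
  qed
  have q: "(perturbed_sg h u - u) /\<^sub>R h = (S h u - u) /\<^sub>R h + duhamel S B (\<lambda>s. perturbed_sg s u) h" if "0 < h" for h u
    using perturbed_sg_eq[of h u] that by (simp add: algebra_simps)
  have ev: "\<forall>\<^sub>F h in at_right 0. (perturbed_sg h u - u) /\<^sub>R h = (S h u - u) /\<^sub>R h + duhamel S B (\<lambda>s. perturbed_sg s u) h" for u
    by (auto simp: eventually_at_right_field q intro!: exI[of _ 1])
  show ?thesis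
  proof (intro equalityI subsetI)
    fix p assume "p \<in> {(u, v + B u) |u v. (u, v) \<in> generator S}"
    then obtain u v where p: "p = (u, v + B u)" "((\<lambda>h. (S h u - u) /\<^sub>R h) \<longlongrightarrow> v) (at_right 0)"
      by (auto simp: generator_def)
    have "((\<lambda>h. (perturbed_sg h u - u) /\<^sub>R h) \<longlongrightarrow> v + B u) (at_right 0)"
      by (rule Lim_transform_eventually[OF tendsto_add[OF p(2) lim]]) (use ev[of u] in eventually_elim, simp)
    then show "p \<in> generator perturbed_sg" by (simp add: p generator_def)
  next
    fix p assume "p \<in> generator perturbed_sg"
    then obtain u w where p: "p = (u, w)" "((\<lambda>h. (perturbed_sg h u - u) /\<^sub>R h) \<longlongrightarrow> w) (at_right 0)"
      by (cases p) (auto simp: generator_def)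
    have "((\<lambda>h. (S h u - u) /\<^sub>R h) \<longlongrightarrow> w - B u) (at_right 0)"
      by (rule Lim_transform_eventually[OF tendsto_diff[OF p(2) lim]]) (use ev[of u] in eventually_elim, simp)
    then have "(u, (w - B u) + B u) \<in> {(u, v + B u) |u v. (u, v) \<in> generator S}"
      unfolding generator_def by blast
    then show "p \<in> {(u, v + B u) |u v. (u, v) \<in> generator S}" by (simp add: p)
  qed
qed

end

text \<open>The rescaling factor \<open>e\<^sup>-\<^sup>c\<^sup>t\<close> with \<open>c = w + 2K\<close> produces the decay rate \<open>\<mu> = 2K\<close>, twice the norm bound of \<open>B\<close>.\<close>

theorem bounded_perturbation:
  fixes S :: "real \<Rightarrow> 'n::finite L2 \<Rightarrow> 'n L2"
  assumes S: "C0_semigroup S" and bd: "\<And>t x. 0 \<le> t \<Longrightarrow> norm (S t x) \<le> exp (w * t) * norm x"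
    and B: "bounded_clinear_L2 B"
  shows "\<exists>T c. C0_semigroup T \<and> generator T = {(u, v + B u) |u v. (u, v) \<in> generator S} \<and>
    (\<forall>t\<ge>0. \<forall>x. norm (T t x) \<le> 2 * exp (c * t) * norm x)"
proof -
  obtain K where K: "K > 0" "\<And>x. norm (B x) \<le> norm x * K"
    using bounded_linear.pos_bounded[of B] B by (auto simp: bounded_clinear_L2_def)
  define c where "c = w + 2 * K"
  define S' where "S' t u = exp (- c * t) *\<^sub>R S t u" for t u
  have S': "C0_semigroup S'" unfolding S'_def by (rule C0_semigroup_rescale[OF S])
  have dec: "norm (S' t x) \<le> exp (- (2 * K) * t) * norm x" if "0 \<le> t" for t x
  proof -
    have "norm (S' t x) \<le> exp (- c * t) * (exp (w * t) * norm x)"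
      unfolding S'_def using bd[OF that, of x] by simp
    also have "\<dots> = exp (- (2 * K) * t) * norm x"
    proof -
      have "exp (- c * t) * exp (w * t) = exp (- (2 * K) * t)"
        by (subst exp_add[symmetric]) (simp add: c_def algebra_simps)
      then show ?thesis by (simp only: mult.assoc[symmetric])
    qed
    finally show ?thesis .
  qed
  have Kp: "0 < 2 * K" using K by simp
  have Bb: "norm (B x) \<le> (2 * K / 2) * norm x" for x using K(2)[of x] by (simp add: mult.commute)
  define P where "P = perturbed_sg S' B"
  have P: "C0_semigroup P" "generator P = {(u, v + B u) |u v. (u, v) \<in> generator S'}"
    using perturbed_sg_C0[OF S' Kp dec B Bb] perturbed_sg_generator[OF S' Kp dec B Bb] unfolding P_def by blast+
  have Pb: "norm (P t x) \<le> 2 * norm x" if "0 \<le> t" for t x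
    unfolding P_def by (rule perturbed_sg_bound[OF S' Kp dec B Bb that])
  define T where "T t u = exp (c * t) *\<^sub>R P t u" for t u
  have T: "C0_semigroup T" unfolding T_def by (rule C0_semigroup_rescale[OF P(1)])
  have gS': "generator S' = {(u, v + (- c) *\<^sub>R u) |u v. (u, v) \<in> generator S}"
    unfolding S'_def by (rule generator_rescale[OF S])
  have "generator T = {(u, v + c *\<^sub>R u) |u v. (u, v) \<in> generator P}"
    unfolding T_def by (rule generator_rescale[OF P(1)])
  also have "\<dots> = {(u, v + B u) |u v. (u, v) \<in> generator S}"
  proof (intro equalityI subsetI)
    fix p assume "p \<in> {(u, v + c *\<^sub>R u) |u v. (u, v) \<in> generator P}"
    then show "p \<in> {(u, v + B u) |u v. (u, v) \<in> generator S}"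
      unfolding P(2) gS' by auto
  next
    fix p assume "p \<in> {(u, v + B u) |u v. (u, v) \<in> generator S}"
    then obtain u v where p: "p = (u, v + B u)" "(u, v) \<in> generator S" by blast
    then have "(u, v + (- c) *\<^sub>R u) \<in> generator S'" unfolding gS' by blast
    then have "(u, (v + (- c) *\<^sub>R u) + B u) \<in> generator P" unfolding P(2) by blast
    then have "(u, ((v + (- c) *\<^sub>R u) + B u) + c *\<^sub>R u) \<in> {(u, v + c *\<^sub>R u) |u v. (u, v) \<in> generator P}" by blast
    then show "p \<in> {(u, v + c *\<^sub>R u) |u v. (u, v) \<in> generator P}" by (simp add: p add_ac)
  qed
  finally have gT: "generator T = {(u, v + B u) |u v. (u, v) \<in> generator S}" .
  have "norm (T t x) \<le> 2 * exp (c * t) * norm x" if "0 \<le> t" for t x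
    using Pb[OF that, of x] by (simp add: T_def mult_ac)
  with T gT show ?thesis by blast
qed


section \<open>Fourier multipliers and the free semigroup\<close>

definition fmult :: "(real^'n::finite \<Rightarrow> complex) \<Rightarrow> 'n L2 \<Rightarrow> 'n L2" where
  "fmult \<sigma> u = ifourier (mult_L2 \<sigma> (fourier_L2 u))"

lemma fourier_fmult [simp]: "fourier_L2 (fmult \<sigma> u) = mult_L2 \<sigma> (fourier_L2 u)"
  by (simp add: fmult_def)

lemma fourier_eqI: "fourier_L2 u = fourier_L2 v \<Longrightarrow> u = v"
  by (metis ifourier_fourier)

lemma bounded_clinear_fmult: "bdd_symbol \<sigma> c \<Longrightarrow> bounded_clinear_L2 (fmult \<sigma>)"
  unfolding fmult_def[abs_def]
  by (intro bounded_clinear_compose[OF bounded_clinear_ifourier]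
      bounded_clinear_compose[OF _ bounded_clinear_fourier] bounded_clinear_mult_L2)

lemma bounded_clinear_imp_linear: "bounded_clinear_L2 T \<Longrightarrow> bounded_linear T"
  by (simp add: bounded_clinear_L2_def)

lemma norm_fmult_le: "bdd_symbol \<sigma> c \<Longrightarrow> norm (fmult \<sigma> u) \<le> c * norm (u :: 'n::finite L2)"
proof -
  assume b: "bdd_symbol \<sigma> c"
  have "norm (fmult \<sigma> u) = norm (mult_L2 \<sigma> (fourier_L2 u)) / sqrt (plancherel_const TYPE('n))"
    by (simp add: fmult_def norm_ifourier)
  also have "\<dots> \<le> (c * norm (fourier_L2 u)) / sqrt (plancherel_const TYPE('n))"
    by (intro divide_right_mono norm_mult_L2_le[OF b]) (simp add: less_imp_le)
  also have "\<dots> = c * norm u" by (simp add: norm_fourier_L2 plancherel_const_ne)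
  finally show ?thesis .
qed

lemma fmult_fmult:
  "bdd_symbol \<sigma> c \<Longrightarrow> bdd_symbol \<sigma>' c' \<Longrightarrow> fmult \<sigma> (fmult \<sigma>' u) = fmult (\<lambda>\<xi>. \<sigma> \<xi> * \<sigma>' \<xi>) u"
  by (rule fourier_eqI) (simp add: mult_L2_mult)

lemma fmult_tendsto:
  assumes "\<And>k. bdd_symbol (m k) c" "bdd_symbol m' c'" "\<And>x. (\<lambda>k. m k x) \<longlonglongrightarrow> m' x"
  shows "(\<lambda>k. fmult (m k) u) \<longlonglongrightarrow> fmult m' u"
  unfolding fmult_def
  by (rule bounded_linear.tendsto[OF bounded_clinear_imp_linear[OF bounded_clinear_ifourier] mult_L2_tendsto[OF assms]])

lemma fmult_one: "fmult (\<lambda>\<xi>. 1) u = u"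
  by (simp add: fmult_def mult_L2_one)

lemma rep_fourier_fmult:
  "bdd_symbol \<sigma> c \<Longrightarrow> AE \<xi> in lebesgue. rep_L2 (fourier_L2 (fmult \<sigma> u)) \<xi> = \<sigma> \<xi> * rep_L2 (fourier_L2 u) \<xi>"
  by (simp add: rep_mult_L2)

lemma tendsto_at_right_0_sequentially:
  fixes f :: "real \<Rightarrow> 'a::first_countable_topology"
  assumes "\<And>X. (\<And>k. 0 < X k) \<Longrightarrow> (\<And>k. X k < 1) \<Longrightarrow> X \<longlonglongrightarrow> 0 \<Longrightarrow> (\<lambda>k. f (X k)) \<longlonglongrightarrow> l"
  shows "(f \<longlongrightarrow> l) (at_right 0)"
proof -
  have "at_right (0::real) = at 0 within {0<..<1}"
    by (rule at_within_nhd[of _ "{..<1}"]) auto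
  moreover have "(f \<longlongrightarrow> l) (at 0 within {0<..<1})"
    unfolding tendsto_at_iff_sequentially using assms by (auto simp: o_def)
  ultimately show ?thesis by simp
qed

lemma at_right_0_sequentiallyD:
  fixes f :: "real \<Rightarrow> 'a::topological_space"
  assumes "(f \<longlongrightarrow> l) (at_right 0)"
  shows "(\<lambda>k. f (1 / real (Suc k))) \<longlonglongrightarrow> l"
proof (rule filterlim_compose[OF assms])
  show "filterlim (\<lambda>k. 1 / real (Suc k)) (at_right 0) sequentially"
    unfolding filterlim_at
    using LIMSEQ_inverse_real_of_nat by (auto simp: inverse_eq_divide)
qed

subsection \<open>Admissible symbols\<close>

lemma inf_from_le:
  assumes F: "admissible_symbol F" and r: "0 \<le> R" "R \<le> r"
  shows "inf_from R F \<le> F r"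
proof -
  have "bdd_below (F ` {R..})"
    using F r by (auto simp: admissible_symbol_def intro: bdd_below_mono image_mono)
  then show ?thesis unfolding inf_from_def using r by (intro cINF_lower) auto
qed

lemma inf_from_mono:
  assumes F: "admissible_symbol F" and R: "0 \<le> R"
  shows "inf_from 0 F \<le> inf_from R F"
  unfolding inf_from_def[of R] using inf_from_le[OF F, of 0] R by (intro cINF_greatest) auto

lemma symbol_measurable:
  assumes "admissible_symbol F"
  shows "(\<lambda>\<xi>::real^'n::finite. F (norm \<xi>)) \<in> borel_measurable borel"
proof (rule borel_measurable_continuous_onI)
  have "continuous_on {0..} F" using assms by (simp add: admissible_symbol_def)
  then show "continuous_on UNIV (\<lambda>\<xi>::real^'n. F (norm \<xi>))"
    by (rule continuous_on_compose2) (auto intro!: continuous_intros)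
qed

lemma symbol_measurable_leb:
  assumes F: "admissible_symbol F" and [measurable]: "G \<in> borel_measurable borel"
  shows "(\<lambda>\<xi>::real^'n::finite. complex_of_real (G (F (norm \<xi>)))) \<in> borel_measurable lebesgue"
proof -
  have [measurable]: "(\<lambda>\<xi>::real^'n. F (norm \<xi>)) \<in> borel_measurable borel" by (rule symbol_measurable[OF F])
  have "(\<lambda>\<xi>::real^'n. complex_of_real (G (F (norm \<xi>)))) \<in> borel_measurable lborel" by measurable
  then show ?thesis by (rule measurable_completion)
qed

definition free_sg :: "(real \<Rightarrow> real) \<Rightarrow> real \<Rightarrow> 'n::finite L2 \<Rightarrow> 'n L2" where
  "free_sg F t = fmult (\<lambda>\<xi>. of_real (exp (- t * F (norm \<xi>))))"

lemma bdd_symbol_exp: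
  assumes F: "admissible_symbol F" and t: "0 \<le> t"
  shows "bdd_symbol (\<lambda>\<xi>::real^'n::finite. of_real (exp (- t * F (norm \<xi>)))) (exp (- t * inf_from 0 F))"
  unfolding bdd_symbol_def
proof
  show "(\<lambda>\<xi>::real^'n. complex_of_real (exp (- t * F (norm \<xi>)))) \<in> borel_measurable lebesgue"
    by (rule symbol_measurable_leb[OF F, of "\<lambda>x. exp (- t * x)"]) measurable
  show "\<forall>\<xi>::real^'n. norm (complex_of_real (exp (- t * F (norm \<xi>)))) \<le> exp (- t * inf_from 0 F)"
    using inf_from_le[OF F, of 0] t by (auto intro: mult_left_mono)
qed

text \<open>The cutoff \<open>|F(|\<xi>|)| \<le> k\<close> commutes with everything and makes the symbol bounded.\<close>

definition level :: "(real \<Rightarrow> real) \<Rightarrow> nat \<Rightarrow> real^'n::finite \<Rightarrow> complex" where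
  "level F k \<xi> = (if \<bar>F (norm \<xi>)\<bar> \<le> real k then 1 else 0)"

lemma bdd_symbol_level:
  assumes F: "admissible_symbol F"
  shows "bdd_symbol (level F k) 1"
proof -
  have "(\<lambda>\<xi>::real^'a. complex_of_real (indicator {x. \<bar>x\<bar> \<le> real k} (F (norm \<xi>)))) \<in> borel_measurable lebesgue"
    by (rule symbol_measurable_leb[OF F, of "indicator {x. \<bar>x\<bar> \<le> real k}"]) measurable
  moreover have "(\<lambda>\<xi>::real^'a. complex_of_real (indicator {x. \<bar>x\<bar> \<le> real k} (F (norm \<xi>)))) = level F k"
    by (auto simp: level_def indicator_def)
  ultimately show ?thesis by (auto simp: bdd_symbol_def level_def)
qed

lemma level_eventually: "eventually (\<lambda>k. level F k \<xi> = 1) sequentially"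
proof -
  obtain k0 :: nat where "\<bar>F (norm \<xi>)\<bar> \<le> real k0" using real_arch_simple by blast
  then show ?thesis by (auto simp: level_def eventually_sequentially intro!: exI[of _ k0])
qed

lemma fmult_level_tendsto:
  assumes F: "admissible_symbol F"
  shows "(\<lambda>k. fmult (level F k) u) \<longlonglongrightarrow> u"
proof -
  have "(\<lambda>k. fmult (level F k) u) \<longlonglongrightarrow> fmult (\<lambda>\<xi>. 1) u"
    by (rule fmult_tendsto[OF bdd_symbol_level[OF F]])
       (auto simp: bdd_symbol_def intro: tendsto_eventually level_eventually)
  then show ?thesis by (simp add: fmult_one)
qed

text \<open>Functions of \<open>F\<close> become bounded multipliers after the cutoff.\<close>

lemma bdd_symbol_level_times:
  assumes F: "admissible_symbol F" and G: "G \<in> borel_measurable borel"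
    and bd: "\<And>x. \<bar>x\<bar> \<le> real k \<Longrightarrow> \<bar>G x\<bar> \<le> c" and c: "0 \<le> c"
  shows "bdd_symbol (\<lambda>\<xi>::real^'n::finite. level F k \<xi> * of_real (G (F (norm \<xi>)))) c"
proof -
  have "bdd_symbol (level F k :: real^'n \<Rightarrow> complex) 1" by (rule bdd_symbol_level[OF F])
  then have "(level F k :: real^'n \<Rightarrow> complex) \<in> borel_measurable lebesgue" by (simp add: bdd_symbol_def)
  then have "(\<lambda>\<xi>::real^'n. level F k \<xi> * of_real (G (F (norm \<xi>)))) \<in> borel_measurable lebesgue"
    by (intro borel_measurable_times symbol_measurable_leb[OF F G])
  then show ?thesis using bd c by (auto simp: bdd_symbol_def level_def norm_mult)
qed

lemma fourier_multiplier_level: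
  assumes F: "admissible_symbol F"
  shows "(fmult (level F k) u, fmult (\<lambda>\<xi>. level F k \<xi> * of_real (F (norm \<xi>))) u) \<in> fourier_multiplier F"
proof -
  have b: "bdd_symbol (\<lambda>\<xi>. level F k \<xi> * of_real (F (norm \<xi>))) (real k)"
    using bdd_symbol_level_times[OF F, of "\<lambda>x. x" k "real k"] by simp
  show ?thesis
    unfolding fourier_multiplier_def
    using rep_fourier_fmult[OF b, of u] rep_fourier_fmult[OF bdd_symbol_level[OF F], of k u]
    by (auto elim!: eventually_elim2)
qed

text \<open>The domain of the multiplier is dense: it contains all spectral cutoffs \<open>|F(|\<xi>|)| \<le> k\<close> of a given function.\<close>

lemma fourier_multiplier_dense:
  assumes F: "admissible_symbol F" and W: "closed W"
    and "\<And>u v. (u, v) \<in> fourier_multiplier F \<Longrightarrow> u \<in> W"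
  shows "u \<in> W"
  by (rule closed_sequentially[OF W _ fmult_level_tendsto[OF F]]) (rule assms(3)[OF fourier_multiplier_level[OF F]])

lemma abs_exp_minus_one_le: "\<bar>exp x - 1\<bar> \<le> \<bar>x\<bar> * exp (max x 0)" for x :: real
proof (cases "0 \<le> x")
  case True
  have "1 - x \<le> exp (- x)" using exp_ge_add_one_self[of "- x"] by simp
  then have "(1 - x) * exp x \<le> exp (- x) * exp x" by (intro mult_right_mono) auto
  then have "exp x - 1 \<le> x * exp x" by (simp add: exp_add[symmetric] algebra_simps)
  then show ?thesis using True by simp
next
  case False
  then have "\<bar>exp x - 1\<bar> = 1 - exp x" "\<bar>x\<bar> * exp (max x 0) = - x" by simp_all
  moreover have "1 + x \<le> exp x" by (rule exp_ge_add_one_self)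
  ultimately show ?thesis by linarith
qed

lemma free_sg_C0:
  assumes F: "admissible_symbol F"
  shows "C0_semigroup (free_sg F :: real \<Rightarrow> 'n::finite L2 \<Rightarrow> 'n L2)"
  unfolding C0_semigroup_def
proof (intro conjI allI impI)
  show "bounded_clinear_L2 (free_sg F t :: 'n L2 \<Rightarrow> 'n L2)" if "0 \<le> t" for t
    unfolding free_sg_def by (rule bounded_clinear_fmult[OF bdd_symbol_exp[OF F that]])
  show "(free_sg F 0 :: 'n L2 \<Rightarrow> 'n L2) = id"
    by (simp add: fun_eq_iff free_sg_def fmult_one)
  show "(free_sg F (s + t) :: 'n L2 \<Rightarrow> 'n L2) = free_sg F s \<circ> free_sg F t" if "0 \<le> s" "0 \<le> t" for s t
    unfolding free_sg_def o_def fmult_fmult[OF bdd_symbol_exp[OF F that(1)] bdd_symbol_exp[OF F that(2)]]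
    by (rule ext, rule arg_cong[where f = "\<lambda>m. fmult m _"])
       (simp add: distrib_right left_diff_distrib exp_add[symmetric] flip: of_real_mult)
  fix f :: "'n L2"
  show "((\<lambda>t. free_sg F t f) \<longlongrightarrow> f) (at_right 0)"
  proof (rule tendsto_at_right_0_sequentially)
    fix X :: "nat \<Rightarrow> real" assume X: "\<And>k. 0 < X k" "\<And>k. X k < 1" "X \<longlonglongrightarrow> 0"
    have "(\<lambda>k. free_sg F (X k) f) \<longlonglongrightarrow> fmult (\<lambda>\<xi>. 1) f"
      unfolding free_sg_def
    proof (rule fmult_tendsto)
      show "bdd_symbol (\<lambda>\<xi>::real^'n. complex_of_real (exp (- X k * F (norm \<xi>)))) (exp \<bar>inf_from 0 F\<bar>)" for k
      proof -
        have "- X k * inf_from 0 F \<le> \<bar>inf_from 0 F\<bar>"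
        proof -
          have "- X k * inf_from 0 F \<le> X k * \<bar>inf_from 0 F\<bar>"
            using mult_left_mono[OF abs_ge_minus_self[of "inf_from 0 F"], of "X k"] X(1)[of k] by simp
          also have "\<dots> \<le> 1 * \<bar>inf_from 0 F\<bar>" using X(2)[of k] by (intro mult_right_mono) auto
          finally show ?thesis by simp
        qed
        then have "exp (- X k * inf_from 0 F) \<le> exp \<bar>inf_from 0 F\<bar>" by simp
        then show ?thesis using bdd_symbol_exp[OF F less_imp_le[OF X(1)], of k, where 'n = 'n]
          unfolding bdd_symbol_def by (meson order.trans)
      qed
      show "bdd_symbol (\<lambda>\<xi>::real^'n. 1) 1" by (simp add: bdd_symbol_def)
      fix \<xi> :: "real^'n"
      have "(\<lambda>k. complex_of_real (exp (- X k * F (norm \<xi>)))) \<longlonglongrightarrow> complex_of_real (exp (- 0 * F (norm \<xi>)))"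
        by (intro tendsto_intros X)
      then show "(\<lambda>k. complex_of_real (exp (- X k * F (norm \<xi>)))) \<longlonglongrightarrow> 1" by simp
    qed
    then show "(\<lambda>k. free_sg F (X k) f) \<longlonglongrightarrow> f" by (simp add: fmult_one)
  qed
qed

lemma free_sg_bound:
  assumes F: "admissible_symbol F" and t: "0 \<le> t"
  shows "norm (free_sg F t u) \<le> exp (- inf_from 0 F * t) * norm u"
  using norm_fmult_le[OF bdd_symbol_exp[OF F t], of u] by (simp add: free_sg_def mult.commute)

lemma exp_quotient_seq:
  assumes "\<And>k. 0 < X k" "X \<longlonglongrightarrow> (0::real)"
  shows "(\<lambda>k. (exp (- X k * a) - 1) / X k) \<longlonglongrightarrow> - a"
proof -
  have "filterlim X (at_right 0) sequentially"
    unfolding filterlim_at using assms(2) by (simp add: assms(1) less_imp_neq[OF assms(1), symmetric])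
  from filterlim_compose[OF exp_quotient[of "- a"] this] show ?thesis by (simp add: mult.commute)
qed

lemma fourier_free_quotient:
  assumes F: "admissible_symbol F" and t: "0 < t"
  shows "AE \<xi> in lebesgue. rep_L2 (fourier_L2 ((free_sg F t u - u) /\<^sub>R t)) \<xi>
    = of_real ((exp (- t * F (norm \<xi>)) - 1) / t) * rep_L2 (fourier_L2 u) \<xi>"
proof -
  have e: "fourier_L2 ((free_sg F t u - u) /\<^sub>R t)
      = inverse t *\<^sub>R (mult_L2 (\<lambda>\<xi>. of_real (exp (- t * F (norm \<xi>)))) (fourier_L2 u) - fourier_L2 u)"
    by (simp add: bounded_clinear_simps[OF bounded_clinear_fourier] free_sg_def)
  show ?thesis
    unfolding e
    using rep_scaleR_L2[of "inverse t" "mult_L2 (\<lambda>\<xi>. of_real (exp (- t * F (norm \<xi>)))) (fourier_L2 u) - fourier_L2 u"]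
      rep_diff_L2[of "mult_L2 (\<lambda>\<xi>. of_real (exp (- t * F (norm \<xi>)))) (fourier_L2 u)" "fourier_L2 u"]
      rep_mult_L2[OF bdd_symbol_exp[OF F less_imp_le[OF t]], of "fourier_L2 u"]
  proof eventually_elim
    case (elim \<xi>)
    show ?case unfolding elim by (simp add: divide_inverse algebra_simps)
  qed
qed

lemma tendsto_fourier_iff:
  fixes l :: "'n::finite L2"
  assumes "((\<lambda>t. fourier_L2 (f t)) \<longlongrightarrow> fourier_L2 l) G"
  shows "(f \<longlongrightarrow> l) G"
proof -
  have "((\<lambda>t. ifourier (fourier_L2 (f t))) \<longlongrightarrow> ifourier (fourier_L2 l)) G"
    by (rule bounded_linear.tendsto[OF bounded_clinear_imp_linear[OF bounded_clinear_ifourier] assms])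
  then show ?thesis by simp
qed

text \<open>Dominated convergence on the Fourier side: for \<open>0 < t < 1\<close> the difference quotients of \<open>e\<^sup>-\<^sup>t\<^sup>F\<close> are bounded
  by \<open>|F|\<close> times a constant, because \<open>F\<close> is bounded from below.\<close>

lemma free_sg_generator_superset:
  assumes F: "admissible_symbol F" and uv: "(u, v) \<in> fourier_multiplier F"
  shows "(u, - v) \<in> generator (free_sg F)"
proof -
  let ?m = "\<bar>inf_from 0 F\<bar>"
  have fv: "AE \<xi> in lebesgue. rep_L2 (fourier_L2 v) \<xi> = of_real (F (norm \<xi>)) * rep_L2 (fourier_L2 u) \<xi>"
    using uv by (simp add: fourier_multiplier_def)
  have "((\<lambda>t. (free_sg F t u - u) /\<^sub>R t) \<longlongrightarrow> - v) (at_right 0)"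
  proof (rule tendsto_at_right_0_sequentially, rule tendsto_fourier_iff)
    fix X :: "nat \<Rightarrow> real" assume X: "\<And>k. 0 < X k" "\<And>k. X k < 1" "X \<longlonglongrightarrow> 0"
    let ?q = "\<lambda>k. fourier_L2 ((free_sg F (X k) u - u) /\<^sub>R X k)"
    have "(\<lambda>k. abs_L2 (rep_L2 (?q k))) \<longlonglongrightarrow> abs_L2 (rep_L2 (fourier_L2 (- v)))"
    proof (rule L2_dominated_convergence(2))
      show "square_integrable (\<lambda>\<xi>. of_real (exp ?m) * rep_L2 (fourier_L2 v) \<xi>)"
        by (intro square_integrable_cmult) simp
      show "AE \<xi> in lebesgue. norm (rep_L2 (?q k) \<xi>) \<le> norm (of_real (exp ?m) * rep_L2 (fourier_L2 v) \<xi>)" for k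
        using fourier_free_quotient[OF F X(1)[of k], of u] fv
      proof eventually_elim
        case (elim \<xi>)
        let ?f = "F (norm \<xi>)"
        have "\<bar>(exp (- X k * ?f) - 1) / X k\<bar> \<le> \<bar>?f\<bar> * exp ?m"
        proof -
          have "\<bar>exp (- X k * ?f) - 1\<bar> \<le> \<bar>- X k * ?f\<bar> * exp (max (- X k * ?f) 0)"
            by (rule abs_exp_minus_one_le)
          also have "\<dots> \<le> (X k * \<bar>?f\<bar>) * exp ?m"
          proof (intro mult_mono)
            have "- X k * ?f \<le> X k * ?m"
              using mult_left_mono[of "- ?f" ?m "X k"] inf_from_le[OF F, of 0 "norm \<xi>"] X(1)[of k] by simp
            also have "\<dots> \<le> 1 * ?m" using X(2)[of k] by (intro mult_right_mono) auto
            finally show "exp (max (- X k * ?f) 0) \<le> exp ?m" by simp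
          qed (use X(1)[of k] in \<open>auto simp: abs_mult\<close>)
          finally show ?thesis using X(1)[of k] by (simp add: field_simps)
        qed
        then have "\<bar>(exp (- X k * ?f) - 1) / X k\<bar> * norm (rep_L2 (fourier_L2 u) \<xi>) \<le> \<bar>?f\<bar> * exp ?m * norm (rep_L2 (fourier_L2 u) \<xi>)"
          by (rule mult_right_mono) simp
        then show ?case unfolding elim by (simp add: norm_mult norm_divide mult_ac del: of_real_divide flip: of_real_diff of_real_divide)
      qed
      have "AE \<xi> in lebesgue. \<forall>k. rep_L2 (?q k) \<xi> = of_real ((exp (- X k * F (norm \<xi>)) - 1) / X k) * rep_L2 (fourier_L2 u) \<xi>"
        by (subst AE_all_countable) (intro allI fourier_free_quotient[OF F X(1)])
      moreover have "AE \<xi> in lebesgue. rep_L2 (fourier_L2 (- v)) \<xi> = - rep_L2 (fourier_L2 v) \<xi>"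
        using rep_uminus_L2 by (simp add: bounded_clinear_simps[OF bounded_clinear_fourier])
      ultimately show "AE \<xi> in lebesgue. (\<lambda>k. rep_L2 (?q k) \<xi>) \<longlonglongrightarrow> rep_L2 (fourier_L2 (- v)) \<xi>"
        using fv
      proof eventually_elim
        case (elim \<xi>)
        have "(\<lambda>k. complex_of_real ((exp (- X k * F (norm \<xi>)) - 1) / X k) * rep_L2 (fourier_L2 u) \<xi>)
            \<longlonglongrightarrow> complex_of_real (- F (norm \<xi>)) * rep_L2 (fourier_L2 u) \<xi>"
          by (intro tendsto_mult tendsto_of_real exp_quotient_seq X tendsto_const)
        then show ?case using elim by simp
      qed
    qed auto
    then show "(\<lambda>k. ?q k) \<longlonglongrightarrow> fourier_L2 (- v)" by simp
  qed
  then show ?thesis by (simp add: generator_def)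
qed

text \<open>If the difference quotients converge, so do their cutoffs to \<open>|F(|\<xi>|)| \<le> j\<close>, where the limit is known;
  then let \<open>j\<close> grow.\<close>

lemma free_sg_generator_subset:
  assumes F: "admissible_symbol F" and uw: "(u, w) \<in> generator (free_sg F)"
  shows "(u, - w) \<in> fourier_multiplier F"
proof -
  define X where "X k = 1 / real (Suc k)" for k
  have X: "\<And>k. 0 < X k" "X \<longlonglongrightarrow> 0" "\<And>k. X k \<le> 1"
    using LIMSEQ_inverse_real_of_nat by (auto simp: X_def[abs_def] inverse_eq_divide)
  let ?q = "\<lambda>k. fourier_L2 ((free_sg F (X k) u - u) /\<^sub>R X k)"
  have "((\<lambda>t. (free_sg F t u - u) /\<^sub>R t) \<longlongrightarrow> w) (at_right 0)" using uw by (simp add: generator_def)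
  from at_right_0_sequentiallyD[OF this] have "(\<lambda>k. (free_sg F (X k) u - u) /\<^sub>R X k) \<longlonglongrightarrow> w" by (simp add: X_def)
  then have qlim: "?q \<longlonglongrightarrow> fourier_L2 w"
    by (rule bounded_linear.tendsto[OF bounded_clinear_imp_linear[OF bounded_clinear_fourier]])
  have lev: "AE \<xi> in lebesgue. level F j \<xi> * rep_L2 (fourier_L2 w) \<xi> = - (level F j \<xi> * of_real (F (norm \<xi>))) * rep_L2 (fourier_L2 u) \<xi>" for j
  proof -
    let ?s = "\<lambda>k \<xi>. level F j \<xi> * of_real ((exp (- X k * F (norm \<xi>)) - 1) / X k)"
    let ?s' = "\<lambda>\<xi>. level F j \<xi> * of_real (- F (norm \<xi>))"
    have bs: "bdd_symbol (?s k) (real j * exp (real j))" for k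
    proof (rule bdd_symbol_level_times[OF F, of "\<lambda>x. (exp (- X k * x) - 1) / X k"])
      fix x :: real assume x: "\<bar>x\<bar> \<le> real j"
      have "\<bar>exp (- X k * x) - 1\<bar> \<le> \<bar>- X k * x\<bar> * exp (max (- X k * x) 0)"
        by (rule abs_exp_minus_one_le)
      also have "\<dots> \<le> (X k * real j) * exp (real j)"
      proof (intro mult_mono)
        show "\<bar>- X k * x\<bar> \<le> X k * real j" using X(1)[of k] x by (simp add: abs_mult)
        have "- X k * x \<le> X k * real j" using X(1)[of k] x mult_left_mono[of "- x" "real j" "X k"] by simp
        also have "\<dots> \<le> 1 * real j" using X(3)[of k] by (intro mult_right_mono) auto
        finally show "exp (max (- X k * x) 0) \<le> exp (real j)" by simp
      qed (use X(1)[of k] in auto)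
      finally show "\<bar>(exp (- X k * x) - 1) / X k\<bar> \<le> real j * exp (real j)"
        using X(1)[of k] by (simp add: field_simps)
    qed auto
    have bs': "bdd_symbol ?s' (real j)"
      by (rule bdd_symbol_level_times[OF F, of "\<lambda>x. - x"]) auto
    have bl: "bdd_symbol (level F j) 1" by (rule bdd_symbol_level[OF F])
    have "(\<lambda>k. mult_L2 (?s k) (fourier_L2 u)) \<longlonglongrightarrow> mult_L2 ?s' (fourier_L2 u)"
      by (rule mult_L2_tendsto[OF bs bs']) (intro tendsto_mult tendsto_of_real exp_quotient_seq X tendsto_const)
    moreover have "mult_L2 (?s k) (fourier_L2 u) = mult_L2 (level F j) (?q k)" for k
    proof (rule L2_eqI)
      show "AE \<xi> in lebesgue. rep_L2 (mult_L2 (?s k) (fourier_L2 u)) \<xi> = rep_L2 (mult_L2 (level F j) (?q k)) \<xi>"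
        using rep_mult_L2[OF bs, of k "fourier_L2 u"] rep_mult_L2[OF bl, of "?q k"] fourier_free_quotient[OF F X(1), of k u]
        by eventually_elim (simp add: mult.assoc)
    qed
    ultimately have "(\<lambda>k. mult_L2 (level F j) (?q k)) \<longlonglongrightarrow> mult_L2 ?s' (fourier_L2 u)" by simp
    moreover have "(\<lambda>k. mult_L2 (level F j) (?q k)) \<longlonglongrightarrow> mult_L2 (level F j) (fourier_L2 w)"
      by (rule bounded_linear.tendsto[OF bounded_clinear_imp_linear[OF bounded_clinear_mult_L2[OF bl]] qlim])
    ultimately have "mult_L2 (level F j) (fourier_L2 w) = mult_L2 ?s' (fourier_L2 u)" by (rule LIMSEQ_unique[rotated])
    then show ?thesis
      using rep_mult_L2[OF bl, of "fourier_L2 w"] rep_mult_L2[OF bs', of "fourier_L2 u"]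
      by (auto elim!: eventually_elim2)
  qed
  have "AE \<xi> in lebesgue. \<forall>j. level F j \<xi> * rep_L2 (fourier_L2 w) \<xi> = - (level F j \<xi> * of_real (F (norm \<xi>))) * rep_L2 (fourier_L2 u) \<xi>"
    by (subst AE_all_countable) (intro allI lev)
  moreover have "AE \<xi> in lebesgue. rep_L2 (fourier_L2 (- w)) \<xi> = - rep_L2 (fourier_L2 w) \<xi>"
    using rep_uminus_L2 by (simp add: bounded_clinear_simps[OF bounded_clinear_fourier])
  ultimately have "AE \<xi> in lebesgue. rep_L2 (fourier_L2 (- w)) \<xi> = of_real (F (norm \<xi>)) * rep_L2 (fourier_L2 u) \<xi>"
  proof eventually_elim
    case (elim \<xi>)
    obtain j where "level F j \<xi> = 1" using eventually_happens[OF level_eventually[of F \<xi>]] by auto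
    then show ?case using elim(1)[rule_format, of j] elim(2) by simp
  qed
  then show ?thesis by (simp add: fourier_multiplier_def)
qed

lemma free_sg_generator:
  assumes F: "admissible_symbol F"
  shows "generator (free_sg F) = {(u, - v) |u v. (u, v) \<in> fourier_multiplier F}"
proof (intro equalityI subsetI)
  fix p assume "p \<in> generator (free_sg F)"
  then obtain u w where p: "p = (u, w)" "(u, - w) \<in> fourier_multiplier F"
    using free_sg_generator_subset[OF F] by (cases p) auto
  then have "(u, - (- w)) \<in> {(u, - v) |u v. (u, v) \<in> fourier_multiplier F}" by blast
  then show "p \<in> {(u, - v) |u v. (u, v) \<in> fourier_multiplier F}" by (simp add: p)
qed (use free_sg_generator_superset[OF F] in auto)

text \<open>The bound on the growth is what the differentiability of orbits is deduced from.\<close>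

theorem perturbed_semigroup_exists:
  fixes B :: "'n::finite L2 \<Rightarrow> 'n L2"
  assumes F: "admissible_symbol F" and B: "bounded_clinear_L2 B"
  shows "\<exists>T c. generates (neg_perturbed (fourier_multiplier F) B) T \<and>
    (\<forall>t\<ge>0. \<forall>x. norm (T t x) \<le> 2 * exp (c * t) * norm x)"
proof -
  have B': "bounded_clinear_L2 (\<lambda>u. (-1) *\<^sub>R B u)" by (rule bounded_clinear_scaleR[OF B])
  have "norm (free_sg F t x) \<le> exp (- inf_from 0 F * t) * norm x" if "0 \<le> t" for t and x :: "'n L2"
    by (rule free_sg_bound[OF F that])
  from bounded_perturbation[OF free_sg_C0[OF F] this B'] obtain T c where T: "C0_semigroup T"
    "generator T = {(u, v + (-1) *\<^sub>R B u) |u v. (u, v) \<in> generator (free_sg F)}"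
    "\<forall>t\<ge>0. \<forall>x. norm (T t x) \<le> 2 * exp (c * t) * norm x" by blast
  have "generator T = neg_perturbed (fourier_multiplier F) B"
    unfolding T(2) free_sg_generator[OF F] neg_perturbed_def by auto
  then show ?thesis using T(1,3) unfolding generates_def by blast
qed

section \<open>The frequency projection\<close>

lemma cinner_L2_inner: "cinner_L2 f g = Complex (inner f g) (inner f (scaleC_L2 \<i> g))"
proof -
  have i: "integrable lebesgue (\<lambda>x. rep_L2 f x * cnj (rep_L2 g x))"
  proof (rule Bochner_Integration.integrable_bound)
    show "integrable lebesgue (\<lambda>x. (norm (rep_L2 f x))\<^sup>2 + (norm (rep_L2 g x))\<^sup>2)"
      using square_integrable_rep[of f] square_integrable_rep[of g] by (simp add: square_integrable_def)
    show "AE x in lebesgue. norm (rep_L2 f x * cnj (rep_L2 g x)) \<le> norm ((norm (rep_L2 f x))\<^sup>2 + (norm (rep_L2 g x))\<^sup>2)"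
    proof (rule AE_I2)
      fix x
      have "norm (rep_L2 f x) * norm (rep_L2 g x) \<le> 2 * norm (rep_L2 f x) * norm (rep_L2 g x)" by simp
      also have "\<dots> \<le> (norm (rep_L2 f x))\<^sup>2 + (norm (rep_L2 g x))\<^sup>2" by (rule sum_squares_bound)
      finally show "norm (rep_L2 f x * cnj (rep_L2 g x)) \<le> norm ((norm (rep_L2 f x))\<^sup>2 + (norm (rep_L2 g x))\<^sup>2)"
        by (simp add: norm_mult)
    qed
  qed measurable
  have "Re (cinner_L2 f g) = inner f g"
    unfolding cinner_L2_def inner_L2_rep integral_Re[OF i, symmetric]
    by (simp add: inner_complex_def)
  moreover have "Im (cinner_L2 f g) = inner f (scaleC_L2 \<i> g)"
    unfolding cinner_L2_def inner_L2_rep integral_Im[OF i, symmetric]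
  proof (rule integral_cong_AE)
    show "AE x in lebesgue. Im (rep_L2 f x * cnj (rep_L2 g x)) = inner (rep_L2 f x) (rep_L2 (scaleC_L2 \<i> g) x)"
      using rep_scaleC_L2[of \<i> g] by eventually_elim (simp add: inner_complex_def)
  qed measurable
  ultimately show ?thesis by (simp add: complex_eq_iff)
qed

text \<open>The union of all open sets on which \<open>w\<close> vanishes almost everywhere is, by the Lindelof property, a
  union of countably many of them.\<close>

lemma supp_L2_subset_cball:
  "supp_L2 w \<subseteq> cball 0 R \<longleftrightarrow> (AE x in lebesgue. norm x > R \<longrightarrow> rep_L2 w x = 0)"
proof
  assume s: "supp_L2 w \<subseteq> cball 0 R"
  let ?\<F> = "{U. open U \<and> (AE x in lebesgue. x \<in> U \<longrightarrow> rep_L2 w x = 0)}"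
  obtain \<F>' where F': "\<F>' \<subseteq> ?\<F>" "countable \<F>'" "\<Union>\<F>' = \<Union>?\<F>"
    using Lindelof[of ?\<F>] by blast
  have "AE x in lebesgue. \<forall>U\<in>\<F>'. x \<in> U \<longrightarrow> rep_L2 w x = 0"
    using F' by (subst AE_ball_countable) auto
  then show "AE x in lebesgue. norm x > R \<longrightarrow> rep_L2 w x = 0"
  proof eventually_elim
    case (elim x)
    show ?case
    proof
      assume "norm x > R"
      then have "x \<in> \<Union>?\<F>" using s unfolding supp_L2_def by auto
      then show "rep_L2 w x = 0" using elim F'(3) by blast
    qed
  qed
next
  assume ae: "AE x in lebesgue. norm x > R \<longrightarrow> rep_L2 w x = 0"
  have "AE x in lebesgue. x \<in> - cball 0 R \<longrightarrow> rep_L2 w x = 0"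
    using ae by eventually_elim auto
  then have "- cball 0 R \<subseteq> \<Union>{U. open U \<and> (AE x in lebesgue. x \<in> U \<longrightarrow> rep_L2 w x = 0)}"
    by (intro Union_upper) auto
  then show "supp_L2 w \<subseteq> cball 0 R" unfolding supp_L2_def by blast
qed

definition low_pass :: "real \<Rightarrow> 'n::finite L2 \<Rightarrow> 'n L2" where
  "low_pass R = fmult (indicator (cball 0 R))"

lemma bdd_symbol_cball: "bdd_symbol (indicator (cball 0 R)) 1"
  by (rule bdd_symbol_indicator) simp

lemma bounded_clinear_low: "bounded_clinear_L2 (low_pass R)"
  unfolding low_pass_def by (rule bounded_clinear_fmult[OF bdd_symbol_cball])

lemma rep_fourier_low:
  "AE \<xi> in lebesgue. rep_L2 (fourier_L2 (low_pass R u)) \<xi> = indicator (cball 0 R) \<xi> * rep_L2 (fourier_L2 u) \<xi>"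
  unfolding low_pass_def by (rule rep_fourier_fmult[OF bdd_symbol_cball])

lemma inner_fourier:
  "inner u v = (LINT \<xi>|lebesgue. inner (rep_L2 (fourier_L2 u) \<xi>) (rep_L2 (fourier_L2 v) \<xi>)) / plancherel_const TYPE('n)"
  for u v :: "'n::finite L2"
  using inner_fourier_L2[of u v] by (simp add: inner_L2_rep[of "fourier_L2 u"] plancherel_const_ne)

lemma inner_low_self_adjoint: "inner (low_pass R u) v = inner (low_pass R u) (low_pass R v)"
proof -
  have "(LINT \<xi>|lebesgue. inner (rep_L2 (fourier_L2 (low_pass R u)) \<xi>) (rep_L2 (fourier_L2 v) \<xi>))
      = (LINT \<xi>|lebesgue. inner (rep_L2 (fourier_L2 (low_pass R u)) \<xi>) (rep_L2 (fourier_L2 (low_pass R v)) \<xi>))"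
  proof (rule integral_cong_AE)
    show "AE \<xi> in lebesgue. inner (rep_L2 (fourier_L2 (low_pass R u)) \<xi>) (rep_L2 (fourier_L2 v) \<xi>)
        = inner (rep_L2 (fourier_L2 (low_pass R u)) \<xi>) (rep_L2 (fourier_L2 (low_pass R v)) \<xi>)"
      using rep_fourier_low[of R u] rep_fourier_low[of R v] by eventually_elim (auto simp: indicator_def)
  qed measurable
  then show ?thesis by (simp add: inner_fourier)
qed

text \<open>The cutoff of the transform is self-adjoint and idempotent and its range consists of the functions
  with frequencies in the ball; the definite description in the orthogonal projection has no other
  solution.\<close>

lemma freq_proj_eq: "freq_proj R = (low_pass R :: 'n::finite L2 \<Rightarrow> 'n L2)"
proof
  fix f :: "'n L2"
  let ?V = "{f :: 'n L2. supp_L2 (fourier_L2 f) \<subseteq> cball 0 R}"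
  have V: "g \<in> ?V \<longleftrightarrow> low_pass R g = g" for g
  proof
    assume "g \<in> ?V"
    then have ae: "AE x in lebesgue. norm x > R \<longrightarrow> rep_L2 (fourier_L2 g) x = 0"
      by (simp add: supp_L2_subset_cball)
    have "fourier_L2 (low_pass R g) = fourier_L2 g"
    proof (rule L2_eqI)
      show "AE x in lebesgue. rep_L2 (fourier_L2 (low_pass R g)) x = rep_L2 (fourier_L2 g) x"
        using ae rep_fourier_low[of R g] by eventually_elim (auto simp: indicator_def)
    qed
    then show "low_pass R g = g" by (rule fourier_eqI)
  next
    assume "low_pass R g = g"
    then have "AE x in lebesgue. norm x > R \<longrightarrow> rep_L2 (fourier_L2 g) x = 0"
      using rep_fourier_low[of R g] by (auto elim: eventually_mono simp: indicator_def)
    then show "g \<in> ?V" by (simp add: supp_L2_subset_cball)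
  qed
  have idem: "low_pass R (low_pass R g) = low_pass R g" for g :: "'n L2"
    unfolding low_pass_def fmult_fmult[OF bdd_symbol_cball bdd_symbol_cball]
    by (rule arg_cong[where f = "\<lambda>m. fmult m g"]) (auto simp: indicator_def)
  note lin = bounded_clinear_simps[OF bounded_clinear_low[of R]]
  have orth: "inner (f - low_pass R f) g = 0" if "low_pass R g = g" for g
  proof -
    have "inner (low_pass R g) f = inner (low_pass R g) (low_pass R f)" by (rule inner_low_self_adjoint)
    then show ?thesis using that by (simp add: inner_diff_right inner_commute[of _ g])
  qed
  show "freq_proj R f = low_pass R f"
    unfolding freq_proj_def orth_proj_L2_def
  proof (rule the_equality)
    show "low_pass R f \<in> ?V \<and> (\<forall>g\<in>?V. cinner_L2 (f - low_pass R f) g = 0)"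
    proof (intro conjI ballI)
      show "low_pass R f \<in> ?V" unfolding V by (rule idem)
      fix g assume "g \<in> ?V"
      then have "low_pass R g = g" unfolding V .
      then show "cinner_L2 (f - low_pass R f) g = 0"
        by (simp add: cinner_L2_inner orth lin complex_eq_iff)
    qed
    fix p assume p: "p \<in> ?V \<and> (\<forall>g\<in>?V. cinner_L2 (f - p) g = 0)"
    have lp: "low_pass R p = p" using p unfolding V by blast
    have "low_pass R (p - low_pass R f) = p - low_pass R f" by (simp add: lin lp idem)
    then have "inner (f - p) (p - low_pass R f) = 0"
      using p[THEN conjunct2, rule_format, of "p - low_pass R f"] unfolding V
      by (simp add: cinner_L2_inner complex_eq_iff)
    moreover have "inner (f - low_pass R f) (p - low_pass R f) = 0"
      by (rule orth) (simp add: lin lp idem)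
    ultimately have "inner (p - low_pass R f) (p - low_pass R f) = 0"
      by (simp add: inner_diff_left)
    then show "p = low_pass R f" by simp
  qed
qed


section \<open>Stabilizability forces thickness\<close>

lemma Borel_kernel:
  fixes \<omega> :: "(real^'n::finite) set"
  assumes "\<omega> \<in> sets lebesgue"
  obtains S where "S \<in> sets borel" "S \<subseteq> \<omega>" "AE x in lebesgue. x \<in> \<omega> \<longleftrightarrow> x \<in> S"
proof -
  obtain S N N' where S: "\<omega> = S \<union> N" "N \<subseteq> N'" "N' \<in> null_sets lborel" "S \<in> sets lborel"
    using sets_completionE[OF assms] by metis
  have "N' \<in> null_sets lebesgue" using S(3) by (simp add: null_sets_completionI)
  then have "AE x in lebesgue. x \<in> \<omega> \<longleftrightarrow> x \<in> S"
    by (rule eventually_mono[OF AE_not_in]) (use S(1,2) in auto)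
  then show ?thesis using that[of S] S by auto
qed

lemma indicator_L2_symmetric:
  fixes \<omega> :: "(real^'n::finite) set"
  assumes \<omega>: "\<omega> \<in> sets lebesgue"
  shows "inner (indicator_L2 \<omega> u) v = inner u (indicator_L2 \<omega> v)"
  unfolding inner_L2_rep indicator_L2_eq
proof (rule integral_cong_AE)
  show "AE x in lebesgue. inner (rep_L2 (mult_L2 (indicator \<omega>) u) x) (rep_L2 v x) = inner (rep_L2 u x) (rep_L2 (mult_L2 (indicator \<omega>) v) x)"
    using rep_mult_L2[OF bdd_symbol_indicator[OF \<omega>], of u] rep_mult_L2[OF bdd_symbol_indicator[OF \<omega>], of v]
    by eventually_elim (auto simp: indicator_def)
qed measurable

text \<open>The symbol is real.\<close>

lemma fourier_multiplier_symmetric: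
  fixes u v :: "'n::finite L2"
  assumes "(u, v) \<in> fourier_multiplier F" "(u', v') \<in> fourier_multiplier F"
  shows "inner v u' = inner u v'"
proof -
  have "(LINT \<xi>|lebesgue. inner (rep_L2 (fourier_L2 v) \<xi>) (rep_L2 (fourier_L2 u') \<xi>))
      = (LINT \<xi>|lebesgue. inner (rep_L2 (fourier_L2 u) \<xi>) (rep_L2 (fourier_L2 v') \<xi>))"
  proof (rule integral_cong_AE)
    have "AE \<xi> in lebesgue. rep_L2 (fourier_L2 v) \<xi> = of_real (F (norm \<xi>)) * rep_L2 (fourier_L2 u) \<xi>"
      "AE \<xi> in lebesgue. rep_L2 (fourier_L2 v') \<xi> = of_real (F (norm \<xi>)) * rep_L2 (fourier_L2 u') \<xi>"
      using assms by (auto simp: fourier_multiplier_def)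
    then show "AE \<xi> in lebesgue. inner (rep_L2 (fourier_L2 v) \<xi>) (rep_L2 (fourier_L2 u') \<xi>)
      = inner (rep_L2 (fourier_L2 u) \<xi>) (rep_L2 (fourier_L2 v') \<xi>)"
      by eventually_elim (simp add: scaleR_conv_of_real[symmetric])
  qed measurable
  then show ?thesis by (simp add: inner_fourier)
qed

text \<open>Let \<open>I(t) = \<langle>T\<^sub>t u, u\<rangle>\<close>. By symmetry of the multiplier and of the cutoff to \<open>\<omega>\<close>, \<open>I' - \<rho>I\<close> equals
  \<open>-\<langle>T\<^sub>t u, v + \<rho>u\<rangle> - \<langle>K T\<^sub>t u, 1\<^sub>\<omega>u\<rangle>\<close>, which is \<open>O(e\<^sup>-\<^sup>\<alpha>\<^sup>t)\<close> times the bracket on the right. Integrating \<open>(e\<^sup>-\<^sup>\<rho>\<^sup>tI)'\<close> over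
  all times gives \<open>I(0) = \<parallel>u\<parallel>\<^sup>2\<close>.\<close>

lemma stabilizability_observability:
  fixes T :: "real \<Rightarrow> 'n::finite L2 \<Rightarrow> 'n L2" and K :: "'n L2 \<Rightarrow> 'n L2"
  assumes F: "admissible_symbol F" and \<omega>: "\<omega> \<in> sets lebesgue"
    and gen: "generates (neg_perturbed (fourier_multiplier F) (\<lambda>f. indicator_L2 \<omega> (K f))) T"
    and decay: "\<And>t. 0 \<le> t \<Longrightarrow> onorm (T t) \<le> M * exp (- \<alpha> * t)"
    and K: "\<And>x. norm (K x) \<le> k * norm x" "0 \<le> k" and M: "0 \<le> M"
    and uv: "(u, v) \<in> fourier_multiplier F" and \<kappa>: "0 < \<alpha> + \<rho>" and \<alpha>: "0 < \<alpha>"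
  shows "norm u \<le> M / (\<alpha> + \<rho>) * (norm (v + \<rho> *\<^sub>R u) + k * norm (indicator_L2 \<omega> u))"
proof -
  have T: "C0_semigroup T" "generator T = neg_perturbed (fourier_multiplier F) (\<lambda>f. indicator_L2 \<omega> (K f))"
    using gen by (auto simp: generates_def)
  have bd: "norm (T t x) \<le> M * exp (- \<alpha> * t) * norm x" if "0 \<le> t" for t x
    using onorm[OF bounded_clinear_imp_linear[OF C0_semigroupD(1)[OF T(1) that]], of x] decay[OF that]
    by (meson mult_right_mono norm_ge_zero order_trans)
  have bdM: "norm (T t x) \<le> M * norm x" if "0 \<le> t" for t x
  proof -
    have "M * exp (- \<alpha> * t) \<le> M * 1" using M \<alpha> that by (intro mult_left_mono) auto
    then have "M * exp (- \<alpha> * t) * norm x \<le> M * 1 * norm x" by (rule mult_right_mono) simp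
    then show ?thesis using bd[OF that, of x] by simp
  qed
  define w where "w = - (v + indicator_L2 \<omega> (K u))"
  have uw: "(u, w) \<in> generator T" using uv unfolding T(2) neg_perturbed_def w_def by blast
  define N where "N = norm (v + \<rho> *\<^sub>R u) + k * norm (indicator_L2 \<omega> u)"
  have N: "0 \<le> N" using K(2) by (simp add: N_def)
  define C where "C = M * norm u * N"
  define E where "E = C / (\<alpha> + \<rho>)"
  have CE: "C = (\<alpha> + \<rho>) * E" using \<kappa> by (simp add: E_def)
  \<comment> \<open>Increasing, and bounded above by a function that tends to \<open>0\<close>; hence \<open>h 0 \<le> 0\<close>. This replaces the
    integral over all times.\<close>
  define h where "h t = exp (- \<rho> * t) * inner (T t u) u - E * exp (- (\<alpha> + \<rho>) * t)" for t
  have der: "\<exists>y. (h has_real_derivative y) (at t) \<and> 0 \<le> y" if t: "0 < t" for t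
  proof -
    have tT: "t < t + 1" by simp
    have dT: "((\<lambda>t. T t u) has_vector_derivative T t w) (at t)" and gt: "(T t u, T t w) \<in> generator T"
      using orbit_differentiable[OF T(1) M bdM uw t tT] by auto
    obtain vt where vt: "(T t u, vt) \<in> fourier_multiplier F" "T t w = - (vt + indicator_L2 \<omega> (K (T t u)))"
      using gt unfolding T(2) neg_perturbed_def by blast
    have "((\<lambda>t. inner (T t u) u) has_vector_derivative inner (T t w) u) (at t)"
      by (rule bounded_linear.has_vector_derivative[OF bounded_linear_inner_left dT])
    then have di: "((\<lambda>t. inner (T t u) u) has_real_derivative inner (T t w) u) (at t)"
      by (simp add: has_real_derivative_iff_has_vector_derivative)
    have iw: "inner (T t w) u = - inner (T t u) v - inner (K (T t u)) (indicator_L2 \<omega> u)"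
      using fourier_multiplier_symmetric[OF vt(1) uv] indicator_L2_symmetric[OF \<omega>, of "K (T t u)" u]
      by (simp add: vt(2) inner_diff_left)
    let ?y = "exp (- \<rho> * t) * (inner (T t w) u - \<rho> * inner (T t u) u) + C * exp (- (\<alpha> + \<rho>) * t)"
    have "(h has_real_derivative ?y) (at t)"
      unfolding h_def[abs_def]
      unfolding CE by (auto intro!: derivative_eq_intros di simp: algebra_simps)
    moreover have "0 \<le> ?y"
    proof -
      have "\<bar>inner (T t w) u - \<rho> * inner (T t u) u\<bar> = \<bar>inner (T t u) (v + \<rho> *\<^sub>R u) + inner (K (T t u)) (indicator_L2 \<omega> u)\<bar>"
        unfolding iw by (simp add: inner_add_right)
      also have "\<dots> \<le> norm (T t u) * norm (v + \<rho> *\<^sub>R u) + norm (K (T t u)) * norm (indicator_L2 \<omega> u)"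
        by (intro order.trans[OF abs_triangle_ineq] add_mono Cauchy_Schwarz_ineq2)
      also have "\<dots> \<le> norm (T t u) * norm (v + \<rho> *\<^sub>R u) + (k * norm (T t u)) * norm (indicator_L2 \<omega> u)"
        by (intro add_left_mono mult_right_mono K) simp
      also have "\<dots> = norm (T t u) * N" by (simp add: N_def algebra_simps)
      also have "\<dots> \<le> (M * exp (- \<alpha> * t) * norm u) * N"
        using bd[of t u] t N by (intro mult_right_mono) auto
      also have "\<dots> = C * exp (- \<alpha> * t)" by (simp add: C_def)
      finally have "\<bar>inner (T t w) u - \<rho> * inner (T t u) u\<bar> \<le> C * exp (- \<alpha> * t)" .
      then have "- (C * exp (- \<alpha> * t)) \<le> inner (T t w) u - \<rho> * inner (T t u) u" by linarith
      then have "exp (- \<rho> * t) * (- (C * exp (- \<alpha> * t))) \<le> exp (- \<rho> * t) * (inner (T t w) u - \<rho> * inner (T t u) u)"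
        by (rule mult_left_mono) simp
      moreover have "exp (- \<rho> * t) * (- (C * exp (- \<alpha> * t))) = - (C * exp (- (\<alpha> + \<rho>) * t))"
      proof -
        have "exp (- (\<alpha> + \<rho>) * t) = exp (- \<rho> * t) * exp (- \<alpha> * t)"
          by (subst exp_add[symmetric]) (simp add: algebra_simps)
        then show ?thesis by simp
      qed
      ultimately show ?thesis by linarith
    qed
    ultimately show ?thesis by blast
  qed
  have cont: "continuous_on {0..t} h" for t
  proof -
    have "continuous_on {0..t} (\<lambda>t. T t u)" by (rule C0_semigroup_continuous[OF T(1) M bdM])
    then show ?thesis unfolding h_def[abs_def] by (intro continuous_intros)
  qed
  have mono: "h 0 \<le> h t" if "0 \<le> t" for t
    using that
  proof (cases "t = 0")
    case False
    then show ?thesis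
      using DERIV_nonneg_imp_increasing_open[of 0 t h] that cont[of t] der by auto
  qed simp
  have up: "h t \<le> M * (norm u)\<^sup>2 * exp (- (\<alpha> + \<rho>) * t)" if "0 \<le> t" for t
  proof -
    have "inner (T t u) u \<le> norm (T t u) * norm u" by (rule norm_cauchy_schwarz)
    also have "\<dots> \<le> (M * exp (- \<alpha> * t) * norm u) * norm u" by (intro mult_right_mono bd that) simp
    finally have "exp (- \<rho> * t) * inner (T t u) u \<le> exp (- \<rho> * t) * ((M * exp (- \<alpha> * t) * norm u) * norm u)"
      by (rule mult_left_mono) simp
    also have "\<dots> = M * (norm u)\<^sup>2 * (exp (- \<rho> * t) * exp (- \<alpha> * t))" by (simp add: power2_eq_square)
    also have "exp (- \<rho> * t) * exp (- \<alpha> * t) = exp (- (\<alpha> + \<rho>) * t)"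
      by (subst exp_add[symmetric]) (simp add: algebra_simps)
    finally have "exp (- \<rho> * t) * inner (T t u) u \<le> M * (norm u)\<^sup>2 * exp (- (\<alpha> + \<rho>) * t)" .
    moreover have "0 \<le> E * exp (- (\<alpha> + \<rho>) * t)" using M N \<kappa> by (simp add: E_def C_def)
    ultimately show ?thesis by (simp add: h_def)
  qed
  have "((\<lambda>t. M * (norm u)\<^sup>2 * exp (- (\<alpha> + \<rho>) * t)) \<longlongrightarrow> M * (norm u)\<^sup>2 * 0) at_top"
  proof (intro tendsto_mult tendsto_const filterlim_compose[OF exp_at_bot])
    show "LIM t at_top. - (\<alpha> + \<rho>) * t :> at_bot"
      using \<kappa> by (intro filterlim_tendsto_neg_mult_at_bot[OF tendsto_const _ filterlim_ident]) auto
  qed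
  moreover have "\<forall>\<^sub>F t in at_top. h 0 \<le> M * (norm u)\<^sup>2 * exp (- (\<alpha> + \<rho>) * t)"
    using eventually_ge_at_top[of 0] by eventually_elim (use mono up order.trans in blast)
  ultimately have "h 0 \<le> M * (norm u)\<^sup>2 * 0"
    by (intro tendsto_lowerbound[of _ _ at_top]) auto
  then have "(norm u)\<^sup>2 \<le> C / (\<alpha> + \<rho>)"
    by (simp add: h_def E_def C0_semigroupD(2)[OF T(1)] power2_norm_eq_inner)
  then have "norm u * norm u \<le> norm u * (M / (\<alpha> + \<rho>) * N)"
    by (simp add: C_def power2_eq_square mult_ac)
  then show ?thesis
    unfolding N_def[symmetric] using M N \<kappa>
    by (cases "norm u = 0") (simp, metis mult_le_cancel_left_pos norm_ge_zero order_le_less)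
qed


lemma synth_modulate:
  "synth (\<lambda>\<xi>. exp (- (\<i> * of_real (y \<bullet> \<xi>))) * g \<xi>) x = synth g (x - y)"
proof -
  have "(LINT \<xi>|lborel. exp (\<i> * of_real (x \<bullet> \<xi>)) * (exp (- (\<i> * of_real (y \<bullet> \<xi>))) * g \<xi>))
      = (LINT \<xi>|lborel. exp (\<i> * of_real ((x - y) \<bullet> \<xi>)) * g \<xi>)"
    by (intro Bochner_Integration.integral_cong refl)
       (simp add: inner_diff_left right_diff_distrib exp_diff exp_minus divide_inverse)
  then show ?thesis by (simp add: synth_def)
qed

text \<open>The observability estimate is tested on the translates of one wave packet with frequencies near a point
  where the symbol is smaller than the decay rate.\<close>

theorem stabilizable_imp_thick:
  fixes \<omega> :: "(real^'n::finite) set"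
  assumes F: "admissible_symbol F" and \<omega>: "\<omega> \<in> sets lebesgue" and inf: "inf_from 0 F \<le> 0"
    and stab: "exp_stabilizable F \<omega>"
  shows "thick \<omega>"
proof -
  obtain \<alpha> M K T where \<alpha>: "\<alpha> > 0" and M: "M \<ge> 1" and K: "bounded_clinear_L2 K"
    and gen: "generates (neg_perturbed (fourier_multiplier F) (\<lambda>f. indicator_L2 \<omega> (K f))) T"
    and dec: "\<And>t. t \<ge> 0 \<Longrightarrow> onorm (T t) \<le> M * exp (- \<alpha> * t)"
    using stab unfolding exp_stabilizable_def exp_stabilizable_at_rate_def by blast
  obtain k where k: "k > 0" "\<And>x. norm (K x) \<le> norm x * k"
    using bounded_linear.pos_bounded[OF bounded_clinear_imp_linear[OF K]] by blast
  \<comment> \<open>A frequency at which the free evolution decays more slowly than the stabilized one.\<close>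
  obtain r0 where r0: "0 \<le> r0" "F r0 < \<alpha>"
  proof -
    have "(INF r\<in>{0..}. F r) < \<alpha>" using inf \<alpha> by (simp add: inf_from_def)
    moreover have "bdd_below (F ` {0..})" using F by (simp add: admissible_symbol_def)
    ultimately have "\<exists>r\<in>{0..}. F r < \<alpha>" by (subst (asm) cINF_less_iff) auto
    then show ?thesis using that by auto
  qed
  define \<mu> where "\<mu> = F r0"
  define C1 where "C1 = M / (\<alpha> - \<mu>)"
  have C1: "C1 > 0" using M r0 by (simp add: C1_def \<mu>_def)
  define \<xi>0 :: "real^'n" where "\<xi>0 = r0 *\<^sub>R axis undefined 1"
  have n\<xi>0: "norm \<xi>0 = r0" using r0 by (simp add: \<xi>0_def)
  have "continuous_on {0..} F" using F by (simp add: admissible_symbol_def)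
  then have "continuous_on UNIV (\<lambda>\<xi>::real^'n. F (norm \<xi>))"
    by (rule continuous_on_compose2[OF _ continuous_on_norm_id]) auto
  then have "isCont (\<lambda>\<xi>::real^'n. F (norm \<xi>)) \<xi>0" by (simp add: continuous_on_eq_continuous_at)
  moreover have "0 < 1 / (2 * C1)" using C1 by simp
  ultimately obtain d where d: "d > 0" "\<And>\<xi>. dist \<xi> \<xi>0 < d \<Longrightarrow> \<bar>F (norm \<xi>) - \<mu>\<bar> < 1 / (2 * C1)"
    unfolding continuous_at_eps_delta n\<xi>0 \<mu>_def[symmetric] dist_real_def by metis
  define D where "D = ball \<xi>0 d"
  have D[measurable]: "D \<in> sets borel" by (simp add: D_def)
  have eD: "emeasure lborel D < \<infinity>" unfolding D_def by (rule emeasure_lborel_ball_finite)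
  \<comment> \<open>Modulations of the indicator of \<open>D\<close>; their inverse transforms are translates of one function.\<close>
  define g where "g y \<xi> = exp (- (\<i> * of_real (y \<bullet> \<xi>))) * indicator D \<xi>" for y \<xi> :: "real^'n"
  have gm[measurable]: "g y \<in> borel_measurable borel" for y unfolding g_def by measurable
  have gl: "g y \<in> borel_measurable lebesgue" for y using measurable_completion[of "g y" lborel borel] gm by simp
  have ng: "norm (g y \<xi>) = indicator D \<xi>" for y \<xi> by (simp add: g_def norm_mult indicator_def)
  have iD: "integrable lborel (indicator D :: _ \<Rightarrow> real)" using eD by (simp add: integrable_indicator_iff)
  have ig: "integrable lborel (g y)" for y
    by (rule Bochner_Integration.integrable_bound[OF iD]) (auto simp: ng)
  have sqg: "square_integrable (g y)" for y
  proof (rule square_integrableI_nn[OF gl])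
    have "(\<integral>\<^sup>+x. ennreal ((norm (g y x))\<^sup>2) \<partial>lebesgue) = (\<integral>\<^sup>+x. indicator D x \<partial>lebesgue)"
      by (intro nn_integral_cong) (auto simp: ng indicator_def)
    also have "\<dots> = emeasure lborel D" by simp
    finally show "(\<integral>\<^sup>+x. ennreal ((norm (g y x))\<^sup>2) \<partial>lebesgue) < \<infinity>" using eD by simp
  qed
  define u where "u y = ifourier (abs_L2 (g y))" for y
  define U where "U = synth (g 0)"
  have Um[measurable]: "U \<in> borel_measurable borel" unfolding U_def by (rule synth_measurable[OF gm])
  have sy: "synth (g y) = (\<lambda>x. U (x - y))" for y
  proof
    fix x
    have "synth (g y) x = synth (\<lambda>\<xi>. exp (- (\<i> * of_real (y \<bullet> \<xi>))) * g 0 \<xi>) x"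
      by (simp add: g_def[abs_def])
    then show "synth (g y) x = U (x - y)" by (simp add: synth_modulate U_def)
  qed
  have uU: "u y = abs_L2 (\<lambda>x. U (x - y))" and sqU: "square_integrable (\<lambda>x. U (x - y))" for y
    using synth_L2[OF sqg[of y] ig gm] by (simp_all add: u_def sy)
  define \<nu> where "\<nu> = norm (u 0)"
  have nug: "(norm (abs_L2 (g y)))\<^sup>2 = measure lborel D" for y
  proof -
    have "(norm (abs_L2 (g y)))\<^sup>2 = (LINT x|lebesgue. (norm (g y x))\<^sup>2)" by (rule norm_abs_L2_sq[OF sqg])
    also have "\<dots> = (LINT x|lebesgue. indicator D x)"
      by (intro Bochner_Integration.integral_cong) (auto simp: ng indicator_def)
    finally show ?thesis by simp
  qed
  have nu: "norm (u y) = \<nu>" for y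
  proof -
    have "norm (abs_L2 (g y)) = norm (abs_L2 (g 0))"
      using nug[of y] nug[of 0] by (metis norm_ge_zero power2_eq_imp_eq)
    then show ?thesis by (simp add: u_def \<nu>_def norm_ifourier)
  qed
  have "measure lborel D > 0" unfolding D_def using d(1) by (simp add: content_ball_pos)
  then have "norm (abs_L2 (g 0)) > 0" using nug[of 0] by (metis less_irrefl norm_ge_zero order_le_less power_zero_numeral)
  then have \<nu>: "\<nu> > 0" by (simp add: \<nu>_def u_def norm_ifourier)
  \<comment> \<open>On the packet the multiplier differs from \<open>\<mu>\<close> by at most \<open>1/(2 C1)\<close>, so half of the left-hand side of the
    observability estimate absorbs this term.\<close>
  have low: "\<nu> \<le> 2 * C1 * k * norm (indicator_L2 \<omega> (u y))" for y
  proof -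
    let ?s = "\<lambda>\<xi>::real^'n. complex_of_real (indicator D \<xi> * F (norm \<xi>))"
    let ?s' = "\<lambda>\<xi>::real^'n. complex_of_real (indicator D \<xi> * (F (norm \<xi>) - \<mu>))"
    have [measurable]: "(\<lambda>\<xi>::real^'n. F (norm \<xi>)) \<in> borel_measurable borel" by (rule symbol_measurable[OF F])
    have m1: "?s \<in> borel_measurable lebesgue" "?s' \<in> borel_measurable lebesgue"
      by (rule measurable_completion, measurable)+
    have b': "bdd_symbol ?s' (1 / (2 * C1))"
      unfolding bdd_symbol_def
    proof (intro conjI m1 allI)
      fix \<xi> :: "real^'n"
      show "norm (?s' \<xi>) \<le> 1 / (2 * C1)"
        unfolding norm_of_real using d(2)[of \<xi>] C1
        by (cases "\<xi> \<in> D") (simp_all add: D_def dist_commute less_imp_le)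
    qed
    have b: "bdd_symbol ?s (1 / (2 * C1) + \<bar>\<mu>\<bar>)"
      unfolding bdd_symbol_def
    proof (intro conjI m1 allI)
      fix \<xi> :: "real^'n"
      show "norm (?s \<xi>) \<le> 1 / (2 * C1) + \<bar>\<mu>\<bar>"
      proof (cases "\<xi> \<in> D")
        case True
        then have "\<bar>F (norm \<xi>) - \<mu>\<bar> < 1 / (2 * C1)" using d(2)[of \<xi>] by (simp add: D_def dist_commute)
        then have "\<bar>F (norm \<xi>)\<bar> \<le> 1 / (2 * C1) + \<bar>\<mu>\<bar>" by linarith
        then show ?thesis using True by simp
      qed (use C1 in simp)
    qed
    have fu: "AE \<xi> in lebesgue. rep_L2 (fourier_L2 (u y)) \<xi> = g y \<xi>"
      unfolding u_def using rep_abs_L2[OF sqg[of y]] by simp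
    define v where "v = fmult ?s (u y)"
    have uv: "(u y, v) \<in> fourier_multiplier F"
      unfolding fourier_multiplier_def v_def
      unfolding mem_Collect_eq prod.case using rep_fourier_fmult[OF b, of "u y"] fu
      by eventually_elim (auto simp: g_def indicator_def)
    have "v + (- \<mu>) *\<^sub>R u y = fmult ?s' (u y)"
    proof (rule fourier_eqI, rule L2_eqI)
      show "AE \<xi> in lebesgue. rep_L2 (fourier_L2 (v + (- \<mu>) *\<^sub>R u y)) \<xi> = rep_L2 (fourier_L2 (fmult ?s' (u y))) \<xi>"
        unfolding bounded_clinear_simps(1,5)[OF bounded_clinear_fourier]
        using rep_add_L2[of "fourier_L2 v" "(- \<mu>) *\<^sub>R fourier_L2 (u y)"] rep_scaleR_L2[of "- \<mu>" "fourier_L2 (u y)"]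
          rep_fourier_fmult[OF b', of "u y"] rep_fourier_fmult[OF b, of "u y", folded v_def] fu
      proof eventually_elim
        case (elim \<xi>)
        show ?case unfolding elim g_def by (simp add: indicator_def left_diff_distrib)
      qed
    qed
    then have nv: "norm (v + (- \<mu>) *\<^sub>R u y) \<le> 1 / (2 * C1) * \<nu>"
      using norm_fmult_le[OF b', of "u y"] by (simp add: nu)
    have "norm (u y) \<le> M / (\<alpha> + (- \<mu>)) * (norm (v + (- \<mu>) *\<^sub>R u y) + k * norm (indicator_L2 \<omega> (u y)))"
      using r0 k M \<alpha>
      by (intro stabilizability_observability[OF F \<omega> gen dec _ _ _ uv]) (auto simp: \<mu>_def mult.commute)
    then have "\<nu> \<le> C1 * (norm (v + (- \<mu>) *\<^sub>R u y) + k * norm (indicator_L2 \<omega> (u y)))"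
      by (simp add: nu C1_def)
    also have "\<dots> \<le> C1 * (1 / (2 * C1) * \<nu> + k * norm (indicator_L2 \<omega> (u y)))"
      using nv C1 by (intro mult_left_mono add_right_mono) auto
    also have "\<dots> = \<nu> / 2 + C1 * k * norm (indicator_L2 \<omega> (u y))" using C1 by (simp add: field_simps)
    finally show ?thesis by simp
  qed
  obtain S where S[measurable]: "S \<in> sets borel" and S\<omega>: "S \<subseteq> \<omega>" and Sae: "AE x in lebesgue. x \<in> \<omega> \<longleftrightarrow> x \<in> S"
    using Borel_kernel[OF \<omega>] by metis
  \<comment> \<open>The mass on \<open>\<omega>\<close> that every translate has at least.\<close>
  define c2 where "c2 = (\<nu> / (2 * C1 * k))\<^sup>2"
  have c2: "c2 > 0" using \<nu> C1 k by (simp add: c2_def)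
  have lowI: "ennreal c2 \<le> (\<integral>\<^sup>+x. indicator S x * ennreal ((norm (U (x - y)))\<^sup>2) \<partial>lborel)" for y
  proof -
    have Sl: "S \<in> sets lebesgue" using S by simp
    have m: "(\<lambda>x. indicator S x * U (x - y)) \<in> borel_measurable borel" by measurable
    have sq: "square_integrable (\<lambda>x. indicator S x * U (x - y))"
      by (rule square_integrable_mult[OF bdd_symbol_indicator[OF Sl] sqU])
    have "indicator_L2 \<omega> (u y) = abs_L2 (\<lambda>x. indicator S x * U (x - y))"
      unfolding uU indicator_L2_eq mult_L2_abs[OF bdd_symbol_indicator[OF \<omega>] sqU]
      by (rule abs_L2_eqI[OF square_integrable_mult[OF bdd_symbol_indicator[OF \<omega>] sqU] sq])
         (use Sae in \<open>eventually_elim, auto simp: indicator_def\<close>)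
    then have "ennreal ((norm (indicator_L2 \<omega> (u y)))\<^sup>2) = (\<integral>\<^sup>+x. ennreal ((norm (indicator S x * U (x - y)))\<^sup>2) \<partial>lborel)"
      using nn_integral_abs_L2_lborel[OF sq m] by simp
    also have "\<dots> = (\<integral>\<^sup>+x. indicator S x * ennreal ((norm (U (x - y)))\<^sup>2) \<partial>lborel)"
      by (intro nn_integral_cong) (auto simp: indicator_def)
    finally have e: "ennreal ((norm (indicator_L2 \<omega> (u y)))\<^sup>2) = \<dots>" .
    have "\<nu> / (2 * C1 * k) \<le> norm (indicator_L2 \<omega> (u y))"
      using low[of y] C1 k by (simp add: field_simps)
    then have "c2 \<le> (norm (indicator_L2 \<omega> (u y)))\<^sup>2"
      unfolding c2_def using \<nu> C1 k by (intro power_mono) auto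
    then show ?thesis unfolding e[symmetric] by (rule ennreal_leI)
  qed
  \<comment> \<open>\<open>U\<close> is bounded and its mass is concentrated in a ball.\<close>
  define B where "B = 1 / plancherel_const TYPE('n) * (LINT \<xi>|lborel. norm (g 0 \<xi>))"
  have UB: "norm (U x) \<le> B" for x
  proof -
    have "norm (LINT \<xi>|lborel. exp (\<i> * of_real (x \<bullet> \<xi>)) * g 0 \<xi>) \<le> (LINT \<xi>|lborel. norm (g 0 \<xi>))"
      by (rule integral_norm_bound[THEN order.trans]) (simp add: norm_mult)
    then show ?thesis
      unfolding U_def synth_def B_def norm_mult
      using less_imp_le[OF plancherel_const_pos[where 'n = 'n]] by (intro mult_mono) (auto simp: norm_divide)
  qed
  have B0: "0 \<le> B" using UB[of 0] norm_ge_zero order.trans by blast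
  have "(\<lambda>j. norm (trunc_L2 j (u 0) - u 0)) \<longlonglongrightarrow> 0"
    by (intro tendsto_norm_zero LIM_zero trunc_L2_tendsto)
  then obtain j0 where j0: "\<And>j. j \<ge> j0 \<Longrightarrow> norm (norm (trunc_L2 j (u 0) - u 0) - 0) < sqrt (c2 / 2)"
    using c2 LIMSEQ_D[of _ 0 "sqrt (c2 / 2)"] by (metis half_gt_zero real_sqrt_gt_0_iff)
  define j where "j = max j0 1"
  have j: "j \<ge> 1" "j \<ge> j0" by (auto simp: j_def)
  let ?Bj = "ball (0::real^'n) (real j)"
  have tail: "(\<integral>\<^sup>+x. indicator (- ?Bj) x * ennreal ((norm (U x))\<^sup>2) \<partial>lborel) \<le> ennreal (c2 / 2)"
  proof -
    have U0: "square_integrable U" "u 0 = abs_L2 U" using sqU[of 0] uU[of 0] by simp_all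
    have sqB: "square_integrable (\<lambda>x. indicator ?Bj x * U x)"
      by (rule square_integrable_mult[OF bdd_symbol_ball U0(1)])
    have "trunc_L2 j (u 0) - u 0 = abs_L2 (\<lambda>x. indicator ?Bj x * U x - U x)"
      unfolding trunc_L2_def U0(2) mult_L2_abs[OF bdd_symbol_ball U0(1)] by (rule abs_L2_diff[OF sqB U0(1)])
    moreover have "(\<lambda>x. indicator ?Bj x * U x - U x) \<in> borel_measurable borel"
      by (intro borel_measurable_diff borel_measurable_times borel_measurable_indicator Um) simp
    ultimately have "ennreal ((norm (trunc_L2 j (u 0) - u 0))\<^sup>2) = (\<integral>\<^sup>+x. ennreal ((norm (indicator ?Bj x * U x - U x))\<^sup>2) \<partial>lborel)"
      using nn_integral_abs_L2_lborel[OF square_integrable_diff[OF sqB U0(1)]] by simp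
    also have "\<dots> = (\<integral>\<^sup>+x. indicator (- ?Bj) x * ennreal ((norm (U x))\<^sup>2) \<partial>lborel)"
      by (intro nn_integral_cong) (auto simp: indicator_def)
    finally have e: "(\<integral>\<^sup>+x. indicator (- ?Bj) x * ennreal ((norm (U x))\<^sup>2) \<partial>lborel) = ennreal ((norm (trunc_L2 j (u 0) - u 0))\<^sup>2)" ..
    have "(norm (trunc_L2 j (u 0) - u 0))\<^sup>2 \<le> (sqrt (c2 / 2))\<^sup>2"
      using j0[OF j(2)] by (intro power_mono) auto
    then show ?thesis unfolding e using c2 by (intro ennreal_leI) simp
  qed
  define L where "L = 2 * real j"
  have L: "L > 0" using j by (simp add: L_def)
  \<comment> \<open>The cube with corner \<open>x\<close> and side \<open>2 j\<close> contains the ball of radius \<open>j\<close> around its centre \<open>y\<close>; the packet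
    centred at \<open>y\<close> has at most half of the mass \<open>c2\<close> outside of it and is bounded by \<open>B\<close> inside.\<close>
  have mass: "c2 / 2 \<le> B\<^sup>2 * measure lebesgue (\<omega> \<inter> (+) x ` cbox 0 (\<chi> i. L))" for x
  proof -
    define y :: "real^'n" where "y = x + (\<chi> i. real j)"
    let ?X = "(+) x ` cbox 0 ((\<chi> i. L) :: real^'n)"
    have Xb: "?X \<in> sets borel" by (simp add: cbox_translation[symmetric])
    have Xc: "?X = cbox (x + 0) (x + (\<chi> i. L))" by (rule cbox_translation[symmetric])
    have bX: "ball y (real j) \<subseteq> ?X"
    proof
      fix z assume "z \<in> ball y (real j)"
      then have "norm (z - y) < real j" by (simp add: dist_norm norm_minus_commute)
      then have "\<bar>(z - y) $ i\<bar> \<le> real j" for i using component_le_norm_cart[of "z - y" i] by linarith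
      then have "\<bar>z $ i - (x $ i + real j)\<bar> \<le> real j" for i by (simp add: y_def)
      then show "z \<in> ?X" unfolding Xc by (simp add: mem_box_cart L_def abs_le_iff) (smt (verit))
    qed
    have "ennreal c2 \<le> (\<integral>\<^sup>+z. indicator S z * ennreal ((norm (U (z - y)))\<^sup>2) \<partial>lborel)" by (rule lowI)
    also have "\<dots> \<le> (\<integral>\<^sup>+z. ennreal (B\<^sup>2) * indicator (S \<inter> ?X) z + indicator (- ?Bj) (z - y) * ennreal ((norm (U (z - y)))\<^sup>2) \<partial>lborel)"
    proof (rule nn_integral_mono)
      fix z
      show "indicator S z * ennreal ((norm (U (z - y)))\<^sup>2)
        \<le> ennreal (B\<^sup>2) * indicator (S \<inter> ?X) z + indicator (- ?Bj) (z - y) * ennreal ((norm (U (z - y)))\<^sup>2)"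
      proof (cases "z \<in> ball y (real j)")
        case True
        have "ennreal ((norm (U (z - y)))\<^sup>2) \<le> ennreal (B\<^sup>2)" by (intro ennreal_leI power_mono UB) simp
        then show ?thesis using True bX by (auto simp: indicator_def intro: add_increasing2)
      next
        case False
        then have "z - y \<in> - ?Bj" by (simp add: dist_norm norm_minus_commute)
        then show ?thesis by (auto simp: indicator_def intro: add_increasing)
      qed
    qed
    also have "\<dots> = (\<integral>\<^sup>+z. ennreal (B\<^sup>2) * indicator (S \<inter> ?X) z \<partial>lborel)
        + (\<integral>\<^sup>+z. indicator (- ?Bj) (z - y) * ennreal ((norm (U (z - y)))\<^sup>2) \<partial>lborel)"
      using Xb by (intro nn_integral_add) (auto intro!: borel_measurable_times_ennreal borel_measurable_indicator)
    also have "(\<integral>\<^sup>+z. indicator (- ?Bj) (z - y) * ennreal ((norm (U (z - y)))\<^sup>2) \<partial>lborel)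
        = (\<integral>\<^sup>+z. indicator (- ?Bj) z * ennreal ((norm (U z))\<^sup>2) \<partial>lborel)"
      using nn_integral_lborel_translate[of "\<lambda>z. indicator (- ?Bj) z * ennreal ((norm (U z))\<^sup>2)" "- y"] by simp
    also have "(\<integral>\<^sup>+z. ennreal (B\<^sup>2) * indicator (S \<inter> ?X) z \<partial>lborel) = ennreal (B\<^sup>2) * emeasure lborel (S \<inter> ?X)"
      using Xb by (intro nn_integral_cmult_indicator) auto
    also have "emeasure lborel (S \<inter> ?X) = ennreal (measure lborel (S \<inter> ?X))"
    proof (rule emeasure_eq_ennreal_measure)
      have "emeasure lborel (S \<inter> ?X) \<le> emeasure lborel ?X" using Xb by (intro emeasure_mono) auto
      also have "\<dots> < \<infinity>" unfolding Xc by (rule emeasure_lborel_cbox_finite)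
      finally show "emeasure lborel (S \<inter> ?X) \<noteq> top" by simp
    qed
    finally have "ennreal c2 \<le> ennreal (B\<^sup>2) * ennreal (measure lborel (S \<inter> ?X)) + ennreal (c2 / 2)"
      using tail by (meson add_left_mono order_trans)
    also have "\<dots> = ennreal (B\<^sup>2 * measure lborel (S \<inter> ?X) + c2 / 2)"
      using c2 by (simp add: ennreal_mult ennreal_plus)
    finally have "c2 \<le> B\<^sup>2 * measure lborel (S \<inter> ?X) + c2 / 2"
      using c2 by (subst (asm) ennreal_le_iff) auto
    moreover have "measure lborel (S \<inter> ?X) \<le> measure lebesgue (\<omega> \<inter> ?X)"
    proof -
      have Xl: "?X \<in> lmeasurable" unfolding Xc by simp
      have "\<omega> \<inter> ?X \<in> lmeasurable" by (rule fmeasurableI2[OF Xl Int_lower2 sets.Int[OF \<omega> fmeasurableD[OF Xl]]])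
      moreover have "S \<inter> ?X \<in> sets lebesgue" using S Xb by auto
      ultimately have "measure lebesgue (S \<inter> ?X) \<le> measure lebesgue (\<omega> \<inter> ?X)"
        using S\<omega> by (intro measure_mono_fmeasurable) auto
      then show ?thesis using S Xb by (simp add: measure_completion)
    qed
    ultimately show ?thesis by (smt (verit) mult_left_mono zero_le_power2 field_sum_of_halves)
  qed
  have Bp: "B\<^sup>2 > 0" using mass[of 0] c2 by (metis half_gt_zero less_le_trans mult_zero_left not_less order_refl zero_less_power2 zero_eq_power2)
  define \<gamma> where "\<gamma> = min (1/2) (c2 / 2 / B\<^sup>2 / L ^ CARD('n))"
  have "thick_at_scale \<gamma> L \<omega>"
    unfolding thick_at_scale_def
  proof (intro conjI allI \<omega>)
    fix x
    have "\<gamma> * L ^ CARD('n) \<le> (c2 / 2 / B\<^sup>2 / L ^ CARD('n)) * L ^ CARD('n)"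
      using L by (intro mult_right_mono) (auto simp: \<gamma>_def)
    also have "\<dots> = c2 / 2 / B\<^sup>2" using L by simp
    also have "\<dots> \<le> measure lebesgue (\<omega> \<inter> (+) x ` cbox 0 (\<chi> i. L))"
      using mass[of x] Bp by (simp add: divide_le_eq mult.commute)
    finally show "\<gamma> * L ^ CARD('n) \<le> measure lebesgue (\<omega> \<inter> (+) x ` cbox 0 (\<chi> i. L))" .
  qed
  moreover have "0 < \<gamma>" "\<gamma> < 1" using c2 Bp L by (auto simp: \<gamma>_def)
  ultimately show ?thesis using L unfolding thick_def by blast
qed


section \<open>Stabilization by the low frequencies\<close>

text \<open>Plancherel: a pointwise comparison of the symbol with \<open>a\<close> on the spectral set \<open>A\<close>.\<close>

lemma spectral_lower_bound:
  fixes u v w :: "'n::finite L2"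
  assumes uv: "(u, v) \<in> fourier_multiplier F"
    and w: "AE \<xi> in lebesgue. rep_L2 (fourier_L2 w) \<xi> = indicator A \<xi> * rep_L2 (fourier_L2 u) \<xi>"
    and a: "\<And>\<xi>. \<xi> \<in> A \<Longrightarrow> a \<le> F (norm \<xi>)"
  shows "a * (norm w)\<^sup>2 \<le> inner w v"
proof -
  have "(LINT \<xi>|lebesgue. a * inner (rep_L2 (fourier_L2 w) \<xi>) (rep_L2 (fourier_L2 w) \<xi>))
      \<le> (LINT \<xi>|lebesgue. inner (rep_L2 (fourier_L2 w) \<xi>) (rep_L2 (fourier_L2 v) \<xi>))"
  proof (rule integral_mono_AE)
    have v: "AE \<xi> in lebesgue. rep_L2 (fourier_L2 v) \<xi> = of_real (F (norm \<xi>)) * rep_L2 (fourier_L2 u) \<xi>"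
      using uv by (simp add: fourier_multiplier_def)
    show "AE \<xi> in lebesgue. a * inner (rep_L2 (fourier_L2 w) \<xi>) (rep_L2 (fourier_L2 w) \<xi>)
      \<le> inner (rep_L2 (fourier_L2 w) \<xi>) (rep_L2 (fourier_L2 v) \<xi>)"
      using w v
    proof eventually_elim
      case (elim \<xi>)
      then show ?case
        using mult_right_mono[OF a[of \<xi>], of "inner (rep_L2 (fourier_L2 u) \<xi>) (rep_L2 (fourier_L2 u) \<xi>)"]
        by (auto simp: indicator_def scaleR_conv_of_real[symmetric])
    qed
  qed (intro integrable_mult_right square_integrable_inner square_integrable_rep)+
  then have "a * inner w w \<le> inner w v"
    unfolding inner_fourier[of w] using divide_right_mono[OF _ less_imp_le[OF plancherel_const_pos[where 'n = 'n]]]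
    by fastforce
  then show ?thesis by (simp add: power2_norm_eq_inner)
qed

lemma low_orthogonal: "inner (u - low_pass R u) (low_pass R z) = 0"
  using inner_low_self_adjoint[of R z u] by (simp add: inner_diff_right inner_commute)

lemma norm_low_split: "(norm u)\<^sup>2 = (norm (low_pass R u))\<^sup>2 + (norm (u - low_pass R u))\<^sup>2"
proof -
  have "inner u u = inner (low_pass R u + (u - low_pass R u)) (low_pass R u + (u - low_pass R u))" by simp
  also have "\<dots> = inner (low_pass R u) (low_pass R u) + inner (u - low_pass R u) (u - low_pass R u)"
    using low_orthogonal[of u R u] by (simp only: inner_add_left inner_add_right inner_commute[of "low_pass R u" "u - low_pass R u"])
  finally show ?thesis by (simp add: power2_norm_eq_inner)
qed

text \<open>The balance of the Lyapunov functional, with \<open>P\<close>, \<open>Q\<close> the norms of the low and high part and \<open>a\<close> the norm of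
  the low part on \<open>\<omega>\<close>. Half of the damping \<open>D\<^sup>3\<delta>a\<^sup>2\<close> pays for the low part through \<open>P\<^sup>2 \<le> D a\<^sup>2\<close>; the rest, with
  half of the decay of the high part, completes the square \<open>(D a - Q)\<^sup>2\<close> that contains the coupling.\<close>

lemma Lyapunov_arithmetic:
  fixes D \<delta> P Q a m \<alpha> x y z :: real
  assumes D: "1 \<le> D" and \<delta>: "\<delta> = \<alpha> - m" "0 \<le> \<delta>" and P: "P\<^sup>2 \<le> D * a\<^sup>2"
    and x: "m * P\<^sup>2 \<le> x" and y: "\<alpha> * Q\<^sup>2 \<le> y" and z: "- z \<le> Q * a"
  shows "D\<^sup>2 * (- x - D * \<delta> * a\<^sup>2) + (- y - D * \<delta> * z) \<le> - ((\<alpha> + m) / 2) * (D\<^sup>2 * P\<^sup>2 + Q\<^sup>2)"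
proof -
  have 1: "D\<^sup>2 * (- x) \<le> D\<^sup>2 * (- (m * P\<^sup>2))" using x by (intro mult_left_mono) auto
  have 2: "D * \<delta> * (- z) \<le> D * \<delta> * (Q * a)" using z D \<delta> by (intro mult_left_mono) auto
  have 3: "D\<^sup>2 * (\<delta> / 2) * P\<^sup>2 \<le> D\<^sup>2 * (\<delta> / 2) * (D * a\<^sup>2)" using P \<delta> by (intro mult_left_mono) auto
  have "D\<^sup>2 * 1 * a\<^sup>2 \<le> D\<^sup>2 * D * a\<^sup>2" using D by (intro mult_right_mono mult_left_mono) auto
  then have "0 \<le> (\<delta> / 2) * (D\<^sup>2 * D * a\<^sup>2 - D\<^sup>2 * a\<^sup>2 + (D * a - Q)\<^sup>2)"
    using \<delta> by (intro mult_nonneg_nonneg) auto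
  then have 4: "D\<^sup>2 * (\<delta> / 2) * (D * a\<^sup>2) - D\<^sup>2 * (D * \<delta> * a\<^sup>2) + D * \<delta> * (Q * a) \<le> (\<delta> / 2) * Q\<^sup>2"
    by (simp add: power2_eq_square algebra_simps)
  have e: "- ((\<alpha> + m) / 2) * (D\<^sup>2 * P\<^sup>2 + Q\<^sup>2)
      = D\<^sup>2 * (- (m * P\<^sup>2)) - D\<^sup>2 * (\<delta> / 2) * P\<^sup>2 + (- (\<alpha> * Q\<^sup>2)) + (\<delta> / 2) * Q\<^sup>2"
    unfolding \<delta>(1) by (simp add: field_simps)
  have "D\<^sup>2 * (- x - D * \<delta> * a\<^sup>2) + (- y - D * \<delta> * z)
      = D\<^sup>2 * (- x) - D\<^sup>2 * (D * \<delta> * a\<^sup>2) - y + D * \<delta> * (- z)"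
    by (simp add: algebra_simps)
  with 1 2 3 4 y show ?thesis unfolding e by linarith
qed

text \<open>On the domain of the generator, \<open>W = D\<^sup>2\<parallel>p\<parallel>\<^sup>2 + \<parallel>q\<parallel>\<^sup>2\<close> satisfies \<open>W' \<le> -(\<alpha> + m)W\<close>. As \<open>1 \<le> D\<close>, \<open>W\<close> lies between
  \<open>\<parallel>u\<parallel>\<^sup>2\<close> and \<open>D\<^sup>2\<parallel>u\<parallel>\<^sup>2\<close>; density of the domain extends the resulting bound to all initial values.\<close>

theorem low_frequency_feedback_decay:
  fixes \<omega> :: "(real^'n::finite) set"
  assumes F: "admissible_symbol F" and \<omega>: "\<omega> \<in> sets lebesgue" and R: "0 \<le> R" and D: "1 \<le> D"
    and spectral: "\<And>u :: 'n L2. (AE \<xi> in lebesgue. norm \<xi> > R \<longrightarrow> rep_L2 (fourier_L2 u) \<xi> = 0)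
      \<Longrightarrow> (norm u)\<^sup>2 \<le> D * (norm (indicator_L2 \<omega> u))\<^sup>2"
  defines "m \<equiv> inf_from 0 F" and "\<alpha> \<equiv> inf_from R F"
  shows "\<exists>T. generates (neg_perturbed (fourier_multiplier F)
        (\<lambda>f. (D * (\<alpha> - m)) *\<^sub>R indicator_L2 \<omega> (freq_proj R f))) T \<and>
      (\<forall>t\<ge>0. \<forall>f :: 'n L2. norm (T t f) \<le> D * exp (- (\<alpha> + m) * t / 2) * norm f)"
proof -
  define c where "c = D * (\<alpha> - m)"
  have \<delta>: "0 \<le> \<alpha> - m" using inf_from_mono[OF F, of R] R by (simp add: m_def \<alpha>_def)
  have bi: "bounded_clinear_L2 (indicator_L2 \<omega> :: 'n L2 \<Rightarrow> _)"
    unfolding indicator_L2_eq[abs_def] by (rule bounded_clinear_mult_L2[OF bdd_symbol_indicator[OF \<omega>]])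
  have bl: "bounded_clinear_L2 (low_pass R :: 'n L2 \<Rightarrow> _)" by (rule bounded_clinear_low)
  have "bounded_clinear_L2 (\<lambda>f :: 'n L2. c *\<^sub>R indicator_L2 \<omega> (low_pass R f))"
    by (intro bounded_clinear_scaleR bounded_clinear_compose[OF bi bl])
  then obtain T b where gen: "generates (neg_perturbed (fourier_multiplier F) (\<lambda>f :: 'n L2. c *\<^sub>R indicator_L2 \<omega> (low_pass R f))) T"
    and Tb: "\<And>t x. 0 \<le> t \<Longrightarrow> norm (T t x) \<le> 2 * exp (b * t) * norm x"
    using perturbed_semigroup_exists[OF F] by metis
  have T: "C0_semigroup T" "generator T = neg_perturbed (fourier_multiplier F) (\<lambda>f. c *\<^sub>R indicator_L2 \<omega> (low_pass R f))"
    using gen by (auto simp: generates_def)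
  have bd: "norm (T r x) \<le> 2 * exp (\<bar>b\<bar> * s) * norm x" if "0 \<le> r" "r \<le> s" for r s x
  proof -
    have "b * r \<le> \<bar>b\<bar> * s" using that by (meson abs_ge_self abs_ge_zero mult_mono order_trans mult_right_mono mult_left_mono)
    then have "2 * exp (b * r) * norm x \<le> 2 * exp (\<bar>b\<bar> * s) * norm x" by (intro mult_right_mono) auto
    then show ?thesis using Tb[OF that(1), of x] by linarith
  qed
  have dom: "norm (T t u) \<le> D * exp (- (\<alpha> + m) * t / 2) * norm u"
    if uv: "(u, v) \<in> fourier_multiplier F" and t: "0 \<le> t" for u v :: "'n L2" and t
  proof -
    define w where "w = - (v + c *\<^sub>R indicator_L2 \<omega> (low_pass R u))"
    have uw: "(u, w) \<in> generator T" using uv unfolding T(2) neg_perturbed_def w_def by blast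
    define W where "W s = D\<^sup>2 * inner (low_pass R (T s u)) (low_pass R (T s u))
      + inner (T s u - low_pass R (T s u)) (T s u - low_pass R (T s u))" for s
    define h where "h s = exp ((\<alpha> + m) * s) * W s" for s
    have der: "\<exists>y. (h has_real_derivative y) (at s) \<and> y \<le> 0" if s: "0 < s" for s
    proof -
      have s1: "s < s + 1" by simp
      have ge: "(0::real) \<le> 2 * exp (\<bar>b\<bar> * (s + 1))" by simp
      define z where "z = T s w"
      have dT: "((\<lambda>s. T s u) has_vector_derivative z) (at s)" and gs: "(T s u, z) \<in> generator T"
        unfolding z_def using orbit_differentiable[OF T(1) ge bd uw s s1] by auto
      define U p q where "U = T s u" and "p = low_pass R U" and "q = U - p"
      obtain vs where vs: "(U, vs) \<in> fourier_multiplier F" "z = - (vs + c *\<^sub>R indicator_L2 \<omega> p)"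
        using gs unfolding T(2) neg_perturbed_def p_def U_def by blast
      have dl: "((\<lambda>s. low_pass R (T s u)) has_vector_derivative low_pass R z) (at s)"
        by (rule bounded_linear.has_vector_derivative[OF bounded_clinear_imp_linear[OF bl] dT])
      have dq: "((\<lambda>s. T s u - low_pass R (T s u)) has_vector_derivative (z - low_pass R z)) (at s)"
        by (rule has_vector_derivative_diff[OF dT dl])
      have sq: "((\<lambda>s. inner (f s) (f s)) has_real_derivative 2 * inner (f s) f') (at s)"
        if "(f has_vector_derivative f') (at s)" for f :: "real \<Rightarrow> 'n L2" and f'
        using bounded_bilinear.has_vector_derivative[OF bounded_bilinear_inner that that]
        by (simp add: has_real_derivative_iff_has_vector_derivative inner_commute)
      have "(W has_real_derivative (D\<^sup>2 * (2 * inner p (low_pass R z)) + 2 * inner q (z - low_pass R z))) (at s)"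
        unfolding W_def[abs_def] p_def q_def U_def
        by (intro DERIV_add DERIV_cmult sq[OF dl] sq[OF dq])
      moreover have "inner p (low_pass R z) = inner p z" by (simp add: p_def inner_low_self_adjoint[symmetric])
      moreover have "inner q (z - low_pass R z) = inner q z"
        unfolding q_def p_def by (simp add: inner_diff_right low_orthogonal)
      ultimately have dW: "(W has_real_derivative (2 * (D\<^sup>2 * inner p z + inner q z))) (at s)"
        by (simp add: algebra_simps)
      define a where "a = norm (indicator_L2 \<omega> p)"
      have "AE \<xi> in lebesgue. rep_L2 (fourier_L2 q) \<xi> = indicator (- cball 0 R) \<xi> * rep_L2 (fourier_L2 U) \<xi>"
        unfolding q_def p_def bounded_clinear_simps(2)[OF bounded_clinear_fourier]
        using rep_fourier_low[of R U] rep_diff_L2[of "fourier_L2 U" "fourier_L2 (low_pass R U)"]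
        by eventually_elim (auto simp: indicator_def)
      then have qv: "\<alpha> * (norm q)\<^sup>2 \<le> inner q vs"
        by (rule spectral_lower_bound[OF vs(1)]) (auto simp: \<alpha>_def intro!: inf_from_le[OF F R])
      have pv: "m * (norm p)\<^sup>2 \<le> inner p vs"
        unfolding p_def by (rule spectral_lower_bound[OF vs(1) rep_fourier_low])
           (auto simp: m_def intro!: inf_from_le[OF F])
      have pa: "(norm p)\<^sup>2 \<le> D * a\<^sup>2"
        unfolding a_def
      proof (rule spectral)
        show "AE \<xi> in lebesgue. norm \<xi> > R \<longrightarrow> rep_L2 (fourier_L2 p) \<xi> = 0"
          unfolding p_def using rep_fourier_low[of R U] by eventually_elim auto
      qed
      have ip: "inner p (indicator_L2 \<omega> p) = a\<^sup>2"
      proof -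
        have "indicator_L2 \<omega> (indicator_L2 \<omega> p) = indicator_L2 \<omega> p"
        proof (rule L2_eqI)
          show "AE x in lebesgue. rep_L2 (indicator_L2 \<omega> (indicator_L2 \<omega> p)) x = rep_L2 (indicator_L2 \<omega> p) x"
            unfolding indicator_L2_eq
            using rep_mult_L2[OF bdd_symbol_indicator[OF \<omega>], of p]
              rep_mult_L2[OF bdd_symbol_indicator[OF \<omega>], of "mult_L2 (indicator \<omega>) p"]
            by eventually_elim (auto simp: indicator_def)
        qed
        then show ?thesis
          using indicator_L2_symmetric[OF \<omega>, of p "indicator_L2 \<omega> p"]
          by (simp add: a_def power2_norm_eq_inner)
      qed
      have "- inner q (indicator_L2 \<omega> p) \<le> norm q * a"
        using Cauchy_Schwarz_ineq2[of q "indicator_L2 \<omega> p"] by (simp add: a_def)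
      then have "D\<^sup>2 * (- inner p vs - D * (\<alpha> - m) * a\<^sup>2) + (- inner q vs - D * (\<alpha> - m) * inner q (indicator_L2 \<omega> p))
          \<le> - ((\<alpha> + m) / 2) * (D\<^sup>2 * (norm p)\<^sup>2 + (norm q)\<^sup>2)"
        by (intro Lyapunov_arithmetic[OF D refl \<delta> pa pv qv])
      moreover have "inner p z = - inner p vs - D * (\<alpha> - m) * a\<^sup>2"
        "inner q z = - inner q vs - D * (\<alpha> - m) * inner q (indicator_L2 \<omega> p)"
        by (simp_all add: vs(2) c_def inner_diff_right inner_add_right ip)
      moreover have "W s = D\<^sup>2 * (norm p)\<^sup>2 + (norm q)\<^sup>2"
        by (simp add: W_def q_def p_def U_def power2_norm_eq_inner)
      ultimately have neg: "2 * (D\<^sup>2 * inner p z + inner q z) + (\<alpha> + m) * W s \<le> 0"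
        by simp
      have "(h has_real_derivative (exp ((\<alpha> + m) * s) * (2 * (D\<^sup>2 * inner p z + inner q z) + (\<alpha> + m) * W s))) (at s)"
        unfolding h_def[abs_def]
        by (auto intro!: derivative_eq_intros dW simp: algebra_simps)
      moreover have "exp ((\<alpha> + m) * s) * (2 * (D\<^sup>2 * inner p z + inner q z) + (\<alpha> + m) * W s) \<le> 0"
        using neg by (simp add: mult_le_0_iff)
      ultimately show ?thesis by blast
    qed
    have "continuous_on {0..t} h"
    proof -
      have ge: "(0::real) \<le> 2 * exp (\<bar>b\<bar> * t)" by simp
      have c: "continuous_on {0..t} (\<lambda>s. T s u)"
        by (rule C0_semigroup_continuous[OF T(1) ge bd])
      have "continuous_on {0..t} (\<lambda>s. low_pass R (T s u))"
        by (rule bounded_linear.continuous_on[OF bounded_clinear_imp_linear[OF bl] c])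
      then show ?thesis unfolding h_def[abs_def] W_def[abs_def] using c by (intro continuous_intros)
    qed
    then have "h t \<le> h 0"
      using DERIV_nonpos_imp_decreasing_open[of 0 t h] t der by auto
    also have "h 0 \<le> D\<^sup>2 * (norm u)\<^sup>2"
    proof -
      have "1 \<le> D\<^sup>2" using D by (rule one_le_power)
      then have "1 * (norm (u - low_pass R u))\<^sup>2 \<le> D\<^sup>2 * (norm (u - low_pass R u))\<^sup>2" by (rule mult_right_mono) simp
      then show ?thesis
        by (simp add: h_def W_def C0_semigroupD(2)[OF T(1)] norm_low_split[of u R] power2_norm_eq_inner[symmetric] distrib_left)
    qed
    finally have ht: "exp ((\<alpha> + m) * t) * W t \<le> D\<^sup>2 * (norm u)\<^sup>2" by (simp add: h_def)
    have "(norm (T t u))\<^sup>2 \<le> W t"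
    proof -
      have "1 \<le> D\<^sup>2" using D by (rule one_le_power)
      then have "1 * (norm (low_pass R (T t u)))\<^sup>2 \<le> D\<^sup>2 * (norm (low_pass R (T t u)))\<^sup>2" by (rule mult_right_mono) simp
      then show ?thesis
        by (simp add: W_def norm_low_split[of "T t u" R] power2_norm_eq_inner[symmetric])
    qed
    also have "W t = exp (- (\<alpha> + m) * t) * (exp ((\<alpha> + m) * t) * W t)"
      by (simp add: mult.assoc[symmetric] exp_add[symmetric] distrib_right[symmetric] del: mult_minus_left)
    also have "\<dots> \<le> exp (- (\<alpha> + m) * t) * (D\<^sup>2 * (norm u)\<^sup>2)" by (rule mult_left_mono[OF ht]) simp
    also have "exp (- (\<alpha> + m) * t) = (exp (- (\<alpha> + m) * t / 2))\<^sup>2"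
      by (simp add: power2_eq_square mult_exp_exp)
    finally have "(norm (T t u))\<^sup>2 \<le> (D * exp (- (\<alpha> + m) * t / 2) * norm u)\<^sup>2"
      by (simp add: power_mult_distrib mult_ac)
    then show ?thesis by (rule power2_le_imp_le) (use D in auto)
  qed
  have "norm (T t f) \<le> D * exp (- (\<alpha> + m) * t / 2) * norm f" if t: "0 \<le> t" for t f
  proof -
    let ?W = "{f. norm (T t f) \<le> D * exp (- (\<alpha> + m) * t / 2) * norm f}"
    have "continuous_on UNIV (T t)"
      by (rule bounded_linear.continuous_on[OF bounded_clinear_imp_linear[OF C0_semigroupD(1)[OF T(1) t]] continuous_on_id])
    then have "closed ?W" by (intro closed_Collect_le continuous_intros)
    then have "f \<in> ?W" by (rule fourier_multiplier_dense[OF F]) (use dom t in blast)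
    then show ?thesis by simp
  qed
  then show ?thesis using gen unfolding freq_proj_eq c_def by blast
qed


text \<open>The constant of the spectral inequality serves both in the feedback and in the bound; it is independent
  of the symbol, and \<open>R \<ge> 1\<close> suffices for every symbol.\<close>

lemma thick_frequency_feedback:
  fixes \<omega> :: "(real^'n::finite) set"
  assumes "thick \<omega>"
  obtains C where "1 \<le> C" "\<And>F R. admissible_symbol F \<Longrightarrow> 1 \<le> R \<Longrightarrow>
      \<exists>T. generates (neg_perturbed (fourier_multiplier F)
            (\<lambda>f. (C * exp (C * R) * (inf_from R F - inf_from 0 F)) *\<^sub>R indicator_L2 \<omega> (freq_proj R f))) T \<and>
          (\<forall>t\<ge>0. onorm (T t) \<le> sqrt 2 * C * exp (C * R) * exp (- (inf_from R F + inf_from 0 F) * t / 2))"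
proof -
  obtain C where C: "1 \<le> C" and LS: "\<And>R (u :: 'n L2). 1 \<le> R \<Longrightarrow>
      (AE \<xi> in lebesgue. norm \<xi> > R \<longrightarrow> rep_L2 (fourier_L2 u) \<xi> = 0) \<Longrightarrow>
      (norm u)\<^sup>2 \<le> C * exp (C * R) * (norm (indicator_L2 \<omega> u))\<^sup>2"
    using Logvinenko_Sereda[OF assms] by blast
  have \<omega>: "\<omega> \<in> sets lebesgue" using assms by (auto simp: thick_def thick_at_scale_def)
  have "\<exists>T. generates (neg_perturbed (fourier_multiplier F)
            (\<lambda>f. (C * exp (C * R) * (inf_from R F - inf_from 0 F)) *\<^sub>R indicator_L2 \<omega> (freq_proj R f))) T \<and>
          (\<forall>t\<ge>0. onorm (T t) \<le> sqrt 2 * C * exp (C * R) * exp (- (inf_from R F + inf_from 0 F) * t / 2))"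
    if F: "admissible_symbol F" and R: "1 \<le> R" for F R
  proof -
    have "1 * 1 \<le> C * exp (C * R)" using C R by (intro mult_mono) auto
    then have D: "1 \<le> C * exp (C * R)" by simp
    have "0 \<le> R" using R by simp
    from low_frequency_feedback_decay[OF F \<omega> this D LS[OF R]]
    obtain T where T: "generates (neg_perturbed (fourier_multiplier F)
          (\<lambda>f. (C * exp (C * R) * (inf_from R F - inf_from 0 F)) *\<^sub>R indicator_L2 \<omega> (freq_proj R f))) T"
        "\<And>t f. 0 \<le> t \<Longrightarrow> norm (T t f) \<le> C * exp (C * R) * exp (- (inf_from R F + inf_from 0 F) * t / 2) * norm f"
      by blast
    have "onorm (T t) \<le> sqrt 2 * C * exp (C * R) * exp (- (inf_from R F + inf_from 0 F) * t / 2)" if "0 \<le> t" for t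
    proof -
      have "onorm (T t) \<le> 1 * (C * exp (C * R) * exp (- (inf_from R F + inf_from 0 F) * t / 2))"
        unfolding mult_1_left by (rule onorm_bound) (use C T(2)[OF that] in auto)
      also have "\<dots> \<le> sqrt 2 * (C * exp (C * R) * exp (- (inf_from R F + inf_from 0 F) * t / 2))"
        using C by (intro mult_right_mono) auto
      finally show ?thesis by (simp only: mult.assoc)
    qed
    with T(1) show ?thesis by blast
  qed
  with C show ?thesis by (rule that)
qed

text \<open>For large \<open>R\<close> the rate \<open>(inf\<^bsub>r\<ge>R\<^esub> F(r) + inf F)/2\<close> of the frequency feedback is positive.\<close>

lemma thick_imp_stabilizable:
  fixes \<omega> :: "(real^'n::finite) set"
  assumes F: "admissible_symbol F" and \<omega>: "thick \<omega>"
    and lim: "Liminf at_top (\<lambda>r. ereal (F r)) > ereal \<bar>inf_from 0 F\<bar>"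
  shows "exp_stabilizable F \<omega>"
proof -
  obtain y where y: "ereal \<bar>inf_from 0 F\<bar> < y" "y < Liminf at_top (\<lambda>r. ereal (F r))"
    using dense[OF lim] by blast
  then obtain b where b: "y = ereal b" by (cases y) auto
  have "\<forall>\<^sub>F r in at_top. ereal b < ereal (F r)"
    using less_LiminfD[OF y(2)] by (simp add: b)
  then obtain N where N: "\<And>r. r \<ge> N \<Longrightarrow> b < F r" by (auto simp: eventually_at_top_linorder)
  define R where "R = max N 1"
  have R: "1 \<le> R" by (simp add: R_def)
  have "b \<le> inf_from R F"
    unfolding inf_from_def using N by (intro cINF_greatest) (auto simp: R_def less_imp_le)
  then have rate: "0 < (inf_from R F + inf_from 0 F) / 2" using y(1) by (simp add: b)
  obtain C T where C: "1 \<le> C" and T: "generates (neg_perturbed (fourier_multiplier F)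
        (\<lambda>f. (C * exp (C * R) * (inf_from R F - inf_from 0 F)) *\<^sub>R indicator_L2 \<omega> (freq_proj R f))) T"
      "\<And>t. 0 \<le> t \<Longrightarrow> onorm (T t) \<le> sqrt 2 * C * exp (C * R) * exp (- (inf_from R F + inf_from 0 F) * t / 2)"
    using thick_frequency_feedback[OF \<omega>] F R by metis
  define K :: "'n L2 \<Rightarrow> 'n L2" where "K f = (C * exp (C * R) * (inf_from R F - inf_from 0 F)) *\<^sub>R freq_proj R f" for f
  have "bounded_clinear_L2 K"
    unfolding K_def[abs_def] freq_proj_eq by (rule bounded_clinear_scaleR[OF bounded_clinear_low])
  moreover have "generates (neg_perturbed (fourier_multiplier F) (\<lambda>f. indicator_L2 \<omega> (K f))) T"
  proof -
    have "\<omega> \<in> sets lebesgue" using \<omega> by (auto simp: thick_def thick_at_scale_def)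
    then have "indicator_L2 \<omega> (r *\<^sub>R f) = r *\<^sub>R indicator_L2 \<omega> f" for r and f :: "'n L2"
      unfolding indicator_L2_eq
      by (intro bounded_clinear_simps(5) bounded_clinear_mult_L2[OF bdd_symbol_indicator])
    then show ?thesis using T(1) by (simp add: K_def)
  qed
  moreover have "1 \<le> sqrt 2 * C * exp (C * R)"
  proof -
    have "1 * 1 * 1 \<le> sqrt 2 * C * exp (C * R)" using C R by (intro mult_mono) auto
    then show ?thesis by simp
  qed
  moreover have "onorm (T t) \<le> sqrt 2 * C * exp (C * R) * exp (- ((inf_from R F + inf_from 0 F) / 2) * t)" if "0 \<le> t" for t
    using T(2)[OF that] by (simp only: mult_minus_left minus_divide_left times_divide_eq_left)
  ultimately have "exp_stabilizable_at_rate F \<omega> ((inf_from R F + inf_from 0 F) / 2)"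
    unfolding exp_stabilizable_at_rate_def by blast
  with rate show ?thesis unfolding exp_stabilizable_def by blast
qed

theorem theorem2p1:
  shows
    "(\<forall>(F :: real \<Rightarrow> real) (\<omega> :: (real^'n::finite) set).
        admissible_symbol F \<and> \<omega> \<in> sets lebesgue \<and>
        inf_from 0 F \<le> 0 \<and> exp_stabilizable F \<omega> \<longrightarrow> thick \<omega>)
     \<and>
     (\<exists>(C :: (real^'n) set \<Rightarrow> real) (R\<^sub>0 :: (real \<Rightarrow> real) \<Rightarrow> real).
        \<forall>(F :: real \<Rightarrow> real) (\<omega> :: (real^'n) set).
          admissible_symbol F \<and> \<omega> \<in> sets lebesgue \<and>
          Liminf at_top (\<lambda>r. ereal (F r)) > ereal (inf_from 0 F) \<and> thick \<omega> \<longrightarrow>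
          C \<omega> \<ge> 1 \<and> R\<^sub>0 F > 0 \<and>
          (\<forall>R \<ge> R\<^sub>0 F.
             \<exists>T. generates
                   (neg_perturbed (fourier_multiplier F)
                      (\<lambda>f. (C \<omega> * exp (C \<omega> * R) * (inf_from R F - inf_from 0 F)) *\<^sub>R
                             indicator_L2 \<omega> (freq_proj R f))) T \<and>
                 (\<forall>t\<ge>0. onorm (T t) \<le>
                    sqrt 2 * C \<omega> * exp (C \<omega> * R) * exp (- (inf_from R F + inf_from 0 F) * t / 2))))
     \<and>
     (\<forall>(F :: real \<Rightarrow> real) (\<omega> :: (real^'n) set).
        admissible_symbol F \<and> \<omega> \<in> sets lebesgue \<and>
        Liminf at_top (\<lambda>r. ereal (F r)) > ereal \<bar>inf_from 0 F\<bar> \<and> thick \<omega> \<longrightarrow>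
        exp_stabilizable F \<omega>)"
proof (intro conjI)
  show "\<forall>(F :: real \<Rightarrow> real) (\<omega> :: (real^'n) set).
        admissible_symbol F \<and> \<omega> \<in> sets lebesgue \<and>
        inf_from 0 F \<le> 0 \<and> exp_stabilizable F \<omega> \<longrightarrow> thick \<omega>"
    using stabilizable_imp_thick by blast
  define Q :: "(real^'n) set \<Rightarrow> real \<Rightarrow> bool" where
    "Q \<omega> C \<longleftrightarrow> 1 \<le> C \<and> (\<forall>F R. admissible_symbol F \<longrightarrow> 1 \<le> R \<longrightarrow>
      (\<exists>T. generates (neg_perturbed (fourier_multiplier F)
            (\<lambda>f. (C * exp (C * R) * (inf_from R F - inf_from 0 F)) *\<^sub>R indicator_L2 \<omega> (freq_proj R f))) T \<and>
          (\<forall>t\<ge>0. onorm (T t) \<le> sqrt 2 * C * exp (C * R) * exp (- (inf_from R F + inf_from 0 F) * t / 2))))"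
    for \<omega> C
  have "\<exists>C. thick \<omega> \<longrightarrow> Q \<omega> C" for \<omega>
  proof (cases "thick \<omega>")
    case True
    show ?thesis
    proof (rule thick_frequency_feedback[OF True])
      fix C :: real
      assume "1 \<le> C" and "\<And>F R. admissible_symbol F \<Longrightarrow> 1 \<le> R \<Longrightarrow>
        \<exists>T. generates (neg_perturbed (fourier_multiplier F)
            (\<lambda>f. (C * exp (C * R) * (inf_from R F - inf_from 0 F)) *\<^sub>R indicator_L2 \<omega> (freq_proj R f))) T \<and>
          (\<forall>t\<ge>0. onorm (T t) \<le> sqrt 2 * C * exp (C * R) * exp (- (inf_from R F + inf_from 0 F) * t / 2))"
      then have "Q \<omega> C" unfolding Q_def by blast
      then show ?thesis by blast
    qed
  qed blast
  then have "\<forall>\<omega>. \<exists>C. thick \<omega> \<longrightarrow> Q \<omega> C" by (rule allI)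
  then obtain C where C: "\<And>\<omega>. thick \<omega> \<Longrightarrow> Q \<omega> (C \<omega>)"
    by (rule choice[THEN exE]) blast
  show "\<exists>(C :: (real^'n) set \<Rightarrow> real) (R\<^sub>0 :: (real \<Rightarrow> real) \<Rightarrow> real).
        \<forall>(F :: real \<Rightarrow> real) (\<omega> :: (real^'n) set).
          admissible_symbol F \<and> \<omega> \<in> sets lebesgue \<and>
          Liminf at_top (\<lambda>r. ereal (F r)) > ereal (inf_from 0 F) \<and> thick \<omega> \<longrightarrow>
          C \<omega> \<ge> 1 \<and> R\<^sub>0 F > 0 \<and>
          (\<forall>R \<ge> R\<^sub>0 F.
             \<exists>T. generates
                   (neg_perturbed (fourier_multiplier F)
                      (\<lambda>f. (C \<omega> * exp (C \<omega> * R) * (inf_from R F - inf_from 0 F)) *\<^sub>R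
                             indicator_L2 \<omega> (freq_proj R f))) T \<and>
                 (\<forall>t\<ge>0. onorm (T t) \<le>
                    sqrt 2 * C \<omega> * exp (C \<omega> * R) * exp (- (inf_from R F + inf_from 0 F) * t / 2)))"
  proof (intro exI[of _ C] exI[of _ "\<lambda>_. 1"] allI impI)
    fix F and \<omega> :: "(real^'n) set"
    assume "admissible_symbol F \<and> \<omega> \<in> sets lebesgue \<and>
      Liminf at_top (\<lambda>r. ereal (F r)) > ereal (inf_from 0 F) \<and> thick \<omega>"
    then have "admissible_symbol F" and "Q \<omega> (C \<omega>)" using C by simp_all
    then show "C \<omega> \<ge> 1 \<and> 1 > (0::real) \<and> (\<forall>R \<ge> 1.
             \<exists>T. generates
                   (neg_perturbed (fourier_multiplier F)
                      (\<lambda>f. (C \<omega> * exp (C \<omega> * R) * (inf_from R F - inf_from 0 F)) *\<^sub>R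
                             indicator_L2 \<omega> (freq_proj R f))) T \<and>
                 (\<forall>t\<ge>0. onorm (T t) \<le>
                    sqrt 2 * C \<omega> * exp (C \<omega> * R) * exp (- (inf_from R F + inf_from 0 F) * t / 2)))"
      unfolding Q_def by (intro conjI zero_less_one) simp_all
  qed
  show "\<forall>(F :: real \<Rightarrow> real) (\<omega> :: (real^'n) set).
        admissible_symbol F \<and> \<omega> \<in> sets lebesgue \<and>
        Liminf at_top (\<lambda>r. ereal (F r)) > ereal \<bar>inf_from 0 F\<bar> \<and> thick \<omega> \<longrightarrow>
        exp_stabilizable F \<omega>"
    using thick_imp_stabilizable by blast
qed

end
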